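(* Let $T>0$, $0<\alpha<1$, $1<p<\infty$, let $f\in C([0,T]\times\mathbb{R},\mathbb{R})$ and put $F(t,u)=\int_0^u f(t,s)\,ds$. Suppose that: $(f_1)$ $F(t,0)=0$ for all $t\in[0,T]$, and $F(t,u)\ge a(t)|u|^{q}$ and $|f(t,u)|\le q\,b(t)|u|^{q-1}$ for all $(t,u)\in[0,T]\times\mathbb{R}$, where $1<q<p$ is a constant and $a,b:[0,T]\to(0,\infty)$ are continuous functions; $(f_2)$ there is a constant $\mu$ with $1<\mu\le q<p$ such that $f(t,u)u\le\mu F(t,u)$ for all $t\in[0,T]$ and $u\in\mathbb{R}$; $(f_3)$ $F(t,u)=F(t,-u)$ for all $t\in[0,T]$ and $u\in\mathbb{R}$. Then the problem $${}_tD_T^{\alpha}\left(|{}_0D_t^{\alpha}u(t)|^{p-2}{}_0D_t^{\alpha}u(t)\right)=f(t,u(t)),\quad t\in[0,T],\qquad u(0)=u(T)=0,$$ has infinitely many nontrivial (i.e. not identically zero) weak solutions $u\in E_0^{\alpha,p}$.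
   Context: For $0<\alpha<1$: the left and right Riemann-Liouville fractional integrals of order $\beta>0$ on $[0,T]$ are ${}_0I_t^{\beta}u(t)=\frac1{\Gamma(\beta)}\int_0^t(t-s)^{\beta-1}u(s)\,ds$ and ${}_tI_T^{\beta}u(t)=\frac1{\Gamma(\beta)}\int_t^T(s-t)^{\beta-1}u(s)\,ds$; the left and right Riemann-Liouville fractional derivatives are ${}_0D_t^{\alpha}u=\frac{d}{dt}\,{}_0I_t^{1-\alpha}u$ and ${}_tD_T^{\alpha}u=-\frac{d}{dt}\,{}_tI_T^{1-\alpha}u$. The fractional derivative space $E_0^{\alpha,p}$ is the closure of $C_0^\infty[0,T]$ (smooth functions vanishing at $0$ and $T$; using compactly supported smooth functions in $(0,T)$ gives the same closure) with respect to the norm $\left(\int_0^T|u|^p\,dt+\int_0^T|{}_0D_t^\alpha u|^p\,dt\right)^{1/p}$; its elements are functions $u\in L^p[0,T]$ with ${}_0D_t^\alpha u\in L^p[0,T]$, the boundary condition $u(0)=u(T)=0$ being encoded in membership in this space. An equivalent norm on it is $\|u\|_{\alpha,p}=\|{}_0D_t^\alpha u\|_{L^p[0,T]}$. A function $u\in E_0^{\alpha,p}$ is a weak solution of the problem if $$\int_0^T|{}_0D_t^\alpha u|^{p-2}{}_0D_t^\alpha u\;{}_0D_t^\alpha\varphi\,dt=\int_0^Tf(t,u(t))\varphi(t)\,dt\quad\text{for all }\varphi\in E_0^{\alpha,p}.$$ The expression $|x|^{p-2}x$ is read as $0$ at $x=0$. *)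

theory Defs
  imports "HOL-Analysis.Analysis"
begin

definition left_RL_integral :: "real \<Rightarrow> (real \<Rightarrow> real) \<Rightarrow> real \<Rightarrow> real" where
  "left_RL_integral \<beta> u t =
     1 / Gamma \<beta> * (LINT s|lebesgue_on {0..t}. (t - s) powr (\<beta> - 1) * u s)"

definition left_RL_deriv :: "real \<Rightarrow> (real \<Rightarrow> real) \<Rightarrow> real \<Rightarrow> real" where
  "left_RL_deriv \<alpha> u t = deriv (left_RL_integral (1 - \<alpha>) u) t"

text \<open>The left derivative of order \<open>\<alpha>\<close> exists almost everywhere on \<open>[0,T]\<close>. The first conjunct says
  that the fractional integral of order \<open>1 - \<alpha>\<close> is a convergent integral at every point, so that
  it (and hence the derivative) is linear and its value is never the default \<open>0\<close> of a
  divergent integral. It holds for every \<open>u\<close> that is almost everywhere a fractional integral of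
  order \<open>\<alpha>\<close> of an integrable function, in particular for every limit of smooth functions in
  the norm \<open>frac_norm\<close> below.\<close>

definition left_RL_differentiable :: "real \<Rightarrow> real \<Rightarrow> (real \<Rightarrow> real) \<Rightarrow> bool" where
  "left_RL_differentiable \<alpha> T u \<longleftrightarrow>
     (\<forall>t\<in>{0..T}. integrable (lebesgue_on {0..t}) (\<lambda>s. (t - s) powr (- \<alpha>) * u s)) \<and>
     (AE t in lebesgue_on {0..T}. left_RL_integral (1 - \<alpha>) u differentiable (at t))"

text \<open>Elements of Lebesgue spaces are represented by functions on the real line of which only the
  restriction to \<open>[0,T]\<close> matters; they are identified by \<open>ae_eq_rel\<close>.\<close>

definition Lp_space :: "real \<Rightarrow> real \<Rightarrow> (real \<Rightarrow> real) set" where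
  "Lp_space p T = {u. u \<in> borel_measurable (lebesgue_on {0..T}) \<and>
                      integrable (lebesgue_on {0..T}) (\<lambda>t. \<bar>u t\<bar> powr p)}"

definition ae_eq_rel :: "real \<Rightarrow> ((real \<Rightarrow> real) \<times> (real \<Rightarrow> real)) set" where
  "ae_eq_rel T = {(u, v). AE t in lebesgue_on {0..T}. u t = v t}"

text \<open>Smooth functions on the closed interval (one-sided derivatives at the end points) that vanish
  at \<open>0\<close> and \<open>T\<close>; \<open>d k\<close> is the \<open>k\<close>-th derivative.\<close>

definition C0_infinity :: "real \<Rightarrow> (real \<Rightarrow> real) set" where
  "C0_infinity T = {\<phi>. (\<exists>d. d 0 = \<phi> \<and>
        (\<forall>k. \<forall>t\<in>{0..T}. (d k has_real_derivative d (Suc k) t) (at t within {0..T}))) \<and>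
      \<phi> 0 = 0 \<and> \<phi> T = 0}"

definition frac_norm :: "real \<Rightarrow> real \<Rightarrow> real \<Rightarrow> (real \<Rightarrow> real) \<Rightarrow> real" where
  "frac_norm \<alpha> p T u =
     ((LINT t|lebesgue_on {0..T}. \<bar>u t\<bar> powr p) +
      (LINT t|lebesgue_on {0..T}. \<bar>left_RL_deriv \<alpha> u t\<bar> powr p)) powr (1 / p)"

text \<open>The closure of \<open>C0_infinity T\<close> under \<open>frac_norm\<close>.\<close>

definition frac_space :: "real \<Rightarrow> real \<Rightarrow> real \<Rightarrow> (real \<Rightarrow> real) set" where
  "frac_space \<alpha> p T = {u. u \<in> Lp_space p T \<and> left_RL_differentiable \<alpha> T u \<and>
      left_RL_deriv \<alpha> u \<in> Lp_space p T \<and>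
      (\<forall>\<epsilon>>0. \<exists>\<phi>\<in>C0_infinity T. frac_norm \<alpha> p T (\<lambda>t. u t - \<phi> t) < \<epsilon>)}"

text \<open>Weak solutions of the Dirichlet problem for the fractional \<open>p\<close>-Laplacian. The integral on the left
  converges by Hoelder's inequality, the one on the right as soon as
  \<open>\<bar>f t x\<bar> \<le> c (1 + \<bar>x\<bar> powr (p - 1))\<close> and \<open>f\<close> is continuous.\<close>

definition weak_solution ::
  "real \<Rightarrow> real \<Rightarrow> real \<Rightarrow> (real \<Rightarrow> real \<Rightarrow> real) \<Rightarrow> (real \<Rightarrow> real) \<Rightarrow> bool" where
  "weak_solution \<alpha> p T f u \<longleftrightarrow> u \<in> frac_space \<alpha> p T \<and>
     (\<forall>\<phi>\<in>frac_space \<alpha> p T.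
        (LINT t|lebesgue_on {0..T}.
           \<bar>left_RL_deriv \<alpha> u t\<bar> powr (p - 2) * left_RL_deriv \<alpha> u t * left_RL_deriv \<alpha> \<phi> t) =
        (LINT t|lebesgue_on {0..T}. f t (u t) * \<phi> t))"

text \<open>The integral is oriented: for negative \<open>x\<close> it is minus the integral over \<open>[x,0]\<close>.\<close>

definition primitive :: "(real \<Rightarrow> real \<Rightarrow> real) \<Rightarrow> real \<Rightarrow> real \<Rightarrow> real" where
  "primitive f t x = (LBINT s=ereal 0..ereal x. f t s)"

end

theory Submission
  imports Defs "HOL-Homology.Homology"
begin

text \<open>
  The left fractional derivative identifies the fractional derivative space with a closed subspace
  \<open>V\<close> of \<open>L\<^sup>p\<close>, with inverse the fractional integral \<open>K\<close> of order \<open>\<alpha>\<close>, a compact operator. Weak solutions are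
  the images \<open>K v\<close> of the critical points \<open>v\<close> of the even functional \<open>J v = \<parallel>v\<parallel>\<^sup>p / p - \<integral> F(t, K v)\<close> on \<open>V\<close>; it is
  coercive because \<open>q < p\<close>, and negative on small spheres of finite-dimensional subspaces because
  \<open>F(t, x) \<ge> a(t) \<bar>x\<bar>\<^sup>q\<close>.

  Critical values accumulate at \<open>0\<close> from below, which gives infinitely many solutions. Suppose that
  there are none in \<open>[-\<epsilon>, 0)\<close>. Let \<open>B u\<close> be the minimiser over \<open>w \<in> V\<close> of the strictly convex functional
  \<open>Phi u w = \<parallel>w\<parallel>\<^sup>p / p - \<integral> f(t, u) K w\<close>. The map \<open>v \<mapsto> (1 - s) v + s B (K v)\<close> is odd and continuous, and for small \<open>s\<close> it
  decreases \<open>J\<close> by a fixed amount as long as \<open>J\<close> stays in a compact part of the window. So finitely many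
  iterations take a small \<open>m\<close>-sphere, on which \<open>J < 0\<close>, to the set \<open>J \<le> -2\<epsilon>/3\<close>. By the Borsuk--Ulam theorem
  the image contains a point where \<open>m\<close> given linear functionals vanish. By compactness of \<open>K\<close> these
  functionals and \<open>m\<close> can be chosen such that their vanishing makes \<open>K v\<close> so small that
  \<open>J v \<ge> -\<epsilon>/3\<close>, a contradiction.
\<close>

section \<open>Inequalities for powers\<close>

text \<open>Size is measured by \<open>Np\<close>, the p-th power of the norm, and limits are
  derived from integrated pointwise estimates of the shape \<open>e * X + C * Y\<close> with
  \<open>X\<close> bounded, \<open>Y\<close> tending to 0 and \<open>C\<close> depending on
  \<open>e\<close>; the first lemma turns such families into limits. No dual space, weak topology or
  differentiability of \<open>J\<close> is involved.

  The obstacle is to lower \<open>J\<close> by an odd continuous map without a gradient flow.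
  Freezing the nonlinearity at \<open>u = K v\<close> leaves a strictly convex problem whose
  minimiser depends continuously and oddly on \<open>u\<close>, and by convexity the excess
  \<open>Phi u v - min_val u\<close> bounds the decrease of \<open>J\<close> along the segment from
  \<open>v\<close> to \<open>B u\<close> to first order. This excess replaces the norm of the
  gradient: compactness of \<open>K\<close> bounds it away from 0 where there are no critical
  points.

  The Borsuk-Ulam theorem is reached through the parity of the Brouwer degree. Its induction works
  with maps that preserve the equator, but a merely continuous image of the equator could meet every
  line; hence the Lipschitz approximation and the count of directions.\<close>

lemma tendsto_zero_of_eps_bound:
  fixes a X Y :: "nat \<Rightarrow> real"
  assumes bd: "\<And>\<epsilon>. \<epsilon> > 0 \<Longrightarrow> \<exists>C. \<forall>n. \<bar>a n\<bar> \<le> \<epsilon> * X n + C * Y n"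
    and X: "\<And>n. X n \<le> R" and Y: "Y \<longlonglongrightarrow> 0"
  shows "a \<longlonglongrightarrow> 0"
proof (rule LIMSEQ_I)
  fix r :: real assume "r > 0"
  define \<epsilon> where "\<epsilon> = r / (2 * (\<bar>R\<bar> + 1))"
  have "\<epsilon> > 0" using \<open>r > 0\<close> by (simp add: \<epsilon>_def add_nonneg_pos)
  then obtain C where C: "\<And>n. \<bar>a n\<bar> \<le> \<epsilon> * X n + C * Y n" using bd by blast
  have "(\<lambda>n. C * Y n) \<longlonglongrightarrow> 0" using tendsto_mult_right_zero[OF Y] by simp
  then obtain N where N: "\<And>n. n \<ge> N \<Longrightarrow> \<bar>C * Y n\<bar> < r / 2"
    using LIMSEQ_D[of _ 0 "r/2"] \<open>r > 0\<close> by (metis diff_zero half_gt_zero real_norm_def)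
  have "\<epsilon> * X n \<le> r / 2" for n
  proof -
    have "\<epsilon> * X n \<le> \<epsilon> * (\<bar>R\<bar> + 1)" using X[of n] \<open>\<epsilon> > 0\<close> by (intro mult_left_mono) auto
    also have "\<dots> = r / 2" unfolding \<epsilon>_def using abs_ge_zero[of R] by (simp add: field_simps)
    finally show ?thesis .
  qed
  then show "\<exists>no. \<forall>n\<ge>no. norm (a n - 0) < r"
    using N C by (smt (verit, ccfv_threshold) field_sum_of_halves real_norm_def)
qed

lemma abs_powr_add_le:
  fixes x y p :: real
  assumes "p > 0"
  shows "\<bar>x + y\<bar> powr p \<le> 2 powr p * (\<bar>x\<bar> powr p + \<bar>y\<bar> powr p)"
proof -
  have "\<bar>x + y\<bar> powr p \<le> (2 * max \<bar>x\<bar> \<bar>y\<bar>) powr p" using assms by (intro powr_mono2) auto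
  also have "\<dots> = 2 powr p * max \<bar>x\<bar> \<bar>y\<bar> powr p" by (simp add: powr_mult)
  also have "\<dots> \<le> 2 powr p * (\<bar>x\<bar> powr p + \<bar>y\<bar> powr p)"
    by (intro mult_left_mono) (auto simp: max_def)
  finally show ?thesis .
qed

text \<open>A crude form of Young's inequality: both factors are at most the larger of
  \<open>\<bar>x\<bar>\<close> and \<open>\<bar>y\<bar>\<close>, so no conjugate exponent
  appears.\<close>

lemma powr_diff_one_mult_le:
  fixes x y p :: real
  assumes "p > 1"
  shows "\<bar>x\<bar> powr (p - 1) * \<bar>y\<bar> \<le> \<bar>x\<bar> powr p + \<bar>y\<bar> powr p"
proof -
  define z where "z = max \<bar>x\<bar> \<bar>y\<bar>"
  have z: "z \<ge> 0" unfolding z_def by simp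
  have "\<bar>x\<bar> powr (p - 1) * \<bar>y\<bar> \<le> z powr (p - 1) * z"
    unfolding z_def using assms by (intro mult_mono powr_mono2) auto
  also have "\<dots> = z powr p" using z powr_mult_base[of z "p - 1"] by (simp add: mult.commute)
  also have "\<dots> \<le> \<bar>x\<bar> powr p + \<bar>y\<bar> powr p" by (auto simp: z_def max_def)
  finally show ?thesis .
qed

text \<open>The unscaled inequality for \<open>l * x\<close> and \<open>y\<close>, divided by
  \<open>l powr (p - 1)\<close>; varying \<open>l\<close> moves the small coefficient to either
  term.\<close>

lemma powr_diff_one_mult_scaled:
  fixes x y p l :: real
  assumes "p > 1" "l > 0"
  shows "\<bar>x\<bar> powr (p - 1) * \<bar>y\<bar> \<le> l * \<bar>x\<bar> powr p + l powr (1 - p) * \<bar>y\<bar> powr p"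
proof -
  have "l powr (p - 1) * (\<bar>x\<bar> powr (p - 1) * \<bar>y\<bar>) = \<bar>l * x\<bar> powr (p - 1) * \<bar>y\<bar>"
    using assms by (simp add: abs_mult powr_mult)
  also have "\<dots> \<le> \<bar>l * x\<bar> powr p + \<bar>y\<bar> powr p" by (rule powr_diff_one_mult_le) fact
  also have "\<dots> = l powr p * \<bar>x\<bar> powr p + \<bar>y\<bar> powr p" using assms by (simp add: abs_mult powr_mult)
  finally have "l powr (1 - p) * (l powr (p - 1) * (\<bar>x\<bar> powr (p - 1) * \<bar>y\<bar>))
    \<le> l powr (1 - p) * (l powr p * \<bar>x\<bar> powr p + \<bar>y\<bar> powr p)"
    by (intro mult_left_mono) auto
  moreover have "l powr (1 - p) * l powr (p - 1) = 1" "l powr (1 - p) * l powr p = l"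
    using assms by (simp_all flip: powr_add)
  moreover have "a * (b * X) \<le> a * (c * Y + Z) \<Longrightarrow> a * b = 1 \<Longrightarrow> a * c = l \<Longrightarrow> X \<le> l * Y + a * Z"
    for a b c X Y Z :: real
    by (metis distrib_left mult.assoc mult_1)
  ultimately show ?thesis by blast
qed

lemma powr_diff_one_mult_eps:
  fixes p :: real
  assumes "p > 1" "\<epsilon> > 0"
  obtains C where "C \<ge> 0" "\<And>x y. \<bar>x\<bar> powr (p - 1) * \<bar>y\<bar> \<le> \<epsilon> * \<bar>y\<bar> powr p + C * \<bar>x\<bar> powr p"
proof -
  define l where "l = \<epsilon> powr (1 / (1 - p))"
  have l: "l > 0" using assms by (simp add: l_def)
  have "l powr (1 - p) = \<epsilon>" using assms by (simp add: l_def powr_powr)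
  then show ?thesis using powr_diff_one_mult_scaled[OF assms(1) l] l that[of l]
    by (simp add: add.commute)
qed

text \<open>Split at \<open>\<bar>x\<bar> = l\<close>. A large \<open>l\<close> makes the
  coefficient of the p-th power small, a small \<open>l\<close> makes the constant small; the next
  two lemmas choose it accordingly.\<close>

lemma powr_le_powr_scaled:
  fixes p q l :: real
  assumes "0 < q" "q < p" "l > 0"
  shows "\<bar>x\<bar> powr q \<le> l powr (q - p) * \<bar>x\<bar> powr p + l powr q"
proof (cases "\<bar>x\<bar> \<le> l")
  case True
  then have "\<bar>x\<bar> powr q \<le> l powr q" using assms by (intro powr_mono2) auto
  then show ?thesis by (simp add: add_increasing)
next
  case False
  then have x: "\<bar>x\<bar> > 0" using assms by auto
  have "\<bar>x\<bar> powr q = \<bar>x\<bar> powr p * \<bar>x\<bar> powr (q - p)" using x by (simp flip: powr_add)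
  also have "\<dots> \<le> \<bar>x\<bar> powr p * l powr (q - p)"
    using False assms by (intro mult_left_mono powr_mono2') auto
  finally show ?thesis by (simp add: mult.commute add_increasing2)
qed

lemma powr_le_eps_powr:
  fixes p q :: real
  assumes "0 < q" "q < p" "\<epsilon> > 0"
  obtains C where "C \<ge> 0" "\<And>x. \<bar>x\<bar> powr q \<le> \<epsilon> * \<bar>x\<bar> powr p + C"
proof -
  define l where "l = \<epsilon> powr (1 / (q - p))"
  have "l > 0" "l powr (q - p) = \<epsilon>" using assms by (simp_all add: l_def powr_powr)
  then show ?thesis using powr_le_powr_scaled[OF assms(1,2)] by (intro that[of "l powr q"]) fastforce+
qed

lemma powr_le_powr_plus_eps:
  fixes p q :: real
  assumes "0 < q" "q < p" "\<epsilon> > 0"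
  obtains C where "C \<ge> 0" "\<And>x. \<bar>x\<bar> powr q \<le> \<epsilon> + C * \<bar>x\<bar> powr p"
proof -
  define l where "l = \<epsilon> powr (1 / q)"
  have "l > 0" "l powr q = \<epsilon>" using assms by (simp_all add: l_def powr_powr)
  then show ?thesis using powr_le_powr_scaled[OF assms(1,2)]
    by (intro that[of "l powr (q - p)"]) (fastforce simp: add.commute)+
qed

text \<open>By homogeneity this is continuity of \<open>\<bar>1 + z\<bar> powr p\<close> at 0 as
  long as \<open>x - y\<close> is small compared with \<open>y\<close>. Otherwise \<open>y\<close>,
  and with it \<open>x\<close>, is bounded by a multiple of \<open>x - y\<close>, and the last term
  absorbs everything.\<close>

lemma abs_powr_perturb:
  fixes p :: real
  assumes "p > 0" "\<epsilon> > 0"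
  obtains C where "C \<ge> 0"
    "\<And>x y. \<bar>\<bar>x\<bar> powr p - \<bar>y\<bar> powr p\<bar> \<le> \<epsilon> * \<bar>y\<bar> powr p + C * \<bar>x - y\<bar> powr p"
proof -
  have "isCont (\<lambda>z::real. \<bar>1 + z\<bar> powr p) 0" using assms by (intro continuous_intros) auto
  then obtain d where d: "d > 0" "\<And>z. \<bar>z\<bar> < d \<Longrightarrow> \<bar>\<bar>1 + z\<bar> powr p - 1\<bar> < \<epsilon>"
    using assms(2) by (auto simp: continuous_at_eps_delta dist_real_def)
  define C where "C = 2 powr p * (1 + (1 / d) powr p) + (1 / d) powr p"
  have "\<bar>\<bar>x\<bar> powr p - \<bar>y\<bar> powr p\<bar> \<le> \<epsilon> * \<bar>y\<bar> powr p + C * \<bar>x - y\<bar> powr p" for x y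
  proof (cases "\<bar>x - y\<bar> < d * \<bar>y\<bar>")
    case True
    then have y: "\<bar>y\<bar> > 0" using d by (auto simp: zero_less_mult_iff)
    have "\<bar>(x - y) / y\<bar> < d" using True y by (simp add: field_simps)
    from d(2)[OF this] have "\<bar>\<bar>x / y\<bar> powr p - 1\<bar> < \<epsilon>" using y by (simp add: field_simps)
    moreover have "\<bar>x\<bar> powr p - \<bar>y\<bar> powr p = \<bar>y\<bar> powr p * (\<bar>x / y\<bar> powr p - 1)"
      using y by (simp add: abs_divide powr_divide field_simps)
    ultimately have "\<bar>\<bar>x\<bar> powr p - \<bar>y\<bar> powr p\<bar> \<le> \<bar>y\<bar> powr p * \<epsilon>"
      by (simp add: abs_mult mult_left_mono)
    moreover have "C * \<bar>x - y\<bar> powr p \<ge> 0" by (simp add: C_def)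
    ultimately show ?thesis by (simp add: mult.commute)
  next
    case False
    then have "\<bar>y\<bar> \<le> (1 / d) * \<bar>x - y\<bar>" using d by (simp add: field_simps)
    then have y: "\<bar>y\<bar> powr p \<le> (1 / d) powr p * \<bar>x - y\<bar> powr p"
      using assms d by (metis abs_ge_zero less_imp_le powr_mono2 powr_mult)
    have "\<bar>x\<bar> powr p \<le> 2 powr p * (\<bar>x - y\<bar> powr p + \<bar>y\<bar> powr p)"
      using abs_powr_add_le[of p "x - y" y] assms by simp
    also have "\<dots> \<le> 2 powr p * (\<bar>x - y\<bar> powr p + (1 / d) powr p * \<bar>x - y\<bar> powr p)"
      using y by (intro mult_left_mono add_mono) auto
    finally have "\<bar>x\<bar> powr p + \<bar>y\<bar> powr p \<le> C * \<bar>x - y\<bar> powr p"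
      using y by (simp add: C_def algebra_simps)
    moreover have "\<epsilon> * \<bar>y\<bar> powr p \<ge> 0" using assms by simp
    moreover have "\<bar>x\<bar> powr p \<ge> 0" "\<bar>y\<bar> powr p \<ge> 0" by auto
    ultimately show ?thesis by linarith
  qed
  moreover have "C \<ge> 0" by (simp add: C_def)
  ultimately show ?thesis using that by blast
qed

lemma powr_strict_convex_mid:
  fixes x y p :: real
  assumes p: "p > 1" and "x \<ge> 0" "y \<ge> 0" "x \<noteq> y"
  shows "((x + y) / 2) powr p < (x powr p + y powr p) / 2"
proof -
  have main: "((x + y) / 2) powr p < (x powr p + y powr p) / 2" if xy: "0 \<le> x" "x < y" for x y :: real
  proof -
    define m where "m = (x + y) / 2"
    have m: "x < m" "m < y" "m > 0" using xy by (auto simp: m_def)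
    have D: "((\<lambda>t. t powr p) has_real_derivative p * z powr (p - 1)) (at z)" if "z > 0" for z
      using that by (auto intro!: derivative_eq_intros)
    have "\<exists>z. m < z \<and> z < y \<and> y powr p - m powr p = (y - m) * (p * z powr (p - 1))"
      using m by (intro MVT2 D) auto
    then obtain z where z: "m < z" "z < y" "y powr p - m powr p = (y - m) * (p * z powr (p - 1))" by blast
    have cont: "continuous_on {x..m} (\<lambda>t. t powr p)"
      using p xy by (intro continuous_on_powr' continuous_intros) auto
    \<comment> \<open>The left end point may be 0, so only continuity is used at the ends of this
      interval, and differentiability in its interior.\<close>
    have "\<exists>l w. x < w \<and> w < m \<and> ((\<lambda>t. t powr p) has_real_derivative l) (at w) \<and> m powr p - x powr p = (m - x) * l"
    proof (rule MVT)
      show "\<And>w. x < w \<Longrightarrow> w < m \<Longrightarrow> (\<lambda>t. t powr p) differentiable at w"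
        using D xy by (meson order_le_less_trans real_differentiable_def)
    qed (use m cont in auto)
    then obtain l w where w: "x < w" "w < m" "((\<lambda>t. t powr p) has_real_derivative l) (at w)"
      "m powr p - x powr p = (m - x) * l" by blast
    have "l = p * w powr (p - 1)" using DERIV_unique[OF w(3) D] w(1) xy by auto
    moreover have "w powr (p - 1) < z powr (p - 1)" using w z xy p by (intro powr_less_mono2) auto
    ultimately have "(m - x) * l < (y - m) * (p * z powr (p - 1))"
    proof -
      have "m - x = y - m" by (simp add: m_def field_simps)
      then show ?thesis using m p \<open>l = _\<close> \<open>w powr _ < _\<close>
        by (metis diff_gt_0_iff_gt less_trans mult_strict_left_mono zero_less_one)
    qed
    with z(3) w(4) show ?thesis by (simp add: m_def)
  qed
  show ?thesis using main[of x y] main[of y x] assms by (cases "x < y") (auto simp: add.commute)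
qed

lemma abs_powr_strict_convex_mid:
  fixes x y p :: real
  assumes p: "p > 1" and "x \<noteq> y"
  shows "\<bar>(x + y) / 2\<bar> powr p < (\<bar>x\<bar> powr p + \<bar>y\<bar> powr p) / 2"
proof (cases "\<bar>x\<bar> = \<bar>y\<bar>")
  case True
  then have "x + y = 0" "x \<noteq> 0" using assms by auto
  then show ?thesis by (simp add: True[symmetric])
next
  case False
  have "\<bar>(x + y) / 2\<bar> powr p \<le> ((\<bar>x\<bar> + \<bar>y\<bar>) / 2) powr p" using p by (intro powr_mono2) auto
  also have "\<dots> < (\<bar>x\<bar> powr p + \<bar>y\<bar> powr p) / 2" using False p by (intro powr_strict_convex_mid) auto
  finally show ?thesis .
qed

lemma abs_powr_convex:
  fixes x y p s :: real
  assumes p: "p > 1" and s: "0 \<le> s" "s \<le> 1"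
  shows "\<bar>(1 - s) * x + s * y\<bar> powr p \<le> (1 - s) * \<bar>x\<bar> powr p + s * \<bar>y\<bar> powr p"
proof -
  have pos: "((1 - s) * a + s * b) powr p \<le> (1 - s) * a powr p + s * b powr p" if "a \<ge> 0" "b \<ge> 0" for a b :: real
  proof -
    have sm: "t powr p \<le> t" if "0 \<le> t" "t \<le> 1" for t :: real
      using powr_mono'[of 1 p t] that p by simp
    \<comment> \<open>If one argument vanishes, homogeneity reduces the claim to
      \<open>t powr p \<le> t\<close> on the unit interval.\<close>
    consider "a = 0" | "b = 0" | "a > 0" "b > 0" using \<open>a \<ge> 0\<close> \<open>b \<ge> 0\<close> by fastforce
    then show ?thesis
    proof cases
      case 3
      then show ?thesis using convex_onD[OF powr_convex[of p], of s a b] p s by simp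
    qed (use sm[of s] sm[of "1 - s"] s in \<open>auto simp: powr_mult intro!: mult_right_mono\<close>)
  qed
  have "\<bar>(1 - s) * x + s * y\<bar> \<le> (1 - s) * \<bar>x\<bar> + s * \<bar>y\<bar>"
    using abs_triangle_ineq[of "(1 - s) * x" "s * y"] s by (simp add: abs_mult)
  then have "\<bar>(1 - s) * x + s * y\<bar> powr p \<le> ((1 - s) * \<bar>x\<bar> + s * \<bar>y\<bar>) powr p"
    using p by (intro powr_mono2) auto
  also have "\<dots> \<le> (1 - s) * \<bar>x\<bar> powr p + s * \<bar>y\<bar> powr p" by (rule pos) auto
  finally show ?thesis .
qed

text \<open>Uniform convexity of \<open>\<bar>\<cdot>\<bar> powr p\<close>: by homogeneity it suffices to treat the compact set
  \<open>max \<bar>x\<bar> \<bar>y\<bar> = 1\<close>, where strict convexity gives a positive minimum.\<close>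

lemma abs_powr_uniform_convex:
  fixes p :: real
  assumes p: "p > 1" and e: "\<epsilon> > 0"
  obtains C where "C \<ge> 0" "\<And>x y. \<bar>x - y\<bar> powr p \<le> \<epsilon> * (\<bar>x\<bar> powr p + \<bar>y\<bar> powr p)
      + C * ((\<bar>x\<bar> powr p + \<bar>y\<bar> powr p) / 2 - \<bar>(x + y) / 2\<bar> powr p)"
proof -
  define D where "D = (\<lambda>z::real \<times> real. (\<bar>fst z\<bar> powr p + \<bar>snd z\<bar> powr p) / 2 - \<bar>(fst z + snd z) / 2\<bar> powr p)"
  define G where "G = (\<lambda>z::real \<times> real. \<bar>fst z - snd z\<bar> powr p - \<epsilon> * (\<bar>fst z\<bar> powr p + \<bar>snd z\<bar> powr p))"
  \<comment> \<open>The condition \<open>G z \<ge> 0\<close> keeps \<open>A\<close> away from the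
    diagonal, where \<open>D\<close> vanishes; where \<open>G z < 0\<close> the desired estimate is
    trivial.\<close>
  define A where "A = {z::real \<times> real. \<bar>fst z\<bar> \<le> 1 \<and> \<bar>snd z\<bar> \<le> 1 \<and> max \<bar>fst z\<bar> \<bar>snd z\<bar> = 1 \<and> G z \<ge> 0}"
  have contD: "continuous_on UNIV D" and contG: "continuous_on UNIV G"
    unfolding D_def G_def using p
    by (intro continuous_on_diff continuous_on_divide continuous_on_add continuous_on_mult
          continuous_on_powr' continuous_intros; simp)+
  have "closed A" unfolding A_def
    by (intro closed_Collect_conj closed_Collect_le closed_Collect_eq continuous_intros contG)
  moreover have "bounded A"
    by (rule bounded_subset[OF bounded_Times[OF bounded_cbox[of "-1" "1::real"] bounded_cbox[of "-1" "1::real"]]])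
       (auto simp: A_def)
  ultimately have "compact A" by (simp add: compact_eq_bounded_closed)
  have Dnn: "D z \<ge> 0" for z
  proof (cases "fst z = snd z")
    case True
    then have e: "\<bar>(fst z + snd z) / 2\<bar> = \<bar>snd z\<bar>" by simp
    show ?thesis unfolding D_def e True by simp
  qed (use abs_powr_strict_convex_mid[OF p, of "fst z" "snd z"] in \<open>simp add: D_def\<close>)
  have Dpos: "D z > 0" if "z \<in> A" for z
  proof -
    have "fst z \<noteq> snd z"
    proof
      assume "fst z = snd z"
      with that e show False by (auto simp: A_def G_def max_def mult_le_0_iff split: if_splits)
    qed
    then show ?thesis using abs_powr_strict_convex_mid[OF p, of "fst z" "snd z"] by (simp add: D_def)
  qed
  obtain d where d: "d > 0" "\<And>z. z \<in> A \<Longrightarrow> d \<le> D z"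
  proof (cases "A = {}")
    case False
    then obtain z where "z \<in> A" "\<And>w. w \<in> A \<Longrightarrow> D z \<le> D w"
      using continuous_attains_inf[OF \<open>compact A\<close> False continuous_on_subset[OF contD]] by blast
    then show ?thesis using Dpos that by blast
  qed (use that[of 1] in auto)
  define C where "C = 2 powr p / d"
  have norm1: "G z \<le> C * D z" if z: "\<bar>fst z\<bar> \<le> 1" "\<bar>snd z\<bar> \<le> 1" "max \<bar>fst z\<bar> \<bar>snd z\<bar> = 1" for z
  proof (cases "G z \<ge> 0")
    case True
    then have "z \<in> A" using z by (auto simp: A_def)
    have "G z \<le> \<bar>fst z - snd z\<bar> powr p" using e by (simp add: G_def)
    also have "\<dots> \<le> 2 powr p" using z p by (intro powr_mono2) auto
    also have "\<dots> = C * d" using d by (simp add: C_def)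
    also have "\<dots> \<le> C * D z" using d(1) d(2)[OF \<open>z \<in> A\<close>] by (intro mult_left_mono) (auto simp: C_def)
    finally show ?thesis .
  next
    case False
    moreover have "C * D z \<ge> 0" using d Dnn by (simp add: C_def)
    ultimately show ?thesis by linarith
  qed
  have GD: "G (x, y) \<le> C * D (x, y)" for x y
  proof (cases "x = 0 \<and> y = 0")
    case True then show ?thesis by (simp add: G_def D_def)
  next
    case False
    define r where "r = max \<bar>x\<bar> \<bar>y\<bar>"
    have r: "r > 0" using False by (auto simp: r_def max_def)
    have x: "\<bar>x / r\<bar> powr p = \<bar>x\<bar> powr p / r powr p" for x using r by (simp add: abs_divide powr_divide)
    have "G (x / r, y / r) \<le> C * D (x / r, y / r)"
      using r by (intro norm1) (auto simp: r_def max_def abs_divide)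
    moreover have "G (x / r, y / r) = G (x, y) / r powr p"
      using x[of x] x[of y] x[of "x - y"] by (simp add: G_def diff_divide_distrib add_divide_distrib distrib_left)
    moreover have "D (x / r, y / r) = D (x, y) / r powr p"
    proof -
      have e: "(x / r + y / r) / 2 = ((x + y) / 2) / r" by (simp add: add_divide_distrib)
      have "(a / R + b / R) / 2 - c / R = ((a + b) / 2 - c) / R" for a b c R :: real
        by (simp add: add_divide_distrib diff_divide_distrib)
      then show ?thesis unfolding D_def fst_conv snd_conv e x .
    qed
    ultimately show ?thesis using r by (simp add: divide_le_cancel)
  qed
  then have "\<bar>x - y\<bar> powr p \<le> \<epsilon> * (\<bar>x\<bar> powr p + \<bar>y\<bar> powr p)
      + C * ((\<bar>x\<bar> powr p + \<bar>y\<bar> powr p) / 2 - \<bar>(x + y) / 2\<bar> powr p)" for x y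
    using GD[of x y] unfolding G_def D_def fst_conv snd_conv by linarith
  moreover have "C \<ge> 0" using d by (simp add: C_def)
  ultimately show ?thesis using that by blast
qed

section \<open>The space \<open>L\<^sup>p\<close>\<close>

definition Lp :: "real \<Rightarrow> 'a measure \<Rightarrow> ('a \<Rightarrow> real) set" where
  "Lp p M = {u. u \<in> borel_measurable M \<and> integrable M (\<lambda>t. \<bar>u t\<bar> powr p)}"

text \<open>The p-th power of the norm: scaling and limits are free of roots, at the price of a
  factor \<open>2 powr p\<close> in the triangle inequality.\<close>

definition Np :: "real \<Rightarrow> 'a measure \<Rightarrow> ('a \<Rightarrow> real) \<Rightarrow> real" where
  "Np p M u = (LINT t|M. \<bar>u t\<bar> powr p)"

lemma LpD: "u \<in> Lp p M \<Longrightarrow> u \<in> borel_measurable M" "u \<in> Lp p M \<Longrightarrow> integrable M (\<lambda>t. \<bar>u t\<bar> powr p)"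
  by (auto simp: Lp_def)

lemma Lp_bounded_by:
  fixes h g :: "'a \<Rightarrow> real"
  assumes "h \<in> borel_measurable M" "integrable M g" "\<And>t. t \<in> space M \<Longrightarrow> \<bar>h t\<bar> \<le> g t"
  shows "integrable M h" "\<bar>LINT t|M. h t\<bar> \<le> (LINT t|M. g t)"
proof -
  show *: "integrable M h"
    by (rule Bochner_Integration.integrable_bound[OF assms(2) assms(1)])
       (use assms(3) in \<open>auto intro!: AE_I2 order_trans[OF _ abs_ge_self]\<close>)
  have "\<bar>LINT t|M. h t\<bar> \<le> (LINT t|M. \<bar>h t\<bar>)" by (rule integral_abs_bound)
  also have "\<dots> \<le> (LINT t|M. g t)" using * assms by (intro integral_mono) auto
  finally show "\<bar>LINT t|M. h t\<bar> \<le> (LINT t|M. g t)" .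
qed

lemma Np_nonneg: "Np p M u \<ge> 0"
  by (simp add: Np_def)

lemma Lp_scale: "u \<in> Lp p M \<Longrightarrow> (\<lambda>t. c * u t) \<in> Lp p M"
  by (auto simp: Lp_def abs_mult powr_mult)

lemma Np_scale: "Np p M (\<lambda>t. c * u t) = \<bar>c\<bar> powr p * Np p M u"
  by (simp add: Np_def abs_mult powr_mult)

lemma Np_minus: "Np p M (\<lambda>t. - u t) = Np p M u"
  by (simp add: Np_def)

lemma Np_minus_commute: "Np p M (\<lambda>t. u t - v t) = Np p M (\<lambda>t. v t - u t)"
  by (simp add: Np_def abs_minus_commute)

lemma Lp_add:
  assumes p: "p > 0" and "u \<in> Lp p M" "v \<in> Lp p M"
  shows "(\<lambda>t. u t + v t) \<in> Lp p M"
    and "Np p M (\<lambda>t. u t + v t) \<le> 2 powr p * (Np p M u + Np p M v)"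
proof -
  have m: "u \<in> borel_measurable M" "v \<in> borel_measurable M" using assms by (auto simp: Lp_def)
  have i: "integrable M (\<lambda>t. 2 powr p * (\<bar>u t\<bar> powr p + \<bar>v t\<bar> powr p))" using assms by (auto simp: Lp_def)
  have "integrable M (\<lambda>t. \<bar>u t + v t\<bar> powr p)"
    using m by (intro Lp_bounded_by(1)[OF _ i]) (auto simp: abs_powr_add_le[OF p])
  moreover have "\<bar>LINT t|M. \<bar>u t + v t\<bar> powr p\<bar> \<le> (LINT t|M. 2 powr p * (\<bar>u t\<bar> powr p + \<bar>v t\<bar> powr p))"
    using m by (intro Lp_bounded_by(2)[OF _ i]) (auto simp: abs_powr_add_le[OF p])
  ultimately show "(\<lambda>t. u t + v t) \<in> Lp p M" "Np p M (\<lambda>t. u t + v t) \<le> 2 powr p * (Np p M u + Np p M v)"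
    using m LpD(2)[OF assms(2)] LpD(2)[OF assms(3)] by (auto simp: Lp_def Np_def)
qed

lemma Lp_diff:
  assumes p: "p > 0" and "u \<in> Lp p M" "v \<in> Lp p M"
  shows "(\<lambda>t. u t - v t) \<in> Lp p M"
    and "Np p M (\<lambda>t. u t - v t) \<le> 2 powr p * (Np p M u + Np p M v)"
  using Lp_add[OF p assms(2) Lp_scale[OF assms(3), of "-1"]] Np_scale[of p M "-1" v] by simp_all

lemma Np_triangle:
  assumes p: "p > 0" and "u \<in> Lp p M" "v \<in> Lp p M" "w \<in> Lp p M"
  shows "Np p M (\<lambda>t. u t - w t) \<le> 2 powr p * (Np p M (\<lambda>t. u t - v t) + Np p M (\<lambda>t. v t - w t))"
  using Lp_add(2)[OF p Lp_diff(1)[OF p assms(2,3)] Lp_diff(1)[OF p assms(3,4)]] by simp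

lemma Np_cong_AE:
  assumes "u \<in> borel_measurable M" "v \<in> borel_measurable M" "AE t in M. u t = v t"
  shows "Np p M u = Np p M v"
  unfolding Np_def using assms by (intro integral_cong_AE) auto

lemma Np_eq_0_iff:
  assumes "u \<in> Lp p M"
  shows "Np p M u = 0 \<longleftrightarrow> (AE t in M. u t = 0)"
  unfolding Np_def using assms by (subst integral_nonneg_eq_0_iff_AE) (auto simp: Lp_def)

lemma Np_diff_tendsto_trans:
  assumes p: "p > 0" and L: "\<And>n. u n \<in> Lp p M" "\<And>n. v n \<in> Lp p M" "\<And>n. w n \<in> Lp p M"
    and "(\<lambda>n. Np p M (\<lambda>t. u n t - v n t)) \<longlonglongrightarrow> 0" "(\<lambda>n. Np p M (\<lambda>t. v n t - w n t)) \<longlonglongrightarrow> 0"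
  shows "(\<lambda>n. Np p M (\<lambda>t. u n t - w n t)) \<longlonglongrightarrow> 0"
proof (rule tendsto_sandwich[OF _ _ tendsto_const])
  show "(\<lambda>n. 2 powr p * (Np p M (\<lambda>t. u n t - v n t) + Np p M (\<lambda>t. v n t - w n t))) \<longlonglongrightarrow> 0"
    using tendsto_mult_right_zero[OF tendsto_add_zero[OF assms(5,6)]] by simp
qed (intro always_eventually allI Np_nonneg Np_triangle[OF p L])+

lemma Np_tendsto:
  assumes p: "p > 0" and L: "\<And>n. u n \<in> Lp p M" "v \<in> Lp p M"
    and lim: "(\<lambda>n. Np p M (\<lambda>t. u n t - v t)) \<longlonglongrightarrow> 0"
  shows "(\<lambda>n. Np p M (u n)) \<longlonglongrightarrow> Np p M v"
proof -
  have "(\<lambda>n. Np p M (u n) - Np p M v) \<longlonglongrightarrow> 0"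
  proof (rule tendsto_zero_of_eps_bound[OF _ order_refl lim])
    fix \<epsilon> :: real assume "\<epsilon> > 0"
    then obtain C where C: "\<And>x y. \<bar>\<bar>x\<bar> powr p - \<bar>y\<bar> powr p\<bar> \<le> \<epsilon> * \<bar>y\<bar> powr p + C * \<bar>x - y\<bar> powr p"
      using abs_powr_perturb[OF p] by metis
    have "\<bar>Np p M (u n) - Np p M v\<bar> \<le> \<epsilon> * Np p M v + C * Np p M (\<lambda>t. u n t - v t)" for n
    proof -
      have "\<bar>LINT t|M. \<bar>u n t\<bar> powr p - \<bar>v t\<bar> powr p\<bar> \<le> (LINT t|M. \<epsilon> * \<bar>v t\<bar> powr p + C * \<bar>u n t - v t\<bar> powr p)"
        using L(1)[of n] L(2) Lp_diff(1)[OF p L(1)[of n] L(2)]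
        by (intro Lp_bounded_by(2) C) (auto simp: Lp_def)
      then show ?thesis
        using L(1)[of n] L(2) Lp_diff(1)[OF p L(1)[of n] L(2)] by (simp add: Np_def Lp_def)
    qed
    then show "\<exists>C. \<forall>n. \<bar>Np p M (u n) - Np p M v\<bar> \<le> \<epsilon> * Np p M v + C * Np p M (\<lambda>t. u n t - v t)" by blast
  qed
  then show ?thesis by (simp add: LIM_zero_iff)
qed

text \<open>The Riesz-Fischer argument: a fast subsequence converges almost everywhere, and Fatou's
  lemma carries the Cauchy estimate over to the distance from its limit, for the whole
  sequence.\<close>

lemma Lp_complete:
  assumes p: "p > 0" and L: "\<And>n. u n \<in> Lp p M"
    and cauchy: "\<And>e. e > 0 \<Longrightarrow> \<exists>N. \<forall>m\<ge>N. \<forall>n\<ge>N. Np p M (\<lambda>t. u m t - u n t) < e"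
  obtains v where "v \<in> Lp p M" "(\<lambda>n. Np p M (\<lambda>t. u n t - v t)) \<longlonglongrightarrow> 0"
proof -
  have um [measurable]: "u n \<in> borel_measurable M" for n using L by (auto simp: Lp_def)
  define d where "d = (\<lambda>k::nat. ((1/4) powr p) ^ k)"
  have d: "d k > 0" for k by (simp add: d_def)
  have "\<exists>N. \<forall>m\<ge>N. \<forall>n\<ge>N. Np p M (\<lambda>t. u m t - u n t) < d k" for k using cauchy d by blast
  then obtain R where R: "\<And>k m n. m \<ge> R k \<Longrightarrow> n \<ge> R k \<Longrightarrow> Np p M (\<lambda>t. u m t - u n t) < d k" by metis
  define r where "r = (\<lambda>k. Max (R ` {..k}))"
  have rR: "r k \<ge> R k" for k by (auto simp: r_def)
  have rmono: "r k \<le> r (Suc k)" for k unfolding r_def by (intro Max_mono) auto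
  \<comment> \<open>The weight \<open>(2 powr p) ^ k\<close> still leaves a convergent geometric
    series, since \<open>d k\<close> is a power of \<open>(1/4) powr p\<close>. Where the weighted
    sum is finite, consecutive differences are eventually at most \<open>(1/2) ^ k\<close>.\<close>
  define w where "w = (\<lambda>k t. (2 powr p) ^ k * \<bar>u (r (Suc k)) t - u (r k) t\<bar> powr p)"
  have wm [measurable]: "w k \<in> borel_measurable M" for k unfolding w_def by measurable
  have w0: "w k t \<ge> 0" for k t by (simp add: w_def)
  have wint: "integrable M (w k)" for k
    using Lp_diff(1)[OF p L L, of "r (Suc k)" "r k"] by (auto simp: w_def Lp_def)
  have wle: "(LINT t|M. w k t) \<le> ((1/2) powr p) ^ k" for k
  proof -
    have "(LINT t|M. w k t) = (2 powr p) ^ k * Np p M (\<lambda>t. u (r (Suc k)) t - u (r k) t)"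
      by (simp add: w_def Np_def)
    also have "\<dots> \<le> (2 powr p) ^ k * d k"
      using R[of k "r (Suc k)" "r k"] rR[of k] rmono[of k] by (intro mult_left_mono) auto
    also have "\<dots> = ((1/2) powr p) ^ k"
      by (simp add: d_def flip: power_mult_distrib powr_mult)
    finally show ?thesis .
  qed
  have small: "(1/2::real) powr p < 1" using p powr_less_mono2[of p "1/2" 1] by simp
  have "(\<integral>\<^sup>+t. suminf (\<lambda>k. ennreal (w k t)) \<partial>M) = suminf (\<lambda>k. \<integral>\<^sup>+t. ennreal (w k t) \<partial>M)"
    by (intro nn_integral_suminf) auto
  also have "\<dots> = suminf (\<lambda>k. ennreal (LINT t|M. w k t))"
    using wint w0 by (intro suminf_cong nn_integral_eq_integral) auto
  also have "\<dots> \<le> suminf (\<lambda>k. ennreal (((1/2) powr p) ^ k))"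
    using wle by (intro suminf_le ennreal_leI) auto
  also have "\<dots> = ennreal (suminf (\<lambda>k. ((1/2) powr p) ^ k))"
    using small by (intro suminf_ennreal2) (auto intro!: summable_geometric)
  finally have "(\<integral>\<^sup>+t. suminf (\<lambda>k. ennreal (w k t)) \<partial>M) \<noteq> \<infinity>"
    by (metis ennreal_less_top infinity_ennreal_def leD)
  then have "AE t in M. suminf (\<lambda>k. ennreal (w k t)) \<noteq> \<infinity>" by (intro nn_integral_PInf_AE) auto
  then have conv: "AE t in M. convergent (\<lambda>k. u (r k) t)"
  proof eventually_elim
    fix t assume "suminf (\<lambda>k. ennreal (w k t)) \<noteq> \<infinity>"
    then have "summable (\<lambda>k. w k t)" using w0 by (intro summable_suminf_not_top) auto
    then have "(\<lambda>k. w k t) \<longlonglongrightarrow> 0" by (rule summable_LIMSEQ_zero)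
    then have ev: "eventually (\<lambda>k. w k t < 1) sequentially" by (rule order_tendstoD) simp
    have ev': "eventually (\<lambda>k. norm (u (r (Suc k)) t - u (r k) t) \<le> (1/2) ^ k) sequentially"
      using ev
    proof eventually_elim
      fix k assume "w k t < 1"
      have "(2 ^ k * \<bar>u (r (Suc k)) t - u (r k) t\<bar>) powr p = w k t"
        by (simp add: w_def powr_mult powr_power mult.commute flip: powr_realpow powr_powr)
          (simp add: powr_powr mult.commute)
      then have "2 ^ k * \<bar>u (r (Suc k)) t - u (r k) t\<bar> \<le> 1"
        using \<open>w k t < 1\<close> p powr_less_mono2[of p 1 "2 ^ k * \<bar>u (r (Suc k)) t - u (r k) t\<bar>"] by force
      then show "norm (u (r (Suc k)) t - u (r k) t) \<le> (1/2) ^ k" by (simp add: field_simps)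
    qed
    have "summable (\<lambda>k. u (r (Suc k)) t - u (r k) t)"
      by (rule summable_comparison_test_ev[OF ev']) (auto intro!: summable_geometric)
    then have "convergent (\<lambda>n. \<Sum>k<n. u (r (Suc k)) t - u (r k) t)" by (simp add: summable_iff_convergent)
    then have "convergent (\<lambda>n. u (r n) t - u (r 0) t)" by (subst (asm) sum_lessThan_telescope)
    then show "convergent (\<lambda>k. u (r k) t)" by (simp add: convergent_diff_const_right_iff)
  qed
  define v where "v = (\<lambda>t. lim (\<lambda>k. u (r k) t))"
  have vm [measurable]: "v \<in> borel_measurable M" unfolding v_def by measurable
  have lim: "AE t in M. (\<lambda>k. u (r k) t) \<longlonglongrightarrow> v t"
    using conv by eventually_elim (simp add: v_def convergent_LIMSEQ_iff)
  have fatou: "integrable M (\<lambda>t. \<bar>u n t - v t\<bar> powr p) \<and> Np p M (\<lambda>t. u n t - v t) \<le> d K" if n: "n \<ge> R K" for n K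
  proof -
    have "(\<integral>\<^sup>+t. ennreal (\<bar>u n t - v t\<bar> powr p) \<partial>M) = (\<integral>\<^sup>+t. liminf (\<lambda>k. ennreal (\<bar>u n t - u (r k) t\<bar> powr p)) \<partial>M)"
    proof (rule nn_integral_cong_AE, use lim in eventually_elim)
      fix t assume "(\<lambda>k. u (r k) t) \<longlonglongrightarrow> v t"
      then have "(\<lambda>k. ennreal (\<bar>u n t - u (r k) t\<bar> powr p)) \<longlonglongrightarrow> ennreal (\<bar>u n t - v t\<bar> powr p)"
        using p by (intro tendsto_ennrealI tendsto_powr2 tendsto_intros) auto
      then show "ennreal (\<bar>u n t - v t\<bar> powr p) = liminf (\<lambda>k. ennreal (\<bar>u n t - u (r k) t\<bar> powr p))"
        by (intro lim_imp_Liminf[symmetric]) simp_all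
    qed
    also have "\<dots> \<le> liminf (\<lambda>k. \<integral>\<^sup>+t. ennreal (\<bar>u n t - u (r k) t\<bar> powr p) \<partial>M)"
      by (intro nn_integral_liminf) auto
    also have "\<dots> \<le> liminf (\<lambda>k::nat. ennreal (d K))"
    proof (rule Liminf_mono)
      have "(\<integral>\<^sup>+t. ennreal (\<bar>u n t - u (r k) t\<bar> powr p) \<partial>M) \<le> ennreal (d K)" if "k \<ge> K" for k
      proof -
        have "r K \<le> r k" using that by (rule lift_Suc_mono_le[of r, OF rmono])
        then have "Np p M (\<lambda>t. u n t - u (r k) t) < d K" using n rR[of K] by (intro R) auto
        moreover have "(\<integral>\<^sup>+t. ennreal (\<bar>u n t - u (r k) t\<bar> powr p) \<partial>M) = ennreal (Np p M (\<lambda>t. u n t - u (r k) t))"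
          unfolding Np_def using Lp_diff(1)[OF p L L, of n "r k"]
          by (intro nn_integral_eq_integral) (auto simp: Lp_def)
        ultimately show ?thesis by (simp add: ennreal_leI)
      qed
      then show "eventually (\<lambda>k. (\<integral>\<^sup>+t. ennreal (\<bar>u n t - u (r k) t\<bar> powr p) \<partial>M) \<le> ennreal (d K)) sequentially"
        by (auto simp: eventually_sequentially)
    qed
    also have "\<dots> = ennreal (d K)" by (simp add: Liminf_const)
    finally have le: "(\<integral>\<^sup>+t. ennreal (\<bar>u n t - v t\<bar> powr p) \<partial>M) \<le> ennreal (d K)" .
    then have int: "integrable M (\<lambda>t. \<bar>u n t - v t\<bar> powr p)"
      by (intro integrableI_nonneg) (auto intro: le_less_trans)
    have "ennreal (Np p M (\<lambda>t. u n t - v t)) \<le> ennreal (d K)"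
      unfolding Np_def using le int by (subst nn_integral_eq_integral[symmetric]) auto
    then show ?thesis using int d[of K] by simp
  qed
  have "(\<lambda>t. u (R 0) t - v t) \<in> Lp p M" using fatou[of 0 "R 0"] by (simp add: Lp_def)
  from Lp_diff(1)[OF p L[of "R 0"] this] have "v \<in> Lp p M" by simp
  moreover have "(\<lambda>n. Np p M (\<lambda>t. u n t - v t)) \<longlonglongrightarrow> 0"
  proof (rule LIMSEQ_I)
    fix e :: real assume "e > 0"
    have "(\<lambda>k. d k) \<longlonglongrightarrow> 0" unfolding d_def using p by (intro LIMSEQ_power_zero) (use powr_less_mono2[of p "1/4" 1] in auto)
    then have "eventually (\<lambda>k. d k < e) sequentially" using \<open>e > 0\<close> by (rule order_tendstoD)
    then obtain K where "d K < e" by (auto simp: eventually_sequentially)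
    have "norm (Np p M (\<lambda>t. u n t - v t) - 0) < e" if "n \<ge> R K" for n
      using fatou[OF that] Np_nonneg[of p M "\<lambda>t. u n t - v t"] \<open>d K < e\<close> by simp
    then show "\<exists>no. \<forall>n\<ge>no. norm (Np p M (\<lambda>t. u n t - v t) - 0) < e" by blast
  qed
  ultimately show ?thesis using that by blast
qed

section \<open>The Borsuk--Ulam theorem\<close>

text \<open>The index range \<open>{..m}\<close> makes this the m-dimensional sphere, realised
  inside sequences just as \<open>nsphere m\<close> is.\<close>

definition sph :: "nat \<Rightarrow> (nat \<Rightarrow> real) set" where
  "sph m = {x. (\<forall>i>m. x i = 0) \<and> (\<Sum>i\<le>m. (x i)\<^sup>2) = 1}"

lemma sphD: "x \<in> sph m \<Longrightarrow> i > m \<Longrightarrow> x i = 0" "x \<in> sph m \<Longrightarrow> (\<Sum>i\<le>m. (x i)\<^sup>2) = 1"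
  by (auto simp: sph_def)

lemma sph_abs_le: "x \<in> sph m \<Longrightarrow> \<bar>x i\<bar> \<le> 1"
proof (cases "i \<le> m")
  case True
  assume x: "x \<in> sph m"
  have "(x i)\<^sup>2 \<le> (\<Sum>i\<le>m. (x i)\<^sup>2)" using True by (intro member_le_sum) auto
  then show ?thesis using sphD(2)[OF x] by (simp add: abs_square_le_1)
qed (auto simp: sph_def)

lemma sph_uminus: "x \<in> sph m \<Longrightarrow> (\<lambda>i. - x i) \<in> sph m"
  by (auto simp: sph_def)

lemma sph_nonempty: "sph m \<noteq> {}"
proof -
  have "(\<Sum>i\<le>m. (if i = 0 then 1 else 0::real)\<^sup>2) = (\<Sum>i\<le>m. if i = 0 then 1 else 0)"
    by (intro sum.cong) auto
  then have "(\<lambda>i. if i = 0 then 1 else 0) \<in> sph m" by (simp add: sph_def)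
  then show ?thesis by blast
qed

lemma sph_subset_Suc: "x \<in> sph m \<Longrightarrow> x \<in> sph (Suc m)"
  by (auto simp: sph_def)

lemma sph_Suc_equator: "x \<in> sph (Suc m) \<Longrightarrow> x (Suc m) = 0 \<Longrightarrow> x \<in> sph m"
  unfolding sph_def by (auto, metis Suc_lessI)

lemma continuous_coordinate [continuous_intros]: "continuous_on S (\<lambda>x::nat \<Rightarrow> real. x i)"
  by (rule continuous_on_subset[OF continuous_on_product_coordinates]) simp

lemma nsphere_sph: "nsphere m = top_of_set (sph m)"
  by (simp add: nsphere sph_def euclidean_product_topology conj_commute)

lemma topspace_nsphere_sph: "topspace (nsphere m) = sph m"
  by (simp add: nsphere_sph)

lemma compact_sph: "compact (sph m)"
proof -
  have "compact (Pi\<^sub>E UNIV (\<lambda>j::nat. {- 1..1::real}))"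
    using compactin_PiE[of "\<lambda>_. euclideanreal" UNIV "\<lambda>j. {- 1..1}"]
    by (simp add: euclidean_product_topology)
  moreover have "closed (sph m)"
    unfolding sph_def
    by (intro closed_Collect_conj closed_Collect_all closed_Collect_imp closed_Collect_eq continuous_intros open_Collect_const)
  moreover have "sph m \<subseteq> Pi\<^sub>E UNIV (\<lambda>j::nat. {- 1..1::real})"
    using sph_abs_le by (fastforce simp: abs_le_iff)
  ultimately show ?thesis using compact_Int_closed by (metis inf.absorb_iff2)
qed

section \<open>Normalisation and the degree of nowhere vanishing maps\<close>

definition nrm :: "nat \<Rightarrow> (nat \<Rightarrow> real) \<Rightarrow> real" where
  "nrm m y = sqrt (\<Sum>i\<le>m. (y i)\<^sup>2)"

definition nrml :: "nat \<Rightarrow> (nat \<Rightarrow> real) \<Rightarrow> nat \<Rightarrow> real" where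
  "nrml m y = (\<lambda>i. if i \<le> m then y i / nrm m y else 0)"

lemma nrm_pos: "i \<le> m \<Longrightarrow> y i \<noteq> 0 \<Longrightarrow> nrm m y > 0"
  unfolding nrm_def by (auto intro!: sum_pos2[of _ i])

lemma nrml_sph:
  assumes "i \<le> m" "y i \<noteq> 0"
  shows "nrml m y \<in> sph m"
proof -
  have pos: "nrm m y > 0" by (rule nrm_pos[of i m y, OF assms])
  have "(\<Sum>i\<le>m. (nrml m y i)\<^sup>2) = (\<Sum>i\<le>m. (y i)\<^sup>2) / (nrm m y)\<^sup>2"
    by (simp add: nrml_def power_divide sum_divide_distrib)
  also have "(nrm m y)\<^sup>2 = (\<Sum>i\<le>m. (y i)\<^sup>2)" by (simp add: nrm_def sum_nonneg)
  also have "(\<Sum>i\<le>m. (y i)\<^sup>2) / (\<Sum>i\<le>m. (y i)\<^sup>2) = 1" using pos by (simp add: nrm_def)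
  finally show ?thesis by (simp add: sph_def nrml_def)
qed

lemma nrml_uminus: "(\<And>i. i \<le> m \<Longrightarrow> z i = - y i) \<Longrightarrow> nrml m z = (\<lambda>i. - nrml m y i)"
proof -
  assume z: "\<And>i. i \<le> m \<Longrightarrow> z i = - y i"
  then have "nrm m z = nrm m y" unfolding nrm_def by simp
  then show ?thesis using z by (auto simp: nrml_def)
qed

lemma continuous_on_nrml:
  fixes F :: "'a::topological_space \<Rightarrow> nat \<Rightarrow> real"
  assumes "\<And>i. i \<le> m \<Longrightarrow> continuous_on S (\<lambda>x. F x i)" "\<And>x. x \<in> S \<Longrightarrow> \<exists>i\<le>m. F x i \<noteq> 0"
  shows "continuous_on S (\<lambda>x. nrml m (F x))"
proof (rule continuous_on_coordinatewise_then_product)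
  fix i
  have "nrm m (F x) \<noteq> 0" if "x \<in> S" for x using nrm_pos assms(2)[OF that] by fastforce
  then show "continuous_on S (\<lambda>x. nrml m (F x) i)"
    unfolding nrml_def using assms(1)
    by (cases "i \<le> m") (auto intro!: continuous_on_divide continuous_on_sum continuous_on_power continuous_on_real_sqrt simp: nrm_def)
qed

text \<open>Normalising inside the definition lets maps and homotopies leave the sphere as long as
  they avoid 0.\<close>

definition deg :: "nat \<Rightarrow> ((nat \<Rightarrow> real) \<Rightarrow> nat \<Rightarrow> real) \<Rightarrow> int" where
  "deg m F = Brouwer_degree2 m (\<lambda>x. nrml m (F x))"

lemma deg_homotopic:
  fixes H :: "real \<Rightarrow> (nat \<Rightarrow> real) \<Rightarrow> nat \<Rightarrow> real"
  assumes c: "\<And>i. i \<le> m \<Longrightarrow> continuous_on ({0..1} \<times> sph m) (\<lambda>z. H (fst z) (snd z) i)"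
    and nz: "\<And>t x. 0 \<le> t \<Longrightarrow> t \<le> 1 \<Longrightarrow> x \<in> sph m \<Longrightarrow> \<exists>i\<le>m. H t x i \<noteq> 0"
  shows "deg m (H 0) = deg m (H 1)"
  unfolding deg_def
proof (rule Brouwer_degree2_homotopic)
  have "continuous_on ({0..1} \<times> sph m) (\<lambda>z. nrml m (H (fst z) (snd z)))"
    by (rule continuous_on_nrml[where F = "\<lambda>z. H (fst z) (snd z)"]) (use c nz in auto)
  moreover have "nrml m (H t x) \<in> sph m" if "0 \<le> t" "t \<le> 1" "x \<in> sph m" for t x
    using nz[OF that] nrml_sph by blast
  ultimately have "homotopic_with_canon (\<lambda>x. True) (sph m) (sph m) (\<lambda>x. nrml m (H 0 x)) (\<lambda>x. nrml m (H 1 x))"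
    unfolding homotopic_with_def
    by (intro exI[of _ "\<lambda>z. nrml m (H (fst z) (snd z))"])
      (auto simp: continuous_map_in_subtopology subtopology_Times[symmetric])
  then show "homotopic_with (\<lambda>x. True) (nsphere m) (nsphere m) (\<lambda>x. nrml m (H 0 x)) (\<lambda>x. nrml m (H 1 x))"
    by (simp add: nsphere_sph)
qed

text \<open>The continuous Lipschitz functions on the compact sphere form an algebra that separates
  points, so Stone-Weierstrass applies. Passing to the odd part keeps the error, as the sphere is
  symmetric and \<open>F\<close> is odd. The Lipschitz constant is what allows counting missed
  directions.\<close>

lemma odd_lipschitz_approximation:
  fixes F :: "(nat \<Rightarrow> real) \<Rightarrow> real"
  assumes c: "continuous_on (sph m) F" and odd: "\<And>x. x \<in> sph m \<Longrightarrow> F (\<lambda>i. - x i) = - F x" and e: "e > 0"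
  obtains G L where "L \<ge> 0" "\<And>x. G (\<lambda>i. - x i) = - G x" "\<And>x. x \<in> sph m \<Longrightarrow> \<bar>G x - F x\<bar> < e"
    "\<And>x y. x \<in> sph m \<Longrightarrow> y \<in> sph m \<Longrightarrow> \<bar>G x - G y\<bar> \<le> L * (\<Sum>j\<le>m. \<bar>x j - y j\<bar>)"
    "continuous_on (sph m) G"
proof -
  define d where "d x y = (\<Sum>j\<le>m. \<bar>x j - y j\<bar>)" for x y :: "nat \<Rightarrow> real"
  have d0: "d x y \<ge> 0" for x y by (simp add: d_def sum_nonneg)
  define P where "P f \<longleftrightarrow> continuous_on (sph m) f \<and> (\<exists>L\<ge>0. \<forall>x\<in>sph m. \<forall>y\<in>sph m. \<bar>f x - f y\<bar> \<le> L * d x y)" for f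
  have "\<exists>g. P g \<and> (\<forall>x\<in>sph m. \<bar>F x - g x\<bar> < e)"
  proof (rule Stone_Weierstrass_HOL[OF compact_sph _ _ _ _ _ c e])
    show "P (\<lambda>x. k)" for k by (auto simp: P_def intro!: exI[of _ 0])
    show "P f \<Longrightarrow> continuous_on (sph m) f" for f by (simp add: P_def)
    show "P (\<lambda>x. f x + g x)" if "P f \<and> P g" for f g
    proof -
      obtain L1 L2 where L: "L1 \<ge> 0" "L2 \<ge> 0" "\<And>x y. x \<in> sph m \<Longrightarrow> y \<in> sph m \<Longrightarrow> \<bar>f x - f y\<bar> \<le> L1 * d x y"
        "\<And>x y. x \<in> sph m \<Longrightarrow> y \<in> sph m \<Longrightarrow> \<bar>g x - g y\<bar> \<le> L2 * d x y"
        using \<open>P f \<and> P g\<close> unfolding P_def by metis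
      have "\<bar>(f x + g x) - (f y + g y)\<bar> \<le> (L1 + L2) * d x y" if "x \<in> sph m" "y \<in> sph m" for x y
        using L(3)[OF that] L(4)[OF that] by (simp add: distrib_right)
      then show ?thesis using \<open>P f \<and> P g\<close> L(1,2) unfolding P_def
        by (intro conjI continuous_on_add exI[of _ "L1 + L2"]) auto
    qed
    show "P (\<lambda>x. f x * g x)" if "P f \<and> P g" for f g
    proof -
      obtain L1 L2 where L: "L1 \<ge> 0" "L2 \<ge> 0" "\<And>x y. x \<in> sph m \<Longrightarrow> y \<in> sph m \<Longrightarrow> \<bar>f x - f y\<bar> \<le> L1 * d x y"
        "\<And>x y. x \<in> sph m \<Longrightarrow> y \<in> sph m \<Longrightarrow> \<bar>g x - g y\<bar> \<le> L2 * d x y"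
        using \<open>P f \<and> P g\<close> unfolding P_def by metis
      have bdd: "\<exists>B\<ge>0. \<forall>x\<in>sph m. \<bar>h x\<bar> \<le> B" if h: "continuous_on (sph m) h" for h :: "(nat \<Rightarrow> real) \<Rightarrow> real"
      proof -
        obtain z where "z \<in> sph m" "\<And>x. x \<in> sph m \<Longrightarrow> \<bar>h x\<bar> \<le> \<bar>h z\<bar>"
          using continuous_attains_sup[OF compact_sph sph_nonempty continuous_on_rabs[OF h]] by blast
        then show ?thesis by (intro exI[of _ "\<bar>h z\<bar>"]) auto
      qed
      obtain B1 B2 where B: "B1 \<ge> 0" "B2 \<ge> 0" "\<And>x. x \<in> sph m \<Longrightarrow> \<bar>f x\<bar> \<le> B1" "\<And>x. x \<in> sph m \<Longrightarrow> \<bar>g x\<bar> \<le> B2"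
        using bdd[of f] bdd[of g] \<open>P f \<and> P g\<close> unfolding P_def by metis
      have "\<bar>f x * g x - f y * g y\<bar> \<le> (B1 * L2 + B2 * L1) * d x y" if xy: "x \<in> sph m" "y \<in> sph m" for x y
      proof -
        have "f x * g x - f y * g y = f x * (g x - g y) + g y * (f x - f y)" by (simp add: algebra_simps)
        then have "\<bar>f x * g x - f y * g y\<bar> \<le> \<bar>f x\<bar> * \<bar>g x - g y\<bar> + \<bar>g y\<bar> * \<bar>f x - f y\<bar>"
          by (metis abs_mult abs_triangle_ineq)
        also have "\<dots> \<le> B1 * (L2 * d x y) + B2 * (L1 * d x y)"
          using B L xy by (intro add_mono mult_mono) auto
        finally show ?thesis by (simp add: algebra_simps)
      qed
      then show ?thesis using \<open>P f \<and> P g\<close> L(1,2) B(1,2) unfolding P_def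
        by (intro conjI continuous_on_mult exI[of _ "B1 * L2 + B2 * L1"]) auto
    qed
    show "\<exists>f. P f \<and> f x \<noteq> f y" if xy: "x \<in> sph m \<and> y \<in> sph m \<and> x \<noteq> y" for x y
    proof -
      obtain i where i: "x i \<noteq> y i" using xy by blast
      then have "i \<le> m" using xy sphD(1) by (metis not_le_imp_less)
      have "\<bar>u i - v i\<bar> \<le> 1 * d u v" for u v
        unfolding d_def using member_le_sum[of i "{..m}" "\<lambda>j. \<bar>u j - v j\<bar>"] \<open>i \<le> m\<close> by simp
      then have "P (\<lambda>x. x i)" unfolding P_def by (intro conjI continuous_intros exI[of _ 1]) auto
      then show ?thesis using i by blast
    qed
  qed
  then obtain g L where g: "continuous_on (sph m) g" "L \<ge> 0"
    "\<And>x y. x \<in> sph m \<Longrightarrow> y \<in> sph m \<Longrightarrow> \<bar>g x - g y\<bar> \<le> L * d x y" "\<And>x. x \<in> sph m \<Longrightarrow> \<bar>F x - g x\<bar> < e"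
    unfolding P_def by metis
  define G where "G x = (g x - g (\<lambda>i. - x i)) / 2" for x
  have "\<bar>G x - F x\<bar> < e" if x: "x \<in> sph m" for x
    using g(4)[OF x] g(4)[OF sph_uminus[OF x]] odd[OF x] unfolding G_def by (simp add: field_simps)
  moreover have "\<bar>G x - G y\<bar> \<le> L * d x y" if xy: "x \<in> sph m" "y \<in> sph m" for x y
  proof -
    have "d (\<lambda>i. - x i) (\<lambda>i. - y i) = d x y" unfolding d_def by (intro sum.cong) auto
    then have "\<bar>g (\<lambda>i. - x i) - g (\<lambda>i. - y i)\<bar> \<le> L * d x y"
      using g(3)[OF sph_uminus[OF xy(1)] sph_uminus[OF xy(2)]] by simp
    then show ?thesis using g(3)[OF xy] unfolding G_def by (simp add: field_simps)
  qed
  moreover have "continuous_on (sph m) (\<lambda>x. g (\<lambda>i. - x i))"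
    by (rule continuous_on_compose2[OF g(1)])
       (auto intro!: continuous_on_coordinatewise_then_product continuous_intros sph_uminus)
  then have "continuous_on (sph m) G" unfolding G_def by (intro continuous_intros g(1)) auto
  moreover have "G (\<lambda>i. - x i) = - G x" for x unfolding G_def by (simp add: field_simps)
  ultimately show ?thesis using that g(2) unfolding d_def by blast
qed


text \<open>Pigeonhole count: a Lipschitz map on the \<open>m\<close>-sphere into \<open>\<real>\<^sup>m\<^sup>+\<^sup>2\<close> cannot meet all lines, since the
  \<open>m\<close>-sphere splits into \<open>O(N^m)\<close> cells of diameter \<open>O(1/N)\<close> while there are \<open>(n+1)^(m+1)\<close> grid
  directions.\<close>

lemma sphere_cells:
  fixes N :: nat
  assumes N: "N > 0"
  obtains cell :: "(nat \<Rightarrow> real) \<Rightarrow> nat \<times> bool \<times> (nat \<Rightarrow> int)" and C where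
    "finite C" "card C = (m + 1) * (2 * (2 * N + 1) ^ m)" "\<And>x. x \<in> sph m \<Longrightarrow> cell x \<in> C"
    "\<And>x y. x \<in> sph m \<Longrightarrow> y \<in> sph m \<Longrightarrow> cell x = cell y \<Longrightarrow>
      (\<Sum>j\<le>m. \<bar>x j - y j\<bar>) \<le> real ((m + 1) * (m + 1)) / real N"
proof -
  \<comment> \<open>Since the squares sum to 1 and do not exceed the absolute values, some
    coordinate is at least \<open>1 / (m + 1)\<close> in size. That coordinate is left out of the
    grid and only its sign is recorded: this brings the exponent in the count down to
    \<open>m\<close>.\<close>
  define big where "big x = (SOME j. j \<le> m \<and> \<bar>x j\<bar> \<ge> 1 / real (m + 1))" for x :: "nat \<Rightarrow> real"
  have big: "big x \<le> m" "\<bar>x (big x)\<bar> \<ge> 1 / real (m + 1)" if x: "x \<in> sph m" for x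
  proof -
    have "\<exists>j. j \<le> m \<and> \<bar>x j\<bar> \<ge> 1 / real (m + 1)"
    proof (rule ccontr)
      assume no: "\<not> ?thesis"
      have "(x j)\<^sup>2 < 1 / real (m + 1)" if "j \<le> m" for j
      proof -
        have "(x j)\<^sup>2 \<le> \<bar>x j\<bar>"
          using sph_abs_le[OF x, of j] mult_right_le_one_le[of "\<bar>x j\<bar>" "\<bar>x j\<bar>"] by (simp add: power2_eq_square)
        then show ?thesis using no that by fastforce
      qed
      then have "(\<Sum>j\<le>m. (x j)\<^sup>2) < (\<Sum>j\<le>m. 1 / real (m + 1))" by (intro sum_strict_mono) auto
      then show False using sphD(2)[OF x] by simp
    qed
    then have "big x \<le> m \<and> \<bar>x (big x)\<bar> \<ge> 1 / real (m + 1)" unfolding big_def by (rule someI_ex)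
    then show "big x \<le> m" "\<bar>x (big x)\<bar> \<ge> 1 / real (m + 1)" by auto
  qed
  define cell where "cell x = (big x, x (big x) \<ge> 0, restrict (\<lambda>j. \<lfloor>real N * x j\<rfloor>) ({..m} - {big x}))" for x
  define C where "C = (SIGMA k:{..m}. (UNIV :: bool set) \<times> (Pi\<^sub>E ({..m} - {k}) (\<lambda>_. {- int N..int N})))"
  have "finite C" unfolding C_def by (intro finite_SigmaI finite_PiE) auto
  moreover have "card C = (m + 1) * (2 * (2 * N + 1) ^ m)"
  proof -
    have "card C = (\<Sum>k\<le>m. card ((UNIV :: bool set) \<times> (Pi\<^sub>E ({..m} - {k}) (\<lambda>_. {- int N..int N}))))"
      unfolding C_def by (intro card_SigmaI) (auto intro!: finite_PiE)
    also have "\<dots> = (\<Sum>k\<le>m. 2 * (2 * N + 1) ^ m)"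
    proof (rule sum.cong)
      fix k assume k: "k \<in> {..m}"
      have "nat (int N - - int N + 1) = 2 * N + 1" by simp
      then have "card (Pi\<^sub>E ({..m} - {k}) (\<lambda>_. {- int N..int N})) = (2 * N + 1) ^ m"
        using k by (subst card_PiE) (auto simp: card_Diff_singleton)
      then show "card ((UNIV :: bool set) \<times> (Pi\<^sub>E ({..m} - {k}) (\<lambda>_. {- int N..int N}))) = 2 * (2 * N + 1) ^ m"
        by (simp add: card_cartesian_product)
    qed simp
    finally show ?thesis by simp
  qed
  moreover have "cell x \<in> C" if x: "x \<in> sph m" for x
  proof -
    have "\<lfloor>real N * x j\<rfloor> \<in> {- int N..int N}" for j
    proof -
      have "real N * \<bar>x j\<bar> \<le> real N * 1" by (intro mult_left_mono sph_abs_le[OF x]) auto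
      then have "\<bar>real N * x j\<bar> \<le> real N" by (simp add: abs_mult)
      then show ?thesis by (simp add: le_floor_iff abs_le_iff) linarith
    qed
    then show ?thesis unfolding cell_def C_def using big(1)[OF x] by auto
  qed
  moreover have "(\<Sum>j\<le>m. \<bar>x j - y j\<bar>) \<le> real ((m + 1) * (m + 1)) / real N"
    if x: "x \<in> sph m" and y: "y \<in> sph m" and eq: "cell x = cell y" for x y
  proof -
    define k where "k = big x"
    have k: "big y = k" "k \<le> m" "x k \<ge> 0 \<longleftrightarrow> y k \<ge> 0" using eq big(1)[OF x] by (auto simp: cell_def k_def)
    have close: "\<bar>x j - y j\<bar> \<le> 1 / real N" if "j \<in> {..m} - {k}" for j
    proof -
      have "restrict (\<lambda>j. \<lfloor>real N * x j\<rfloor>) ({..m} - {k}) = restrict (\<lambda>j. \<lfloor>real N * y j\<rfloor>) ({..m} - {k})"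
        using eq k(1) by (simp add: cell_def k_def)
      from fun_cong[OF this, of j] have "\<lfloor>real N * x j\<rfloor> = \<lfloor>real N * y j\<rfloor>" using that by simp
      then have "\<bar>real N * x j - real N * y j\<bar> \<le> 1" by linarith
      then have "real N * \<bar>x j - y j\<bar> \<le> 1" by (simp add: abs_mult flip: right_diff_distrib)
      then show ?thesis using N by (simp add: field_simps)
    qed
    have sumle: "(\<Sum>j\<in>{..m} - {k}. \<bar>x j - y j\<bar>) \<le> real m / real N"
      using sum_bounded_above[of "{..m} - {k}" "\<lambda>j. \<bar>x j - y j\<bar>" "1 / real N"] close k(2)
      by (simp add: card_Diff_singleton)
    have split: "(\<Sum>j\<le>m. g j) = g k + (\<Sum>j\<in>{..m} - {k}. g j)" for g :: "nat \<Rightarrow> real"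
      using k(2) by (intro sum.remove) auto
    \<comment> \<open>The omitted coordinate is recovered from the equation of the sphere: its
      squares differ by little, and \<open>\<bar>x k + y k\<bar>\<close> is at least
      \<open>2 / (m + 1)\<close> because both values are large and of equal sign.\<close>
    have sq: "(x k)\<^sup>2 - (y k)\<^sup>2 = (\<Sum>j\<in>{..m} - {k}. (y j)\<^sup>2 - (x j)\<^sup>2)"
      using sphD(2)[OF x] sphD(2)[OF y] split[of "\<lambda>j. (x j)\<^sup>2"] split[of "\<lambda>j. (y j)\<^sup>2"] by (simp add: sum_subtractf)
    have "\<bar>(x k)\<^sup>2 - (y k)\<^sup>2\<bar> \<le> (\<Sum>j\<in>{..m} - {k}. \<bar>(y j)\<^sup>2 - (x j)\<^sup>2\<bar>)" unfolding sq by (rule sum_abs)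
    also have "\<dots> \<le> (\<Sum>j\<in>{..m} - {k}. 2 * \<bar>x j - y j\<bar>)"
    proof (rule sum_mono)
      fix j
      have "\<bar>(y j)\<^sup>2 - (x j)\<^sup>2\<bar> = \<bar>y j + x j\<bar> * \<bar>x j - y j\<bar>"
        by (simp add: power2_eq_square square_diff_square_factored abs_mult abs_minus_commute)
      also have "\<dots> \<le> 2 * \<bar>x j - y j\<bar>"
        using sph_abs_le[OF x, of j] sph_abs_le[OF y, of j] by (intro mult_right_mono) auto
      finally show "\<bar>(y j)\<^sup>2 - (x j)\<^sup>2\<bar> \<le> 2 * \<bar>x j - y j\<bar>" .
    qed
    also have "\<dots> = 2 * (\<Sum>j\<in>{..m} - {k}. \<bar>x j - y j\<bar>)" by (simp add: sum_distrib_left)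
    also have "\<dots> \<le> 2 * (real m / real N)" using sumle by simp
    finally have A: "\<bar>(x k)\<^sup>2 - (y k)\<^sup>2\<bar> \<le> 2 * (real m / real N)" .
    have "\<bar>x k + y k\<bar> \<ge> 2 / real (m + 1)"
      using big(2)[OF x] big(2)[OF y] k unfolding k_def[symmetric] by (cases "x k \<ge> 0") auto
    then have "2 / real (m + 1) * \<bar>x k - y k\<bar> \<le> \<bar>x k + y k\<bar> * \<bar>x k - y k\<bar>" by (rule mult_right_mono) simp
    also have "\<dots> = \<bar>(x k)\<^sup>2 - (y k)\<^sup>2\<bar>"
      by (simp add: power2_eq_square square_diff_square_factored abs_mult)
    finally have "2 / real (m + 1) * \<bar>x k - y k\<bar> \<le> 2 * (real m / real N)" using A by linarith
    then have "real (m + 1) / 2 * (2 / real (m + 1) * \<bar>x k - y k\<bar>) \<le> real (m + 1) / 2 * (2 * (real m / real N))"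
      by (intro mult_left_mono) auto
    moreover have "real (m + 1) / 2 * (2 / real (m + 1) * z) = z" "real (m + 1) / 2 * (2 * z) = real (m + 1) * z" for z
      by simp_all
    ultimately have "\<bar>x k - y k\<bar> \<le> real (m + 1) * (real m / real N)" by simp
    then have "(\<Sum>j\<le>m. \<bar>x j - y j\<bar>) \<le> real (m + 1) * (real m / real N) + real m / real N"
      using sumle split[of "\<lambda>j. \<bar>x j - y j\<bar>"] by linarith
    also have "\<dots> \<le> real ((m + 1) * (m + 1)) / real N"
      using N by (simp add: field_simps)
    finally show ?thesis .
  qed
  ultimately show ?thesis using that by blast
qed

text \<open>If every direction \<open>(b, 1)\<close> were hit, choose a preimage for each grid
  vector \<open>b\<close> with entries in \<open>{0, 1/n, ..., 1}\<close>. Preimages in one cell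
  have almost equal images, hence equal slopes, so different \<open>b\<close> occupy different
  cells; there are too few cells for that.\<close>

lemma missed_direction:
  fixes G :: "(nat \<Rightarrow> real) \<Rightarrow> nat \<Rightarrow> real"
  assumes L: "L \<ge> 0" "\<And>x y i. x \<in> sph m \<Longrightarrow> y \<in> sph m \<Longrightarrow> i \<le> Suc m \<Longrightarrow> \<bar>G x i - G y i\<bar> \<le> L * (\<Sum>j\<le>m. \<bar>x j - y j\<bar>)"
    and c: "c > 0" "\<And>x. x \<in> sph m \<Longrightarrow> (\<Sum>i\<le>Suc m. \<bar>G x i\<bar>) \<ge> c"
  obtains b where "\<And>x. x \<in> sph m \<Longrightarrow> \<exists>i\<le>m. G x i \<noteq> b i * G x (Suc m)"
proof (rule ccontr)
  note goal = that
  assume "\<not> thesis"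
  then have hit: "\<exists>x\<in>sph m. \<forall>i\<le>m. G x i = b i * G x (Suc m)" for b
    using goal by metis
  define \<eta> where "\<eta> = c / real (m + 2)"
  have \<eta>: "\<eta> > 0" using c(1) by (simp add: \<eta>_def)
  \<comment> \<open>With \<open>N = \<kappa> * n\<close> cells per unit, this makes the slopes over
    one cell differ by less than the grid width \<open>1 / n\<close>.\<close>
  obtain \<kappa> :: nat where \<kappa>: "real \<kappa> > 2 * L * real ((m + 1) * (m + 1)) / \<eta>" using reals_Archimedean2 by blast
  have "2 * L * real ((m + 1) * (m + 1)) / \<eta> \<ge> 0" using L(1) \<eta> by (intro divide_nonneg_pos mult_nonneg_nonneg) auto
  then have \<kappa>0: "\<kappa> > 0" using \<kappa> by (cases "\<kappa> = 0") auto
  \<comment> \<open>Chosen so that the number of cells is at most \<open>n * (n + 1) ^ m\<close>,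
    just below the number \<open>(n + 1) ^ (m + 1)\<close> of directions.\<close>
  define n where "n = 2 * (m + 1) * (2 * \<kappa> + 1) ^ m"
  have n: "n > 0" by (simp add: n_def)
  define N where "N = \<kappa> * n"
  have N: "N > 0" using \<kappa>0 n by (simp add: N_def)
  obtain cell :: "(nat \<Rightarrow> real) \<Rightarrow> nat \<times> bool \<times> (nat \<Rightarrow> int)" and C where cell:
    "finite C" "card C = (m + 1) * (2 * (2 * N + 1) ^ m)" "\<And>x. x \<in> sph m \<Longrightarrow> cell x \<in> C"
    "\<And>x y. x \<in> sph m \<Longrightarrow> y \<in> sph m \<Longrightarrow> cell x = cell y \<Longrightarrow>
      (\<Sum>j\<le>m. \<bar>x j - y j\<bar>) \<le> real ((m + 1) * (m + 1)) / real N"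
    by (rule sphere_cells[OF N]) blast
  define D where "D = (Pi\<^sub>E {..m} (\<lambda>_. {0..n}))"
  have "\<exists>x. x \<in> sph m \<and> (\<forall>i\<le>m. G x i = (real (b i) / real n) * G x (Suc m))" for b :: "nat \<Rightarrow> nat"
    using hit[of "\<lambda>i. real (b i) / real n"] by blast
  then obtain \<xi> where \<xi>: "\<And>b. \<xi> b \<in> sph m" "\<And>b i. i \<le> m \<Longrightarrow> G (\<xi> b) i = (real (b i) / real n) * G (\<xi> b) (Suc m)"
    by metis
  \<comment> \<open>The slopes lie in \<open>[0,1]\<close>, so the last coordinate dominates all
    \<open>m + 2\<close> of them and takes at least the share \<open>\<eta>\<close> of the total
    \<open>c\<close>.\<close>
  have last: "\<bar>G (\<xi> b) (Suc m)\<bar> \<ge> \<eta>" if b: "b \<in> D" for b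
  proof -
    have "(\<Sum>i\<le>m. \<bar>G (\<xi> b) i\<bar>) \<le> (\<Sum>i\<le>m. \<bar>G (\<xi> b) (Suc m)\<bar>)"
    proof (rule sum_mono)
      fix i assume i: "i \<in> {..m}"
      then have "b i \<le> n" using b by (auto simp: D_def)
      then have "real (b i) / real n \<le> 1" using n by simp
      then have "real (b i) / real n * \<bar>G (\<xi> b) (Suc m)\<bar> \<le> 1 * \<bar>G (\<xi> b) (Suc m)\<bar>"
        by (rule mult_right_mono) simp
      moreover have "\<bar>G (\<xi> b) i\<bar> = real (b i) / real n * \<bar>G (\<xi> b) (Suc m)\<bar>"
        using \<xi>(2)[of i b] i by (simp add: abs_mult)
      ultimately show "\<bar>G (\<xi> b) i\<bar> \<le> \<bar>G (\<xi> b) (Suc m)\<bar>" by simp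
    qed
    then have "c \<le> real (m + 2) * \<bar>G (\<xi> b) (Suc m)\<bar>" using c(2)[OF \<xi>(1)[of b]] by (simp add: algebra_simps)
    then show ?thesis by (simp add: \<eta>_def field_simps)
  qed
  have "inj_on (cell \<circ> \<xi>) D"
  proof (rule inj_onI)
    fix b b' assume b: "b \<in> D" "b' \<in> D" and eq: "(cell \<circ> \<xi>) b = (cell \<circ> \<xi>) b'"
    define d where "d = (\<Sum>j\<le>m. \<bar>\<xi> b j - \<xi> b' j\<bar>)"
    have d: "d \<le> real ((m + 1) * (m + 1)) / real N"
      unfolding d_def using cell(4)[OF \<xi>(1) \<xi>(1)] eq by simp
    have "b i = b' i" if i: "i \<le> m" for i
    proof -
      define g g' where "g = G (\<xi> b) (Suc m)" and "g' = G (\<xi> b') (Suc m)"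
      have 1: "\<bar>G (\<xi> b) i - G (\<xi> b') i\<bar> \<le> L * d" "\<bar>g - g'\<bar> \<le> L * d"
        unfolding g_def g'_def d_def using i by (auto intro!: L(2) \<xi>(1))
      have b'1: "\<bar>real (b' i) / real n\<bar> \<le> 1" using b(2) i n by (auto simp: D_def)
      have eq: "(real (b i) / real n - real (b' i) / real n) * g
          = (G (\<xi> b) i - G (\<xi> b') i) - (real (b' i) / real n) * (g - g')"
        using \<xi>(2)[OF i] by (simp add: g_def g'_def algebra_simps)
      have "\<bar>(real (b i) / real n - real (b' i) / real n) * g\<bar> \<le> L * d + 1 * (L * d)"
      proof -
        have "\<bar>real (b' i) / real n * (g - g')\<bar> \<le> 1 * (L * d)"
          unfolding abs_mult using 1 b'1 by (intro mult_mono) auto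
        then show ?thesis
          unfolding eq by (rule order_trans[OF abs_triangle_ineq4 add_mono[OF 1(1)]])
      qed
      moreover have "\<bar>real (b i) / real n - real (b' i) / real n\<bar> * \<eta> \<le> \<bar>(real (b i) / real n - real (b' i) / real n) * g\<bar>"
        unfolding abs_mult g_def using last[OF b(1)] by (intro mult_left_mono) auto
      ultimately have "\<bar>real (b i) / real n - real (b' i) / real n\<bar> * \<eta> \<le> 2 * L * d" by linarith
      also have "\<dots> \<le> 2 * L * (real ((m + 1) * (m + 1)) / real N)" using d L(1) by (intro mult_left_mono) auto
      also have "\<dots> = (2 * L * real ((m + 1) * (m + 1)) / \<eta>) * (\<eta> / real N)" using \<eta> by simp
      also have "\<dots> < real \<kappa> * (\<eta> / real N)" using \<kappa> \<eta> N by (intro mult_strict_right_mono) auto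
      also have "\<dots> = \<eta> / real n" using \<kappa>0 by (simp add: N_def)
      finally have "\<bar>real (b i) / real n - real (b' i) / real n\<bar> * \<eta> < 1 / real n * \<eta>" by simp
      then have "\<bar>real (b i) / real n - real (b' i) / real n\<bar> < 1 / real n"
        using \<eta> mult_less_cancel_right_pos by blast
      then have "\<bar>real (b i) - real (b' i)\<bar> < 1" using n by (simp add: field_simps flip: diff_divide_distrib)
      then show "b i = b' i" by linarith
    qed
    then show "b = b'" using b unfolding D_def by (intro PiE_ext) auto
  qed
  then have "card D \<le> card C"
    by (rule card_inj_on_le) (use cell(1,3) \<xi>(1) in auto)
  also have "card C \<le> (m + 1) * (2 * ((2 * \<kappa> + 1) * (n + 1)) ^ m)"
    unfolding cell(2) N_def by (intro mult_left_mono power_mono) (auto simp: algebra_simps)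
  also have "\<dots> = (2 * (m + 1) * (2 * \<kappa> + 1) ^ m) * (n + 1) ^ m"
    by (simp only: power_mult_distrib mult_ac)
  also have "\<dots> = n * (n + 1) ^ m" by (simp only: n_def)
  also have "card D = (n + 1) * (n + 1) ^ m" unfolding D_def by (subst card_PiE) auto
  finally have "(n + 1) * (n + 1) ^ m \<le> n * (n + 1) ^ m" .
  then show False by simp
qed


section \<open>Parity of the degree of odd maps\<close>

definition nonvanishing_odd :: "nat \<Rightarrow> ((nat \<Rightarrow> real) \<Rightarrow> nat \<Rightarrow> real) \<Rightarrow> bool" where
  "nonvanishing_odd m F \<longleftrightarrow> (\<forall>i\<le>m. continuous_on (sph m) (\<lambda>x. F x i)) \<and>
     (\<forall>x\<in>sph m. \<exists>i\<le>m. F x i \<noteq> 0) \<and> (\<forall>x\<in>sph m. \<forall>i\<le>m. F (\<lambda>i. - x i) i = - F x i)"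

lemma continuous_map_nrml:
  assumes "nonvanishing_odd m F"
  shows "continuous_map (nsphere m) (nsphere m) (\<lambda>x. nrml m (F x))"
proof -
  have "continuous_on (sph m) (\<lambda>x. nrml m (F x))"
    using assms by (intro continuous_on_nrml) (auto simp: nonvanishing_odd_def)
  moreover have "nrml m (F x) \<in> sph m" if "x \<in> sph m" for x
    using assms that nrml_sph unfolding nonvanishing_odd_def by blast
  ultimately show ?thesis by (auto simp: nsphere_sph continuous_map_in_subtopology)
qed

text \<open>The 0-sphere consists of two antipodal points, so an odd self-map is the identity or the
  reflection, of degree 1 or -1.\<close>

lemma deg_odd_0:
  assumes "nonvanishing_odd 0 F"
  shows "odd (deg 0 F)"
proof -
  define e :: "nat \<Rightarrow> real" where "e = (\<lambda>i. if i = 0 then 1 else 0)"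
  have S: "x = e \<or> x = (\<lambda>i. - e i)" if "x \<in> sph 0" for x
  proof -
    have "x 0 = 1 \<or> x 0 = - 1" using sphD(2)[OF that] by (simp add: power2_eq_1_iff)
    then show ?thesis using sphD(1)[OF that] by (auto simp: e_def)
  qed
  have eS: "e \<in> sph 0" by (simp add: sph_def e_def)
  define f where "f x = nrml 0 (F x)" for x
  have fe: "f e \<in> sph 0" using nrml_sph eS assms unfolding nonvanishing_odd_def f_def by blast
  have neg: "f (\<lambda>i. - e i) = (\<lambda>i. - f e i)"
    unfolding f_def by (rule nrml_uminus) (use assms eS in \<open>auto simp: nonvanishing_odd_def\<close>)
  from S[OF fe] show ?thesis
  proof
    assume "f e = e"
    then have "f x = id x" if "x \<in> sph 0" for x using S[OF that] neg by auto
    then have "deg 0 F = Brouwer_degree2 0 id"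
      unfolding deg_def f_def[symmetric] by (intro Brouwer_degree2_eq) (simp add: topspace_nsphere_sph)
    then show ?thesis by simp
  next
    assume "f e = (\<lambda>i. - e i)"
    then have "f x = (\<lambda>i. if i = 0 then - x i else x i)" if "x \<in> sph 0" for x using S[OF that] neg by (auto simp: e_def)
    then have "deg 0 F = Brouwer_degree2 0 (\<lambda>x i. if i = 0 then - x i else x i)"
      unfolding deg_def f_def[symmetric] by (intro Brouwer_degree2_eq) (simp add: topspace_nsphere_sph)
    then show ?thesis by (simp add: Brouwer_degree2_reflection)
  qed
qed

text \<open>An odd map is deformed, through odd nowhere vanishing maps, to one that preserves the equator:
  approximate it by a Lipschitz map, shear so that a direction missed by the image of the equator
  becomes the last axis, and damp the last coordinate to zero on the equator.\<close>

theorem deg_odd: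
  "nonvanishing_odd m F \<Longrightarrow> odd (deg m F)"
proof (induction m arbitrary: F)
  case 0
  then show ?case by (rule deg_odd_0)
next
  case (Suc m)
  let ?S = "sph (Suc m)"
  have Fc: "\<And>i. i \<le> Suc m \<Longrightarrow> continuous_on ?S (\<lambda>x. F x i)"
    and Fnz: "\<And>x. x \<in> ?S \<Longrightarrow> \<exists>i\<le>Suc m. F x i \<noteq> 0"
    and Fodd: "\<And>x i. x \<in> ?S \<Longrightarrow> i \<le> Suc m \<Longrightarrow> F (\<lambda>i. - x i) i = - F x i"
    using Suc.prems unfolding nonvanishing_odd_def by auto
  have "continuous_on ?S (\<lambda>x. \<Sum>i\<le>Suc m. \<bar>F x i\<bar>)" by (intro continuous_on_sum continuous_on_rabs Fc) auto
  then obtain z where z: "z \<in> ?S" "\<And>x. x \<in> ?S \<Longrightarrow> (\<Sum>i\<le>Suc m. \<bar>F z i\<bar>) \<le> (\<Sum>i\<le>Suc m. \<bar>F x i\<bar>)"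
    using continuous_attains_inf[OF compact_sph sph_nonempty] by blast
  define c where "c = (\<Sum>i\<le>Suc m. \<bar>F z i\<bar>)"
  have c: "c > 0"
  proof -
    obtain i where "i \<le> Suc m" "F z i \<noteq> 0" using Fnz[OF z(1)] by blast
    then show ?thesis unfolding c_def by (intro sum_pos2[of _ i]) auto
  qed
  \<comment> \<open>There are \<open>m + 2\<close> coordinates; moving each of them by at most
    \<open>e\<close> costs at most half of the minimum \<open>c\<close>.\<close>
  define e where "e = c / (2 * real (m + 2))"
  have e: "e > 0" using c by (simp add: e_def)
  define Pr where "Pr i G L \<longleftrightarrow> L \<ge> 0 \<and> (\<forall>x. G (\<lambda>i. - x i) = - G x) \<and> (\<forall>x\<in>?S. \<bar>G x - F x i\<bar> < e) \<and>
    (\<forall>x\<in>?S. \<forall>y\<in>?S. \<bar>G x - G y\<bar> \<le> L * (\<Sum>j\<le>Suc m. \<bar>x j - y j\<bar>)) \<and> continuous_on ?S G" for i G and L :: real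
  have "\<forall>i\<in>{..Suc m}. \<exists>z. Pr i (fst z) (snd z)"
  proof
    fix i assume "i \<in> {..Suc m}"
    then have i: "i \<le> Suc m" by simp
    obtain G L where "L \<ge> 0" "\<And>x. G (\<lambda>i. - x i) = - G x" "\<And>x. x \<in> ?S \<Longrightarrow> \<bar>G x - F x i\<bar> < e"
      "\<And>x y. x \<in> ?S \<Longrightarrow> y \<in> ?S \<Longrightarrow> \<bar>G x - G y\<bar> \<le> L * (\<Sum>j\<le>Suc m. \<bar>x j - y j\<bar>)" "continuous_on ?S G"
      by (rule odd_lipschitz_approximation[OF Fc[OF i] Fodd[OF _ i] e]) blast+
    then have "Pr i (fst (G, L)) (snd (G, L))" unfolding Pr_def by auto
    then show "\<exists>z. Pr i (fst z) (snd z)" ..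
  qed
  then obtain z' where z': "\<forall>i\<in>{..Suc m}. Pr i (fst (z' i)) (snd (z' i))" unfolding bchoice_iff ..
  define G' L' where "G' i = fst (z' i)" and "L' i = snd (z' i)" for i
  have G': "L' i \<ge> 0 \<and> (\<forall>x. G' i (\<lambda>i. - x i) = - G' i x) \<and> (\<forall>x\<in>?S. \<bar>G' i x - F x i\<bar> < e) \<and>
    (\<forall>x\<in>?S. \<forall>y\<in>?S. \<bar>G' i x - G' i y\<bar> \<le> L' i * (\<Sum>j\<le>Suc m. \<bar>x j - y j\<bar>)) \<and> continuous_on ?S (G' i)"
    if "i \<le> Suc m" for i
    using z' that unfolding Pr_def G'_def L'_def by blast
  define G where "G x i = G' i x" for x i
  have Gc: "continuous_on ?S (\<lambda>x. G x i)" if "i \<le> Suc m" for i using G'[OF that] by (simp add: G_def)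
  have Godd: "G (\<lambda>i. - x i) i = - G x i" if "i \<le> Suc m" for x i using G'[OF that] by (simp add: G_def)
  have GF: "\<bar>G x i - F x i\<bar> < e" if "i \<le> Suc m" "x \<in> ?S" for x i using G'[OF that(1)] that(2) by (simp add: G_def)
  have close: "(\<Sum>i\<le>Suc m. \<bar>H i\<bar>) \<ge> c / 2" if x: "x \<in> ?S" and H: "\<And>i. i \<le> Suc m \<Longrightarrow> \<bar>H i - F x i\<bar> \<le> e" for x H
  proof -
    have "c \<le> (\<Sum>i\<le>Suc m. \<bar>F x i\<bar>)" unfolding c_def by (rule z(2)[OF x])
    also have "\<dots> \<le> (\<Sum>i\<le>Suc m. \<bar>H i\<bar> + e)" using H by (intro sum_mono) fastforce
    also have "\<dots> = (\<Sum>i\<le>Suc m. \<bar>H i\<bar>) + real (m + 2) * e" by (simp add: sum.distrib algebra_simps)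
    also have "real (m + 2) * e = c / 2"
    proof -
      have "a * (c / (2 * a)) = c / 2" if "a \<noteq> 0" for a :: real using that by simp
      then show ?thesis unfolding e_def by (metis add_2_eq_Suc' nat.distinct(1) of_nat_eq_0_iff)
    qed
    finally show ?thesis by simp
  qed
  have ex_nz: "\<exists>i\<le>Suc m. H i \<noteq> 0" if "(\<Sum>i\<le>Suc m. \<bar>H i\<bar>) \<ge> c / 2" for H :: "nat \<Rightarrow> real"
  proof (rule ccontr)
    assume "\<not> ?thesis"
    then have "(\<Sum>i\<le>Suc m. \<bar>H i\<bar>) = 0" by (intro sum.neutral) auto
    then show False using that c by simp
  qed
  have Gbig: "(\<Sum>i\<le>Suc m. \<bar>G x i\<bar>) \<ge> c / 2" if "x \<in> ?S" for x
    using GF that by (intro close[OF that]) (auto intro: less_imp_le)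
  note cz = continuous_on_compose2[OF _ continuous_on_snd[OF continuous_on_id]]
  have cS: "continuous_on ({0..1::real} \<times> ?S) (\<lambda>z. h (snd z))" if "continuous_on ?S h" for h :: "(nat \<Rightarrow> real) \<Rightarrow> real"
    by (rule continuous_on_compose2[OF that continuous_on_snd[OF continuous_on_id]]) auto
  have deg1: "deg (Suc m) F = deg (Suc m) G"
  proof -
    define H where "H t x i = F x i + t * (G x i - F x i)" for t x i
    have "deg (Suc m) (H 0) = deg (Suc m) (H 1)"
    proof (rule deg_homotopic)
      fix i assume i: "i \<le> Suc m"
      show "continuous_on ({0..1} \<times> ?S) (\<lambda>z. H (fst z) (snd z) i)"
        unfolding H_def by (intro continuous_intros cS Fc Gc i)
    next
      fix t :: real and x assume t: "0 \<le> t" "t \<le> 1" and x: "x \<in> ?S"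
      show "\<exists>i\<le>Suc m. H t x i \<noteq> 0"
      proof (rule ex_nz, rule close[OF x])
        fix i assume i: "i \<le> Suc m"
        have "\<bar>t * (G x i - F x i)\<bar> \<le> 1 * \<bar>G x i - F x i\<bar>" unfolding abs_mult using t by (intro mult_right_mono) auto
        then show "\<bar>H t x i - F x i\<bar> \<le> e" using GF[OF i x] by (simp add: H_def)
      qed
    qed
    moreover have "H 0 = F" "H 1 = G" by (auto simp: H_def fun_eq_iff)
    ultimately show ?thesis by simp
  qed
  define L where "L = (\<Sum>i\<le>Suc m. L' i)"
  have L'le: "L' i \<le> L" if "i \<le> Suc m" for i
    unfolding L_def using G' that by (intro member_le_sum) auto
  have L0: "L \<ge> 0" unfolding L_def using G' by (intro sum_nonneg) auto
  obtain b where b: "\<And>x. x \<in> sph m \<Longrightarrow> \<exists>i\<le>m. G x i \<noteq> b i * G x (Suc m)"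
  proof (rule missed_direction[of L m G "c / 2"])
    fix x y i assume x: "x \<in> sph m" and y: "y \<in> sph m" and i: "i \<le> Suc m"
    have "\<bar>G x i - G y i\<bar> \<le> L' i * (\<Sum>j\<le>Suc m. \<bar>x j - y j\<bar>)"
      using G'[OF i] sph_subset_Suc[OF x] sph_subset_Suc[OF y] by (simp add: G_def)
    also have "\<dots> \<le> L * (\<Sum>j\<le>Suc m. \<bar>x j - y j\<bar>)" by (intro mult_right_mono L'le i sum_nonneg) auto
    also have "(\<Sum>j\<le>Suc m. \<bar>x j - y j\<bar>) = (\<Sum>j\<le>m. \<bar>x j - y j\<bar>)"
      using sphD(1)[OF x, of "Suc m"] sphD(1)[OF y, of "Suc m"] by simp
    finally show "\<bar>G x i - G y i\<bar> \<le> L * (\<Sum>j\<le>m. \<bar>x j - y j\<bar>)" .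
  qed (use L0 c Gbig sph_subset_Suc in auto)
  \<comment> \<open>The shear is invertible for every \<open>t\<close>, so no zero appears on the
    way. At \<open>t = 1\<close> a point of the equator sent to the last axis would have
    \<open>G x\<close> in the direction \<open>(b, 1)\<close>, which is excluded.\<close>
  define P where "P t x i = (if i = Suc m then G x i else G x i - t * b i * G x (Suc m))" for t x i
  have deg2: "deg (Suc m) (P 0) = deg (Suc m) (P 1)"
  proof (rule deg_homotopic)
    fix i assume i: "i \<le> Suc m"
    show "continuous_on ({0..1} \<times> ?S) (\<lambda>z. P (fst z) (snd z) i)"
      unfolding P_def by (cases "i = Suc m") (auto intro!: continuous_intros cS Gc i)
  next
    fix t :: real and x assume x: "x \<in> ?S"
    show "\<exists>i\<le>Suc m. P t x i \<noteq> 0"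
    proof (rule ccontr)
      assume no: "\<not> ?thesis"
      then have l: "G x (Suc m) = 0" by (auto simp: P_def)
      have "G x i = 0" if "i \<le> Suc m" for i using no l that by (cases "i = Suc m") (auto simp: P_def)
      then show False using ex_nz[OF Gbig[OF x]] by blast
    qed
  qed
  have P0: "P 0 = G" by (auto simp: P_def fun_eq_iff)
  define p where "p = P 1"
  have pc: "continuous_on ?S (\<lambda>x. p x i)" if "i \<le> Suc m" for i
    unfolding p_def P_def using that by (cases "i = Suc m") (auto intro!: continuous_intros Gc)
  have podd: "p (\<lambda>i. - x i) i = - p x i" if "i \<le> Suc m" for x i
    using Godd[OF that] Godd[of "Suc m"] by (simp add: p_def P_def)
  have pnz: "\<exists>i\<le>Suc m. p x i \<noteq> 0" if x: "x \<in> ?S" for x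
  proof (rule ccontr)
    assume no: "\<not> ?thesis"
    then have l: "G x (Suc m) = 0" by (auto simp: p_def P_def)
    have "G x i = 0" if "i \<le> Suc m" for i using no l that by (cases "i = Suc m") (auto simp: p_def P_def)
    then show False using ex_nz[OF Gbig[OF x]] by blast
  qed
  have peq: "\<exists>i\<le>m. p x i \<noteq> 0" if x: "x \<in> sph m" for x
  proof -
    obtain i where "i \<le> m" "G x i \<noteq> b i * G x (Suc m)" using b[OF x] by blast
    then show ?thesis by (intro exI[of _ i]) (simp add: p_def P_def)
  qed
  define \<rho> where "\<rho> x = (\<Sum>i\<le>m. \<bar>p x i\<bar>)" for x
  have \<rho>0: "\<rho> x \<ge> 0" for x by (simp add: \<rho>_def sum_nonneg)
  have \<rho>z: "p x i = 0" if "\<rho> x = 0" "i \<le> m" for x i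
    using that by (simp add: \<rho>_def sum_nonneg_eq_0_iff)
  have den: "\<rho> x + \<bar>x (Suc m)\<bar> > 0" if x: "x \<in> ?S" for x
  proof (rule ccontr)
    assume "\<not> ?thesis"
    then have "\<rho> x = 0" "x (Suc m) = 0" using \<rho>0[of x] by auto
    then show False using peq[OF sph_Suc_equator[OF x]] \<rho>z by blast
  qed
  \<comment> \<open>At \<open>t = 1\<close> the factor is 0 on the equator, where
    \<open>x (Suc m) = 0\<close>. Where \<open>\<rho>\<close> vanishes the factor is 1 for every
    \<open>t\<close>, so the last coordinate survives exactly where it is the only nonzero
    one.\<close>
  define Q where "Q t x i = (if i = Suc m then p x i * (1 - t * (\<rho> x / (\<rho> x + \<bar>x (Suc m)\<bar>))) else p x i)" for t x i
  have \<rho>c: "continuous_on ?S \<rho>" unfolding \<rho>_def by (intro continuous_intros pc) auto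
  have \<rho>c': "continuous_on ?S (\<lambda>x. \<rho> x / (\<rho> x + \<bar>x (Suc m)\<bar>))"
    using den by (intro continuous_intros \<rho>c) force
  have Qnz: "\<exists>i\<le>Suc m. Q t x i \<noteq> 0" if x: "x \<in> ?S" for t x
  proof (rule ccontr)
    assume no: "\<not> ?thesis"
    have z: "p x i = 0" if "i \<le> m" for i
    proof -
      have "Q t x i = 0" using no that by auto
      then show ?thesis using that by (simp add: Q_def)
    qed
    then have "\<rho> x = 0" by (simp add: \<rho>_def)
    moreover have "Q t x (Suc m) = 0" using no by auto
    ultimately have "p x (Suc m) = 0" by (simp add: Q_def)
    with z have "p x i = 0" if "i \<le> Suc m" for i using that le_Suc_eq by blast
    then show False using pnz[OF x] by blast
  qed
  have Qc: "continuous_on ({0..1} \<times> ?S) (\<lambda>z. Q (fst z) (snd z) i)" if i: "i \<le> Suc m" for i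
  proof (cases "i = Suc m")
    case True
    then have "(\<lambda>z. Q (fst z) (snd z) i) = (\<lambda>z. p (snd z) i * (1 - fst z * (\<rho> (snd z) / (\<rho> (snd z) + \<bar>snd z (Suc m)\<bar>))))"
      by (simp add: Q_def fun_eq_iff)
    then show ?thesis
      by (simp only:) (intro continuous_on_mult continuous_on_diff continuous_on_const continuous_on_fst
          continuous_on_id cS[OF pc[OF i]] cS[OF \<rho>c'])
  next
    case False
    then show ?thesis by (simp add: Q_def cS[OF pc[OF i]])
  qed
  have deg3: "deg (Suc m) (Q 0) = deg (Suc m) (Q 1)" by (rule deg_homotopic) (use Qc Qnz in auto)
  have Q0: "Q 0 = p" by (auto simp: Q_def fun_eq_iff)
  define q where "q = Q 1"
  have qc: "continuous_on ?S (\<lambda>x. q x i)" if "i \<le> Suc m" for i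
    unfolding q_def Q_def using that by (cases "i = Suc m") (auto intro!: continuous_on_mult continuous_on_diff continuous_on_const pc \<rho>c')
  have qodd: "q (\<lambda>i. - x i) i = - q x i" if "i \<le> Suc m" for x i
  proof -
    have "\<rho> (\<lambda>i. - x i) = \<rho> x" unfolding \<rho>_def using podd by simp
    then show ?thesis using podd[OF that] podd[of "Suc m" x] by (simp add: q_def Q_def)
  qed
  have qno: "nonvanishing_odd (Suc m) q"
    unfolding nonvanishing_odd_def using qc Qnz qodd by (auto simp: q_def)
  have qlast: "q x (Suc m) = 0" if "x \<in> sph m" for x
    using den[OF sph_subset_Suc[OF that]] sphD(1)[OF that, of "Suc m"] by (simp add: q_def Q_def)
  have pno: "nonvanishing_odd m q"
  proof -
    have "sph m \<subseteq> ?S" using sph_subset_Suc by blast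
    then have "continuous_on (sph m) (\<lambda>x. q x i)" if "i \<le> m" for i using qc that by (meson continuous_on_subset le_SucI)
    moreover have "\<exists>i\<le>m. q x i \<noteq> 0" if "x \<in> sph m" for x
      using Qnz[OF sph_subset_Suc[OF that], of 1] qlast[OF that] by (metis le_Suc_eq q_def)
    ultimately show ?thesis unfolding nonvanishing_odd_def using qodd by auto
  qed
  have restr: "nrml (Suc m) (q x) = nrml m (q x)" if "x \<in> sph m" for x
  proof -
    have "nrm (Suc m) (q x) = nrm m (q x)" using qlast[OF that] by (simp add: nrm_def)
    then show ?thesis using qlast[OF that] by (auto simp: nrml_def le_Suc_eq fun_eq_iff)
  qed
  \<comment> \<open>An odd map that preserves the equator has a degree of the same parity as its
    restriction to the equator, to which the induction hypothesis applies.\<close>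
  have "even (Brouwer_degree2 (Suc m) (\<lambda>x. nrml (Suc m) (q x)) - Brouwer_degree2 (Suc m - Suc 0) (\<lambda>x. nrml (Suc m) (q x)))"
  proof (rule Borsuk_odd_mapping_degree_step)
    show "continuous_map (nsphere (Suc m)) (nsphere (Suc m)) (\<lambda>x. nrml (Suc m) (q x))"
      by (rule continuous_map_nrml[OF qno])
    show "((\<lambda>x. nrml (Suc m) (q x)) \<circ> (\<lambda>x i. - x i)) u = ((\<lambda>x i. - x i) \<circ> (\<lambda>x. nrml (Suc m) (q x))) u" for u
      using nrml_uminus[of "Suc m" "q (\<lambda>i. - u i)" "q u", OF qodd] by simp
    show "(\<lambda>x. nrml (Suc m) (q x)) \<in> topspace (nsphere (Suc m - Suc 0)) \<rightarrow> topspace (nsphere (Suc m - Suc 0))"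
      unfolding topspace_nsphere_sph
    proof
      fix x assume "x \<in> sph (Suc m - Suc 0)"
      then have x: "x \<in> sph m" by simp
      then show "nrml (Suc m) (q x) \<in> sph (Suc m - Suc 0)"
        using restr[OF x] nrml_sph pno unfolding nonvanishing_odd_def by auto
    qed
  qed
  moreover have "Brouwer_degree2 m (\<lambda>x. nrml (Suc m) (q x)) = deg m q"
    unfolding deg_def by (rule Brouwer_degree2_eq) (simp add: restr topspace_nsphere_sph)
  moreover have "odd (deg m q)" by (rule Suc.IH[OF pno])
  ultimately have "odd (deg (Suc m) q)" unfolding deg_def[of "Suc m"] by simp
  moreover have "deg (Suc m) F = deg (Suc m) q" using deg1 deg2 deg3 P0 Q0 by (simp add: p_def q_def)
  ultimately show ?case by simp
qed

text \<open>Padded with a zero coordinate, a nowhere vanishing odd \<open>g\<close> normalises to an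
  odd self-map of the sphere that misses a pole. A map that is not surjective has degree 0, against
  \<open>deg_odd\<close>.\<close>

theorem borsuk_ulam:
  fixes g :: "(nat \<Rightarrow> real) \<Rightarrow> nat \<Rightarrow> real"
  assumes c: "\<And>i. i < m \<Longrightarrow> continuous_on (sph m) (\<lambda>x. g x i)"
    and odd: "\<And>x i. x \<in> sph m \<Longrightarrow> i < m \<Longrightarrow> g (\<lambda>j. - x j) i = - g x i"
  obtains x where "x \<in> sph m" "\<And>i. i < m \<Longrightarrow> g x i = 0"
proof (rule ccontr)
  note goal = that
  assume no: "\<not> thesis"
  have nz: "\<exists>i<m. g x i \<noteq> 0" if "x \<in> sph m" for x
  proof (rule ccontr)
    assume "\<not> ?thesis"
    then have thesis by (intro goal[OF that]) auto
    with no show False by contradiction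
  qed
  define F where "F x i = (if i < m then g x i else 0)" for x i
  have F: "nonvanishing_odd m F"
    unfolding nonvanishing_odd_def
  proof (intro conjI allI impI ballI)
    fix i
    show "continuous_on (sph m) (\<lambda>x. F x i)" unfolding F_def by (cases "i < m") (auto intro: c)
  next
    fix x assume "x \<in> sph m"
    then obtain i where "i < m" "g x i \<noteq> 0" using nz by blast
    then show "\<exists>i\<le>m. F x i \<noteq> 0" by (intro exI[of _ i]) (auto simp: F_def)
  next
    fix x i assume "x \<in> sph m"
    then show "F (\<lambda>i. - x i) i = - F x i" by (simp add: F_def odd)
  qed
  define f where "f x = nrml m (F x)" for x
  define e :: "nat \<Rightarrow> real" where "e = (\<lambda>i. if i = m then 1 else 0)"
  have "(\<Sum>i\<le>m. (e i)\<^sup>2) = (\<Sum>i\<le>m. if i = m then 1 else 0)" by (intro sum.cong) (auto simp: e_def)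
  then have "e \<in> sph m" by (simp add: sph_def e_def)
  moreover have "e \<notin> f ` sph m"
  proof
    assume "e \<in> f ` sph m"
    then obtain x where "e m = f x m" by auto
    then show False by (simp add: e_def f_def nrml_def F_def)
  qed
  moreover have cm: "continuous_map (nsphere m) (nsphere m) f" unfolding f_def by (rule continuous_map_nrml[OF F])
  ultimately have "f ` topspace (nsphere m) \<noteq> topspace (nsphere m)" by (auto simp: topspace_nsphere_sph)
  then have "Brouwer_degree2 m f = 0" by (rule Brouwer_degree2_nonsurjective[OF cm])
  then show False using deg_odd[OF F] by (simp add: deg_def f_def[abs_def])
qed

section \<open>An abstract even sublinear variational problem\<close>

text \<open>Compactness of \<open>K\<close> is encoded by a sequence of bounded linear functionals
  \<open>L j\<close>: on a bounded set, smallness of finitely many of them forces \<open>K v\<close>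
  to be small. This replaces weak convergence and is the form in which Borsuk-Ulam can be applied.
  The vectors \<open>E i\<close> span subspaces of every dimension on which \<open>K\<close> is
  injective. \<open>K\<close> is linear only almost everywhere, as its values come from integrals
  that may diverge on a null set. \<open>f_nem\<close> is the quantitative form of the continuity of
  the superposition operator.\<close>

locale variational = finite_measure M for M :: "'a measure" +
  fixes p q A A' a0 :: real and V :: "('a \<Rightarrow> real) set" and K :: "('a \<Rightarrow> real) \<Rightarrow> 'a \<Rightarrow> real"
    and f F :: "'a \<Rightarrow> real \<Rightarrow> real" and L :: "nat \<Rightarrow> ('a \<Rightarrow> real) \<Rightarrow> real" and E :: "nat \<Rightarrow> 'a \<Rightarrow> real"
  assumes p: "1 < p" and q: "1 < q" "q < p" and A: "A \<ge> 0" and A': "A' \<ge> 0" and a0: "a0 > 0"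
    and V_Lp: "\<And>v. v \<in> V \<Longrightarrow> v \<in> Lp p M"
    and V_lin: "\<And>v w c d. v \<in> V \<Longrightarrow> w \<in> V \<Longrightarrow> (\<lambda>t. c * v t + d * w t) \<in> V"
    and V_closed: "\<And>vn u. (\<And>n. vn n \<in> V) \<Longrightarrow> u \<in> Lp p M \<Longrightarrow> (\<lambda>n. Np p M (\<lambda>t. vn n t - u t)) \<longlonglongrightarrow> 0 \<Longrightarrow> u \<in> V"
    and K_Lp: "\<And>v. v \<in> V \<Longrightarrow> K v \<in> Lp p M"
    and K_lin: "\<And>v w c d. v \<in> V \<Longrightarrow> w \<in> V \<Longrightarrow> AE t in M. K (\<lambda>t. c * v t + d * w t) t = c * K v t + d * K w t"
    and K_bd: "\<And>v. v \<in> V \<Longrightarrow> Np p M (K v) \<le> A * Np p M v"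
    and L_lin: "\<And>v w c d j. v \<in> V \<Longrightarrow> w \<in> V \<Longrightarrow> L j (\<lambda>t. c * v t + d * w t) = c * L j v + d * L j w"
    and L_bd: "\<And>j. \<exists>B. \<forall>v\<in>V. \<bar>L j v\<bar> powr p \<le> B * Np p M v"
    and compactness: "\<And>e R. e > 0 \<Longrightarrow> \<exists>m \<eta>. \<eta> > 0 \<and> (\<forall>v\<in>V. Np p M v \<le> R \<longrightarrow> (\<forall>j<m. \<bar>L j v\<bar> \<le> \<eta>) \<longrightarrow> Np p M (K v) \<le> e)"
    and E_V: "\<And>i. E i \<in> V"
    and E_indep: "\<And>i m x. i \<le> m \<Longrightarrow> x i \<noteq> 0 \<Longrightarrow> \<not> (AE t in M. K (\<lambda>t. \<Sum>i\<le>m. x i * E i t) t = 0)"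
    and f_meas: "\<And>u. u \<in> borel_measurable M \<Longrightarrow> (\<lambda>t. f t (u t)) \<in> borel_measurable M"
    and F_meas: "\<And>u. u \<in> borel_measurable M \<Longrightarrow> (\<lambda>t. F t (u t)) \<in> borel_measurable M"
    and f_growth: "\<And>t x. t \<in> space M \<Longrightarrow> \<bar>f t x\<bar> \<le> A' * \<bar>x\<bar> powr (q - 1)"
    and f_nem: "\<And>e. e > 0 \<Longrightarrow> \<exists>C\<ge>0. \<forall>t\<in>space M. \<forall>x x' y. \<bar>f t x - f t x'\<bar> * \<bar>y\<bar>
        \<le> e * (1 + \<bar>x\<bar> powr p + \<bar>y\<bar> powr p) + C * \<bar>x - x'\<bar> powr p"
    and f_odd: "\<And>t x. t \<in> space M \<Longrightarrow> f t (- x) = - f t x"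
    and F_mvt: "\<And>t x y. t \<in> space M \<Longrightarrow> \<exists>\<xi>. \<bar>\<xi> - x\<bar> \<le> \<bar>y - x\<bar> \<and> F t y - F t x = f t \<xi> * (y - x)"
    and F_zero: "\<And>t. t \<in> space M \<Longrightarrow> F t 0 = 0"
    and F_lower: "\<And>t x. t \<in> space M \<Longrightarrow> F t x \<ge> a0 * \<bar>x\<bar> powr q"
begin

abbreviation "N \<equiv> Np p M"
abbreviation "LL \<equiv> Lp p M"
definition "\<mu> = measure M (space M)"

lemma p0: "p > 0" using p by simp

lemma mu_nonneg: "\<mu> \<ge> 0" by (simp add: \<mu>_def)

lemma V_diff: "v \<in> V \<Longrightarrow> w \<in> V \<Longrightarrow> (\<lambda>t. v t - w t) \<in> V"
  using V_lin[of v w 1 "-1"] by simp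

lemma V_scale: "v \<in> V \<Longrightarrow> (\<lambda>t. c * v t) \<in> V"
  using V_lin[of v v c 0] by simp

lemma V_add: "v \<in> V \<Longrightarrow> w \<in> V \<Longrightarrow> (\<lambda>t. v t + w t) \<in> V"
  using V_lin[of v w 1 1] by simp

lemma V_zero: "(\<lambda>t. 0) \<in> V"
  using V_scale[OF E_V, of 0] by simp

lemma K_diff: "v \<in> V \<Longrightarrow> w \<in> V \<Longrightarrow> N (\<lambda>t. K v t - K w t) \<le> A * N (\<lambda>t. v t - w t)"
proof -
  assume vw: "v \<in> V" "w \<in> V"
  have "AE t in M. K v t - K w t = K (\<lambda>t. v t - w t) t"
    using K_lin[OF vw, of 1 "-1"] by (auto simp: add.commute[of "- _"])
  then have "N (\<lambda>t. K v t - K w t) = N (K (\<lambda>t. v t - w t))"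
    using Lp_diff(1)[OF p0 K_Lp[OF vw(1)] K_Lp[OF vw(2)]] K_Lp[OF V_diff[OF vw]]
    by (intro Np_cong_AE) (auto simp: Lp_def)
  then show ?thesis using K_bd[OF V_diff[OF vw]] by simp
qed

lemma K_tendsto:
  assumes "\<And>n. v n \<in> V" "w \<in> V" "(\<lambda>n. N (\<lambda>t. v n t - w t)) \<longlonglongrightarrow> 0"
  shows "(\<lambda>n. N (\<lambda>t. K (v n) t - K w t)) \<longlonglongrightarrow> 0"
proof (rule tendsto_sandwich[OF _ _ tendsto_const])
  show "(\<lambda>n. A * N (\<lambda>t. v n t - w t)) \<longlonglongrightarrow> 0" using tendsto_mult_right_zero[OF assms(3)] by simp
qed (intro always_eventually allI Np_nonneg K_diff assms)+

section \<open>Estimates for the superposition operators of \<open>f\<close> and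
  \<open>F\<close>\<close>

lemma f_mult_growth:
  assumes t: "t \<in> space M"
  shows "\<bar>f t x * y\<bar> \<le> A' * ((1 + \<bar>x\<bar>) powr (p - 1) * \<bar>y\<bar>)"
proof -
  \<comment> \<open>With a base of at least 1 the exponent can be raised to \<open>p - 1\<close>,
    the one that fits Young's inequality.\<close>
  have "\<bar>x\<bar> powr (q - 1) \<le> (1 + \<bar>x\<bar>) powr (q - 1)" using q by (intro powr_mono2) auto
  also have "\<dots> \<le> (1 + \<bar>x\<bar>) powr (p - 1)" using q by (intro powr_mono) auto
  finally have "\<bar>f t x\<bar> \<le> A' * (1 + \<bar>x\<bar>) powr (p - 1)"
    using f_growth[OF t, of x] A' by (meson mult_left_mono order_trans)
  then have "\<bar>f t x\<bar> * \<bar>y\<bar> \<le> A' * (1 + \<bar>x\<bar>) powr (p - 1) * \<bar>y\<bar>" by (rule mult_right_mono) simp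
  then show ?thesis by (simp add: abs_mult mult.assoc)
qed

lemma one_plus_powr: "(1 + \<bar>x::real\<bar>) powr p \<le> 2 powr p * (1 + \<bar>x\<bar> powr p)"
  using abs_powr_add_le[OF p0, of 1 "\<bar>x\<bar>"] by simp

text \<open>Young's inequality is split in two ways. Here the test value \<open>y\<close> gets the
  small coefficient, which serves coercivity; in the next lemma the argument \<open>x\<close> gets
  it, which serves continuity in \<open>y\<close>.\<close>

lemma f_mult_le1:
  assumes "e > 0"
  obtains C where "C \<ge> 0" "\<And>t x y. t \<in> space M \<Longrightarrow> \<bar>f t x * y\<bar> \<le> e * \<bar>y\<bar> powr p + C * (1 + \<bar>x\<bar> powr p)"
proof -
  have "e / (A' + 1) > 0" using assms A' by simp
  then obtain C where C: "C \<ge> 0" "\<And>x y. \<bar>x\<bar> powr (p - 1) * \<bar>y\<bar> \<le> e / (A' + 1) * \<bar>y\<bar> powr p + C * \<bar>x\<bar> powr p"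
    using powr_diff_one_mult_eps[OF p] by metis
  have "\<bar>f t x * y\<bar> \<le> e * \<bar>y\<bar> powr p + (A' * C * 2 powr p) * (1 + \<bar>x\<bar> powr p)" if t: "t \<in> space M" for t x y
  proof -
    have "\<bar>f t x * y\<bar> \<le> A' * ((1 + \<bar>x\<bar>) powr (p - 1) * \<bar>y\<bar>)" by (rule f_mult_growth[OF t])
    also have "\<dots> \<le> A' * (e / (A' + 1) * \<bar>y\<bar> powr p + C * (1 + \<bar>x\<bar>) powr p)"
      using C(2)[of "1 + \<bar>x\<bar>" y] A' by (intro mult_left_mono) auto
    also have "\<dots> \<le> A' * (e / (A' + 1) * \<bar>y\<bar> powr p + C * (2 powr p * (1 + \<bar>x\<bar> powr p)))"
      using one_plus_powr[of x] C(1) A' by (intro mult_left_mono add_left_mono) auto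
    also have "\<dots> = (A' * (e / (A' + 1))) * \<bar>y\<bar> powr p + (A' * C * 2 powr p) * (1 + \<bar>x\<bar> powr p)"
      by (simp add: distrib_left mult.assoc)
    also have "A' * (e / (A' + 1)) \<le> e" using A' assms by (simp add: field_simps)
    finally show ?thesis by (simp add: mult_right_mono)
  qed
  moreover have "A' * C * 2 powr p \<ge> 0" using A' C by simp
  ultimately show ?thesis using that by blast
qed

lemma f_mult_le2:
  assumes "e > 0"
  obtains C where "C \<ge> 0" "\<And>t x y. t \<in> space M \<Longrightarrow> \<bar>f t x * y\<bar> \<le> e * (1 + \<bar>x\<bar> powr p) + C * \<bar>y\<bar> powr p"
proof -
  define l where "l = e / ((A' + 1) * 2 powr p)"
  have l: "l > 0" using assms A' by (simp add: l_def)
  have "\<bar>f t x * y\<bar> \<le> e * (1 + \<bar>x\<bar> powr p) + (A' * l powr (1 - p)) * \<bar>y\<bar> powr p" if t: "t \<in> space M" for t x y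
  proof -
    have "\<bar>f t x * y\<bar> \<le> A' * ((1 + \<bar>x\<bar>) powr (p - 1) * \<bar>y\<bar>)" by (rule f_mult_growth[OF t])
    also have "\<dots> \<le> A' * (l * (1 + \<bar>x\<bar>) powr p + l powr (1 - p) * \<bar>y\<bar> powr p)"
      using powr_diff_one_mult_scaled[OF p l, of "1 + \<bar>x\<bar>" y] A' by (intro mult_left_mono) auto
    also have "\<dots> \<le> A' * (l * (2 powr p * (1 + \<bar>x\<bar> powr p)) + l powr (1 - p) * \<bar>y\<bar> powr p)"
      using one_plus_powr[of x] l A' by (intro mult_left_mono add_right_mono) auto
    also have "\<dots> = (A' * l * 2 powr p) * (1 + \<bar>x\<bar> powr p) + (A' * l powr (1 - p)) * \<bar>y\<bar> powr p"
      by (simp add: distrib_left mult.assoc)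
    also have "A' * l * 2 powr p = A' * (e / (A' + 1))" by (simp add: l_def)
    also have "A' * (e / (A' + 1)) \<le> e" using A' assms by (simp add: field_simps)
    finally show ?thesis by (simp add: mult_right_mono)
  qed
  moreover have "A' * l powr (1 - p) \<ge> 0" using A' by simp
  ultimately show ?thesis using that by blast
qed

lemma F_le:
  assumes "e > 0"
  obtains C where "C \<ge> 0" "\<And>t x. t \<in> space M \<Longrightarrow> \<bar>F t x\<bar> \<le> e * \<bar>x\<bar> powr p + C"
proof -
  have "e / (A' + 1) > 0" using assms A' by simp
  then obtain C where C: "C \<ge> 0" "\<And>x. \<bar>x\<bar> powr q \<le> e / (A' + 1) * \<bar>x\<bar> powr p + C"
    using powr_le_eps_powr[of q p] q by (metis less_trans zero_less_one)
  have "\<bar>F t x\<bar> \<le> e * \<bar>x\<bar> powr p + A' * C" if t: "t \<in> space M" for t x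
  proof -
    obtain \<xi> where \<xi>: "\<bar>\<xi> - 0\<bar> \<le> \<bar>x - 0\<bar>" "F t x - F t 0 = f t \<xi> * (x - 0)" using F_mvt[OF t] by blast
    have "\<bar>F t x\<bar> = \<bar>f t \<xi>\<bar> * \<bar>x\<bar>" using \<xi> F_zero[OF t] by (simp add: abs_mult)
    also have "\<dots> \<le> (A' * \<bar>x\<bar> powr (q - 1)) * \<bar>x\<bar>"
      using f_growth[OF t, of \<xi>] \<xi>(1) q A'
      by (intro mult_right_mono order_trans[OF f_growth[OF t]] mult_left_mono powr_mono2) auto
    also have "\<dots> = A' * \<bar>x\<bar> powr q" using powr_mult_base[of "\<bar>x\<bar>" "q - 1"] by (simp add: mult.commute)
    also have "\<dots> \<le> A' * (e / (A' + 1) * \<bar>x\<bar> powr p + C)" using C(2) A' by (intro mult_left_mono)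
    also have "\<dots> = (A' * (e / (A' + 1))) * \<bar>x\<bar> powr p + A' * C" by (simp add: distrib_left)
    also have "A' * (e / (A' + 1)) \<le> e" using A' assms by (simp add: field_simps)
    finally show ?thesis by (simp add: mult_right_mono)
  qed
  then show ?thesis using that[of "A' * C"] A' C by simp
qed

lemma F_diff_le:
  assumes "e > 0"
  obtains C where "C \<ge> 0" "\<And>t x y. t \<in> space M \<Longrightarrow>
    \<bar>F t x - F t y\<bar> \<le> e * (1 + \<bar>x\<bar> powr p + \<bar>y\<bar> powr p) + C * \<bar>x - y\<bar> powr p"
proof -
  obtain C where C: "C \<ge> 0" "\<And>t x y. t \<in> space M \<Longrightarrow> \<bar>f t x * y\<bar> \<le> e * (1 + \<bar>x\<bar> powr p) + C * \<bar>y\<bar> powr p"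
    using f_mult_le2[OF assms] by blast
  \<comment> \<open>The divisor pays for the intermediate point of the mean value theorem:
    \<open>\<bar>\<xi>\<bar> \<le> 2 * (\<bar>x\<bar> + \<bar>y\<bar>)\<close>, and each of the two
    doublings costs a factor \<open>2 powr p\<close>.\<close>
  obtain D where D: "D \<ge> 0" "\<And>t x y. t \<in> space M \<Longrightarrow> \<bar>f t x * y\<bar> \<le> e / (2 powr p * 2 powr p) * (1 + \<bar>x\<bar> powr p) + D * \<bar>y\<bar> powr p"
    using f_mult_le2[of "e / (2 powr p * 2 powr p)"] assms by auto
  have two: "(2::real) powr p \<ge> 1" using p by (simp add: ge_one_powr_ge_zero)
  have "\<bar>F t x - F t y\<bar> \<le> e * (1 + \<bar>x\<bar> powr p + \<bar>y\<bar> powr p) + D * \<bar>x - y\<bar> powr p" if t: "t \<in> space M" for t x y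
  proof -
    obtain \<xi> where \<xi>: "\<bar>\<xi> - y\<bar> \<le> \<bar>x - y\<bar>" "F t x - F t y = f t \<xi> * (x - y)" using F_mvt[OF t] by blast
    have "\<bar>\<xi>\<bar> powr p \<le> (2 * (\<bar>x\<bar> + \<bar>y\<bar>)) powr p" using \<xi>(1) p by (intro powr_mono2) auto
    also have "\<dots> = 2 powr p * \<bar>\<bar>x\<bar> + \<bar>y\<bar>\<bar> powr p" by (subst powr_mult) simp_all
    also have "\<dots> \<le> 2 powr p * (2 powr p * (\<bar>x\<bar> powr p + \<bar>y\<bar> powr p))"
      using abs_powr_add_le[OF p0, of "\<bar>x\<bar>" "\<bar>y\<bar>"] by (intro mult_left_mono) auto
    finally have le: "\<bar>\<xi>\<bar> powr p \<le> (2 powr p * 2 powr p) * (\<bar>x\<bar> powr p + \<bar>y\<bar> powr p)" by (simp add: mult.assoc)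
    have "1 \<le> (2::real) powr p * 2 powr p" using mult_mono[OF two two] by simp
    with le have "1 + \<bar>\<xi>\<bar> powr p \<le> (2 powr p * 2 powr p) * (1 + \<bar>x\<bar> powr p + \<bar>y\<bar> powr p)"
      by (simp add: algebra_simps)
    then have "e / (2 powr p * 2 powr p) * (1 + \<bar>\<xi>\<bar> powr p)
        \<le> e / (2 powr p * 2 powr p) * ((2 powr p * 2 powr p) * (1 + \<bar>x\<bar> powr p + \<bar>y\<bar> powr p))"
      using assms by (intro mult_left_mono) auto
    also have "\<dots> = e * (1 + \<bar>x\<bar> powr p + \<bar>y\<bar> powr p)" by simp
    finally have "e / (2 powr p * 2 powr p) * (1 + \<bar>\<xi>\<bar> powr p) \<le> e * (1 + \<bar>x\<bar> powr p + \<bar>y\<bar> powr p)" .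
    then show ?thesis using D(2)[OF t, of \<xi> "x - y"] \<xi>(2) by simp
  qed
  then show ?thesis using that D(1) by blast
qed

text \<open>\<open>fi u\<close> is the formal derivative of \<open>FI\<close> at
  \<open>u\<close>.\<close>

definition "fi u y = (LINT t|M. f t (u t) * y t)"
definition "FI u = (LINT t|M. F t (u t))"

lemma integrable_powr: "u \<in> LL \<Longrightarrow> integrable M (\<lambda>t. \<bar>u t\<bar> powr p)"
  by (simp add: Lp_def)

lemma one_plus_int: "u \<in> LL \<Longrightarrow> integrable M (\<lambda>t. 1 + \<bar>u t\<bar> powr p)"
  "u \<in> LL \<Longrightarrow> (LINT t|M. 1 + \<bar>u t\<bar> powr p) = \<mu> + N u"
  by (simp_all add: integrable_powr Np_def \<mu>_def)

lemma fi_integrable: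
  assumes "u \<in> LL" "y \<in> LL"
  shows "integrable M (\<lambda>t. f t (u t) * y t)"
proof -
  obtain C where "C \<ge> 0" and C: "\<And>t x y. t \<in> space M \<Longrightarrow> \<bar>f t x * y\<bar> \<le> 1 * \<bar>y\<bar> powr p + C * (1 + \<bar>x\<bar> powr p)"
    using f_mult_le1[OF zero_less_one] by blast
  show ?thesis
    by (rule Lp_bounded_by(1)[OF _ _ C])
       (use assms one_plus_int[OF assms(1)] in \<open>auto intro!: f_meas borel_measurable_times simp: Lp_def simp del: one_plus_int\<close>)
qed

lemma FI_integrable:
  assumes "u \<in> LL"
  shows "integrable M (\<lambda>t. F t (u t))"
proof -
  obtain C where "C \<ge> 0" and C: "\<And>t x. t \<in> space M \<Longrightarrow> \<bar>F t x\<bar> \<le> 1 * \<bar>x\<bar> powr p + C"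
    using F_le[OF zero_less_one] by blast
  show ?thesis
    by (rule Lp_bounded_by(1)[OF _ _ C]) (use assms in \<open>auto intro!: F_meas simp: Lp_def\<close>)
qed

lemma fi_bound1:
  assumes "e > 0"
  obtains C where "C \<ge> 0" "\<And>u y. u \<in> LL \<Longrightarrow> y \<in> LL \<Longrightarrow> \<bar>fi u y\<bar> \<le> e * N y + C * (\<mu> + N u)"
proof -
  obtain C where C: "C \<ge> 0" "\<And>t x y. t \<in> space M \<Longrightarrow> \<bar>f t x * y\<bar> \<le> e * \<bar>y\<bar> powr p + C * (1 + \<bar>x\<bar> powr p)"
    using f_mult_le1[OF assms] by blast
  have "\<bar>fi u y\<bar> \<le> e * N y + C * (\<mu> + N u)" if "u \<in> LL" "y \<in> LL" for u y
  proof -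
    have "\<bar>fi u y\<bar> \<le> (LINT t|M. e * \<bar>y t\<bar> powr p + C * (1 + \<bar>u t\<bar> powr p))"
      unfolding fi_def
      by (rule Lp_bounded_by(2)[OF _ _ C(2)]) (use that fi_integrable[OF that] in \<open>auto simp: integrable_powr\<close>)
    also have "\<dots> = e * N y + C * (\<mu> + N u)"
      using that integrable_powr[OF that(2)] one_plus_int[OF that(1)]
      by (subst Bochner_Integration.integral_add) (auto simp only: Np_def integral_mult_right_zero integrable_mult_right)
    finally show ?thesis .
  qed
  then show ?thesis using that C(1) by blast
qed

lemma fi_bound2:
  assumes "e > 0"
  obtains C where "C \<ge> 0" "\<And>u y. u \<in> LL \<Longrightarrow> y \<in> LL \<Longrightarrow> \<bar>fi u y\<bar> \<le> e * (\<mu> + N u) + C * N y"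
proof -
  obtain C where C: "C \<ge> 0" "\<And>t x y. t \<in> space M \<Longrightarrow> \<bar>f t x * y\<bar> \<le> e * (1 + \<bar>x\<bar> powr p) + C * \<bar>y\<bar> powr p"
    using f_mult_le2[OF assms] by blast
  have "\<bar>fi u y\<bar> \<le> e * (\<mu> + N u) + C * N y" if "u \<in> LL" "y \<in> LL" for u y
  proof -
    have "\<bar>fi u y\<bar> \<le> (LINT t|M. e * (1 + \<bar>u t\<bar> powr p) + C * \<bar>y t\<bar> powr p)"
      unfolding fi_def
      by (rule Lp_bounded_by(2)[OF _ _ C(2)]) (use that fi_integrable[OF that] in \<open>auto simp: integrable_powr\<close>)
    also have "\<dots> = e * (\<mu> + N u) + C * N y"
      using that integrable_powr[OF that(2)] one_plus_int[OF that(1)]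
      by (subst Bochner_Integration.integral_add) (auto simp only: Np_def integral_mult_right_zero integrable_mult_right)
    finally show ?thesis .
  qed
  then show ?thesis using that C(1) by blast
qed

lemma fi_diff_bound:
  assumes "e > 0"
  obtains C where "C \<ge> 0" "\<And>u u' y. u \<in> LL \<Longrightarrow> u' \<in> LL \<Longrightarrow> y \<in> LL \<Longrightarrow>
    (LINT t|M. \<bar>f t (u t) - f t (u' t)\<bar> * \<bar>y t\<bar>) \<le> e * (\<mu> + N u + N y) + C * N (\<lambda>t. u t - u' t)"
proof -
  obtain C where C: "C \<ge> 0" "\<And>t x x' y. t \<in> space M \<Longrightarrow> \<bar>f t x - f t x'\<bar> * \<bar>y\<bar>
        \<le> e * (1 + \<bar>x\<bar> powr p + \<bar>y\<bar> powr p) + C * \<bar>x - x'\<bar> powr p"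
    using f_nem[OF assms] by blast
  have "(LINT t|M. \<bar>f t (u t) - f t (u' t)\<bar> * \<bar>y t\<bar>) \<le> e * (\<mu> + N u + N y) + C * N (\<lambda>t. u t - u' t)"
    if L: "u \<in> LL" "u' \<in> LL" "y \<in> LL" for u u' y
  proof -
    have i: "integrable M (\<lambda>t. 1 + \<bar>u t\<bar> powr p + \<bar>y t\<bar> powr p)"
      "integrable M (\<lambda>t. \<bar>u t - u' t\<bar> powr p)"
      using L Lp_diff(1)[OF p0 L(1,2)] by (auto simp: integrable_powr)
    have m: "(\<lambda>t. f t (u t)) \<in> borel_measurable M" "(\<lambda>t. f t (u' t)) \<in> borel_measurable M" "y \<in> borel_measurable M"
      using L by (auto intro!: f_meas simp: Lp_def)
    have "\<bar>LINT t|M. \<bar>f t (u t) - f t (u' t)\<bar> * \<bar>y t\<bar>\<bar>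
        \<le> (LINT t|M. e * (1 + \<bar>u t\<bar> powr p + \<bar>y t\<bar> powr p) + C * \<bar>u t - u' t\<bar> powr p)"
      by (rule Lp_bounded_by(2)) (use i m C(2) in \<open>auto simp: abs_mult\<close>)
    also have "\<dots> = e * (LINT t|M. 1 + \<bar>u t\<bar> powr p + \<bar>y t\<bar> powr p) + C * N (\<lambda>t. u t - u' t)"
      using i by (subst Bochner_Integration.integral_add) (auto simp only: Np_def integral_mult_right_zero integrable_mult_right)
    also have "(LINT t|M. 1 + \<bar>u t\<bar> powr p + \<bar>y t\<bar> powr p) = \<mu> + N u + N y"
      using L by (simp add: integrable_powr Np_def \<mu>_def)
    finally show ?thesis by linarith
  qed
  then show ?thesis using that C(1) by blast
qed

lemma fi_diff_le:
  assumes L: "u \<in> LL" "u' \<in> LL" "y \<in> LL"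
  shows "\<bar>fi u y - fi u' y\<bar> \<le> (LINT t|M. \<bar>f t (u t) - f t (u' t)\<bar> * \<bar>y t\<bar>)"
proof -
  have "fi u y - fi u' y = (LINT t|M. (f t (u t) - f t (u' t)) * y t)"
    unfolding fi_def using fi_integrable[OF L(1,3)] fi_integrable[OF L(2,3)]
    by (subst Bochner_Integration.integral_diff[symmetric]) (auto simp: left_diff_distrib)
  then show ?thesis
    using integral_abs_bound[of M "\<lambda>t. (f t (u t) - f t (u' t)) * y t"] by (simp add: abs_mult)
qed

lemma FI_diff_bound:
  assumes "e > 0"
  obtains C where "C \<ge> 0" "\<And>u u'. u \<in> LL \<Longrightarrow> u' \<in> LL \<Longrightarrow>
    \<bar>FI u - FI u'\<bar> \<le> e * (\<mu> + N u + N u') + C * N (\<lambda>t. u t - u' t)"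
proof -
  obtain C where C: "C \<ge> 0" "\<And>t x y. t \<in> space M \<Longrightarrow>
    \<bar>F t x - F t y\<bar> \<le> e * (1 + \<bar>x\<bar> powr p + \<bar>y\<bar> powr p) + C * \<bar>x - y\<bar> powr p"
    using F_diff_le[OF assms] by blast
  have "\<bar>FI u - FI u'\<bar> \<le> e * (\<mu> + N u + N u') + C * N (\<lambda>t. u t - u' t)" if L: "u \<in> LL" "u' \<in> LL" for u u'
  proof -
    have i: "integrable M (\<lambda>t. 1 + \<bar>u t\<bar> powr p + \<bar>u' t\<bar> powr p)"
      "integrable M (\<lambda>t. \<bar>u t - u' t\<bar> powr p)"
      using L Lp_diff(1)[OF p0 L(1,2)] by (auto simp: integrable_powr)
    have "FI u - FI u' = (LINT t|M. F t (u t) - F t (u' t))"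
      unfolding FI_def using L by (simp add: FI_integrable)
    also have "\<bar>\<dots>\<bar> \<le> (LINT t|M. e * (1 + \<bar>u t\<bar> powr p + \<bar>u' t\<bar> powr p) + C * \<bar>u t - u' t\<bar> powr p)"
      by (rule Lp_bounded_by(2)) (use i L C(2) in \<open>auto intro!: borel_measurable_diff F_meas simp: Lp_def\<close>)
    also have "\<dots> = e * (LINT t|M. 1 + \<bar>u t\<bar> powr p + \<bar>u' t\<bar> powr p) + C * N (\<lambda>t. u t - u' t)"
      using i by (subst Bochner_Integration.integral_add) (auto simp only: Np_def integral_mult_right_zero integrable_mult_right)
    also have "(LINT t|M. 1 + \<bar>u t\<bar> powr p + \<bar>u' t\<bar> powr p) = \<mu> + N u + N u'"
      using L by (simp add: integrable_powr Np_def \<mu>_def)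
    finally show ?thesis .
  qed
  then show ?thesis using that C(1) by blast
qed

lemma FI_bound:
  assumes "e > 0"
  obtains C where "C \<ge> 0" "\<And>u. u \<in> LL \<Longrightarrow> \<bar>FI u\<bar> \<le> e * N u + C"
proof -
  obtain C where C: "C \<ge> 0" "\<And>t x. t \<in> space M \<Longrightarrow> \<bar>F t x\<bar> \<le> e * \<bar>x\<bar> powr p + C"
    using F_le[OF assms] by blast
  have "\<bar>FI u\<bar> \<le> e * N u + C * \<mu>" if L: "u \<in> LL" for u
  proof -
    have "\<bar>FI u\<bar> \<le> (LINT t|M. e * \<bar>u t\<bar> powr p + C)"
      unfolding FI_def
      by (rule Lp_bounded_by(2)[OF _ _ C(2)]) (use FI_integrable[OF L] L in \<open>auto simp: integrable_powr\<close>)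
    also have "\<dots> = e * N u + C * \<mu>" using L by (simp add: integrable_powr Np_def \<mu>_def)
    finally show ?thesis .
  qed
  then show ?thesis using that[of "C * \<mu>"] C(1) mu_nonneg by simp
qed

lemma fi_lin:
  assumes "u \<in> LL" "v \<in> V" "w \<in> V"
  shows "fi u (K (\<lambda>t. c * v t + d * w t)) = c * fi u (K v) + d * fi u (K w)"
proof -
  note i = fi_integrable[OF assms(1) K_Lp[OF assms(2)]] fi_integrable[OF assms(1) K_Lp[OF assms(3)]]
  have "fi u (K (\<lambda>t. c * v t + d * w t)) = (LINT t|M. c * (f t (u t) * K v t) + d * (f t (u t) * K w t))"
    unfolding fi_def
  proof (rule integral_cong_AE)
    show "AE t in M. f t (u t) * K (\<lambda>t. c * v t + d * w t) t = c * (f t (u t) * K v t) + d * (f t (u t) * K w t)"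
      using K_lin[OF assms(2,3), of c d] by eventually_elim (simp add: algebra_simps)
  qed (use i fi_integrable[OF assms(1) K_Lp[OF V_lin[OF assms(2,3)]]] in auto)
  then show ?thesis using i by (simp add: fi_def)
qed

lemma fi_diff2:
  assumes "u \<in> LL" "v \<in> V" "w \<in> V"
  shows "fi u (K (\<lambda>t. v t - w t)) = fi u (K v) - fi u (K w)"
  using fi_lin[OF assms, of 1 "-1"] by simp

lemma fi_cong:
  assumes "u \<in> LL" "u' \<in> LL" "y \<in> LL" "AE t in M. u t = u' t"
  shows "fi u y = fi u' y"
  unfolding fi_def
  by (rule integral_cong_AE) (use assms fi_integrable in \<open>auto\<close>)

end

section \<open>The convex problem with frozen nonlinearity\<close>

context variational begin

definition "Phi u w = N w / p - fi u (K w)"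
definition "min_val u = (INF w\<in>V. Phi u w)"

lemma Phi_lower:
  obtains C where "C \<ge> 0" "\<And>u w. u \<in> LL \<Longrightarrow> w \<in> V \<Longrightarrow> N w / (2 * p) \<le> Phi u w + C * (\<mu> + N u)"
proof -
  \<comment> \<open>With this coefficient, \<open>K_bd\<close> turns the linear term into at most
    \<open>N w / (2 * p)\<close>, half of the leading term, plus a constant.\<close>
  have "1 / (2 * p * (A + 1)) > 0" using p A by simp
  then obtain C where C: "C \<ge> 0"
    "\<And>u y. u \<in> LL \<Longrightarrow> y \<in> LL \<Longrightarrow> \<bar>fi u y\<bar> \<le> 1 / (2 * p * (A + 1)) * N y + C * (\<mu> + N u)"
    by (rule fi_bound1) blast
  have "N w / (2 * p) \<le> Phi u w + C * (\<mu> + N u)" if L: "u \<in> LL" "w \<in> V" for u w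
  proof -
    have "fi u (K w) \<le> 1 / (2 * p * (A + 1)) * N (K w) + C * (\<mu> + N u)"
      using C(2)[OF L(1) K_Lp[OF L(2)]] by linarith
    also have "1 / (2 * p * (A + 1)) * N (K w) \<le> 1 / (2 * p * (A + 1)) * ((A + 1) * N w)"
      using K_bd[OF L(2)] Np_nonneg[of p M w] p A by (intro mult_left_mono) (auto simp: distrib_right)
    also have "\<dots> = N w / (2 * p)" using A by simp
    finally have *: "fi u (K w) \<le> N w / (2 * p) + C * (\<mu> + N u)" by simp
    have "N w / p = N w / (2 * p) + N w / (2 * p)" by simp
    then show ?thesis using * unfolding Phi_def by linarith
  qed
  then show ?thesis using that C(1) by blast
qed

lemma Phi_bdd: "u \<in> LL \<Longrightarrow> bdd_below (Phi u ` V)"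
proof -
  assume u: "u \<in> LL"
  obtain C where "C \<ge> 0" and C: "\<And>u w. u \<in> LL \<Longrightarrow> w \<in> V \<Longrightarrow> N w / (2 * p) \<le> Phi u w + C * (\<mu> + N u)"
    by (rule Phi_lower) blast
  show ?thesis
  proof (rule bdd_belowI2)
    fix w assume "w \<in> V"
    then show "- (C * (\<mu> + N u)) \<le> Phi u w" using C[OF u, of w] Np_nonneg[of p M w] p
      by (smt (verit) divide_nonneg_pos)
  qed
qed

lemma min_val_le: "u \<in> LL \<Longrightarrow> w \<in> V \<Longrightarrow> min_val u \<le> Phi u w"
  unfolding min_val_def by (intro cINF_lower Phi_bdd)

lemma min_val_near: "e > 0 \<Longrightarrow> u \<in> LL \<Longrightarrow> \<exists>w\<in>V. Phi u w < min_val u + e"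
  unfolding min_val_def using cINF_less_iff[OF _ Phi_bdd, of u "min_val u + e"] V_zero
  by (auto simp: min_val_def)

lemma Phi_zero: "u \<in> LL \<Longrightarrow> Phi u (\<lambda>t. 0) = 0"
proof -
  assume u: "u \<in> LL"
  have "fi u (K (\<lambda>t. 0 * 0 + 0 * 0)) = 0 * fi u (K (\<lambda>t. 0)) + 0 * fi u (K (\<lambda>t. 0))"
    using fi_lin[OF u V_zero V_zero, of 0 0] by simp
  then show ?thesis by (simp add: Phi_def Np_def)
qed

lemma min_val_nonpos: "u \<in> LL \<Longrightarrow> min_val u \<le> 0"
  using min_val_le[OF _ V_zero] Phi_zero by fastforce

lemma near_min_bounded:
  obtains R' where "\<And>u w. u \<in> LL \<Longrightarrow> N u \<le> R \<Longrightarrow> w \<in> V \<Longrightarrow> Phi u w \<le> min_val u + 1 \<Longrightarrow> N w \<le> R'"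
proof -
  obtain C where C: "C \<ge> 0" "\<And>u w. u \<in> LL \<Longrightarrow> w \<in> V \<Longrightarrow> N w / (2 * p) \<le> Phi u w + C * (\<mu> + N u)"
    by (rule Phi_lower) blast
  have "N w \<le> 2 * p * (1 + C * (\<mu> + R))" if "u \<in> LL" "N u \<le> R" "w \<in> V" "Phi u w \<le> min_val u + 1" for u w
  proof -
    have "C * (\<mu> + N u) \<le> C * (\<mu> + R)" using that C by (intro mult_left_mono) auto
    then have "N w / (2 * p) \<le> 1 + C * (\<mu> + R)"
      using C(2)[OF that(1,3)] min_val_nonpos[OF that(1)] that(4) by linarith
    then show ?thesis using p by (simp add: field_simps)
  qed
  then show ?thesis using that by blast
qed

text \<open>The midpoint of two almost minimisers is not below the minimum, and the linear term
  cancels, so the midpoint defect of \<open>N\<close> is at most \<open>p * \<delta>\<close>.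
  Uniform convexity of the power then forces the two to be close. The bound \<open>R\<close> on
  \<open>N u\<close> is all that \<open>\<delta>\<close> depends on besides
  \<open>e\<close>.\<close>

lemma stability:
  assumes e: "e > 0"
  obtains \<delta> where "\<delta> > 0" "\<And>u w w'. u \<in> LL \<Longrightarrow> N u \<le> R \<Longrightarrow> w \<in> V \<Longrightarrow> w' \<in> V \<Longrightarrow>
    Phi u w \<le> min_val u + \<delta> \<Longrightarrow> Phi u w' \<le> min_val u + \<delta> \<Longrightarrow> N (\<lambda>t. w t - w' t) \<le> e"
proof -
  obtain R' where R': "\<And>u w. u \<in> LL \<Longrightarrow> N u \<le> R \<Longrightarrow> w \<in> V \<Longrightarrow> Phi u w \<le> min_val u + 1 \<Longrightarrow> N w \<le> R'"
    by (rule near_min_bounded[where R = R]) blast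
  define e' where "e' = e / (4 * (\<bar>R'\<bar> + 1))"
  have e': "e' > 0" using e by (simp add: e'_def)
  obtain C where C: "C \<ge> 0" "\<And>x y. \<bar>x - y\<bar> powr p \<le> e' * (\<bar>x\<bar> powr p + \<bar>y\<bar> powr p)
      + C * ((\<bar>x\<bar> powr p + \<bar>y\<bar> powr p) / 2 - \<bar>(x + y) / 2\<bar> powr p)"
    by (rule abs_powr_uniform_convex[OF p e']) blast
  \<comment> \<open>Half of \<open>e\<close> is spent on the bounded norms through
    \<open>e'\<close>, the other half on the convexity defect; the cap 1 puts \<open>w\<close> and
    \<open>w'\<close> into the scope of \<open>R'\<close>.\<close>
  define \<delta> where "\<delta> = min 1 (e / (2 * p * (C + 1)))"
  have \<delta>: "\<delta> > 0" "\<delta> \<le> 1" using e p C by (auto simp: \<delta>_def)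
  have "N (\<lambda>t. w t - w' t) \<le> e"
    if u: "u \<in> LL" "N u \<le> R" and w: "w \<in> V" "w' \<in> V" "Phi u w \<le> min_val u + \<delta>" "Phi u w' \<le> min_val u + \<delta>" for u w w'
  proof -
    define m where "m = (\<lambda>t. (1/2) * w t + (1/2) * w' t)"
    have m: "m \<in> V" unfolding m_def by (rule V_lin) fact+
    have mt: "m t = (w t + w' t) / 2" for t by (simp add: m_def add_divide_distrib)
    have bw: "N w \<le> \<bar>R'\<bar> + 1" "N w' \<le> \<bar>R'\<bar> + 1"
      using R'[OF u w(1)] R'[OF u w(2)] w \<delta> by linarith+
    have "Phi u m = N m / p - (1/2 * fi u (K w) + 1/2 * fi u (K w'))"
      unfolding Phi_def using fi_lin[OF u(1) w(1,2), of "1/2" "1/2"] by (simp only: m_def)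
    moreover have "min_val u \<le> Phi u m" by (rule min_val_le[OF u(1) m])
    ultimately have "((N w + N w') / 2 - N m) / p \<le> \<delta>"
      using w(3,4) unfolding Phi_def by (simp add: diff_divide_distrib add_divide_distrib)
    then have D: "(N w + N w') / 2 - N m \<le> p * \<delta>" using p by (simp add: field_simps)
    have i: "integrable M (\<lambda>t. \<bar>w t\<bar> powr p)" "integrable M (\<lambda>t. \<bar>w' t\<bar> powr p)"
      "integrable M (\<lambda>t. \<bar>m t\<bar> powr p)" "integrable M (\<lambda>t. \<bar>w t - w' t\<bar> powr p)"
      using integrable_powr V_Lp w(1,2) m V_diff[OF w(1,2)] by auto
    have "N (\<lambda>t. w t - w' t) \<le> (LINT t|M. e' * (\<bar>w t\<bar> powr p + \<bar>w' t\<bar> powr p)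
        + C * ((\<bar>w t\<bar> powr p + \<bar>w' t\<bar> powr p) / 2 - \<bar>m t\<bar> powr p))"
      unfolding Np_def
    proof (rule integral_mono)
      show "\<bar>w t - w' t\<bar> powr p \<le> e' * (\<bar>w t\<bar> powr p + \<bar>w' t\<bar> powr p)
        + C * ((\<bar>w t\<bar> powr p + \<bar>w' t\<bar> powr p) / 2 - \<bar>m t\<bar> powr p)" for t
        unfolding mt by (rule C(2))
    qed (use i in auto)
    also have "\<dots> = e' * (N w + N w') + C * ((N w + N w') / 2 - N m)"
      using i by (simp add: Np_def)
    also have "\<dots> \<le> e' * (2 * (\<bar>R'\<bar> + 1)) + C * (p * \<delta>)"
      using bw D C(1) e' by (intro add_mono mult_left_mono) auto
    also have "e' * (2 * (\<bar>R'\<bar> + 1)) = e / 2" by (simp add: e'_def field_simps)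
    also have "C * (p * \<delta>) \<le> e / 2"
    proof -
      have "C * (p * \<delta>) \<le> (C + 1) * (p * (e / (2 * p * (C + 1))))"
        using C(1) p \<delta>(1) by (intro mult_mono) (auto simp: \<delta>_def)
      also have "\<dots> = e / 2"
      proof -
        have "c * (p * (e / (2 * p * c))) = e / 2" if "c \<noteq> 0" for c :: real
          using that p by simp
        then show ?thesis using C(1) by (metis add_nonneg_eq_0_iff zero_le_one zero_neq_one)
      qed
      finally show ?thesis .
    qed
    finally show ?thesis by simp
  qed
  then show ?thesis using that \<delta>(1) by blast
qed

lemma fi_K_tendsto:
  assumes "u \<in> LL" "\<And>n. w n \<in> V" "w' \<in> V" "(\<lambda>n. N (\<lambda>t. w n t - w' t)) \<longlonglongrightarrow> 0"
  shows "(\<lambda>n. fi u (K (w n))) \<longlonglongrightarrow> fi u (K w')"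
proof -
  have "(\<lambda>n. fi u (K (w n)) - fi u (K w')) \<longlonglongrightarrow> 0"
  proof (rule tendsto_zero_of_eps_bound[where X = "\<lambda>n. \<mu> + N u" and Y = "\<lambda>n. A * N (\<lambda>t. w n t - w' t)"])
    fix e :: real assume "e > 0"
    then obtain C where C: "C \<ge> 0" "\<And>u y. u \<in> LL \<Longrightarrow> y \<in> LL \<Longrightarrow> \<bar>fi u y\<bar> \<le> e * (\<mu> + N u) + C * N y"
      by (rule fi_bound2) blast
    have "\<bar>fi u (K (w n)) - fi u (K w')\<bar> \<le> e * (\<mu> + N u) + C * (A * N (\<lambda>t. w n t - w' t))" for n
    proof -
      have d: "(\<lambda>t. w n t - w' t) \<in> V" by (rule V_diff) fact+
      have "\<bar>fi u (K (w n)) - fi u (K w')\<bar> = \<bar>fi u (K (\<lambda>t. w n t - w' t))\<bar>"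
        using fi_diff2[OF assms(1) assms(2)[of n] assms(3)] by simp
      also have "\<dots> \<le> e * (\<mu> + N u) + C * N (K (\<lambda>t. w n t - w' t))"
        by (rule C(2)[OF assms(1) K_Lp[OF d]])
      also have "\<dots> \<le> e * (\<mu> + N u) + C * (A * N (\<lambda>t. w n t - w' t))"
        using K_bd[OF d] C(1) by (intro add_left_mono mult_left_mono) auto
      finally show ?thesis .
    qed
    then show "\<exists>C. \<forall>n. \<bar>fi u (K (w n)) - fi u (K w')\<bar> \<le> e * (\<mu> + N u) + C * (A * N (\<lambda>t. w n t - w' t))" by blast
  qed (use tendsto_mult_right_zero[OF assms(4)] in auto)
  then show ?thesis by (simp add: LIM_zero_iff)
qed

lemma Phi_tendsto:
  assumes "u \<in> LL" "\<And>n. w n \<in> V" "w' \<in> V" "(\<lambda>n. N (\<lambda>t. w n t - w' t)) \<longlonglongrightarrow> 0"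
  shows "(\<lambda>n. Phi u (w n)) \<longlonglongrightarrow> Phi u w'"
  unfolding Phi_def
  using Np_tendsto[OF p0 V_Lp V_Lp assms(4), OF assms(2,3)] fi_K_tendsto[OF assms] p0
  by (intro tendsto_intros) auto

text \<open>By \<open>stability\<close> a minimising sequence is Cauchy, so completeness and
  closedness of \<open>V\<close> replace weak compactness.\<close>

lemma ex_min:
  assumes u: "u \<in> LL"
  shows "\<exists>w\<in>V. Phi u w = min_val u"
proof -
  have "\<exists>w\<in>V. Phi u w < min_val u + inverse (real (Suc n))" for n using min_val_near[OF _ u] by simp
  then obtain w where w: "\<And>n. w n \<in> V" "\<And>n. Phi u (w n) < min_val u + inverse (real (Suc n))" by metis
  have lim: "(\<lambda>n. Phi u (w n)) \<longlonglongrightarrow> min_val u"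
  proof (rule tendsto_sandwich[OF _ _ tendsto_const])
    show "(\<lambda>n. min_val u + inverse (real (Suc n))) \<longlonglongrightarrow> min_val u"
      using tendsto_add[OF tendsto_const LIMSEQ_inverse_real_of_nat, of "min_val u"] by simp
    show "\<forall>\<^sub>F n in sequentially. Phi u (w n) \<le> min_val u + inverse (real (Suc n))"
      using w(2) by (intro always_eventually allI less_imp_le)
  qed (use w(1) min_val_le[OF u] in \<open>auto intro!: always_eventually\<close>)
  obtain w' where w': "w' \<in> LL" "(\<lambda>n. N (\<lambda>t. w n t - w' t)) \<longlonglongrightarrow> 0"
  proof (rule Lp_complete[OF p0])
    show "w n \<in> LL" for n using V_Lp w(1) .
  next
    fix e :: real assume "e > 0"
    then have "e / 2 > 0" by simp
    then obtain \<delta> where \<delta>: "\<delta> > 0" "\<And>v w w'. v \<in> LL \<Longrightarrow> N v \<le> N u \<Longrightarrow> w \<in> V \<Longrightarrow> w' \<in> V \<Longrightarrow>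
      Phi v w \<le> min_val v + \<delta> \<Longrightarrow> Phi v w' \<le> min_val v + \<delta> \<Longrightarrow> N (\<lambda>t. w t - w' t) \<le> e / 2"
      by (rule stability[where R = "N u"]) blast
    have "eventually (\<lambda>n. Phi u (w n) < min_val u + \<delta>) sequentially" using lim \<delta>(1) by (intro order_tendstoD) auto
    then obtain n0 where n0: "\<And>n. n \<ge> n0 \<Longrightarrow> Phi u (w n) < min_val u + \<delta>" by (auto simp: eventually_sequentially)
    have "N (\<lambda>t. w m t - w n t) < e" if "m \<ge> n0" "n \<ge> n0" for m n
      using \<delta>(2)[OF u order_refl w(1) w(1), of m n] n0[OF that(1)] n0[OF that(2)] \<open>e > 0\<close> by fastforce
    then show "\<exists>n0. \<forall>m\<ge>n0. \<forall>n\<ge>n0. N (\<lambda>t. w m t - w n t) < e" by blast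
  qed
  have "w' \<in> V" by (rule V_closed[OF w(1) w'])
  moreover have "Phi u w' = min_val u"
    using LIMSEQ_unique[OF Phi_tendsto[OF u w(1) \<open>w' \<in> V\<close> w'(2)] lim] .
  ultimately show ?thesis by blast
qed

text \<open>An arbitrary minimiser; by uniqueness the choice affects it only on a null set.\<close>

definition "B u = (SOME w. w \<in> V \<and> Phi u w = min_val u)"

lemma B: "u \<in> LL \<Longrightarrow> B u \<in> V" "u \<in> LL \<Longrightarrow> Phi u (B u) = min_val u"
proof -
  have "B u \<in> V \<and> Phi u (B u) = min_val u" if "u \<in> LL"
  proof -
    have "\<exists>w. w \<in> V \<and> Phi u w = min_val u" using ex_min[OF that] by blast
    then show ?thesis unfolding B_def by (rule someI_ex)
  qed
  then show "u \<in> LL \<Longrightarrow> B u \<in> V" "u \<in> LL \<Longrightarrow> Phi u (B u) = min_val u" by auto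
qed

lemma B_unique:
  assumes u: "u \<in> LL" and w: "w \<in> V" "Phi u w = min_val u"
  shows "N (\<lambda>t. w t - B u t) = 0"
proof (rule antisym[OF field_le_epsilon Np_nonneg])
  fix e :: real assume "e > 0"
  then obtain \<delta> where \<delta>: "\<delta> > 0" "\<And>v w w'. v \<in> LL \<Longrightarrow> N v \<le> N u \<Longrightarrow> w \<in> V \<Longrightarrow> w' \<in> V \<Longrightarrow>
      Phi v w \<le> min_val v + \<delta> \<Longrightarrow> Phi v w' \<le> min_val v + \<delta> \<Longrightarrow> N (\<lambda>t. w t - w' t) \<le> e"
    by (rule stability[where R = "N u"]) blast
  show "N (\<lambda>t. w t - B u t) \<le> 0 + e"
    using \<delta>(2)[OF u order_refl w(1) B(1)[OF u]] \<delta>(1) w(2) B(2)[OF u] by simp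
qed

text \<open>Only \<open>u n\<close> converges, the test functions merely stay bounded. This suffices
  because they enter \<open>fi_diff_bound\<close> with the small coefficient, while the large
  constant multiplies the distance of \<open>u n\<close> from \<open>u'\<close>.\<close>

lemma fi_K_diff_tendsto:
  assumes u: "\<And>n. u n \<in> LL" "u' \<in> LL" "(\<lambda>n. N (\<lambda>t. u n t - u' t)) \<longlonglongrightarrow> 0"
    and w: "\<And>n. w n \<in> V" "\<And>n. N (w n) \<le> R"
  shows "(\<lambda>n. fi u' (K (w n)) - fi (u n) (K (w n))) \<longlonglongrightarrow> 0"
proof (rule tendsto_zero_of_eps_bound[where X = "\<lambda>n. \<mu> + N u' + N (K (w n))" and Y = "\<lambda>n. N (\<lambda>t. u n t - u' t)"])
  fix e :: real assume "e > 0"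
  then obtain C where C: "C \<ge> 0" "\<And>u u' y. u \<in> LL \<Longrightarrow> u' \<in> LL \<Longrightarrow> y \<in> LL \<Longrightarrow>
    (LINT t|M. \<bar>f t (u t) - f t (u' t)\<bar> * \<bar>y t\<bar>) \<le> e * (\<mu> + N u + N y) + C * N (\<lambda>t. u t - u' t)"
    by (rule fi_diff_bound) blast
  have "\<bar>fi u' (K (w n)) - fi (u n) (K (w n))\<bar> \<le> e * (\<mu> + N u' + N (K (w n))) + C * N (\<lambda>t. u n t - u' t)" for n
    using order_trans[OF fi_diff_le[OF u(2) u(1)[of n] K_Lp[OF w(1)[of n]]] C(2)[OF u(2) u(1)[of n] K_Lp[OF w(1)[of n]]]]
    by (simp add: Np_minus_commute[of p M u'])
  then show "\<exists>C. \<forall>n. \<bar>fi u' (K (w n)) - fi (u n) (K (w n))\<bar>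
     \<le> e * (\<mu> + N u' + N (K (w n))) + C * N (\<lambda>t. u n t - u' t)" by blast
next
  fix n
  have "N (K (w n)) \<le> A * R" using K_bd[OF w(1)[of n]] w(2)[of n] A by (meson mult_left_mono order_trans)
  then show "\<mu> + N u' + N (K (w n)) \<le> \<mu> + N u' + A * R" by simp
qed (fact u(3))

text \<open>Almost minimisers of \<open>Phi (u n)\<close> converge to the minimiser of \<open>Phi u'\<close> when \<open>u n\<close> tends to \<open>u'\<close>;
  this yields both the continuity of \<open>B\<close> and the Palais--Smale condition.\<close>

lemma almost_min_tendsto:
  assumes u: "\<And>n. u n \<in> LL" "u' \<in> LL" "(\<lambda>n. N (\<lambda>t. u n t - u' t)) \<longlonglongrightarrow> 0"
    and w: "\<And>n. w n \<in> V" "(\<lambda>n. Phi (u n) (w n) - min_val (u n)) \<longlonglongrightarrow> 0" "\<And>n. Phi (u n) (w n) \<le> min_val (u n) + 1"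
  shows "(\<lambda>n. N (\<lambda>t. w n t - B u' t)) \<longlonglongrightarrow> 0"
proof -
  have "(\<lambda>n. N (u n)) \<longlonglongrightarrow> N u'" by (rule Np_tendsto[OF p0 u])
  then have "Bseq (\<lambda>n. N (u n))" by (intro convergent_imp_Bseq convergentI)
  then obtain R where R: "\<And>n. N (u n) \<le> R" unfolding Bseq_def by (metis abs_le_D1 real_norm_def)
  obtain R' where R': "\<And>u w. u \<in> LL \<Longrightarrow> N u \<le> R \<Longrightarrow> w \<in> V \<Longrightarrow> Phi u w \<le> min_val u + 1 \<Longrightarrow> N w \<le> R'"
    by (rule near_min_bounded[where R = R]) blast
  have bw: "N (w n) \<le> R'" for n by (rule R'[OF u(1) R w(1) w(3)])
  have lim1: "(\<lambda>n. fi u' (K (w n)) - fi (u n) (K (w n))) \<longlonglongrightarrow> 0"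
    by (rule fi_K_diff_tendsto[OF u w(1) bw])
  have lim2: "(\<lambda>n. fi u' (K (B u')) - fi (u n) (K (B u'))) \<longlonglongrightarrow> 0"
    by (rule fi_K_diff_tendsto[OF u B(1)[OF u(2)] order_refl])
  have gap: "(\<lambda>n. Phi u' (w n)) \<longlonglongrightarrow> min_val u'"
  proof (rule tendsto_sandwich[OF _ _ tendsto_const])
    \<comment> \<open>\<open>B u'\<close> is a competitor in the problem for \<open>u n\<close>.
      Exchanging \<open>u n\<close> and \<open>u'\<close> in the linear terms of \<open>w n\<close>
      and of \<open>B u'\<close> costs the two differences that vanish in the limit.\<close>
    have "Phi u' (w n) \<le> min_val u' + ((Phi (u n) (w n) - min_val (u n)) - (fi u' (K (w n)) - fi (u n) (K (w n)))
        + (fi u' (K (B u')) - fi (u n) (K (B u'))))" for n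
      using min_val_le[OF u(1)[of n] B(1)[OF u(2)]] B(2)[OF u(2)] unfolding Phi_def by linarith
    then show "\<forall>\<^sub>F n in sequentially. Phi u' (w n) \<le> min_val u' + ((Phi (u n) (w n) - min_val (u n)) - (fi u' (K (w n)) - fi (u n) (K (w n)))
        + (fi u' (K (B u')) - fi (u n) (K (B u'))))" by (intro always_eventually allI)
    show "(\<lambda>n. min_val u' + ((Phi (u n) (w n) - min_val (u n)) - (fi u' (K (w n)) - fi (u n) (K (w n)))
        + (fi u' (K (B u')) - fi (u n) (K (B u'))))) \<longlonglongrightarrow> min_val u'"
      using tendsto_add[OF tendsto_const[of "min_val u'"] tendsto_add[OF tendsto_diff[OF w(2) lim1] lim2]] by simp
  qed (use min_val_le[OF u(2) w(1)] in auto)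
  show ?thesis
  proof (rule LIMSEQ_I)
    fix e :: real assume "e > 0"
    then have "e / 2 > 0" by simp
    then obtain \<delta> where \<delta>: "\<delta> > 0" "\<And>v w w'. v \<in> LL \<Longrightarrow> N v \<le> N u' \<Longrightarrow> w \<in> V \<Longrightarrow> w' \<in> V \<Longrightarrow>
      Phi v w \<le> min_val v + \<delta> \<Longrightarrow> Phi v w' \<le> min_val v + \<delta> \<Longrightarrow> N (\<lambda>t. w t - w' t) \<le> e / 2"
      by (rule stability[where R = "N u'"]) blast
    have "eventually (\<lambda>n. Phi u' (w n) < min_val u' + \<delta>) sequentially" using gap \<delta>(1) by (intro order_tendstoD) auto
    then obtain n0 where n0: "\<And>n. n \<ge> n0 \<Longrightarrow> Phi u' (w n) < min_val u' + \<delta>" by (auto simp: eventually_sequentially)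
    have "norm (N (\<lambda>t. w n t - B u' t) - 0) < e" if "n \<ge> n0" for n
      using \<delta>(2)[OF u(2) order_refl w(1)[of n] B(1)[OF u(2)]] n0[OF that] B(2)[OF u(2)] \<delta>(1) \<open>e > 0\<close>
        Np_nonneg[of p M "\<lambda>t. w n t - B u' t"] by simp
    then show "\<exists>no. \<forall>n\<ge>no. norm (N (\<lambda>t. w n t - B u' t) - 0) < e" by blast
  qed
qed

lemma B_tendsto:
  assumes u: "\<And>n. u n \<in> LL" "u' \<in> LL" "(\<lambda>n. N (\<lambda>t. u n t - u' t)) \<longlonglongrightarrow> 0"
  shows "(\<lambda>n. N (\<lambda>t. B (u n) t - B u' t)) \<longlonglongrightarrow> 0"
  by (rule almost_min_tendsto[OF u]) (use B u in auto)

text \<open>As \<open>f\<close> is odd, negating both arguments leaves \<open>Phi\<close> unchanged,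
  so \<open>- B u\<close> minimises \<open>Phi u'\<close>. Uniqueness holds up to null functions
  only, hence the form of the conclusion.\<close>

lemma B_odd:
  assumes u: "u \<in> LL" "u' \<in> LL" and ae: "AE t in M. u' t = - u t"
  shows "N (\<lambda>t. B u' t + B u t) = 0"
proof -
  have fi: "fi u' y = - fi u y" if "y \<in> LL" for y
  proof -
    have "fi u' y = (LINT t|M. - (f t (u t) * y t))"
      unfolding fi_def
    proof (rule integral_cong_AE)
      show "AE t in M. f t (u' t) * y t = - (f t (u t) * y t)"
        using ae AE_space by eventually_elim (simp add: f_odd)
    qed (use fi_integrable[OF u(1) that] fi_integrable[OF u(2) that] in auto)
    then show ?thesis by (simp add: fi_def)
  qed
  have Phi: "Phi u' (\<lambda>t. - w t) = Phi u w" if "w \<in> V" for w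
    using fi_lin[OF u(2) that that, of "-1" 0] fi[OF K_Lp[OF that]] by (simp add: Phi_def Np_minus)
  have mV: "(\<lambda>t. - w t) \<in> V" if "w \<in> V" for w using V_scale[OF that, of "-1"] by simp
  have "min_val u' = min_val u"
  proof (rule antisym)
    show "min_val u' \<le> min_val u" using min_val_le[OF u(2) mV[OF B(1)[OF u(1)]]] Phi[OF B(1)[OF u(1)]] B(2)[OF u(1)] by simp
    show "min_val u \<le> min_val u'" using min_val_le[OF u(1) mV[OF B(1)[OF u(2)]]] Phi[OF mV[OF B(1)[OF u(2)]]] B(2)[OF u(2)] by simp
  qed
  then have min: "Phi u' (\<lambda>t. - B u t) = min_val u'" using Phi[OF B(1)[OF u(1)]] B(2)[OF u(1)] by simp
  have "N (\<lambda>t. - B u t - B u' t) = 0" by (rule B_unique[OF u(2) mV[OF B(1)[OF u(1)]] min])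
  moreover have "(\<lambda>t. - B u t - B u' t) = (\<lambda>t. - (B u' t + B u t))" by auto
  ultimately show ?thesis using Np_minus[of p M "\<lambda>t. B u' t + B u t"] by simp
qed

end

text \<open>The derivative of \<open>\<bar>x\<bar> powr p / p\<close>; the factor \<open>x\<close>
  makes it 0 at 0 also when \<open>p < 2\<close>.\<close>

definition pw :: "real \<Rightarrow> real \<Rightarrow> real" where
  "pw p x = \<bar>x\<bar> powr (p - 2) * x"

text \<open>The exponent \<open>p - 2\<close> may be negative; this form has only the positive
  exponent \<open>p - 1\<close> and makes continuity at 0 visible.\<close>

lemma pw_eq: "p > 1 \<Longrightarrow> pw p x = max x 0 powr (p - 1) - max (- x) 0 powr (p - 1)"
proof (cases "x = 0")
  case False
  assume p: "p > 1"
  have *: "y powr (p - 2) * y = y powr (p - 1)" if "y > 0" for y :: real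
    using powr_add[of y "p - 2" 1] that by simp
  from False consider "x > 0" | "x < 0" by linarith
  then show ?thesis using p *[of x] *[of "- x"] by cases (auto simp: pw_def max_def)
qed (auto simp: pw_def)

lemma continuous_pw: "p > 1 \<Longrightarrow> continuous_on UNIV (pw p)"
proof -
  assume p: "p > 1"
  then have "pw p = (\<lambda>x. max x 0 powr (p - 1) - max (- x) 0 powr (p - 1))" by (intro ext pw_eq)
  then show ?thesis using p
    by (simp only:) (intro continuous_on_diff continuous_on_powr' continuous_intros; simp)
qed

lemma abs_pw: "\<bar>pw p x\<bar> = \<bar>x\<bar> powr (p - 1)"
proof (cases "x = 0")
  case False
  then show ?thesis using powr_add[of "\<bar>x\<bar>" "p - 2" 1] by (simp add: pw_def abs_mult)
qed (auto simp: pw_def)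

lemma pw_mult_self: "p > 0 \<Longrightarrow> pw p x * x = \<bar>x\<bar> powr p"
proof (cases "x = 0")
  case False
  have "pw p x * x = \<bar>x\<bar> * (\<bar>x\<bar> * \<bar>x\<bar> powr (p - 2))"
    by (simp add: pw_def flip: mult.assoc)
  also have "\<dots> = \<bar>x\<bar> powr p" by (simp add: powr_mult_base)
  finally show ?thesis .
qed (auto simp: pw_def)

text \<open>The tangent inequality of the convex function \<open>\<bar>x\<bar> powr p / p\<close>.
  As \<open>pw p y * y = \<bar>y\<bar> powr p\<close>, it amounts to Young's inequality with the
  conjugate exponent \<open>r\<close>.\<close>

lemma pw_tangent:
  assumes p: "p > 1"
  shows "\<bar>y\<bar> powr p / p + pw p y * (x - y) \<le> \<bar>x\<bar> powr p / p"
proof -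
  define r where "r = p / (p - 1)"
  have r: "r > 1" "1 / p + 1 / r = 1" using p by (auto simp: r_def field_simps)
  have "pw p y * x \<le> \<bar>x\<bar> * \<bar>y\<bar> powr (p - 1)"
    using abs_ge_self[of "pw p y * x"] by (simp add: abs_mult abs_pw mult.commute)
  also have "\<dots> \<le> \<bar>x\<bar> powr p / p + (\<bar>y\<bar> powr (p - 1)) powr r / r"
    using r p by (intro Youngs_inequality) auto
  also have "(\<bar>y\<bar> powr (p - 1)) powr r / r = \<bar>y\<bar> powr p - \<bar>y\<bar> powr p / p"
  proof -
    have "(p - 1) * r = p" using p by (simp add: r_def)
    then have "(\<bar>y\<bar> powr (p - 1)) powr r / r = \<bar>y\<bar> powr p * (1 / r)" by (simp add: powr_powr)
    also have "1 / r = 1 - 1 / p" using r(2) by simp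
    finally show ?thesis by (simp add: right_diff_distrib)
  qed
  finally show ?thesis using pw_mult_self[of p y] p by (simp add: algebra_simps)
qed

lemma integral_pw_mult_continuous:
  assumes p: "p > 1" and v: "v \<in> Lp p M" and w: "w \<in> Lp p M" and s: "\<And>n. 0 \<le> s n \<and> s n \<le> 1" "s \<longlonglongrightarrow> 0"
  shows "\<And>n. integrable M (\<lambda>t. pw p (v t + s n * w t) * w t)"
    and "(\<lambda>n. LINT t|M. pw p (v t + s n * w t) * w t) \<longlonglongrightarrow> (LINT t|M. pw p (v t) * w t)"
proof -
  have m [measurable]: "v \<in> borel_measurable M" "w \<in> borel_measurable M" using v w by (auto simp: Lp_def)
  have pm [measurable]: "pw p \<in> borel_measurable borel"
    by (rule borel_measurable_continuous_onI[OF continuous_pw[OF p]])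
  define g where "g t = 2 powr p * (\<bar>v t\<bar> powr p + \<bar>w t\<bar> powr p) + \<bar>w t\<bar> powr p" for t
  have g: "integrable M g" unfolding g_def using v w by (auto simp: Lp_def)
  have bd: "\<bar>pw p (v t + s n * w t) * w t\<bar> \<le> g t" for t n
  proof -
    have "\<bar>pw p (v t + s n * w t) * w t\<bar> \<le> \<bar>v t + s n * w t\<bar> powr p + \<bar>w t\<bar> powr p"
      using powr_diff_one_mult_le[OF p, of "v t + s n * w t" "w t"] by (simp add: abs_mult abs_pw)
    also have "\<bar>v t + s n * w t\<bar> powr p \<le> 2 powr p * (\<bar>v t\<bar> powr p + \<bar>s n * w t\<bar> powr p)"
      using p by (intro abs_powr_add_le) auto
    also have "\<bar>s n * w t\<bar> powr p \<le> \<bar>w t\<bar> powr p"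
      using s(1)[of n] p by (intro powr_mono2) (auto simp: abs_mult mult_left_le_one_le)
    finally show ?thesis by (simp add: g_def)
  qed
  show "integrable M (\<lambda>t. pw p (v t + s n * w t) * w t)" for n
    by (rule Lp_bounded_by(1)[OF _ g bd]) measurable
  show "(\<lambda>n. LINT t|M. pw p (v t + s n * w t) * w t) \<longlonglongrightarrow> (LINT t|M. pw p (v t) * w t)"
  proof (rule integral_dominated_convergence[where w = g])
    show "AE t in M. (\<lambda>n. pw p (v t + s n * w t) * w t) \<longlonglongrightarrow> pw p (v t) * w t"
    proof (rule AE_I2)
      fix t
      have "(\<lambda>n. v t + s n * w t) \<longlonglongrightarrow> v t + 0 * w t" by (intro tendsto_intros s)
      moreover have "isCont (pw p) (v t)" using continuous_pw[OF p] by (simp add: continuous_on_eq_continuous_at)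
      ultimately show "(\<lambda>n. pw p (v t + s n * w t) * w t) \<longlonglongrightarrow> pw p (v t) * w t"
        by (intro tendsto_intros isCont_tendsto_compose[of _ "pw p"]) auto
    qed
  qed (use g bd in \<open>auto\<close>)
qed

section \<open>Critical points, the functional \<open>J\<close> and its Palais-Smale
  property\<close>

context variational begin

definition "crit v \<longleftrightarrow> v \<in> V \<and> (\<forall>w\<in>V. (LINT t|M. pw p (v t) * w t) = fi (K v) (K w))"

text \<open>Minimality is compared along \<open>v + s * w\<close>. The tangent at the displaced
  point, rather than at \<open>v\<close>, bounds the increase of \<open>N / p\<close> from above;
  dividing by \<open>s\<close> and letting it tend to 0 gives one inequality, and the direction
  \<open>- w\<close> gives the other.\<close>

lemma minimiser_Euler_Lagrange:
  assumes u: "u \<in> LL" and v: "v \<in> V" "Phi u v = min_val u" and w: "w \<in> V"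
  shows "(LINT t|M. pw p (v t) * w t) = fi u (K w)"
proof -
  have ge: "fi u (K w) \<le> (LINT t|M. pw p (v t) * w t)" if w: "w \<in> V" for w
  proof (rule LIMSEQ_le_const)
    define s where "s n = inverse (real (Suc n))" for n
    have s: "0 \<le> s n \<and> s n \<le> 1" "s n > 0" for n by (auto simp: s_def field_simps)
    have s0: "s \<longlonglongrightarrow> 0" unfolding s_def by (rule LIMSEQ_inverse_real_of_nat)
    note I = integral_pw_mult_continuous[OF p V_Lp[OF v(1)] V_Lp[OF w] s(1) s0]
    show "(\<lambda>n. LINT t|M. pw p (v t + s n * w t) * w t) \<longlonglongrightarrow> (LINT t|M. pw p (v t) * w t)" by (rule I(2))
    have "fi u (K w) \<le> (LINT t|M. pw p (v t + s n * w t) * w t)" for n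
    proof -
      define z where "z = (\<lambda>t. 1 * v t + s n * w t)"
      have z: "z \<in> V" unfolding z_def by (rule V_lin) fact+
      have "min_val u \<le> Phi u z" by (rule min_val_le[OF u z])
      then have "s n * fi u (K w) \<le> N z / p - N v / p"
        using fi_lin[OF u v(1) w, of 1 "s n"] v(2) unfolding Phi_def z_def by simp
      also have "\<dots> = (LINT t|M. \<bar>z t\<bar> powr p / p - \<bar>v t\<bar> powr p / p)"
        using integrable_powr[OF V_Lp[OF z]] integrable_powr[OF V_Lp[OF v(1)]] by (simp add: Np_def)
      also have "\<dots> \<le> (LINT t|M. s n * (pw p (v t + s n * w t) * w t))"
      proof (rule integral_mono)
        fix t
        show "\<bar>z t\<bar> powr p / p - \<bar>v t\<bar> powr p / p \<le> s n * (pw p (v t + s n * w t) * w t)"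
          using pw_tangent[OF p, of "z t" "v t"] by (simp add: z_def algebra_simps)
      qed (use integrable_powr[OF V_Lp[OF z]] integrable_powr[OF V_Lp[OF v(1)]] I(1) in auto)
      also have "\<dots> = s n * (LINT t|M. pw p (v t + s n * w t) * w t)" by simp
      finally show ?thesis using s(2)[of n] by simp
    qed
    then show "\<exists>n0. \<forall>n\<ge>n0. fi u (K w) \<le> (LINT t|M. pw p (v t + s n * w t) * w t)" by blast
  qed
  have "fi u (K (\<lambda>t. - 1 * w t + 0 * w t)) \<le> (LINT t|M. pw p (v t) * (- 1 * w t + 0 * w t))"
    by (rule ge[OF V_lin[OF w w]])
  then have "- fi u (K w) \<le> - (LINT t|M. pw p (v t) * w t)"
    using fi_lin[OF u w w, of "-1" 0] by simp
  with ge[OF w] show ?thesis by simp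
qed

definition "J v = N v / p - FI (K v)"

lemma J_tendsto:
  assumes "\<And>n. v n \<in> V" "w \<in> V" "(\<lambda>n. N (\<lambda>t. v n t - w t)) \<longlonglongrightarrow> 0"
  shows "(\<lambda>n. J (v n)) \<longlonglongrightarrow> J w"
proof -
  have Kl: "(\<lambda>n. N (\<lambda>t. K (v n) t - K w t)) \<longlonglongrightarrow> 0" by (rule K_tendsto[OF assms])
  have "(\<lambda>n. N (K (v n))) \<longlonglongrightarrow> N (K w)"
    by (rule Np_tendsto[OF p0 K_Lp[OF assms(1)] K_Lp[OF assms(2)] Kl])
  then have "Bseq (\<lambda>n. N (K (v n)))" by (intro convergent_imp_Bseq convergentI)
  then obtain R where R: "\<And>n. N (K (v n)) \<le> R" unfolding Bseq_def by (metis abs_le_D1 real_norm_def)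
  have "(\<lambda>n. FI (K (v n)) - FI (K w)) \<longlonglongrightarrow> 0"
  proof (rule tendsto_zero_of_eps_bound[where X = "\<lambda>n. \<mu> + N (K (v n)) + N (K w)" and Y = "\<lambda>n. N (\<lambda>t. K (v n) t - K w t)"])
    fix e :: real assume "e > 0"
    then obtain C where C: "C \<ge> 0" "\<And>u u'. u \<in> LL \<Longrightarrow> u' \<in> LL \<Longrightarrow>
      \<bar>FI u - FI u'\<bar> \<le> e * (\<mu> + N u + N u') + C * N (\<lambda>t. u t - u' t)"
      by (rule FI_diff_bound) blast
    show "\<exists>C. \<forall>n. \<bar>FI (K (v n)) - FI (K w)\<bar> \<le> e * (\<mu> + N (K (v n)) + N (K w)) + C * N (\<lambda>t. K (v n) t - K w t)"
      using C(2)[OF K_Lp[OF assms(1)] K_Lp[OF assms(2)]] by blast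
  next
    show "\<mu> + N (K (v n)) + N (K w) \<le> \<mu> + R + N (K w)" for n using R by simp
  qed (fact Kl)
  then have "(\<lambda>n. FI (K (v n))) \<longlonglongrightarrow> FI (K w)" by (simp add: LIM_zero_iff)
  then show ?thesis unfolding J_def
    using Np_tendsto[OF p0 V_Lp[OF assms(1)] V_Lp[OF assms(2)] assms(3)] p0 by (intro tendsto_intros) auto
qed

lemma J_lower:
  obtains C where "C \<ge> 0" "\<And>v. v \<in> V \<Longrightarrow> N v / (2 * p) \<le> J v + C"
proof -
  have "1 / (2 * p * (A + 1)) > 0" using p A by simp
  then obtain C where C: "C \<ge> 0" "\<And>u. u \<in> LL \<Longrightarrow> \<bar>FI u\<bar> \<le> 1 / (2 * p * (A + 1)) * N u + C"
    by (rule FI_bound) blast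
  have "N v / (2 * p) \<le> J v + C" if v: "v \<in> V" for v
  proof -
    have "FI (K v) \<le> 1 / (2 * p * (A + 1)) * N (K v) + C" using C(2)[OF K_Lp[OF v]] by linarith
    also have "1 / (2 * p * (A + 1)) * N (K v) \<le> 1 / (2 * p * (A + 1)) * ((A + 1) * N v)"
      using K_bd[OF v] Np_nonneg[of p M v] p A by (intro mult_left_mono) (auto simp: distrib_right)
    also have "\<dots> = N v / (2 * p)" using A by simp
    finally have *: "FI (K v) \<le> N v / (2 * p) + C" by simp
    have "N v / p = N v / (2 * p) + N v / (2 * p)" by simp
    then show ?thesis using * unfolding J_def by linarith
  qed
  then show ?thesis using that C(1) by blast
qed

lemma sublevel_bounded:
  obtains R where "R \<ge> 0" "\<And>v. v \<in> V \<Longrightarrow> J v \<le> 0 \<Longrightarrow> N v \<le> R"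
proof -
  obtain C where C: "C \<ge> 0" "\<And>v. v \<in> V \<Longrightarrow> N v / (2 * p) \<le> J v + C" by (rule J_lower) blast
  have "N v \<le> C * (2 * p)" if "v \<in> V" "J v \<le> 0" for v
    using C(2)[OF that(1)] that(2) p pos_divide_le_eq[of "2 * p" "N v" C] by linarith
  then show ?thesis using that[of "C * (2 * p)"] C(1) p by simp
qed

lemma L_tendsto:
  assumes "\<And>n. v n \<in> V" "w \<in> V" "(\<lambda>n. N (\<lambda>t. v n t - w t)) \<longlonglongrightarrow> 0"
  shows "(\<lambda>n. L j (v n)) \<longlonglongrightarrow> L j w"
proof -
  obtain B where B: "\<And>v. v \<in> V \<Longrightarrow> \<bar>L j v\<bar> powr p \<le> B * N v" using L_bd by blast
  have "(\<lambda>n. \<bar>L j (\<lambda>t. v n t - w t)\<bar> powr p) \<longlonglongrightarrow> 0"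
  proof (rule tendsto_sandwich[OF _ _ tendsto_const])
    show "(\<lambda>n. B * N (\<lambda>t. v n t - w t)) \<longlonglongrightarrow> 0" using tendsto_mult_right_zero[OF assms(3)] by simp
  qed (use B[OF V_diff[OF assms(1,2)]] in auto)
  then have "(\<lambda>n. (\<bar>L j (\<lambda>t. v n t - w t)\<bar> powr p) powr (1 / p)) \<longlonglongrightarrow> 0"
    using p tendsto_powr2[OF _ tendsto_const, of _ 0 sequentially "1/p"] by fastforce
  then have "(\<lambda>n. \<bar>L j (\<lambda>t. v n t - w t)\<bar>) \<longlonglongrightarrow> 0" using p by (simp add: powr_powr)
  moreover have "L j (\<lambda>t. v n t - w t) = L j (v n) - L j w" for n
    using L_lin[OF assms(1)[of n] assms(2), of j 1 "-1"] by simp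
  ultimately have "(\<lambda>n. L j (v n) - L j w) \<longlonglongrightarrow> 0" by (simp add: tendsto_rabs_zero_iff)
  then show ?thesis by (simp add: LIM_zero_iff)
qed

text \<open>The vectors of all values \<open>L j (v n)\<close> lie in a compact product of
  intervals, so they converge coordinatewise along a subsequence. The differences of its members are
  bounded and have finitely many small \<open>L j\<close> eventually, so \<open>compactness\<close>
  makes their images a Cauchy sequence.\<close>

lemma K_subseq:
  assumes v: "\<And>n. v n \<in> V" "\<And>n. N (v n) \<le> R"
  obtains r u where "strict_mono (r :: nat \<Rightarrow> nat)" "u \<in> LL" "(\<lambda>n. N (\<lambda>t. K (v (r n)) t - u t)) \<longlonglongrightarrow> 0"
proof -
  have "\<exists>B. \<forall>n. \<bar>L j (v n)\<bar> \<le> B" for j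
  proof -
    obtain B where B: "\<And>v. v \<in> V \<Longrightarrow> \<bar>L j v\<bar> powr p \<le> B * N v" using L_bd by blast
    have "\<bar>L j (v n)\<bar> \<le> (\<bar>B\<bar> * \<bar>R\<bar>) powr (1 / p)" for n
    proof -
      have "B * N (v n) \<le> \<bar>B\<bar> * \<bar>R\<bar>" using v(2)[of n] Np_nonneg[of p M "v n"] by (intro mult_mono) auto
      then have "\<bar>L j (v n)\<bar> powr p \<le> \<bar>B\<bar> * \<bar>R\<bar>" using B[OF v(1)[of n]] by linarith
      then have "(\<bar>L j (v n)\<bar> powr p) powr (1 / p) \<le> (\<bar>B\<bar> * \<bar>R\<bar>) powr (1 / p)" using p by (intro powr_mono2) auto
      then show ?thesis using p by (simp add: powr_powr)
    qed
    then show ?thesis by blast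
  qed
  then obtain b where b: "\<And>j n. \<bar>L j (v n)\<bar> \<le> b j" by metis
  have "compact (Pi\<^sub>E UNIV (\<lambda>j. {- b j..b j}))"
    using compactin_PiE[of "\<lambda>_. euclideanreal" UNIV "\<lambda>j. {- b j..b j}"]
    by (simp add: euclidean_product_topology)
  then have "seq_compact (Pi\<^sub>E UNIV (\<lambda>j. {- b j..b j}))" by (simp add: compact_eq_seq_compact_metric)
  moreover have "(\<lambda>j. L j (v n)) \<in> Pi\<^sub>E UNIV (\<lambda>j. {- b j..b j})" for n
    using b by (auto simp: abs_le_iff minus_le_iff)
  ultimately obtain l r where r: "strict_mono (r :: nat \<Rightarrow> nat)" "((\<lambda>n j. L j (v n)) \<circ> r) \<longlonglongrightarrow> l"
    using seq_compactE[of "Pi\<^sub>E UNIV (\<lambda>j. {- b j..b j})" "\<lambda>n j. L j (v n)"] by blast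
  have conv: "(\<lambda>n. L j (v (r n))) \<longlonglongrightarrow> l j" for j
  proof -
    have "isCont (\<lambda>x::nat \<Rightarrow> real. x j) l"
      using continuous_on_product_coordinates[of j] by (metis UNIV_I continuous_on_eq_continuous_at open_UNIV)
    from isCont_tendsto_compose[OF this r(2)] show ?thesis by (simp add: o_def)
  qed
  obtain u where "u \<in> LL" "(\<lambda>n. N (\<lambda>t. K (v (r n)) t - u t)) \<longlonglongrightarrow> 0"
  proof (rule Lp_complete[OF p0])
    show "K (v (r n)) \<in> LL" for n using K_Lp v(1) .
  next
    fix e :: real assume "e > 0"
    define R2 where "R2 = 2 powr p * (R + R)"
    obtain m \<eta> where \<eta>: "\<eta> > 0"
      "\<And>v. v \<in> V \<Longrightarrow> N v \<le> R2 \<Longrightarrow> (\<And>j. j < m \<Longrightarrow> \<bar>L j v\<bar> \<le> \<eta>) \<Longrightarrow> N (K v) \<le> e / 2"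
      using compactness[of "e / 2" R2] \<open>e > 0\<close> by (metis half_gt_zero)
    have "\<exists>n0. \<forall>n\<ge>n0. \<bar>L j (v (r n)) - l j\<bar> < \<eta> / 2" for j
      using LIMSEQ_D[OF conv[of j], of "\<eta> / 2"] \<eta>(1) by auto
    then obtain n0 where n0: "\<And>j n. n \<ge> n0 j \<Longrightarrow> \<bar>L j (v (r n)) - l j\<bar> < \<eta> / 2" by metis
    define n1 where "n1 = Max (insert 0 (n0 ` {..<m}))"
    have n1: "n0 j \<le> n1" if "j < m" for j unfolding n1_def using that by (intro Max_ge) auto
    have "N (\<lambda>t. K (v (r k)) t - K (v (r n)) t) < e" if kn: "k \<ge> n1" "n \<ge> n1" for k n
    proof -
      have d: "(\<lambda>t. v (r k) t - v (r n) t) \<in> V" by (rule V_diff[OF v(1) v(1)])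
      have "N (\<lambda>t. v (r k) t - v (r n) t) \<le> 2 powr p * (N (v (r k)) + N (v (r n)))"
        by (rule Lp_diff(2)[OF p0 V_Lp V_Lp]) (rule v(1))+
      also have "\<dots> \<le> R2" unfolding R2_def using v(2) by (intro mult_left_mono add_mono) auto
      finally have "N (K (\<lambda>t. v (r k) t - v (r n) t)) \<le> e / 2"
      proof (rule \<eta>(2)[OF d])
        fix j assume j: "j < m"
        have "L j (\<lambda>t. v (r k) t - v (r n) t) = L j (v (r k)) - L j (v (r n))"
          using L_lin[OF v(1)[of "r k"] v(1)[of "r n"], of j 1 "-1"] by simp
        then show "\<bar>L j (\<lambda>t. v (r k) t - v (r n) t)\<bar> \<le> \<eta>"
          using n0[of j k] n0[of j n] n1[OF j] kn by linarith
      qed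
      moreover have "N (\<lambda>t. K (v (r k)) t - K (v (r n)) t) = N (K (\<lambda>t. v (r k) t - v (r n) t))"
      proof (rule Np_cong_AE)
        show "AE t in M. K (v (r k)) t - K (v (r n)) t = K (\<lambda>t. v (r k) t - v (r n) t) t"
          using K_lin[OF v(1)[of "r k"] v(1)[of "r n"], of 1 "-1"] by eventually_elim simp
      qed (use LpD(1)[OF K_Lp[OF v(1)[of "r k"]]] LpD(1)[OF K_Lp[OF v(1)[of "r n"]]] LpD(1)[OF K_Lp[OF d]] in auto)
      ultimately show ?thesis using \<open>e > 0\<close> by simp
    qed
    then show "\<exists>n1. \<forall>k\<ge>n1. \<forall>n\<ge>n1. N (\<lambda>t. K (v (r k)) t - K (v (r n)) t) < e" by blast
  qed
  then show ?thesis using that r(1) by blast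
qed

lemma gap_nonneg: "v \<in> V \<Longrightarrow> 0 \<le> Phi (K v) v - min_val (K v)"
  using min_val_le[OF K_Lp] by simp

text \<open>The Palais-Smale condition in terms of the gap. If the gap came close to 0, the
  \<open>v n\<close> would be almost minimisers for \<open>K (v n)\<close>. Along a subsequence
  \<open>K (v n)\<close> converges to some \<open>u\<close>, hence \<open>v n\<close> to
  \<open>B u\<close>; then \<open>u = K (B u)\<close> almost everywhere, and \<open>B u\<close> is a
  critical point in the window.\<close>

lemma gap_in_window:
  assumes no: "\<And>v. crit v \<Longrightarrow> \<not> (a \<le> J v \<and> J v \<le> b)" and b: "b \<le> 0"
  obtains \<delta> where "\<delta> > 0" "\<And>v. v \<in> V \<Longrightarrow> a \<le> J v \<Longrightarrow> J v \<le> b \<Longrightarrow> Phi (K v) v - min_val (K v) \<ge> \<delta>"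
proof (rule ccontr)
  note goal = that
  assume "\<not> thesis"
  have neg: "\<exists>v\<in>V. a \<le> J v \<and> J v \<le> b \<and> Phi (K v) v - min_val (K v) < \<delta>" if "\<delta> > 0" for \<delta>
  proof (rule ccontr)
    assume "\<not> (\<exists>v\<in>V. a \<le> J v \<and> J v \<le> b \<and> Phi (K v) v - min_val (K v) < \<delta>)"
    then have thesis by (intro goal[OF that]) (meson leI)
    with \<open>\<not> thesis\<close> show False by contradiction
  qed
  have "\<exists>v\<in>V. a \<le> J v \<and> J v \<le> b \<and> Phi (K v) v - min_val (K v) < inverse (real (Suc n))" for n
    by (rule neg) simp
  then obtain v where v: "\<And>n. v n \<in> V" "\<And>n. a \<le> J (v n)" "\<And>n. J (v n) \<le> b"
    "\<And>n. Phi (K (v n)) (v n) - min_val (K (v n)) < inverse (real (Suc n))" by metis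
  obtain R where R: "R \<ge> 0" "\<And>v. v \<in> V \<Longrightarrow> J v \<le> 0 \<Longrightarrow> N v \<le> R" by (rule sublevel_bounded) blast
  have "N (v n) \<le> R" for n using R(2)[OF v(1)] v(3) b order_trans by blast
  then obtain r u where r: "strict_mono (r :: nat \<Rightarrow> nat)" and u: "u \<in> LL"
    and lim: "(\<lambda>n. N (\<lambda>t. K (v (r n)) t - u t)) \<longlonglongrightarrow> 0"
    using K_subseq[of v R] v(1) by blast
  have gap0: "(\<lambda>n. Phi (K (v n)) (v n) - min_val (K (v n))) \<longlonglongrightarrow> 0"
  proof (rule tendsto_sandwich[OF _ _ tendsto_const LIMSEQ_inverse_real_of_nat])
    show "\<forall>\<^sub>F n in sequentially. Phi (K (v n)) (v n) - min_val (K (v n)) \<le> inverse (real (Suc n))"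
      using v(4) by (intro always_eventually allI less_imp_le)
  qed (use gap_nonneg v(1) in auto)
  have le1: "Phi (K (v n)) (v n) \<le> min_val (K (v n)) + 1" for n
  proof -
    have "inverse (real (Suc n)) \<le> 1" by (simp add: field_simps)
    then show ?thesis using v(4)[of n] by linarith
  qed
  have lim2: "(\<lambda>n. N (\<lambda>t. v (r n) t - B u t)) \<longlonglongrightarrow> 0"
    by (rule almost_min_tendsto[OF K_Lp[OF v(1)] u lim v(1) _ le1])
       (use LIMSEQ_subseq_LIMSEQ[OF gap0 r] in \<open>simp add: o_def\<close>)
  note BV = B(1)[OF u]
  have lim3: "(\<lambda>n. N (\<lambda>t. K (v (r n)) t - K (B u) t)) \<longlonglongrightarrow> 0" by (rule K_tendsto[OF v(1) BV lim2])
  have lim': "(\<lambda>n. N (\<lambda>t. u t - K (v (r n)) t)) \<longlonglongrightarrow> 0" using lim by (simp add: Np_minus_commute[of p M u])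
  have "(\<lambda>n. N (\<lambda>t. u t - K (B u) t)) \<longlonglongrightarrow> 0"
    by (rule Np_diff_tendsto_trans[OF p0 u K_Lp[OF v(1)] K_Lp[OF BV] lim' lim3])
  then have "N (\<lambda>t. u t - K (B u) t) = 0" by (simp add: LIMSEQ_const_iff)
  then have ae: "AE t in M. u t = K (B u) t"
    using Np_eq_0_iff[OF Lp_diff(1)[OF p0 u K_Lp[OF BV]]] by simp
  have "crit (B u)"
    unfolding crit_def
  proof (intro conjI BV ballI)
    fix w assume w: "w \<in> V"
    have "(LINT t|M. pw p (B u t) * w t) = fi u (K w)" by (rule minimiser_Euler_Lagrange[OF u BV B(2)[OF u] w])
    also have "\<dots> = fi (K (B u)) (K w)" by (rule fi_cong[OF u K_Lp[OF BV] K_Lp[OF w] ae])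
    finally show "(LINT t|M. pw p (B u t) * w t) = fi (K (B u)) (K w)" .
  qed
  moreover have "(\<lambda>n. J (v (r n))) \<longlonglongrightarrow> J (B u)" by (rule J_tendsto[OF v(1) BV lim2])
  then have "a \<le> J (B u)" "J (B u) \<le> b"
    using v(2,3) by (auto intro: LIMSEQ_le_const LIMSEQ_le_const2)
  ultimately show False using no by blast
qed

end

section \<open>Descent steps and critical values near zero\<close>

context variational begin

definition "step s v = (\<lambda>t. (1 - s) * v t + s * B (K v) t)"

lemma step_V: "v \<in> V \<Longrightarrow> step s v \<in> V"
  unfolding step_def by (intro V_lin B(1) K_Lp)

lemma step_tendsto:
  assumes "\<And>n. v n \<in> V" "w \<in> V" "(\<lambda>n. N (\<lambda>t. v n t - w t)) \<longlonglongrightarrow> 0"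
  shows "(\<lambda>n. N (\<lambda>t. step s (v n) t - step s w t)) \<longlonglongrightarrow> 0"
proof (rule tendsto_sandwich[OF _ _ tendsto_const])
  have Bl: "(\<lambda>n. N (\<lambda>t. B (K (v n)) t - B (K w) t)) \<longlonglongrightarrow> 0"
    by (rule B_tendsto[OF K_Lp[OF assms(1)] K_Lp[OF assms(2)] K_tendsto[OF assms]])
  show "(\<lambda>n. 2 powr p * (\<bar>1 - s\<bar> powr p * N (\<lambda>t. v n t - w t) + \<bar>s\<bar> powr p * N (\<lambda>t. B (K (v n)) t - B (K w) t))) \<longlonglongrightarrow> 0"
    by (intro tendsto_mult_right_zero tendsto_add_zero assms(3) Bl)
  have "N (\<lambda>t. step s (v n) t - step s w t)
      \<le> 2 powr p * (\<bar>1 - s\<bar> powr p * N (\<lambda>t. v n t - w t) + \<bar>s\<bar> powr p * N (\<lambda>t. B (K (v n)) t - B (K w) t))" for n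
  proof -
    have d: "(\<lambda>t. v n t - w t) \<in> LL" "(\<lambda>t. B (K (v n)) t - B (K w) t) \<in> LL"
      by (intro V_Lp V_diff assms B(1) K_Lp)+
    have "(\<lambda>t. step s (v n) t - step s w t) = (\<lambda>t. (1 - s) * (v n t - w t) + s * (B (K (v n)) t - B (K w) t))"
      by (auto simp: step_def algebra_simps)
    then show ?thesis
      using Lp_add(2)[OF p0 Lp_scale[OF d(1), of "1 - s"] Lp_scale[OF d(2), of s]] by (simp add: Np_scale)
  qed
  then show "\<forall>\<^sub>F n in sequentially. N (\<lambda>t. step s (v n) t - step s w t)
      \<le> 2 powr p * (\<bar>1 - s\<bar> powr p * N (\<lambda>t. v n t - w t) + \<bar>s\<bar> powr p * N (\<lambda>t. B (K (v n)) t - B (K w) t))"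
    by (intro always_eventually allI)
qed (simp add: Np_nonneg)

text \<open>Minimisers are unique and \<open>K\<close> is linear only up to null functions, so
  oddness is expressed by \<open>N\<close> of a sum. Premise and conclusion have the same shape, so
  that the step can be iterated.\<close>

lemma step_odd:
  assumes v: "v \<in> V" "w \<in> V" and z: "N (\<lambda>t. v t + w t) = 0"
  shows "N (\<lambda>t. step s v t + step s w t) = 0"
proof -
  have ae: "AE t in M. v t + w t = 0"
    using z Np_eq_0_iff[OF V_Lp[OF V_add[OF v]]] by simp
  have "N (K (\<lambda>t. 1 * v t + 1 * w t)) \<le> 0" using K_bd[OF V_lin[OF v, of 1 1]] z by simp
  then have "N (K (\<lambda>t. 1 * v t + 1 * w t)) = 0" using Np_nonneg antisym by blast
  then have "AE t in M. K (\<lambda>t. 1 * v t + 1 * w t) t = 0"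
    using Np_eq_0_iff[OF K_Lp[OF V_lin[OF v, of 1 1]]] by simp
  with K_lin[OF v, of 1 1] have "AE t in M. K w t = - K v t"
    by eventually_elim simp
  then have "N (\<lambda>t. B (K w) t + B (K v) t) = 0" by (intro B_odd K_Lp v)
  moreover have "(\<lambda>t. B (K w) t + B (K v) t) \<in> LL" by (intro V_Lp V_add B(1) K_Lp v)
  ultimately have "AE t in M. B (K w) t + B (K v) t = 0" using Np_eq_0_iff by blast
  with ae have "AE t in M. step s v t + step s w t = 0"
  proof eventually_elim
    case (elim t)
    have "step s v t + step s w t = (1 - s) * (v t + w t) + s * (B (K w) t + B (K v) t)"
      by (simp add: step_def algebra_simps)
    then show ?case using elim by simp
  qed
  then show ?thesis using Np_eq_0_iff[OF V_Lp[OF V_add[OF step_V[OF v(1)] step_V[OF v(2)]]]] by simp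
qed

text \<open>The step is a descent direction: convexity handles \<open>N\<close>, and \<open>F\<close> is linearised with an error that is
  uniformly \<open>o(s)\<close> on bounded sets.\<close>

lemma step_descent:
  assumes e: "e > 0"
  obtains s where "0 < s" "s \<le> 1"
    "\<And>v. v \<in> V \<Longrightarrow> N v \<le> R \<Longrightarrow> J (step s v) \<le> J v - s * (Phi (K v) v - min_val (K v)) + s * e"
proof -
  obtain R' where R': "\<And>u w. u \<in> LL \<Longrightarrow> N u \<le> A * R \<Longrightarrow> w \<in> V \<Longrightarrow> Phi u w \<le> min_val u + 1 \<Longrightarrow> N w \<le> R'"
    by (rule near_min_bounded[where R = "A * R"]) blast
  \<comment> \<open>Bounds \<open>N y\<close> for the displacement \<open>y = K w - K v\<close>,
    where \<open>N v \<le> R\<close> and the minimiser \<open>w\<close> satisfies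
    \<open>N w \<le> R'\<close>.\<close>
  define D where "D = 2 powr p * (A * \<bar>R'\<bar> + A * \<bar>R\<bar>)"
  have D0: "D \<ge> 0" using A by (simp add: D_def)
  define e1 where "e1 = e / (2 * (\<mu> + A * \<bar>R\<bar> + D + 1))"
  have pos: "\<mu> + A * \<bar>R\<bar> + D + 1 > 0" using A mu_nonneg D0 by (simp add: add_nonneg_pos)
  have e1: "e1 > 0" using e pos by (simp add: e1_def)
  obtain C where C: "C \<ge> 0" "\<And>t x x' y. t \<in> space M \<Longrightarrow> \<bar>f t x - f t x'\<bar> * \<bar>y\<bar>
        \<le> e1 * (1 + \<bar>x\<bar> powr p + \<bar>y\<bar> powr p) + C * \<bar>x - x'\<bar> powr p"
    using f_nem[OF e1] by blast
  \<comment> \<open>The remainder \<open>C * s powr p * N y\<close> of the linearisation is to stay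
    below \<open>e / 2\<close>; the other half of \<open>e\<close> is taken by
    \<open>e1\<close>.\<close>
  define s where "s = min 1 ((e / (2 * (C * D + 1))) powr (1 / p))"
  have CD: "C * D + 1 > 0" using C(1) D0 by (simp add: add_nonneg_pos)
  have s: "0 < s" "s \<le> 1" using e CD by (auto simp: s_def)
  have sp: "s powr p * (C * D) \<le> e / 2"
  proof -
    have "s powr p \<le> ((e / (2 * (C * D + 1))) powr (1 / p)) powr p"
      using s p by (intro powr_mono2) (auto simp: s_def)
    also have "\<dots> = e / (2 * (C * D + 1))" using p e CD by (simp add: powr_powr)
    finally have "s powr p * (C * D) \<le> e / (2 * (C * D + 1)) * (C * D + 1)"
      using C(1) D0 e CD by (intro mult_mono) auto
    also have "\<dots> = e / 2" using CD by (simp add: field_simps)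
    finally show ?thesis .
  qed
  have "J (step s v) \<le> J v - s * (Phi (K v) v - min_val (K v)) + s * e" if v: "v \<in> V" "N v \<le> R" for v
  proof -
    define u w y where "u = K v" and "w = B (K v)" and "y = (\<lambda>t. K w t - K v t)"
    have u: "u \<in> LL" unfolding u_def by (rule K_Lp[OF v(1)])
    have w: "w \<in> V" "Phi u w = min_val u" unfolding w_def u_def by (rule B[OF K_Lp[OF v(1)]])+
    have y: "y \<in> LL" unfolding y_def by (rule Lp_diff(1)[OF p0 K_Lp[OF w(1)] K_Lp[OF v(1)]])
    have Nu: "N u \<le> A * R" unfolding u_def using K_bd[OF v(1)] v(2) A by (meson mult_left_mono order_trans)
    have Nw: "N w \<le> R'" by (rule R'[OF u Nu w(1)]) (simp add: w(2))
    have R0: "R \<ge> 0" using Np_nonneg[of p M v] v(2) by linarith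
    have R'0: "R' \<ge> 0" using Np_nonneg[of p M w] Nw by linarith
    have NKw: "N (K w) \<le> A * R'" using K_bd[OF w(1)] Nw A by (meson mult_left_mono order_trans)
    have Ny: "N y \<le> D"
    proof -
      have "N y \<le> 2 powr p * (N (K w) + N (K v))" unfolding y_def by (rule Lp_diff(2)[OF p0 K_Lp[OF w(1)] K_Lp[OF v(1)]])
      also have "\<dots> \<le> D" unfolding D_def using NKw Nu R0 R'0 by (intro mult_left_mono add_mono) (auto simp: u_def)
      finally show ?thesis .
    qed
    have sV: "step s v \<in> V" by (rule step_V[OF v(1)])
    have step_eq: "step s v = (\<lambda>t. (1 - s) * v t + s * w t)" by (simp add: step_def w_def)
    have Nstep: "N (step s v) \<le> (1 - s) * N v + s * N w"
    proof -
      have "N (step s v) \<le> (LINT t|M. (1 - s) * \<bar>v t\<bar> powr p + s * \<bar>w t\<bar> powr p)"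
        unfolding Np_def
      proof (rule integral_mono)
        show "\<bar>step s v t\<bar> powr p \<le> (1 - s) * \<bar>v t\<bar> powr p + s * \<bar>w t\<bar> powr p" for t
          unfolding step_eq using s by (intro abs_powr_convex p) auto
      qed (use integrable_powr V_Lp sV v(1) w(1) in auto)
      also have "\<dots> = (1 - s) * N v + s * N w"
        using integrable_powr[OF V_Lp[OF v(1)]] integrable_powr[OF V_Lp[OF w(1)]] by (simp add: Np_def)
      finally show ?thesis .
    qed
    have Kstep: "AE t in M. K (step s v) t = u t + s * y t"
      using K_lin[OF v(1) w(1), of "1 - s" s] unfolding step_eq
      by eventually_elim (simp add: u_def y_def algebra_simps)
    have FIstep: "FI (K (step s v)) = (LINT t|M. F t (u t + s * y t))"
      unfolding FI_def
    proof (rule integral_cong_AE)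
      show "AE t in M. F t (K (step s v) t) = F t (u t + s * y t)" using Kstep by eventually_elim simp
    qed (use K_Lp[OF sV] u y in \<open>auto intro!: F_meas simp: Lp_def\<close>)
    have uy: "(\<lambda>t. u t + s * y t) \<in> LL" by (rule Lp_add(1)[OF p0 u Lp_scale[OF y]])
    have ptw: "F t (u t + s * y t) \<ge> F t (u t) + s * (f t (u t) * y t)
        - s * (e1 * (1 + \<bar>u t\<bar> powr p + \<bar>y t\<bar> powr p) + C * (s powr p * \<bar>y t\<bar> powr p))" if t: "t \<in> space M" for t
    proof -
      obtain \<xi> where \<xi>: "\<bar>\<xi> - u t\<bar> \<le> \<bar>(u t + s * y t) - u t\<bar>"
        "F t (u t + s * y t) - F t (u t) = f t \<xi> * ((u t + s * y t) - u t)" using F_mvt[OF t] by blast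
      have "\<bar>f t (u t) - f t \<xi>\<bar> * \<bar>y t\<bar> \<le> e1 * (1 + \<bar>u t\<bar> powr p + \<bar>y t\<bar> powr p) + C * \<bar>u t - \<xi>\<bar> powr p"
        by (rule C(2)[OF t])
      also have "\<bar>u t - \<xi>\<bar> powr p \<le> \<bar>s * y t\<bar> powr p" using \<xi>(1) p by (intro powr_mono2) auto
      also have "\<dots> = s powr p * \<bar>y t\<bar> powr p" using s by (simp add: abs_mult powr_mult)
      finally have "\<bar>(f t (u t) - f t \<xi>) * y t\<bar> \<le> e1 * (1 + \<bar>u t\<bar> powr p + \<bar>y t\<bar> powr p) + C * (s powr p * \<bar>y t\<bar> powr p)"
        using C(1) by (simp add: abs_mult mult_left_mono)
      then have "(f t (u t) - f t \<xi>) * y t \<le> e1 * (1 + \<bar>u t\<bar> powr p + \<bar>y t\<bar> powr p) + C * (s powr p * \<bar>y t\<bar> powr p)"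
        by linarith
      then have "s * ((f t (u t) - f t \<xi>) * y t) \<le> s * (e1 * (1 + \<bar>u t\<bar> powr p + \<bar>y t\<bar> powr p) + C * (s powr p * \<bar>y t\<bar> powr p))"
        using s by (intro mult_left_mono) auto
      moreover have "F t (u t + s * y t) = F t (u t) + s * (f t \<xi> * y t)" using \<xi>(2) by (simp add: algebra_simps)
      ultimately show ?thesis by (simp only: left_diff_distrib right_diff_distrib)
    qed
    have i: "integrable M (\<lambda>t. F t (u t))" "integrable M (\<lambda>t. f t (u t) * y t)"
      "integrable M (\<lambda>t. \<bar>u t\<bar> powr p)" "integrable M (\<lambda>t. \<bar>y t\<bar> powr p)"
      using FI_integrable[OF u] fi_integrable[OF u y] integrable_powr u y by auto
    have "(LINT t|M. F t (u t + s * y t)) \<ge> (LINT t|M. F t (u t) + s * (f t (u t) * y t)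
        - s * (e1 * (1 + \<bar>u t\<bar> powr p + \<bar>y t\<bar> powr p) + C * (s powr p * \<bar>y t\<bar> powr p)))"
      by (rule integral_mono[OF _ FI_integrable[OF uy] ptw]) (use i in auto)
    also have "(LINT t|M. F t (u t) + s * (f t (u t) * y t)
        - s * (e1 * (1 + \<bar>u t\<bar> powr p + \<bar>y t\<bar> powr p) + C * (s powr p * \<bar>y t\<bar> powr p)))
      = FI u + s * fi u y - s * (e1 * (\<mu> + N u + N y) + C * (s powr p * N y))"
      using i by (simp add: FI_def fi_def Np_def \<mu>_def)
    finally have Flow: "FI (K (step s v)) \<ge> FI u + s * fi u y - s * (e1 * (\<mu> + N u + N y) + C * (s powr p * N y))"
      using FIstep by simp
    have fiy: "fi u y = fi u (K w) - fi u (K v)"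
      unfolding fi_def y_def using fi_integrable[OF u K_Lp[OF w(1)]] fi_integrable[OF u K_Lp[OF v(1)]]
      by (simp add: right_diff_distrib)
    have err: "e1 * (\<mu> + N u + N y) + C * (s powr p * N y) \<le> e"
    proof -
      have "e1 * (\<mu> + N u + N y) \<le> e1 * (\<mu> + A * \<bar>R\<bar> + D + 1)"
        using e1 Nu Ny R0 by (intro mult_left_mono) auto
      also have "\<dots> = e / 2"
      proof -
        have "e / (2 * c) * c = e / 2" if "c > 0" for c :: real using that by simp
        then show ?thesis using pos unfolding e1_def by blast
      qed
      finally have 1: "e1 * (\<mu> + N u + N y) \<le> e / 2" .
      have "C * (s powr p * N y) \<le> C * (s powr p * D)" using Ny C(1) by (intro mult_left_mono) auto
      also have "\<dots> = s powr p * (C * D)" by simp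
      finally have "C * (s powr p * N y) \<le> e / 2" using sp by linarith
      with 1 show ?thesis by linarith
    qed
    have "J (step s v) \<le> ((1 - s) * N v + s * N w) / p - (FI u + s * fi u y - s * e)"
      unfolding J_def
    proof (intro diff_mono divide_right_mono Nstep)
      show "FI u + s * fi u y - s * e \<le> FI (K (step s v))"
        using Flow mult_left_mono[OF err less_imp_le[OF s(1)]] by linarith
    qed (use p in auto)
    \<comment> \<open>The linear term \<open>fi u y\<close> is the difference of the linear parts of
      \<open>Phi u w\<close> and \<open>Phi u v\<close>, so together with the convexity bound for
      \<open>N\<close> it makes up exactly the gap.\<close>
    also have "\<dots> = J v - s * (Phi u v - Phi u w) + s * e"
      unfolding J_def Phi_def fiy unfolding u_def by (simp add: field_simps add_divide_distrib diff_divide_distrib)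
    finally show ?thesis using w(2) by (simp add: u_def)
  qed
  then show ?thesis using that s by blast
qed

definition "E_comb m x = (\<lambda>t. \<Sum>i\<le>m. x i * E i t)"

lemma E_comb_V: "E_comb m x \<in> V"
proof (induction m)
  case 0 then show ?case using V_scale[OF E_V, of "x 0" 0] by (simp add: E_comb_def)
next
  case (Suc m)
  then show ?case using V_lin[OF Suc E_V[of "Suc m"], of 1 "x (Suc m)"] by (simp add: E_comb_def)
qed

lemma E_comb_diff: "E_comb m x t - E_comb m y t = E_comb m (\<lambda>i. x i - y i) t"
  by (simp add: E_comb_def sum_subtractf left_diff_distrib)

lemma E_comb_tendsto0:
  assumes "\<And>i. (\<lambda>n. x n i) \<longlonglongrightarrow> (0::real)"
  shows "(\<lambda>n. N (E_comb m (x n))) \<longlonglongrightarrow> 0"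
proof (induction m)
  have pw0: "(\<lambda>n. \<bar>x n i\<bar> powr p) \<longlonglongrightarrow> 0" for i
  proof -
    have "(\<lambda>n. \<bar>x n i\<bar> powr p) \<longlonglongrightarrow> 0 powr p"
      by (rule tendsto_powr2[OF tendsto_rabs_zero[OF assms[of i]] tendsto_const]) (use p in auto)
    then show ?thesis by simp
  qed
  have E0: "(\<lambda>n. N (\<lambda>t. x n i * E i t)) \<longlonglongrightarrow> 0" for i
    unfolding Np_scale by (rule tendsto_mult_left_zero[OF pw0])
  {
    case 0 then show ?case using E0[of 0] by (simp add: E_comb_def)
  next
    case (Suc m)
    show ?case
    proof (rule tendsto_sandwich[OF _ _ tendsto_const])
      show "(\<lambda>n. 2 powr p * (N (E_comb m (x n)) + N (\<lambda>t. x n (Suc m) * E (Suc m) t))) \<longlonglongrightarrow> 0"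
        by (intro tendsto_mult_right_zero tendsto_add_zero Suc E0)
      have "N (E_comb (Suc m) (x n)) \<le> 2 powr p * (N (E_comb m (x n)) + N (\<lambda>t. x n (Suc m) * E (Suc m) t))" for n
        using Lp_add(2)[OF p0 V_Lp[OF E_comb_V] Lp_scale[OF V_Lp[OF E_V]], of m "x n" "x n (Suc m)" "Suc m"]
        by (simp add: E_comb_def)
      then show "\<forall>\<^sub>F n in sequentially. N (E_comb (Suc m) (x n)) \<le> 2 powr p * (N (E_comb m (x n)) + N (\<lambda>t. x n (Suc m) * E (Suc m) t))"
        by (intro always_eventually allI)
    qed (simp add: Np_nonneg)
  }
qed

lemma E_comb_tendsto:
  assumes "x \<longlonglongrightarrow> (y :: nat \<Rightarrow> real)"
  shows "(\<lambda>n. N (\<lambda>t. E_comb m (x n) t - E_comb m y t)) \<longlonglongrightarrow> 0"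
proof -
  have "(\<lambda>n. x n i - y i) \<longlonglongrightarrow> 0" for i
  proof -
    have "isCont (\<lambda>x::nat \<Rightarrow> real. x i) y"
      using continuous_on_product_coordinates[of i] by (metis UNIV_I continuous_on_eq_continuous_at open_UNIV)
    from isCont_tendsto_compose[OF this assms] show ?thesis by (simp add: LIM_zero)
  qed
  from E_comb_tendsto0[of "\<lambda>n i. x n i - y i", OF this] show ?thesis by (simp add: E_comb_diff)
qed

lemma integrable_powr_q: "u \<in> LL \<Longrightarrow> u \<in> Lp q M"
proof -
  assume u: "u \<in> LL"
  obtain C where C: "C \<ge> 0" "\<And>x. \<bar>x\<bar> powr q \<le> 1 + C * \<bar>x\<bar> powr p"
    by (rule powr_le_powr_plus_eps[of q p 1]) (use q in auto)
  have "integrable M (\<lambda>t. \<bar>u t\<bar> powr q)"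
    by (rule Lp_bounded_by(1)[of _ _ "\<lambda>t. 1 + C * \<bar>u t\<bar> powr p"]) (use u C(2) in \<open>auto simp: Lp_def\<close>)
  then show ?thesis using u by (simp add: Lp_def)
qed

lemma Nq_tendsto:
  assumes u: "\<And>n. u n \<in> LL" "v \<in> LL" "(\<lambda>n. N (\<lambda>t. u n t - v t)) \<longlonglongrightarrow> 0"
  shows "(\<lambda>n. Np q M (u n)) \<longlonglongrightarrow> Np q M v"
proof (rule Np_tendsto)
  show "(\<lambda>n. Np q M (\<lambda>t. u n t - v t)) \<longlonglongrightarrow> 0"
  proof (rule tendsto_zero_of_eps_bound[where X = "\<lambda>n. \<mu>" and Y = "\<lambda>n. N (\<lambda>t. u n t - v t)"])
    fix e :: real assume "e > 0"
    then obtain C where C: "C \<ge> 0" "\<And>x. \<bar>x\<bar> powr q \<le> e + C * \<bar>x\<bar> powr p"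
      by (rule powr_le_powr_plus_eps[of q p e, rotated 2]) (use q in auto)
    have "\<bar>Np q M (\<lambda>t. u n t - v t)\<bar> \<le> e * \<mu> + C * N (\<lambda>t. u n t - v t)" for n
    proof -
      have d: "(\<lambda>t. u n t - v t) \<in> LL" by (rule Lp_diff(1)[OF p0 u(1,2)])
      have "Np q M (\<lambda>t. u n t - v t) \<le> (LINT t|M. e + C * \<bar>u n t - v t\<bar> powr p)"
        unfolding Np_def
        by (rule integral_mono[OF _ _ C(2)]) (use LpD(2)[OF integrable_powr_q[OF d]] integrable_powr[OF d] in auto)
      also have "\<dots> = e * \<mu> + C * N (\<lambda>t. u n t - v t)"
        using integrable_powr[OF d] by (simp add: Np_def \<mu>_def)
      finally show ?thesis by (simp add: Np_nonneg)
    qed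
    then show "\<exists>C. \<forall>n. \<bar>Np q M (\<lambda>t. u n t - v t)\<bar> \<le> e * \<mu> + C * N (\<lambda>t. u n t - v t)" by blast
  qed (use u(3) in auto)
qed (use q u integrable_powr_q in auto)

text \<open>By compactness of the sphere, \<open>N\<close> is bounded on it, and the q-th power
  integral of the images has a positive minimum by \<open>E_indep\<close>. Scaling by
  \<open>\<tau>\<close> multiplies the former by \<open>\<tau> powr p\<close> and the latter by
  \<open>\<tau> powr q\<close>, and \<open>q < p\<close> lets the latter win for small
  \<open>\<tau>\<close>.\<close>

lemma small_sphere_negative:
  obtains \<tau> \<eta> where "\<eta> > 0" "\<And>x. x \<in> sph m \<Longrightarrow> J (\<lambda>t. \<tau> * E_comb m x t) \<le> - \<eta>"
proof -
  have c1: "continuous_on (sph m) (\<lambda>x. N (E_comb m x))"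
    by (rule continuous_on_sequentiallyI) (intro Np_tendsto p0 V_Lp E_comb_V E_comb_tendsto)
  have c2: "continuous_on (sph m) (\<lambda>x. Np q M (K (E_comb m x)))"
    by (rule continuous_on_sequentiallyI) (intro Nq_tendsto K_Lp E_comb_V K_tendsto E_comb_tendsto)
  obtain x1 where x1: "x1 \<in> sph m" "\<And>x. x \<in> sph m \<Longrightarrow> N (E_comb m x) \<le> N (E_comb m x1)"
    using continuous_attains_sup[OF compact_sph sph_nonempty c1] by blast
  obtain x2 where x2: "x2 \<in> sph m" "\<And>x. x \<in> sph m \<Longrightarrow> Np q M (K (E_comb m x2)) \<le> Np q M (K (E_comb m x))"
    using continuous_attains_inf[OF compact_sph sph_nonempty c2] by blast
  define a b where "a = N (E_comb m x1) / p + 1" and "b = a0 * Np q M (K (E_comb m x2))"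
  have apos: "a > 0" unfolding a_def using Np_nonneg[of p M "E_comb m x1"] p by (simp add: add_nonneg_pos)
  have "\<exists>i\<le>m. x2 i \<noteq> 0"
  proof (rule ccontr)
    assume "\<not> ?thesis"
    then have "(\<Sum>i\<le>m. (x2 i)\<^sup>2) = 0" by (intro sum.neutral) auto
    then show False using x2(1) by (simp add: sph_def)
  qed
  then have "\<not> (AE t in M. K (E_comb m x2) t = 0)" using E_indep unfolding E_comb_def by blast
  then have "Np q M (K (E_comb m x2)) \<noteq> 0"
    using Np_eq_0_iff[OF integrable_powr_q[OF K_Lp[OF E_comb_V]]] by blast
  then have bpos: "b > 0" unfolding b_def using a0 Np_nonneg[of q M "K (E_comb m x2)"] by (simp add: less_le)
  \<comment> \<open>Solves \<open>\<tau> powr p * a = \<tau> powr q * b / 2\<close>, so that the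
    positive term consumes half of the negative one.\<close>
  define \<tau> where "\<tau> = (b / (2 * a)) powr (1 / (p - q))"
  have \<tau>: "\<tau> > 0" using apos bpos by (simp add: \<tau>_def)
  have \<tau>p: "\<tau> powr p = \<tau> powr q * (b / (2 * a))"
  proof -
    have "\<tau> powr p = \<tau> powr q * \<tau> powr (p - q)" by (simp flip: powr_add)
    also have "\<tau> powr (p - q) = b / (2 * a)" using q apos bpos by (simp add: \<tau>_def powr_powr)
    finally show ?thesis .
  qed
  have "J (\<lambda>t. \<tau> * E_comb m x t) \<le> - (\<tau> powr q * b / 2)" if x: "x \<in> sph m" for x
  proof -
    define w where "w = (\<lambda>t. \<tau> * E_comb m x t + 0 * E_comb m x t)"
    have w: "w \<in> V" unfolding w_def by (rule V_lin) (rule E_comb_V)+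
    have Kw: "AE t in M. K w t = \<tau> * K (E_comb m x) t" using K_lin[OF E_comb_V[of m x] E_comb_V[of m x], of \<tau> 0] by (simp add: w_def)
    have "Np q M (K w) = Np q M (\<lambda>t. \<tau> * K (E_comb m x) t)"
      by (rule Np_cong_AE[OF _ _ Kw]) (use LpD(1)[OF K_Lp[OF w]] LpD(1)[OF K_Lp[OF E_comb_V[of m x]]] in auto)
    then have Nq: "Np q M (K w) = \<tau> powr q * Np q M (K (E_comb m x))" using \<tau> by (simp add: Np_scale)
    have "a0 * Np q M (K w) = (LINT t|M. a0 * \<bar>K w t\<bar> powr q)" by (simp add: Np_def)
    also have "\<dots> \<le> FI (K w)"
      unfolding FI_def
      by (rule integral_mono) (use FI_integrable[OF K_Lp[OF w]] LpD(2)[OF integrable_powr_q[OF K_Lp[OF w]]] F_lower in auto)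
    finally have FI: "\<tau> powr q * (a0 * Np q M (K (E_comb m x))) \<le> FI (K w)" by (simp add: Nq mult.left_commute)
    have "b \<le> a0 * Np q M (K (E_comb m x))" unfolding b_def using x2(2)[OF x] a0 by simp
    then have "\<tau> powr q * b \<le> FI (K w)" using FI by (meson mult_left_mono order_trans powr_ge_zero)
    moreover have "N w / p \<le> \<tau> powr q * b / 2"
    proof -
      have "N w / p = \<tau> powr p * (N (E_comb m x) / p)" using \<tau> by (simp add: w_def Np_scale)
      also have "\<dots> \<le> \<tau> powr p * a"
      proof (rule mult_left_mono)
        have "N (E_comb m x) / p \<le> N (E_comb m x1) / p" using x1(2)[OF x] p by (simp add: divide_right_mono)
        then show "N (E_comb m x) / p \<le> a" unfolding a_def by simp
      qed simp
      also have "\<dots> = \<tau> powr q * b / 2" unfolding \<tau>p using apos by simp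
      finally show ?thesis .
    qed
    moreover have weq: "(\<lambda>t. \<tau> * E_comb m x t) = w" by (simp add: w_def)
    ultimately show ?thesis unfolding J_def weq by linarith
  qed
  moreover have "\<tau> powr q * b / 2 > 0" using \<tau> bpos by simp
  ultimately show ?thesis using that by blast
qed

theorem crit_in_window:
  assumes \<epsilon>: "\<epsilon> > 0"
  shows "\<exists>v. crit v \<and> - \<epsilon> \<le> J v \<and> J v < 0"
proof (rule ccontr)
  assume no: "\<not> ?thesis"
  obtain R where R: "R \<ge> 0" "\<And>v. v \<in> V \<Longrightarrow> J v \<le> 0 \<Longrightarrow> N v \<le> R" by (rule sublevel_bounded) blast
  obtain e1 where e1: "e1 > 0" "\<And>u. u \<in> LL \<Longrightarrow> N u \<le> e1 \<Longrightarrow> FI u \<le> \<epsilon> / 3"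
  proof -
    define e where "e = \<epsilon> / (6 * (\<mu> + 1))"
    have e: "e > 0" using \<epsilon> mu_nonneg by (simp add: e_def)
    obtain C where C: "C \<ge> 0" "\<And>u u'. u \<in> LL \<Longrightarrow> u' \<in> LL \<Longrightarrow>
      \<bar>FI u - FI u'\<bar> \<le> e * (\<mu> + N u + N u') + C * N (\<lambda>t. u t - u' t)" by (rule FI_diff_bound[OF e]) blast
    define e1 where "e1 = min 1 (\<epsilon> / (6 * (C + 1)))"
    have "e1 > 0" using \<epsilon> C(1) by (simp add: e1_def)
    moreover have "FI u \<le> \<epsilon> / 3" if u: "u \<in> LL" "N u \<le> e1" for u
    proof -
      have z: "(\<lambda>t. 0) \<in> LL" by (rule V_Lp[OF V_zero])
      have "FI (\<lambda>t. 0) = (LINT t|M. 0)" unfolding FI_def by (rule Bochner_Integration.integral_cong) (auto simp: F_zero)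
      then have "FI u \<le> e * (\<mu> + N u) + C * N u" using C(2)[OF u(1) z] by (simp add: Np_def)
      also have "e * (\<mu> + N u) \<le> e * (\<mu> + 1)" using e u(2) by (intro mult_left_mono) (auto simp: e1_def)
      also have "\<dots> = \<epsilon> / 6" unfolding e_def using mu_nonneg by (simp add: divide_simps)
      also have "C * N u \<le> (C + 1) * (\<epsilon> / (6 * (C + 1)))"
        using u(2) C(1) Np_nonneg[of p M u] by (intro mult_mono) (auto simp: e1_def)
      also have "\<dots> = \<epsilon> / 6" using C(1) by (simp add: divide_simps)
      finally show ?thesis by simp
    qed
    ultimately show ?thesis using that by blast
  qed
  \<comment> \<open>The number \<open>m\<close> of functionals is fixed first, for the bound
    \<open>R\<close> valid on all of \<open>J \<le> 0\<close>; the sphere then gets the matching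
    dimension \<open>m\<close>, as Borsuk-Ulam requires.\<close>
  obtain m \<eta>0 where m: "\<eta>0 > 0"
    "\<And>v. v \<in> V \<Longrightarrow> N v \<le> R \<Longrightarrow> (\<And>j. j < m \<Longrightarrow> \<bar>L j v\<bar> \<le> \<eta>0) \<Longrightarrow> N (K v) \<le> e1"
    using compactness[OF e1(1), of R] by metis
  obtain \<tau> \<eta>1 where \<eta>1: "\<eta>1 > 0" "\<And>x. x \<in> sph m \<Longrightarrow> J (\<lambda>t. \<tau> * E_comb m x t) \<le> - \<eta>1"
    by (rule small_sphere_negative) blast
  \<comment> \<open>With \<open>\<eta> \<le> \<epsilon> / 3\<close> the target level
    \<open>- 2 * \<epsilon> / 3\<close> lies below \<open>- \<eta>\<close>, so every iterate remains
    in the region where the step estimate holds.\<close>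
  define \<eta> where "\<eta> = min \<eta>1 (\<epsilon> / 3)"
  have \<eta>: "\<eta> > 0" "\<eta> \<le> \<epsilon> / 3" using \<eta>1 \<epsilon> by (auto simp: \<eta>_def)
  have start: "J (\<lambda>t. \<tau> * E_comb m x t) \<le> - \<eta>" if "x \<in> sph m" for x
    using \<eta>1(2)[OF that] by (simp add: \<eta>_def)
  obtain \<delta> where \<delta>: "\<delta> > 0" "\<And>v. v \<in> V \<Longrightarrow> - \<epsilon> \<le> J v \<Longrightarrow> J v \<le> - \<eta> \<Longrightarrow> Phi (K v) v - min_val (K v) \<ge> \<delta>"
    by (rule gap_in_window[of "- \<epsilon>" "- \<eta>"]) (use no \<eta>(1) in force)+
  define e where "e = min (\<delta> / 2) (\<epsilon> / 3)"
  have e: "e > 0" "e \<le> \<delta> / 2" "e \<le> \<epsilon> / 3" using \<delta>(1) \<epsilon> by (auto simp: e_def)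
  obtain s where s: "0 < s" "s \<le> 1"
    "\<And>v. v \<in> V \<Longrightarrow> N v \<le> R \<Longrightarrow> J (step s v) \<le> J v - s * (Phi (K v) v - min_val (K v)) + s * e"
    by (rule step_descent[OF e(1), where R = R]) blast
  have stepJ: "J (step s v) \<le> max (- (2 * \<epsilon> / 3)) (J v - s * \<delta> / 2)" if v: "v \<in> V" "J v \<le> - \<eta>" for v
  proof -
    have "N v \<le> R" by (rule R(2)[OF v(1)]) (use v(2) \<eta> in simp)
    note sv = s(3)[OF v(1) this]
    show ?thesis
    proof (cases "- \<epsilon> \<le> J v")
      case True
      have "s * \<delta> \<le> s * (Phi (K v) v - min_val (K v))" using \<delta>(2)[OF v(1) True v(2)] s by (intro mult_left_mono) auto
      moreover have "s * e \<le> s * (\<delta> / 2)" using e s by (intro mult_left_mono) auto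
      ultimately show ?thesis using sv by simp
    next
      case False
      \<comment> \<open>Below the window the gap is merely nonnegative, and the step may raise
        \<open>J\<close>, but by at most \<open>s * e \<le> \<epsilon> / 3\<close>: from below
        \<open>- \<epsilon>\<close> it cannot pass \<open>- 2 * \<epsilon> / 3\<close>.\<close>
      have "s * (Phi (K v) v - min_val (K v)) \<ge> 0" using gap_nonneg[OF v(1)] s by simp
      moreover have "s * e \<le> \<epsilon> / 3" using mult_mono[OF s(2) e(3)] s e \<epsilon> by simp
      ultimately show ?thesis using sv False by simp
    qed
  qed
  define v where "v n x = (step s ^^ n) (\<lambda>t. \<tau> * E_comb m x t)" for n x
  have v0: "v 0 x = (\<lambda>t. \<tau> * E_comb m x t)" and vS: "v (Suc n) x = step s (v n x)" for n x
    by (simp_all add: v_def)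
  have vV: "v n x \<in> V" for n x
    by (induction n) (auto simp: v0 vS intro!: step_V V_scale E_comb_V)
  have vJ: "J (v n x) \<le> - \<eta> \<and> J (v n x) \<le> max (- (2 * \<epsilon> / 3)) (- \<eta> - real n * (s * \<delta> / 2))" if x: "x \<in> sph m" for n x
  proof (induction n)
    case 0
    then show ?case using start[OF x] by (simp add: v0)
  next
    case (Suc n)
    have "s * \<delta> / 2 > 0" using s \<delta> by simp
    moreover have "real (Suc n) * (s * \<delta> / 2) = real n * (s * \<delta> / 2) + s * \<delta> / 2"
      by (simp add: distrib_right)
    moreover have "J (v (Suc n) x) \<le> max (- (2 * \<epsilon> / 3)) (J (v n x) - s * \<delta> / 2)"
      unfolding vS by (rule stepJ[OF vV conjunct1[OF Suc]])
    ultimately show ?case using Suc \<eta> by linarith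
  qed
  obtain n where n: "real n * (s * \<delta> / 2) > \<epsilon>"
  proof -
    have "s * \<delta> / 2 > 0" using s \<delta> by simp
    then show ?thesis using reals_Archimedean3[of "s * \<delta> / 2"] that by blast
  qed
  have vlow: "J (v n x) \<le> - (2 * \<epsilon> / 3)" if "x \<in> sph m" for x
    using vJ[OF that, of n] n \<eta> \<epsilon> by linarith
  have cont: "(\<lambda>k. N (\<lambda>t. v n (x k) t - v n y t)) \<longlonglongrightarrow> 0" if "x \<longlonglongrightarrow> y" for x n y
  proof (induction n)
    case 0
    have "(\<lambda>k. N (\<lambda>t. \<tau> * (E_comb m (x k) t - E_comb m y t))) \<longlonglongrightarrow> 0"
      unfolding Np_scale by (rule tendsto_mult_right_zero[OF E_comb_tendsto[OF that]])
    then show ?case by (simp add: v0 right_diff_distrib)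
  next
    case (Suc n)
    then show ?case unfolding vS by (intro step_tendsto vV)
  qed
  have odd: "N (\<lambda>t. v n (\<lambda>i. - x i) t + v n x t) = 0" for n x
  proof (induction n)
    case 0
    have "E_comb m (\<lambda>i. - x i) t = - E_comb m x t" for t by (simp add: E_comb_def sum_negf)
    then show ?case by (simp add: v0 Np_def)
  next
    case (Suc n)
    then show ?case unfolding vS by (intro step_odd vV)
  qed
  define g where "g x j = L j (v n x)" for x j
  obtain x where x: "x \<in> sph m" "\<And>j. j < m \<Longrightarrow> g x j = 0"
  proof (rule borsuk_ulam[of m g])
    fix j
    show "continuous_on (sph m) (\<lambda>x. g x j)" unfolding g_def
      by (rule continuous_on_sequentiallyI) (intro L_tendsto vV cont)
  next
    fix x j
    obtain B where B: "\<And>v. v \<in> V \<Longrightarrow> \<bar>L j v\<bar> powr p \<le> B * N v" using L_bd by blast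
    have "\<bar>L j (\<lambda>t. 1 * v n (\<lambda>i. - x i) t + 1 * v n x t)\<bar> powr p \<le> 0"
      using B[OF V_lin[OF vV[of n "\<lambda>i. - x i"] vV[of n x], of 1 1]] odd[of n x] by simp
    then have "L j (\<lambda>t. 1 * v n (\<lambda>i. - x i) t + 1 * v n x t) = 0"
      by (metis abs_eq_0 antisym powr_eq_0_iff powr_ge_zero)
    then show "g (\<lambda>i. - x i) j = - g x j"
      unfolding g_def using L_lin[OF vV[of n "\<lambda>i. - x i"] vV[of n x], of j 1 1] by simp
  qed blast
  have Jx: "J (v n x) \<le> - (2 * \<epsilon> / 3)" by (rule vlow[OF x(1)])
  have "N (v n x) \<le> R" by (rule R(2)[OF vV]) (use Jx \<epsilon> in simp)
  then have "N (K (v n x)) \<le> e1" by (rule m(2)[OF vV]) (use x(2) m(1) in \<open>auto simp: g_def\<close>)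
  then have "FI (K (v n x)) \<le> \<epsilon> / 3" by (rule e1(2)[OF K_Lp[OF vV]])
  then have "J (v n x) \<ge> - (\<epsilon> / 3)" unfolding J_def using Np_nonneg[of p M "v n x"] p
    by (smt (verit) divide_nonneg_pos)
  with Jx \<epsilon> show False by linarith
qed

end

section \<open>Lebesgue differentiation\<close>

text \<open>An indicator is approximated by an Urysohn function between a closed set inside and an
  open set outside. The induction over integrable functions adds finite sums and dominated
  limits.\<close>

lemma integrable_approx_continuous:
  fixes g :: "real \<Rightarrow> real"
  assumes "integrable lebesgue g"
  shows "\<forall>e>0. \<exists>h. continuous_on UNIV h \<and> integrable lebesgue h \<and> (LINT x|lebesgue. \<bar>g x - h x\<bar>) < e"
  using assms
proof (induction rule: integrable_induct)
  case (base A c)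
  show ?case
  proof (intro allI impI)
    fix e :: real assume e: "e > 0"
    define e' where "e' = e / (2 * (\<bar>c\<bar> + 1))"
    have e': "e' > 0" using e by (simp add: e'_def add_nonneg_pos)
    obtain U where U: "open U" "A \<subseteq> U" "U - A \<in> lmeasurable" "emeasure lebesgue (U - A) < ennreal e'"
      using sets_lebesgue_outer_open[OF base(1) e'] by blast
    obtain S where S: "closed S" "S \<subseteq> A" "A - S \<in> lmeasurable" "emeasure lebesgue (A - S) < ennreal e'"
      using sets_lebesgue_inner_closed[OF base(1) e'] by blast
    obtain f :: "real \<Rightarrow> real" where f: "continuous_on UNIV f" "\<And>x. f x \<in> closed_segment 1 0"
      "\<And>x. x \<in> S \<Longrightarrow> f x = 1" "\<And>x. x \<in> - U \<Longrightarrow> f x = 0"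
    proof (rule Urysohn[of S "- U" 1 0])
      show "closed (- U)" using U(1) by (simp add: closed_Compl)
      show "S \<inter> - U = {}" using S(2) U(2) by blast
    qed (use S(1) in auto)
    have f01: "0 \<le> f x" "f x \<le> 1" for x using f(2)[of x] by (auto simp: closed_segment_eq_real_ivl split: if_splits)
    have fm [measurable]: "f \<in> borel_measurable lebesgue"
      using measurable_completion[of f lborel borel] borel_measurable_continuous_onI[OF f(1)] by simp
    have Af: "A \<in> lmeasurable" using base by (simp add: fmeasurableI)
    have Uf: "U \<in> lmeasurable" using fmeasurable.Un[OF Af U(3)] U(2) by (simp add: Un_absorb1)
    have USf: "U - S \<in> lmeasurable"
      using S(1) by (intro fmeasurable_Diff[OF Uf]) (simp add: lborelD)
    have mUS: "measure lebesgue (U - S) \<le> 2 * e'"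
    proof -
      have "U - S \<subseteq> (U - A) \<union> (A - S)" by blast
      then have "measure lebesgue (U - S) \<le> measure lebesgue ((U - A) \<union> (A - S))"
        using USf U(3) S(3) by (intro measure_mono_fmeasurable) auto
      also have "\<dots> \<le> measure lebesgue (U - A) + measure lebesgue (A - S)"
        using U(3) S(3) by (intro measure_Un_le) auto
      also have "\<dots> \<le> e' + e'"
        using U(3,4) S(3,4) e' by (intro add_mono) (auto simp: emeasure_eq_measure2 ennreal_less_iff)
      finally show ?thesis by simp
    qed
    have fi: "integrable lebesgue f"
    proof (rule Bochner_Integration.integrable_bound)
      show "integrable lebesgue (indicat_real U)" using Uf by (simp add: lmeasurable_iff_integrable)
      show "AE x in lebesgue. norm (f x) \<le> norm (indicat_real U x)"
        using f01 f(4) by (intro AE_I2) (auto simp: indicator_def)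
    qed simp
    have "(LINT x|lebesgue. \<bar>indicat_real A x *\<^sub>R c - c * f x\<bar>) \<le> (LINT x|lebesgue. \<bar>c\<bar> * indicat_real (U - S) x)"
    proof (rule integral_mono)
      show "integrable lebesgue (\<lambda>x. \<bar>indicat_real A x *\<^sub>R c - c * f x\<bar>)"
        using fi Af unfolding lmeasurable_iff_integrable by auto
      show "integrable lebesgue (\<lambda>x. \<bar>c\<bar> * indicat_real (U - S) x)"
        using USf unfolding lmeasurable_iff_integrable by simp
      fix x
      have "\<bar>indicat_real A x - f x\<bar> \<le> indicat_real (U - S) x"
        using f01[of x] f(3)[of x] f(4)[of x] U(2) S(2) by (auto simp: indicator_def)
      then have "\<bar>c\<bar> * \<bar>indicat_real A x - f x\<bar> \<le> \<bar>c\<bar> * indicat_real (U - S) x" by (rule mult_left_mono) simp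
      then show "\<bar>indicat_real A x *\<^sub>R c - c * f x\<bar> \<le> \<bar>c\<bar> * indicat_real (U - S) x"
        by (simp add: right_diff_distrib mult.commute flip: abs_mult)
    qed
    also have "\<dots> = \<bar>c\<bar> * measure lebesgue (U - S)" using USf by simp
    also have "\<dots> \<le> \<bar>c\<bar> * (2 * e')" using mUS by (intro mult_left_mono) auto
    also have "\<dots> < (\<bar>c\<bar> + 1) * (2 * e')" using e' by simp
    also have "\<dots> = e"
    proof -
      have *: "a * (2 * (e / (2 * a))) = e" if "a > 0" for a :: real using that by simp
      show ?thesis unfolding e'_def by (rule *) (simp add: add_nonneg_pos)
    qed
    finally show "\<exists>h. continuous_on UNIV h \<and> integrable lebesgue h \<and> (LINT x|lebesgue. \<bar>indicat_real A x *\<^sub>R c - h x\<bar>) < e"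
      using f(1) fi by (intro exI[of _ "\<lambda>x. c * f x"]) (auto intro!: continuous_intros)
  qed
next
  case (add f g)
  show ?case
  proof (intro allI impI)
    fix e :: real assume "e > 0"
    then have "e / 2 > 0" by simp
    then obtain h1 h2 where h: "continuous_on UNIV h1" "integrable lebesgue h1" "(LINT x|lebesgue. \<bar>f x - h1 x\<bar>) < e / 2"
      "continuous_on UNIV h2" "integrable lebesgue h2" "(LINT x|lebesgue. \<bar>g x - h2 x\<bar>) < e / 2"
      using add.IH by blast
    have "(LINT x|lebesgue. \<bar>(f x + g x) - (h1 x + h2 x)\<bar>) \<le> (LINT x|lebesgue. \<bar>f x - h1 x\<bar> + \<bar>g x - h2 x\<bar>)"
      using add.hyps h by (intro integral_mono) auto
    also have "\<dots> < e" using add.hyps h by simp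
    finally show "\<exists>h. continuous_on UNIV h \<and> integrable lebesgue h \<and> (LINT x|lebesgue. \<bar>f x + g x - h x\<bar>) < e"
      using h by (intro exI[of _ "\<lambda>x. h1 x + h2 x"]) (auto intro!: continuous_intros)
  qed
next
  case (lim f s)
  show ?case
  proof (intro allI impI)
    fix e :: real assume "e > 0"
    have "(\<lambda>i. LINT x|lebesgue. \<bar>f x - s i x\<bar>) \<longlonglongrightarrow> (LINT x|(lebesgue :: real measure). (0::real))"
    proof (rule integral_dominated_convergence[where w = "\<lambda>x. 3 * \<bar>f x\<bar>"])
      show "AE x in lebesgue. (\<lambda>i. \<bar>f x - s i x\<bar>) \<longlonglongrightarrow> 0"
      proof (rule AE_I2)
        fix x
        have "(\<lambda>i. \<bar>f x - s i x\<bar>) \<longlonglongrightarrow> \<bar>f x - f x\<bar>" using lim.hyps(2)[of x] by (intro tendsto_intros) auto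
        then show "(\<lambda>i. \<bar>f x - s i x\<bar>) \<longlonglongrightarrow> 0" by simp
      qed
      show "AE x in lebesgue. norm \<bar>f x - s i x\<bar> \<le> 3 * \<bar>f x\<bar>" for i
      proof (rule AE_I2)
        fix x :: real
        show "norm \<bar>f x - s i x\<bar> \<le> 3 * \<bar>f x\<bar>" using lim.hyps(3)[of x i] by simp
      qed
    qed (use lim.hyps(1,4) in auto)
    then have "eventually (\<lambda>i. (LINT x|lebesgue. \<bar>f x - s i x\<bar>) < e / 2) sequentially"
      using \<open>e > 0\<close> by (intro order_tendstoD(2)) auto
    then obtain i where i: "(LINT x|lebesgue. \<bar>f x - s i x\<bar>) < e / 2" by (auto simp: eventually_sequentially)
    have "e / 2 > 0" using \<open>e > 0\<close> by simp
    then obtain h where h: "continuous_on UNIV h" "integrable lebesgue h" "(LINT x|lebesgue. \<bar>s i x - h x\<bar>) < e / 2"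
      using lim.IH[of i] by blast
    have "(LINT x|lebesgue. \<bar>f x - h x\<bar>) \<le> (LINT x|lebesgue. \<bar>f x - s i x\<bar> + \<bar>s i x - h x\<bar>)"
      using lim.hyps(1,4) h by (intro integral_mono) auto
    also have "\<dots> < e" using lim.hyps(1,4) h i by simp
    finally show "\<exists>h. continuous_on UNIV h \<and> integrable lebesgue h \<and> (LINT x|lebesgue. \<bar>f x - h x\<bar>) < e"
      using h by blast
  qed
qed

text \<open>The weak-type estimate of Hardy and Littlewood, stated through an exceptional set
  \<open>U\<close> that is a countable union of balls and hence measurable. Vitali's lemma selects
  disjoint balls whose fivefold enlargements cover all bad centres; an enlarged ball has length
  \<open>10 * r\<close>, whence the constant 10.\<close>

lemma maximal_inequality:
  fixes w :: "real \<Rightarrow> real"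
  assumes w: "integrable lebesgue w" "\<And>x. w x \<ge> 0" and l: "l > 0"
  obtains U where "U \<in> lmeasurable" "measure lebesgue U \<le> 10 / l * (LINT x|lebesgue. w x)"
    "\<And>x r. r > 0 \<Longrightarrow> x \<notin> U \<Longrightarrow> (LINT s|lebesgue. indicator (ball x r) s * w s) \<le> l * r"
proof -
  define E where "E = {x. \<exists>r>0. (LINT s|lebesgue. indicator (ball x r) s * w s) > l * r}"
  define W where "W = (LINT x|lebesgue. w x)"
  have W0: "W \<ge> 0" unfolding W_def using w by simp
  have "\<forall>x\<in>E. \<exists>r. r > 0 \<and> (LINT s|lebesgue. indicator (ball x r) s * w s) > l * r"
    unfolding E_def by blast
  then obtain r where "\<forall>x\<in>E. r x > 0 \<and> (LINT s|lebesgue. indicator (ball x (r x)) s * w s) > l * r x"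
    unfolding bchoice_iff ..
  then have r: "r x > 0 \<and> (LINT s|lebesgue. indicator (ball x (r x)) s * w s) > l * r x" if "x \<in> E" for x
    using that by blast
  have intball: "integrable lebesgue (\<lambda>s. indicat_real (ball x r) s * w s)" for x r
    using integrable_mult_indicator[OF _ w(1), of "ball x r"] by simp
  have rB: "0 < r x \<and> r x \<le> W / l" if "x \<in> E" for x
  proof -
    have "(LINT s|lebesgue. indicator (ball x (r x)) s * w s) \<le> W"
      unfolding W_def using w intball by (intro integral_mono) (auto simp: indicator_def)
    then show ?thesis using r[OF that] l by (simp add: field_simps)
  qed
  obtain C where C: "countable C" "C \<subseteq> E" "pairwise (\<lambda>i j. disjnt (ball i (r i)) (ball j (r j))) C"
    "E \<subseteq> (\<Union>i\<in>C. ball i (5 * r i))"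
  proof (rule Vitali_covering_lemma_balls[where S = E and K = E and a = "\<lambda>x. x" and r = r and B = "W / l"])
    show "E \<subseteq> (\<Union>i\<in>E. ball i (r i))" using rB by force
  qed (use rB that in blast)+
  define I where "I = to_nat_on C ` C"
  define X where "X n = (if n \<in> I then ball (from_nat_into C n) (5 * r (from_nat_into C n)) else {})" for n
  define Y where "Y n = (if n \<in> I then ball (from_nat_into C n) (r (from_nat_into C n)) else {})" for n
  have inC: "from_nat_into C n \<in> C" if "n \<in> I" for n using that C(1) by (auto simp: I_def)
  define \<nu> where "\<nu> = density lebesgue (\<lambda>x. ennreal (w x))"
  have wm: "(\<lambda>x. ennreal (w x)) \<in> borel_measurable lebesgue" using w(1) by measurable
  have UX: "(\<Union>i\<in>C. ball i (5 * r i)) = (\<Union>n. X n)"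
  proof (intro equalityI subsetI)
    fix x assume "x \<in> (\<Union>i\<in>C. ball i (5 * r i))"
    then obtain i where "i \<in> C" "x \<in> ball i (5 * r i)" by blast
    then have "x \<in> X (to_nat_on C i)" using C(1) by (simp add: X_def I_def)
    then show "x \<in> (\<Union>n. X n)" by blast
  next
    fix x assume "x \<in> (\<Union>n. X n)"
    then show "x \<in> (\<Union>i\<in>C. ball i (5 * r i))" using inC by (auto simp: X_def split: if_splits)
  qed
  have disj: "disjoint_family Y"
    unfolding disjoint_family_on_def
  proof (intro ballI impI)
    fix a b :: nat assume "a \<noteq> b"
    show "Y a \<inter> Y b = {}"
    proof (cases "a \<in> I \<and> b \<in> I")
      case True
      then have "from_nat_into C a \<noteq> from_nat_into C b"
        using \<open>a \<noteq> b\<close> C(1) by (auto simp: I_def)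
      then show ?thesis using True C(3) inC by (auto simp: Y_def pairwise_def disjnt_def)
    qed (auto simp: Y_def)
  qed
  have XY: "emeasure lebesgue (X n) \<le> ennreal (10 / l) * emeasure \<nu> (Y n)" for n
  proof (cases "n \<in> I")
    case True
    define x where "x = from_nat_into C n"
    have x: "x \<in> E" using inC[OF True] C(2) by (auto simp: x_def)
    have "emeasure \<nu> (Y n) = (\<integral>\<^sup>+s. ennreal (w s) * indicator (ball x (r x)) s \<partial>lebesgue)"
      unfolding \<nu>_def using True wm by (subst emeasure_density) (auto simp: Y_def x_def)
    also have "\<dots> = (\<integral>\<^sup>+s. ennreal (indicat_real (ball x (r x)) s * w s) \<partial>lebesgue)"
      by (intro nn_integral_cong) (auto simp: indicator_def)
    also have "\<dots> = ennreal (LINT s|lebesgue. indicat_real (ball x (r x)) s * w s)"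
      using w(2) intball by (intro nn_integral_eq_integral) auto
    finally have \<nu>: "emeasure \<nu> (Y n) = ennreal (LINT s|lebesgue. indicat_real (ball x (r x)) s * w s)" .
    have "emeasure lebesgue (X n) = ennreal (10 * r x)"
      using True r[OF x] by (simp add: X_def x_def[symmetric] ball_eq_greaterThanLessThan)
    also have "\<dots> = ennreal (10 / l * (l * r x))" using l by simp
    also have "\<dots> \<le> ennreal (10 / l * (LINT s|lebesgue. indicat_real (ball x (r x)) s * w s))"
      using r[OF x] l by (intro ennreal_leI mult_left_mono) auto
    also have "\<dots> = ennreal (10 / l) * emeasure \<nu> (Y n)" using l unfolding \<nu> by (intro ennreal_mult') auto
    finally show ?thesis .
  qed (simp add: X_def)
  have "emeasure lebesgue (\<Union>n. X n) \<le> suminf (\<lambda>n. emeasure lebesgue (X n))"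
    by (intro emeasure_subadditive_countably) (auto simp: X_def)
  also have "\<dots> \<le> suminf (\<lambda>n. ennreal (10 / l) * emeasure \<nu> (Y n))" by (intro suminf_le XY) auto
  also have "\<dots> = ennreal (10 / l) * suminf (\<lambda>n. emeasure \<nu> (Y n))" by simp
  also have "suminf (\<lambda>n. emeasure \<nu> (Y n)) = emeasure \<nu> (\<Union>n. Y n)"
    by (rule suminf_emeasure[OF _ disj]) (auto simp: Y_def \<nu>_def)
  also have "\<dots> \<le> emeasure \<nu> (space \<nu>)" by (rule emeasure_space)
  also have "emeasure \<nu> (space \<nu>) = (\<integral>\<^sup>+s. ennreal (w s) \<partial>lebesgue)"
    unfolding \<nu>_def using wm by (subst emeasure_density) auto
  also have "\<dots> = ennreal W" unfolding W_def using w by (intro nn_integral_eq_integral) auto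
  also have "ennreal (10 / l) * ennreal W = ennreal (10 / l * W)" using l W0 by (intro ennreal_mult[symmetric]) auto
  finally have le: "emeasure lebesgue (\<Union>n. X n) \<le> ennreal (10 / l * W)"
    by (simp add: mult_left_mono)
  have Xs: "(\<Union>n. X n) \<in> sets lebesgue" by (auto simp: X_def)
  show ?thesis
  proof (rule that[of "\<Union>n. X n"])
    show "(\<Union>n. X n) \<in> lmeasurable" using le Xs by (intro fmeasurableI) (auto intro: le_less_trans)
    then show "measure lebesgue (\<Union>n. X n) \<le> 10 / l * (LINT x|lebesgue. w x)"
      using le l W0 unfolding W_def[symmetric] by (simp add: emeasure_eq_measure2)
    show "(LINT s|lebesgue. indicator (ball x r) s * w s) \<le> l * r" if "r > 0" "x \<notin> (\<Union>n. X n)" for x r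
      using that C(4) UX unfolding E_def by force
  qed
qed


text \<open>Where the distance from a continuous approximation \<open>h\<close> is small at the
  point and on average around it, continuity of \<open>h\<close> bounds the error of the difference
  quotient by \<open>\<epsilon>\<close>. The remaining points have arbitrarily small measure, by
  \<open>maximal_inequality\<close> and Markov's inequality.\<close>

theorem lebesgue_differentiation:
  fixes g :: "real \<Rightarrow> real"
  assumes g: "integrable lebesgue g"
  shows "AE t in lebesgue. ((\<lambda>x. LINT s|lebesgue. indicator {..x} s * g s) has_real_derivative g t) (at t)"
proof -
  define G where "G x = (LINT s|lebesgue. indicator {..x} s * g s)" for x
  define good where "good \<epsilon> t \<longleftrightarrow> (\<exists>d>0. \<forall>y. \<bar>y - t\<bar> < d \<longrightarrow> \<bar>G y - G t - g t * (y - t)\<bar> \<le> \<epsilon> * \<bar>y - t\<bar>)" for \<epsilon> t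
  have intI: "integrable lebesgue (\<lambda>s. indicat_real A s * k s)" if "integrable lebesgue k" "A \<in> sets borel" for k :: "real \<Rightarrow> real" and A
    using integrable_mult_indicator[OF _ that(1), of A] that(2) by simp
  have intIc: "integrable lebesgue (\<lambda>s. indicat_real {a<..b} s * c)" for a b c :: real
    by (cases "a \<le> b") (auto intro!: integrable_mult_left integrable_real_indicator)
  have diffG: "G b - G a - c * (b - a) = (LINT s|lebesgue. indicat_real {a<..b} s * (g s - c))" if "a \<le> b" for a b c
  proof -
    have "G b - G a = (LINT s|lebesgue. indicat_real {..b} s * g s - indicat_real {..a} s * g s)"
      unfolding G_def by (rule Bochner_Integration.integral_diff[symmetric]) (intro intI g; simp)+
    also have "\<dots> = (LINT s|lebesgue. indicat_real {a<..b} s * g s)"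
      using that by (intro Bochner_Integration.integral_cong) (auto simp: indicator_def)
    finally have 1: "G b - G a = (LINT s|lebesgue. indicat_real {a<..b} s * g s)" .
    have "c * (b - a) = (LINT s|lebesgue. indicat_real {a<..b} s * c)" using that by simp
    then have "G b - G a - c * (b - a) = (LINT s|lebesgue. indicat_real {a<..b} s * g s - indicat_real {a<..b} s * c)"
      using 1 intI[OF g, of "{a<..b}"] intIc[of a b c] by (simp add: Bochner_Integration.integral_diff)
    then show ?thesis by (simp add: right_diff_distrib)
  qed
  have neg: "negligible {t. \<not> good \<epsilon> t}" if \<epsilon>: "\<epsilon> > 0" for \<epsilon>
    unfolding negligible_outer_le
  proof (intro allI impI)
    fix e :: real assume e: "e > 0"
    \<comment> \<open>The maximal inequality at level \<open>\<epsilon> / 6\<close> contributes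
      \<open>60 / \<epsilon>\<close> and Markov's inequality at level \<open>\<epsilon> / 3\<close>
      contributes \<open>3 / \<epsilon>\<close>, together 63.\<close>
    define \<delta> where "\<delta> = e * \<epsilon> / 63"
    have "\<delta> > 0" using e \<epsilon> by (simp add: \<delta>_def)
    then obtain h where h: "continuous_on UNIV h" "integrable lebesgue h" "(LINT x|lebesgue. \<bar>g x - h x\<bar>) < \<delta>"
      using integrable_approx_continuous[OF g] by blast
    define w where "w x = \<bar>g x - h x\<bar>" for x
    have w: "integrable lebesgue w" "\<And>x. w x \<ge> 0" unfolding w_def using g h by auto
    obtain U where U: "U \<in> lmeasurable" "measure lebesgue U \<le> 10 / (\<epsilon> / 6) * (LINT x|lebesgue. w x)"
      "\<And>x r. r > 0 \<Longrightarrow> x \<notin> U \<Longrightarrow> (LINT s|lebesgue. indicator (ball x r) s * w s) \<le> \<epsilon> / 6 * r"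
      by (rule maximal_inequality[OF w, of "\<epsilon> / 6"]) (use \<epsilon> in auto)
    define S where "S = {x. w x \<ge> \<epsilon> / 3}"
    have Sm: "{x \<in> space lebesgue. w x \<ge> \<epsilon> / 3} \<in> sets lebesgue" using w(1) by measurable
    have Sle: "emeasure lebesgue S \<le> ennreal (1 / (\<epsilon> / 3) * (LINT x|lebesgue. w x))"
      using integral_Markov_inequality[OF w(1), of "\<epsilon> / 3"] w(2) \<epsilon> by (simp add: S_def)
    have S: "S \<in> lmeasurable" using Sm Sle by (intro fmeasurableI) (auto simp: S_def intro: le_less_trans)
    have W: "(LINT x|lebesgue. w x) \<le> \<delta>" "(LINT x|lebesgue. w x) \<ge> 0" using h(3) w(2) by (auto simp: w_def[abs_def])
    have mS: "measure lebesgue S \<le> 3 / \<epsilon> * (LINT x|lebesgue. w x)"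
      using Sle S W(2) \<epsilon> by (simp add: emeasure_eq_measure2)
    have "measure lebesgue (U \<union> S) \<le> measure lebesgue U + measure lebesgue S" using U(1) S by (intro measure_Un_le) auto
    also have "\<dots> \<le> 10 / (\<epsilon> / 6) * (LINT x|lebesgue. w x) + 3 / \<epsilon> * (LINT x|lebesgue. w x)" using U(2) mS by linarith
    also have "\<dots> = 63 / \<epsilon> * (LINT x|lebesgue. w x)" by simp
    also have "\<dots> \<le> 63 / \<epsilon> * \<delta>" using W \<epsilon> by (intro mult_left_mono) auto
    also have "\<dots> = e" using \<epsilon> by (simp add: \<delta>_def)
    finally have meas: "measure lebesgue (U \<union> S) \<le> e" .
    have "good \<epsilon> t" if t: "t \<notin> U \<union> S" for t
    proof -
      have "isCont h t" using h(1) by (simp add: continuous_on_eq_continuous_at)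
      then obtain d where d: "d > 0" "\<And>s. \<bar>s - t\<bar> < d \<Longrightarrow> \<bar>h s - h t\<bar> < \<epsilon> / 3"
        using \<epsilon> unfolding continuous_at_eps_delta by (metis dist_real_def divide_pos_pos zero_less_numeral)
      have wt: "w t < \<epsilon> / 3" using t by (auto simp: S_def)
      have est: "\<bar>LINT s|lebesgue. indicat_real {a<..b} s * (g s - g t)\<bar> \<le> \<epsilon> * r"
        if r: "0 < r" "r < d" "{a<..b} \<subseteq> {t - r..t + r}" "b - a = r" for a b r
      proof -
        have ig: "integrable lebesgue (\<lambda>s. indicat_real {a<..b} s * (g s - g t))"
          using intI[OF g, of "{a<..b}"] intIc[of a b "g t"] by (simp add: right_diff_distrib)
        have "\<bar>LINT s|lebesgue. indicat_real {a<..b} s * (g s - g t)\<bar> \<le> (LINT s|lebesgue. \<bar>indicat_real {a<..b} s * (g s - g t)\<bar>)"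
          by (rule integral_abs_bound)
        \<comment> \<open>The doubled radius puts the end points into the open ball. The average of
          \<open>w\<close> then costs \<open>\<epsilon> / 6 * (2 * r)\<close>, while
          \<open>w t\<close> and the oscillation of \<open>h\<close> cost
          \<open>\<epsilon> / 3\<close> each per unit of length.\<close>
        also have "\<dots> \<le> (LINT s|lebesgue. indicat_real (ball t (2 * r)) s * w s + indicat_real {a<..b} s * (2 * \<epsilon> / 3))"
        proof (rule integral_mono)
          show "integrable lebesgue (\<lambda>s. indicat_real (ball t (2 * r)) s * w s + indicat_real {a<..b} s * (2 * \<epsilon> / 3))"
            by (intro Bochner_Integration.integrable_add intI w(1) intIc) simp
          show "\<bar>indicat_real {a<..b} s * (g s - g t)\<bar> \<le> indicat_real (ball t (2 * r)) s * w s + indicat_real {a<..b} s * (2 * \<epsilon> / 3)" for s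
          proof (cases "s \<in> {a<..b}")
            case True
            then have s: "\<bar>s - t\<bar> \<le> r" using r(3) by (auto simp: abs_le_iff)
            then have "s \<in> ball t (2 * r)" using r(1) by (auto simp: dist_real_def abs_minus_commute)
            moreover have "\<bar>g s - g t\<bar> \<le> w s + 2 * \<epsilon> / 3"
              using d(2)[of s] s r(2) wt unfolding w_def by linarith
            ultimately show ?thesis using True by simp
          next
            case False
            then have "indicat_real {a<..b} s = 0" by (rule indicator_simps(2))
            then show ?thesis using w(2)[of s] by simp
          qed
        qed (use ig in auto)
        also have "\<dots> = (LINT s|lebesgue. indicat_real (ball t (2 * r)) s * w s) + (b - a) * (2 * \<epsilon> / 3)"
          using intI[OF w(1), of "ball t (2 * r)"] intIc[of a b "2 * \<epsilon> / 3"] r by (subst Bochner_Integration.integral_add) auto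
        also have "\<dots> \<le> \<epsilon> / 6 * (2 * r) + r * (2 * \<epsilon> / 3)"
        proof -
          have "(LINT s|lebesgue. indicat_real (ball t (2 * r)) s * w s) \<le> \<epsilon> / 6 * (2 * r)"
            by (rule U(3)) (use t r in auto)
          then show ?thesis unfolding r(4) by linarith
        qed
        also have "\<dots> = \<epsilon> * r" by simp
        finally show ?thesis .
      qed
      have "\<bar>G y - G t - g t * (y - t)\<bar> \<le> \<epsilon> * \<bar>y - t\<bar>" if y: "\<bar>y - t\<bar> < d" for y
      proof -
        consider "y = t" | "y > t" | "y < t" by linarith
        then show ?thesis
        proof cases
          case 2
          have "{t<..y} \<subseteq> {t - (y - t)..t + (y - t)}" by (intro subsetI) (use 2 in auto)
          from est[OF _ _ this] show ?thesis using 2 y by (simp add: diffG)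
        next
          case 3
          have "G y - G t - g t * (y - t) = - (G t - G y - g t * (t - y))" by (simp add: algebra_simps)
          moreover have "{y<..t} \<subseteq> {t - (t - y)..t + (t - y)}" by (intro subsetI) (use 3 in auto)
          from est[OF _ _ this] have "\<bar>G t - G y - g t * (t - y)\<bar> \<le> \<epsilon> * (t - y)" using 3 y by (simp add: diffG)
          ultimately show ?thesis using 3 by simp
        qed simp
      qed
      then show ?thesis unfolding good_def using d(1) by blast
    qed
    then have "{t. \<not> good \<epsilon> t} \<subseteq> U \<union> S" by blast
    moreover have "U \<union> S \<in> lmeasurable" using U(1) S by (rule fmeasurable.Un)
    ultimately show "\<exists>T. {t. \<not> good \<epsilon> t} \<subseteq> T \<and> T \<in> lmeasurable \<and> measure lebesgue T \<le> e" using meas by blast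
  qed
  have "negligible (\<Union>n. {t. \<not> good (inverse (real (Suc n))) t})" by (intro negligible_countable_Union) (auto intro: neg)
  then have "AE t in lebesgue. t \<notin> (\<Union>n. {t. \<not> good (inverse (real (Suc n))) t})"
    by (intro AE_not_in) (simp add: negligible_iff_null_sets)
  then show ?thesis
  proof eventually_elim
    fix t assume t: "t \<notin> (\<Union>n. {t. \<not> good (inverse (real (Suc n))) t})"
    have "(G has_real_derivative g t) (at t)"
      unfolding DERIV_def LIM_def
    proof (intro allI impI)
      fix r :: real assume "r > 0"
      then obtain n where n: "inverse (real (Suc n)) < r" using reals_Archimedean by blast
      have "good (inverse (real (Suc n))) t" using t by blast
      then obtain d where d: "d > 0" "\<And>y. \<bar>y - t\<bar> < d \<Longrightarrow> \<bar>G y - G t - g t * (y - t)\<bar> \<le> inverse (real (Suc n)) * \<bar>y - t\<bar>"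
        unfolding good_def by blast
      have "dist ((G (t + k) - G t) / k) (g t) < r" if k: "k \<noteq> 0" "\<bar>k\<bar> < d" for k
      proof -
        have "\<bar>(G (t + k) - G t) / k - g t\<bar> = \<bar>G (t + k) - G t - g t * k\<bar> / \<bar>k\<bar>"
          using k(1) by (simp add: field_simps flip: abs_divide)
        also have "\<dots> \<le> inverse (real (Suc n))"
          using d(2)[of "t + k"] k by (simp add: divide_le_eq)
        finally show ?thesis using n by (simp add: dist_real_def)
      qed
      then show "\<exists>s>0. \<forall>x. x \<noteq> 0 \<and> dist x 0 < s \<longrightarrow> dist ((G (t + x) - G t) / x) (g t) < r"
        using d(1) by (intro exI[of _ d]) auto
    qed
    then show "((\<lambda>x. LINT s|lebesgue. indicator {..x} s * g s) has_real_derivative g t) (at t)"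
      by (simp add: G_def[abs_def])
  qed
qed

section \<open>Convolution with Riemann--Liouville kernels\<close>

text \<open>Jensen's inequality for a weight of mass at most \<open>A\<close>, obtained by
  integrating the tangent inequality of the power at a free point \<open>m\<close>.\<close>

lemma weighted_jensen:
  fixes k v :: "'a \<Rightarrow> real"
  assumes p: "p > 1" and k: "integrable M k" "\<And>s. k s \<ge> 0"
    and kv: "integrable M (\<lambda>s. k s * \<bar>v s\<bar>)" "integrable M (\<lambda>s. k s * \<bar>v s\<bar> powr p)"
    and A: "(LINT s|M. k s) \<le> A"
  shows "(LINT s|M. k s * \<bar>v s\<bar>) powr p \<le> A powr (p - 1) * (LINT s|M. k s * \<bar>v s\<bar> powr p)"
proof -
  define X Y a where "X = (LINT s|M. k s * \<bar>v s\<bar>)" and "Y = (LINT s|M. k s * \<bar>v s\<bar> powr p)" and "a = (LINT s|M. k s)"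
  have X0: "X \<ge> 0" unfolding X_def using k(2) by (intro Bochner_Integration.integral_nonneg) auto
  have Y0: "Y \<ge> 0" unfolding Y_def using k(2) by (intro Bochner_Integration.integral_nonneg) auto
  have a0: "a \<ge> 0" unfolding a_def using k(2) by (intro Bochner_Integration.integral_nonneg) auto
  have "X powr p \<le> A powr (p - 1) * Y"
  proof (cases "X = 0")
    case False
    then have X: "X > 0" using X0 by simp
    have tangent: "a * (m powr p / p) + m powr (p - 1) * (X - a * m) \<le> Y / p" if m: "m \<ge> 0" for m
    proof -
      have "(LINT s|M. k s * (m powr p / p) + m powr (p - 1) * (k s * \<bar>v s\<bar> - k s * m)) \<le> (LINT s|M. (k s * \<bar>v s\<bar> powr p) / p)"
      proof (rule integral_mono)
        fix s
        have "m powr p / p + m powr (p - 1) * (\<bar>v s\<bar> - m) \<le> \<bar>v s\<bar> powr p / p"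
          using pw_tangent[OF p, of m "\<bar>v s\<bar>"] pw_eq[OF p, of m] m p by (simp add: max_def split: if_splits)
        then have "k s * (m powr p / p + m powr (p - 1) * (\<bar>v s\<bar> - m)) \<le> k s * (\<bar>v s\<bar> powr p / p)"
          using k(2) by (intro mult_left_mono) auto
        then show "k s * (m powr p / p) + m powr (p - 1) * (k s * \<bar>v s\<bar> - k s * m) \<le> (k s * \<bar>v s\<bar> powr p) / p"
          by (simp add: algebra_simps)
      qed (use k kv in auto)
      also have "(LINT s|M. k s * (m powr p / p) + m powr (p - 1) * (k s * \<bar>v s\<bar> - k s * m)) = a * (m powr p / p) + m powr (p - 1) * (X - a * m)"
        unfolding X_def a_def using k kv by simp
      finally show ?thesis by (simp add: Y_def)
    qed
    \<comment> \<open>If the mass were 0, the tangent inequality would bound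
      \<open>m powr (p - 1) * X\<close> for all \<open>m\<close>, which fails for large
      \<open>m\<close> as \<open>X > 0\<close>.\<close>
    have a: "a > 0"
    proof (rule ccontr)
      assume "\<not> a > 0"
      then have "a = 0" using a0 by simp
      then have t: "m powr (p - 1) * X \<le> Y / p" if "m \<ge> 0" for m using tangent[OF that] by simp
      define m where "m = ((Y / p + 1) / X) powr (1 / (p - 1))"
      have "Y / p + 1 > 0" using Y0 p by (simp add: add_nonneg_pos)
      then have "m powr (p - 1) * X = Y / p + 1" using X p by (simp add: m_def powr_powr)
      then show False using t[of m] by (simp add: m_def)
    qed
    \<comment> \<open>The mean \<open>X / a\<close> is the tangent point at which the linear term
      vanishes.\<close>
    have "a * ((X / a) powr p / p) \<le> Y / p" using tangent[of "X / a"] a X by simp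
    then have "a * (X / a) powr p \<le> Y" using p by (simp add: divide_le_cancel)
    then have "X powr p \<le> a powr (p - 1) * Y"
    proof -
      assume *: "a * (X / a) powr p \<le> Y"
      have "X powr p = a powr p * (X / a) powr p" using a X by (simp add: powr_divide)
      also have "\<dots> = a powr (p - 1) * (a * (X / a) powr p)"
        using powr_mult_base[of a "p - 1"] a by (simp add: mult_ac)
      also have "\<dots> \<le> a powr (p - 1) * Y" using * by (intro mult_left_mono) auto
      finally show ?thesis .
    qed
    also have "\<dots> \<le> A powr (p - 1) * Y"
      using A a Y0 p unfolding a_def[symmetric] by (intro mult_right_mono powr_mono2) auto
    finally show ?thesis .
  qed (use Y0 in simp)
  then show ?thesis by (simp add: X_def Y_def)
qed

definition kernel :: "(real \<Rightarrow> real) \<Rightarrow> real \<Rightarrow> bool" where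
  "kernel \<phi> A \<longleftrightarrow> \<phi> \<in> borel_measurable borel \<and> (\<forall>x. \<phi> x \<ge> 0) \<and> A \<ge> 0 \<and>
     (\<integral>\<^sup>+x. ennreal (\<phi> x) \<partial>lborel) \<le> ennreal A"

lemma kernelD:
  assumes "kernel \<phi> A"
  shows "\<phi> \<in> borel_measurable borel" "\<phi> x \<ge> 0" "A \<ge> 0" "(\<integral>\<^sup>+x. ennreal (\<phi> x) \<partial>lborel) \<le> ennreal A"
  using assms by (auto simp: kernel_def)

section \<open>Convolution operators on a bounded interval\<close>

locale interval =
  fixes T :: real
  assumes T: "T > 0"
begin

abbreviation "M \<equiv> lebesgue_on {0..T}"

lemma finite_M: "finite_measure M"
  by (rule finite_measure_lebesgue_on) simp

lemma space_M: "space M = {0..T}" by simp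

lemma idM [measurable]: "(\<lambda>x. x) \<in> M \<rightarrow>\<^sub>M borel"
  using id_borel_measurable_lebesgue_on[of "{0..T}"] by (simp add: id_def)

lemma pair_M: "pair_sigma_finite M M"
  using finite_M by (simp add: pair_sigma_finite_def finite_measure_def)

lemma measure_M: "measure M {0..T} = T"
  using T by (simp add: measure_restrict_space)

lemma fstM [measurable]: "(\<lambda>z. fst z) \<in> M \<Otimes>\<^sub>M M \<rightarrow>\<^sub>M borel"
  by (rule measurable_compose[OF measurable_fst idM])

lemma sndM [measurable]: "(\<lambda>z. snd z) \<in> M \<Otimes>\<^sub>M M \<rightarrow>\<^sub>M borel"
  by (rule measurable_compose[OF measurable_snd idM])

lemma borel_M: "\<phi> \<in> borel_measurable borel \<Longrightarrow> (\<lambda>s. \<phi> (t - s)) \<in> borel_measurable M"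
  "\<phi> \<in> borel_measurable borel \<Longrightarrow> (\<lambda>s. \<phi> (s - t)) \<in> borel_measurable M"
proof -
  have "(\<lambda>s. t - s) \<in> borel_measurable M" "(\<lambda>s. s - t) \<in> borel_measurable M"
    by (intro borel_measurable_diff borel_measurable_const idM)+
  then show "\<phi> \<in> borel_measurable borel \<Longrightarrow> (\<lambda>s. \<phi> (t - s)) \<in> borel_measurable M"
    "\<phi> \<in> borel_measurable borel \<Longrightarrow> (\<lambda>s. \<phi> (s - t)) \<in> borel_measurable M"
    by (auto intro: measurable_compose)
qed

lemma nn_integral_M_le:
  fixes g :: "real \<Rightarrow> ennreal"
  assumes "g \<in> borel_measurable borel"
  shows "(\<integral>\<^sup>+s. g s \<partial>M) \<le> (\<integral>\<^sup>+s. g s \<partial>lborel)"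
proof -
  have "(\<integral>\<^sup>+s. g s \<partial>M) = (\<integral>\<^sup>+s. g s * indicator {0..T} s \<partial>lebesgue)"
    by (simp add: nn_integral_restrict_space)
  also have "\<dots> \<le> (\<integral>\<^sup>+s. g s \<partial>lebesgue)"
    by (intro nn_integral_mono) (auto simp: indicator_def)
  also have "\<dots> = (\<integral>\<^sup>+s. g s \<partial>lborel)" using assms by (simp add: nn_integral_completion)
  finally show ?thesis .
qed

lemma kernel_int1: "kernel \<phi> A \<Longrightarrow> (\<integral>\<^sup>+s. ennreal (\<phi> (t - s)) \<partial>M) \<le> ennreal A"
proof -
  assume k: "kernel \<phi> A"
  note [measurable] = kernelD(1)[OF k]
  have "(\<integral>\<^sup>+s. ennreal (\<phi> (t - s)) \<partial>M) \<le> (\<integral>\<^sup>+s. ennreal (\<phi> (t - s)) \<partial>lborel)"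
    by (rule nn_integral_M_le) measurable
  also have "\<dots> = (\<integral>\<^sup>+s. ennreal (\<phi> s) \<partial>lborel)"
    using nn_integral_real_affine[of "\<lambda>s. ennreal (\<phi> s)" "-1" t] by simp
  finally show ?thesis using kernelD(4)[OF k] by simp
qed

lemma kernel_int2: "kernel \<phi> A \<Longrightarrow> (\<integral>\<^sup>+s. ennreal (\<phi> (s - t)) \<partial>M) \<le> ennreal A"
proof -
  assume k: "kernel \<phi> A"
  note [measurable] = kernelD(1)[OF k]
  have "(\<integral>\<^sup>+s. ennreal (\<phi> (s - t)) \<partial>M) \<le> (\<integral>\<^sup>+s. ennreal (\<phi> (s - t)) \<partial>lborel)"
    by (rule nn_integral_M_le) measurable
  also have "\<dots> = (\<integral>\<^sup>+s. ennreal (\<phi> s) \<partial>lborel)"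
    using nn_integral_real_affine[of "\<lambda>s. ennreal (\<phi> s)" "1" "- t"] by simp
  finally show ?thesis using kernelD(4)[OF k] by simp
qed

lemma kernel_integrable: "kernel \<phi> A \<Longrightarrow> integrable M (\<lambda>s. \<phi> (t - s))"
  "kernel \<phi> A \<Longrightarrow> (LINT s|M. \<phi> (t - s)) \<le> A"
proof -
  assume k: "kernel \<phi> A"
  show i: "integrable M (\<lambda>s. \<phi> (t - s))"
    using kernel_int1[OF k, of t] kernelD(2)[OF k]
    by (intro integrableI_nonneg borel_M kernelD(1)[OF k]) (auto intro: le_less_trans)
  have "ennreal (LINT s|M. \<phi> (t - s)) \<le> ennreal A"
    using kernel_int1[OF k, of t] kernelD(2)[OF k] i by (subst nn_integral_eq_integral[symmetric]) auto
  then show "(LINT s|M. \<phi> (t - s)) \<le> A" using kernelD(3)[OF k] by simp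
qed

text \<open>The domain of integration is always \<open>[0,T]\<close>; that only the past
  \<open>s < t\<close> contributes will come from kernels that vanish at nonpositive
  arguments.\<close>

definition conv :: "(real \<Rightarrow> real) \<Rightarrow> (real \<Rightarrow> real) \<Rightarrow> real \<Rightarrow> real" where
  "conv \<phi> v t = (LINT s|M. \<phi> (t - s) * v s)"

lemma pair_measurable:
  fixes \<phi> v :: "real \<Rightarrow> real"
  assumes "\<phi> \<in> borel_measurable borel" "v \<in> borel_measurable M"
  shows "(\<lambda>z. \<phi> (fst z - snd z) * v (snd z)) \<in> borel_measurable (M \<Otimes>\<^sub>M M)"
proof -
  have "(\<lambda>z. fst z - snd z) \<in> borel_measurable (M \<Otimes>\<^sub>M M)" by (intro borel_measurable_diff fstM sndM)
  then have "(\<lambda>z. \<phi> (fst z - snd z)) \<in> borel_measurable (M \<Otimes>\<^sub>M M)" by (rule measurable_compose[OF _ assms(1)])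
  moreover have "(\<lambda>z. v (snd z)) \<in> borel_measurable (M \<Otimes>\<^sub>M M)" by (rule measurable_compose[OF measurable_snd assms(2)])
  ultimately show ?thesis by (rule borel_measurable_times)
qed

lemma conv_measurable:
  assumes "\<phi> \<in> borel_measurable borel" "v \<in> borel_measurable M"
  shows "conv \<phi> v \<in> borel_measurable M"
proof -
  interpret finite_measure M by (rule finite_M)
  show ?thesis unfolding conv_def[abs_def]
    by (rule borel_measurable_lebesgue_integral)
       (use pair_measurable[OF assms] in \<open>simp add: case_prod_unfold\<close>)
qed

lemma conv_cong_AE:
  assumes "AE s in M. v s = w s" "v \<in> borel_measurable M" "w \<in> borel_measurable M" "\<phi> \<in> borel_measurable borel"
  shows "conv \<phi> v t = conv \<phi> w t"
  unfolding conv_def using assms borel_M(1)[OF assms(4), of t] by (intro integral_cong_AE) auto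

lemma Lp_integrable:
  assumes p: "p > 1" and v: "v \<in> Lp p M"
  shows "integrable M v"
proof -
  interpret finite_measure M by (rule finite_M)
  have "\<bar>x\<bar> \<le> 1 + \<bar>x\<bar> powr p" for x :: real
    using powr_diff_one_mult_le[OF p, of 1 x] by simp
  then show ?thesis by (intro Lp_bounded_by(1)[of v M "\<lambda>t. 1 + \<bar>v t\<bar> powr p"]) (use v in \<open>auto simp: Lp_def\<close>)
qed

text \<open>Young's inequality for convolutions. Jensen's inequality with the weight
  \<open>\<phi> (t - s)\<close> gives the factor \<open>A powr (p - 1)\<close> for almost every
  \<open>t\<close>, and Tonelli's theorem gives the last factor \<open>A\<close>.\<close>

lemma schur:
  assumes p: "p > 1" and k: "kernel \<phi> A" and v: "v \<in> Lp p M"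
  shows "AE t in M. integrable M (\<lambda>s. \<phi> (t - s) * v s)"
    and "conv \<phi> v \<in> Lp p M"
    and "Np p M (conv \<phi> v) \<le> A powr p * Np p M v"
proof -
  interpret finite_measure M by (rule finite_M)
  interpret P: pair_sigma_finite M M by (rule pair_M)
  note [measurable] = kernelD(1)[OF k]
  have vm [measurable]: "v \<in> borel_measurable M" and vi: "integrable M (\<lambda>t. \<bar>v t\<bar> powr p)" using v by (auto simp: Lp_def)
  have k0: "\<phi> x \<ge> 0" for x by (rule kernelD(2)[OF k])
  define h where "h s = \<bar>v s\<bar> powr p" for s
  have hm [measurable]: "h \<in> borel_measurable M" unfolding h_def by measurable
  have hp: "(\<lambda>z. \<phi> (fst z - snd z) * h (snd z)) \<in> borel_measurable (M \<Otimes>\<^sub>M M)" by (rule pair_measurable) measurable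
  have "(\<integral>\<^sup>+t. (\<integral>\<^sup>+s. ennreal (\<phi> (t - s) * h s) \<partial>M) \<partial>M) = (\<integral>\<^sup>+s. (\<integral>\<^sup>+t. ennreal (\<phi> (t - s) * h s) \<partial>M) \<partial>M)"
    by (rule P.Fubini'[symmetric]) (use hp in \<open>simp add: case_prod_unfold\<close>)
  also have "\<dots> \<le> (\<integral>\<^sup>+s. ennreal A * ennreal (h s) \<partial>M)"
  proof (rule nn_integral_mono)
    fix s
    have "(\<integral>\<^sup>+t. ennreal (\<phi> (t - s) * h s) \<partial>M) = (\<integral>\<^sup>+t. ennreal (\<phi> (t - s)) * ennreal (h s) \<partial>M)"
      using k0 by (intro nn_integral_cong) (simp add: ennreal_mult h_def)
    also have "\<dots> = (\<integral>\<^sup>+t. ennreal (\<phi> (t - s)) \<partial>M) * ennreal (h s)"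
      by (rule nn_integral_multc) (use borel_M(2)[OF kernelD(1)[OF k], of s] in measurable)
    also have "\<dots> \<le> ennreal A * ennreal (h s)" by (intro mult_right_mono kernel_int2[OF k]) auto
    finally show "(\<integral>\<^sup>+t. ennreal (\<phi> (t - s) * h s) \<partial>M) \<le> ennreal A * ennreal (h s)" .
  qed
  also have "\<dots> = ennreal A * ennreal (Np p M v)"
    using vi by (simp add: nn_integral_cmult nn_integral_eq_integral Np_def h_def)
  also have "\<dots> = ennreal (A * Np p M v)" using kernelD(3)[OF k] by (simp add: ennreal_mult Np_nonneg)
  finally have le: "(\<integral>\<^sup>+t. (\<integral>\<^sup>+s. ennreal (\<phi> (t - s) * h s) \<partial>M) \<partial>M) \<le> ennreal (A * Np p M v)" .
  have innm: "(\<lambda>t. \<integral>\<^sup>+s. ennreal (\<phi> (t - s) * h s) \<partial>M) \<in> borel_measurable M"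
    by (rule borel_measurable_nn_integral) (use hp in \<open>simp add: case_prod_unfold\<close>)
  have "AE t in M. (\<integral>\<^sup>+s. ennreal (\<phi> (t - s) * h s) \<partial>M) \<noteq> \<infinity>"
    by (rule nn_integral_PInf_AE[OF innm]) (use le in \<open>auto simp: top_unique\<close>)
  then have AEi: "AE t in M. integrable M (\<lambda>s. \<phi> (t - s) * h s)"
  proof eventually_elim
    fix t assume "(\<integral>\<^sup>+s. ennreal (\<phi> (t - s) * h s) \<partial>M) \<noteq> \<infinity>"
    then show "integrable M (\<lambda>s. \<phi> (t - s) * h s)"
      using k0 borel_M(1)[OF kernelD(1)[OF k], of t] by (intro integrableI_nonneg) (auto simp: h_def top.not_eq_extremum)
  qed
  have bd: "\<phi> x * \<bar>y\<bar> \<le> \<phi> x + \<phi> x * \<bar>y\<bar> powr p" for x y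
  proof -
    have "\<bar>y\<bar> \<le> 1 + \<bar>y\<bar> powr p" using powr_diff_one_mult_le[OF p, of 1 y] by simp
    then have "\<phi> x * \<bar>y\<bar> \<le> \<phi> x * (1 + \<bar>y\<bar> powr p)" by (intro mult_left_mono k0)
    then show ?thesis by (simp add: distrib_left)
  qed
  have int: "integrable M (\<lambda>s. \<phi> (t - s) * \<bar>v s\<bar>)" "integrable M (\<lambda>s. \<phi> (t - s) * v s)"
    if i: "integrable M (\<lambda>s. \<phi> (t - s) * h s)" for t
  proof -
    have m: "(\<lambda>s. \<phi> (t - s)) \<in> borel_measurable M" by (rule borel_M(1)[OF kernelD(1)[OF k]])
    have g: "integrable M (\<lambda>s. \<phi> (t - s) + \<phi> (t - s) * h s)" using i kernel_integrable(1)[OF k] by simp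
    show "integrable M (\<lambda>s. \<phi> (t - s) * \<bar>v s\<bar>)" "integrable M (\<lambda>s. \<phi> (t - s) * v s)"
      using m bd k0 by (auto intro!: Lp_bounded_by(1)[OF _ g] simp: h_def abs_mult)
  qed
  show "AE t in M. integrable M (\<lambda>s. \<phi> (t - s) * v s)" using AEi by eventually_elim (rule int(2))
  have cm: "conv \<phi> v \<in> borel_measurable M" by (rule conv_measurable) measurable
  have "AE t in M. ennreal (\<bar>conv \<phi> v t\<bar> powr p) \<le> ennreal (A powr (p - 1)) * (\<integral>\<^sup>+s. ennreal (\<phi> (t - s) * h s) \<partial>M)"
    using AEi
  proof eventually_elim
    fix t assume i: "integrable M (\<lambda>s. \<phi> (t - s) * h s)"
    have "\<bar>conv \<phi> v t\<bar> \<le> (LINT s|M. \<phi> (t - s) * \<bar>v s\<bar>)"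
      unfolding conv_def using integral_abs_bound[of M "\<lambda>s. \<phi> (t - s) * v s"] k0 by (simp add: abs_mult)
    then have "\<bar>conv \<phi> v t\<bar> powr p \<le> (LINT s|M. \<phi> (t - s) * \<bar>v s\<bar>) powr p" using p by (intro powr_mono2) auto
    also have "\<dots> \<le> A powr (p - 1) * (LINT s|M. \<phi> (t - s) * \<bar>v s\<bar> powr p)"
      using i int(1)[OF i] by (intro weighted_jensen p kernel_integrable[OF k] k0) (auto simp: h_def)
    finally have "ennreal (\<bar>conv \<phi> v t\<bar> powr p) \<le> ennreal (A powr (p - 1) * (LINT s|M. \<phi> (t - s) * h s))"
      by (intro ennreal_leI) (simp add: h_def)
    also have "\<dots> = ennreal (A powr (p - 1)) * (\<integral>\<^sup>+s. ennreal (\<phi> (t - s) * h s) \<partial>M)"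
      using i k0 by (subst nn_integral_eq_integral) (auto simp: ennreal_mult' h_def)
    finally show "ennreal (\<bar>conv \<phi> v t\<bar> powr p) \<le> ennreal (A powr (p - 1)) * (\<integral>\<^sup>+s. ennreal (\<phi> (t - s) * h s) \<partial>M)" .
  qed
  then have "(\<integral>\<^sup>+t. ennreal (\<bar>conv \<phi> v t\<bar> powr p) \<partial>M) \<le> (\<integral>\<^sup>+t. ennreal (A powr (p - 1)) * (\<integral>\<^sup>+s. ennreal (\<phi> (t - s) * h s) \<partial>M) \<partial>M)"
    by (rule nn_integral_mono_AE)
  also have "\<dots> = ennreal (A powr (p - 1)) * (\<integral>\<^sup>+t. (\<integral>\<^sup>+s. ennreal (\<phi> (t - s) * h s) \<partial>M) \<partial>M)"
    by (rule nn_integral_cmult[OF innm])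
  also have "\<dots> \<le> ennreal (A powr (p - 1)) * ennreal (A * Np p M v)" by (intro mult_left_mono le) auto
  also have "\<dots> = ennreal (A powr p * Np p M v)"
  proof -
    have "A powr (p - 1) * A = A powr p" using powr_mult_base[of A "p - 1"] kernelD(3)[OF k] by (simp add: mult.commute)
    then show ?thesis by (simp add: ennreal_mult'[symmetric] flip: mult.assoc)
  qed
  finally have fin: "(\<integral>\<^sup>+t. ennreal (\<bar>conv \<phi> v t\<bar> powr p) \<partial>M) \<le> ennreal (A powr p * Np p M v)" .
  have ci: "integrable M (\<lambda>t. \<bar>conv \<phi> v t\<bar> powr p)"
    using cm fin by (intro integrableI_nonneg) (auto intro: le_less_trans)
  then show "conv \<phi> v \<in> Lp p M" using cm by (simp add: Lp_def)
  have "ennreal (Np p M (conv \<phi> v)) \<le> ennreal (A powr p * Np p M v)"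
    unfolding Np_def using fin ci by (subst nn_integral_eq_integral[symmetric]) (auto simp: Np_def)
  then show "Np p M (conv \<phi> v) \<le> A powr p * Np p M v" by (simp add: Np_nonneg)
qed

lemma conv_lin:
  assumes "integrable M (\<lambda>s. \<phi> (t - s) * v s)" "integrable M (\<lambda>s. \<phi> (t - s) * w s)"
  shows "conv \<phi> (\<lambda>s. c * v s + d * w s) t = c * conv \<phi> v t + d * conv \<phi> w t"
proof -
  have "conv \<phi> (\<lambda>s. c * v s + d * w s) t = (LINT s|M. c * (\<phi> (t - s) * v s) + d * (\<phi> (t - s) * w s))"
    unfolding conv_def by (intro Bochner_Integration.integral_cong) (auto simp: algebra_simps)
  then show ?thesis using assms by (simp add: conv_def)
qed

text \<open>The Riemann--Liouville kernel is cut off at \<open>T\<close>, which does not matter on \<open>[0,T]\<close> but makes it integrable.\<close>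

definition rl :: "real \<Rightarrow> real \<Rightarrow> real" where
  "rl \<beta> x = (if 0 < x \<and> x \<le> T then x powr (\<beta> - 1) / Gamma \<beta> else 0)"

lemma rl_measurable [measurable]: "rl \<beta> \<in> borel_measurable borel"
  unfolding rl_def by measurable

lemma rl_nonneg: "\<beta> > 0 \<Longrightarrow> rl \<beta> x \<ge> 0"
  using Gamma_real_pos[of \<beta>] by (auto simp: rl_def)

lemma nn_integral_powr_initial:
  assumes "\<beta> > 0" "c \<ge> 0"
  shows "(\<integral>\<^sup>+x. ennreal (indicator {0<..c} x * x powr (\<beta> - 1)) \<partial>lborel) = ennreal (c powr \<beta> / \<beta>)"
proof (rule nn_integral_has_integral_lborel)
  have "((\<lambda>x. x powr (\<beta> - 1)) has_integral (c powr (\<beta> - 1 + 1) / (\<beta> - 1 + 1))) {0..c}"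
    using assms by (intro has_integral_powr_from_0) auto
  then have "((\<lambda>x. if x \<in> {0..c} then x powr (\<beta> - 1) else 0) has_integral (c powr \<beta> / \<beta>)) UNIV"
    by (subst has_integral_restrict_UNIV) simp
  moreover have "(if x \<in> {0..c} then x powr (\<beta> - 1) else 0) = indicat_real {0<..c} x * x powr (\<beta> - 1)" for x
    by (cases "x = 0") (auto simp: indicator_def)
  ultimately show "((\<lambda>x. indicat_real {0<..c} x * x powr (\<beta> - 1)) has_integral (c powr \<beta> / \<beta>)) UNIV" by simp
qed auto

lemma kernel_rl: "\<beta> > 0 \<Longrightarrow> kernel (rl \<beta>) (T powr \<beta> / \<beta> / Gamma \<beta>)"
proof -
  assume b: "\<beta> > 0"
  have G: "Gamma \<beta> > 0" using b by (rule Gamma_real_pos)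
  have "(\<integral>\<^sup>+x. ennreal (rl \<beta> x) \<partial>lborel) = (\<integral>\<^sup>+x. ennreal (indicator {0<..T} x * x powr (\<beta> - 1)) * ennreal (1 / Gamma \<beta>) \<partial>lborel)"
    using G by (intro nn_integral_cong) (auto simp: rl_def indicator_def simp flip: ennreal_mult')
  also have "\<dots> = ennreal (T powr \<beta> / \<beta>) * ennreal (1 / Gamma \<beta>)"
    using nn_integral_powr_initial[OF b, of T] T by (subst nn_integral_multc) auto
  also have "\<dots> = ennreal (T powr \<beta> / \<beta> / Gamma \<beta>)" using G b by (simp flip: ennreal_mult')
  finally show ?thesis using b G rl_nonneg[OF b] by (simp add: kernel_def)
qed

text \<open>The substitution \<open>s = r + (t - r) * x\<close> produces the Beta integral
  \<open>Beta b a = Gamma a * Gamma b\<close>, since \<open>Gamma 1 = 1\<close>, and for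
  \<open>a + b = 1\<close> all powers of \<open>t - r\<close> cancel. What remains is the kernel of
  the ordinary integral.\<close>

lemma beta_kernel:
  assumes ab: "a > 0" "b > 0" "a + b = 1" and t: "0 \<le> t" "t \<le> T" and r: "0 \<le> r"
  shows "(\<integral>\<^sup>+s. ennreal (rl a (t - s) * rl b (s - r)) \<partial>M) = (if r < t then 1 else 0)"
proof (cases "r < t")
  case False
  have z: "rl a (t - s) * rl b (s - r) = 0" for s using False by (auto simp: rl_def)
  show ?thesis unfolding z using False by simp
next
  case True
  define f where "f s = rl a (t - s) * rl b (s - r)" for s
  have fm [measurable]: "f \<in> borel_measurable borel" unfolding f_def by measurable
  have supp: "f s = 0" if "s \<notin> {0..T}" for s using that t r by (auto simp: f_def rl_def)
  have "(\<integral>\<^sup>+s. ennreal (f s) \<partial>M) = (\<integral>\<^sup>+s. ennreal (f s) * indicator {0..T} s \<partial>lebesgue)"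
    by (simp add: nn_integral_restrict_space)
  also have "\<dots> = (\<integral>\<^sup>+s. ennreal (f s) \<partial>lebesgue)"
    by (intro nn_integral_cong) (auto simp: indicator_def supp)
  also have "\<dots> = (\<integral>\<^sup>+s. ennreal (f s) \<partial>lborel)" by (simp add: nn_integral_completion)
  also have "\<dots> = ennreal (t - r) * (\<integral>\<^sup>+x. ennreal (f (r + (t - r) * x)) \<partial>lborel)"
    using nn_integral_real_affine[of "\<lambda>s. ennreal (f s)" "t - r" r] True by simp
  also have "(\<integral>\<^sup>+x. ennreal (f (r + (t - r) * x)) \<partial>lborel) = ennreal (1 / (t - r))"
  proof (rule nn_integral_has_integral_lborel)
    define c where "c = t - r"
    have c: "c > 0" using True by (simp add: c_def)
    have G: "Gamma a > 0" "Gamma b > 0" using ab by (auto intro: Gamma_real_pos)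
    have "Beta b a = Gamma a * Gamma b" using ab by (simp add: Beta_def add.commute)
    then have "((\<lambda>x. x powr (b - 1) * (1 - x) powr (a - 1)) has_integral (Gamma a * Gamma b)) {0..1}"
      using has_integral_Beta_real[OF ab(2,1)] by simp
    then have "((\<lambda>x. (x powr (b - 1) * (1 - x) powr (a - 1)) * (1 / (c * Gamma a * Gamma b))) has_integral
        ((Gamma a * Gamma b) * (1 / (c * Gamma a * Gamma b)))) {0..1}" by (rule has_integral_mult_left)
    then have "((\<lambda>x. if x \<in> {0..1} then (x powr (b - 1) * (1 - x) powr (a - 1)) * (1 / (c * Gamma a * Gamma b)) else 0)
        has_integral (1 / c)) UNIV" using G by (subst has_integral_restrict_UNIV) simp
    moreover have "(if x \<in> {0..1} then (x powr (b - 1) * (1 - x) powr (a - 1)) * (1 / (c * Gamma a * Gamma b)) else 0)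
        = f (r + (t - r) * x)" for x
    proof -
      have e: "t - (r + (t - r) * x) = c * (1 - x)" "r + (t - r) * x - r = c * x" by (auto simp: c_def algebra_simps)
      consider "x \<le> 0" | "x \<ge> 1" | "0 < x" "x < 1" by linarith
      then show ?thesis
      proof cases
        case 1
        then have "c * x \<le> 0" using c by (simp add: mult_le_0_iff)
        then show ?thesis unfolding f_def e using 1 by (auto simp: rl_def)
      next
        case 2
        then have "c * (1 - x) \<le> 0" using c by (simp add: mult_le_0_iff)
        then show ?thesis unfolding f_def e using 2 by (auto simp: rl_def)
      next
        case 3
        have cT: "c \<le> T" using t r by (simp add: c_def)
        have "c * x \<le> c * 1" "c * (1 - x) \<le> c * 1" using 3 c by (intro mult_left_mono; simp)+
        then have "c * x \<le> T" "c * (1 - x) \<le> T" using cT by linarith+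
        then have "f (r + (t - r) * x) = (c * (1 - x)) powr (a - 1) / Gamma a * ((c * x) powr (b - 1) / Gamma b)"
          unfolding f_def e using 3 c by (simp add: rl_def)
        also have "\<dots> = (c powr (a - 1) * c powr (b - 1)) * (x powr (b - 1) * (1 - x) powr (a - 1)) * (1 / (Gamma a * Gamma b))"
          using 3 c by (simp add: powr_mult)
        also have "c powr (a - 1) * c powr (b - 1) = c powr (- 1)"
        proof -
          have "a - 1 + (b - 1) = - 1" using ab(3) by simp
          then show ?thesis by (metis powr_add)
        qed
        also have "\<dots> = 1 / c" using c by (simp add: powr_minus_divide)
        finally show ?thesis using 3 by simp
      qed
    qed
    ultimately show "((\<lambda>x. f (r + (t - r) * x)) has_integral (1 / (t - r))) UNIV" by (simp add: c_def)
    show "0 \<le> f x" for x unfolding f_def using ab by (intro mult_nonneg_nonneg rl_nonneg)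
  qed measurable
  also have "ennreal (t - r) * ennreal (1 / (t - r)) = 1"
    using True by (simp flip: ennreal_mult')
  finally show ?thesis using True by (simp add: f_def)
qed

text \<open>Fubini's theorem and \<open>beta_kernel\<close>: fractional integrals of complementary
  orders compose to the ordinary integral. As the composed kernel is bounded by 1, everything
  converges at every \<open>t\<close>, as \<open>left_RL_differentiable\<close> demands, and not
  only at almost every one.\<close>

lemma semigroup:
  assumes ab: "a > 0" "b > 0" "a + b = 1" and v: "integrable M v" and t: "0 \<le> t" "t \<le> T"
  shows "integrable M (\<lambda>s. rl a (t - s) * conv (rl b) v s)"
    and "conv (rl a) (conv (rl b) v) t = (LINT r|M. indicator {..t} r * v r)"
proof -
  interpret P: pair_sigma_finite M M by (rule pair_M)
  have vm [measurable]: "v \<in> borel_measurable M" using v by simp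
  have v2 [measurable]: "(\<lambda>z. v (snd z)) \<in> borel_measurable (M \<Otimes>\<^sub>M M)"
    by (rule measurable_compose[OF measurable_snd vm])
  define h where "h s r = rl a (t - s) * (rl b (s - r) * v r)" for s r
  have hm [measurable]: "(\<lambda>z. h (fst z) (snd z)) \<in> borel_measurable (M \<Otimes>\<^sub>M M)" unfolding h_def by measurable
  have beta: "(\<integral>\<^sup>+s. ennreal (rl a (t - s) * rl b (s - r)) \<partial>M) = (if r < t then 1 else 0)" if "r \<in> space M" for r
    using that by (intro beta_kernel ab t) auto
  have m1: "(\<lambda>s. rl a (t - s) * rl b (s - r)) \<in> borel_measurable M" for r by measurable
  have "(\<integral>\<^sup>+z. ennreal (norm (h (fst z) (snd z))) \<partial>(M \<Otimes>\<^sub>M M)) = (\<integral>\<^sup>+r. (\<integral>\<^sup>+s. ennreal (norm (h s r)) \<partial>M) \<partial>M)"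
    by (subst P.nn_integral_snd[symmetric]) auto
  also have "\<dots> \<le> (\<integral>\<^sup>+r. ennreal \<bar>v r\<bar> \<partial>M)"
  proof (rule nn_integral_mono)
    fix r assume r: "r \<in> space M"
    have "(\<integral>\<^sup>+s. ennreal (norm (h s r)) \<partial>M) = (\<integral>\<^sup>+s. ennreal (rl a (t - s) * rl b (s - r)) * ennreal \<bar>v r\<bar> \<partial>M)"
      using rl_nonneg[OF ab(1)] rl_nonneg[OF ab(2)]
      by (intro nn_integral_cong) (simp add: h_def abs_mult mult.assoc flip: ennreal_mult')
    also have "\<dots> = (\<integral>\<^sup>+s. ennreal (rl a (t - s) * rl b (s - r)) \<partial>M) * ennreal \<bar>v r\<bar>"
      using m1 by (intro nn_integral_multc) auto
    also have "\<dots> \<le> ennreal \<bar>v r\<bar>" unfolding beta[OF r] by simp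
    finally show "(\<integral>\<^sup>+s. ennreal (norm (h s r)) \<partial>M) \<le> ennreal \<bar>v r\<bar>" .
  qed
  also have "\<dots> < \<infinity>" using v by (simp add: integrable_iff_bounded)
  finally have hi: "integrable (M \<Otimes>\<^sub>M M) (case_prod h)"
    using hm by (intro integrableI_bounded) (simp_all add: case_prod_unfold)
  have conv_h: "rl a (t - s) * conv (rl b) v s = (LINT r|M. h s r)" for s
    unfolding conv_def h_def by simp
  show "integrable M (\<lambda>s. rl a (t - s) * conv (rl b) v s)"
    unfolding conv_h by (rule P.integrable_fst[OF hi])
  have "conv (rl a) (conv (rl b) v) t = (LINT s|M. (LINT r|M. h s r))"
    unfolding conv_def[of "rl a"] conv_h ..
  also have "\<dots> = (LINT r|M. (LINT s|M. h s r))" by (rule P.Fubini_integral[OF hi, symmetric])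
  also have "\<dots> = (LINT r|M. indicator {..<t} r * v r)"
  proof (rule Bochner_Integration.integral_cong)
    fix r assume r: "r \<in> space M"
    have nn: "rl a (t - s) * rl b (s - r) \<ge> 0" for s by (intro mult_nonneg_nonneg rl_nonneg ab)
    have "integrable M (\<lambda>s. rl a (t - s) * rl b (s - r))"
      using beta[OF r] nn m1 by (intro integrableI_nonneg) auto
    then have "ennreal (LINT s|M. rl a (t - s) * rl b (s - r)) = (if r < t then 1 else 0)"
      using beta[OF r] nn by (subst nn_integral_eq_integral[symmetric]) auto
    then have "(LINT s|M. rl a (t - s) * rl b (s - r)) = indicator {..<t} r"
      using nn by (auto simp: indicator_def ennreal_eq_1 ennreal_eq_0_iff intro: antisym Bochner_Integration.integral_nonneg split: if_splits)
    then show "(LINT s|M. h s r) = indicator {..<t} r * v r"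
      unfolding h_def by (simp flip: mult.assoc)
  qed simp
  \<comment> \<open>The Beta integral gives the half-open range; the end point is a null
    set.\<close>
  also have "\<dots> = (LINT r|M. indicator {..t} r * v r)"
  proof (rule integral_cong_AE)
    have "AE r in lebesgue. r \<noteq> t" by (rule AE_not_in[of "{t}", simplified]) (simp add: negligible_iff_null_sets[symmetric])
    then have "AE r in M. r \<noteq> t" by (auto simp: AE_restrict_space_iff elim: eventually_mono)
    then show "AE r in M. indicat_real {..<t} r * v r = indicat_real {..t} r * v r"
      by eventually_elim (auto simp: indicator_def)
  qed auto
  finally show "conv (rl a) (conv (rl b) v) t = (LINT r|M. indicator {..t} r * v r)" .
qed

end

section \<open>The truncated kernel and compactness of the fractional integral\<close>

locale frac_interval = interval +
  fixes \<alpha> p :: real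
  assumes \<alpha>: "0 < \<alpha>" "\<alpha> < 1" and p: "1 < p"
begin

text \<open>\<open>rl \<alpha>\<close> with its singularity flattened below \<open>d\<close>: a
  bounded kernel, uniformly continuous on \<open>(0,T]\<close> but still with a jump at 0.\<close>

definition psi :: "real \<Rightarrow> real \<Rightarrow> real" where
  "psi d x = (if 0 < x \<and> x \<le> T then max x d powr (\<alpha> - 1) / Gamma \<alpha> else 0)"

lemma Gamma_pos: "Gamma \<alpha> > 0"
  using \<alpha> by (intro Gamma_real_pos)

lemma psi_measurable [measurable]: "psi d \<in> borel_measurable borel"
  unfolding psi_def by measurable

lemma psi_nonneg: "psi d x \<ge> 0"
  using Gamma_pos by (simp add: psi_def)

lemma psi_le_rl: "psi d x \<le> rl \<alpha> x"
  using Gamma_pos \<alpha> by (auto simp: psi_def rl_def intro!: divide_right_mono powr_mono2')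

lemma psi_le: "d > 0 \<Longrightarrow> psi d x \<le> d powr (\<alpha> - 1) / Gamma \<alpha>"
  using Gamma_pos \<alpha> by (auto simp: psi_def intro!: divide_right_mono powr_mono2')

lemma kernel_psi: "kernel (psi d) (T powr \<alpha> / \<alpha> / Gamma \<alpha>)"
proof -
  have "(\<integral>\<^sup>+x. ennreal (psi d x) \<partial>lborel) \<le> (\<integral>\<^sup>+x. ennreal (rl \<alpha> x) \<partial>lborel)"
    by (intro nn_integral_mono ennreal_leI psi_le_rl)
  then show ?thesis using kernelD(3,4)[OF kernel_rl[OF \<alpha>(1)]] psi_nonneg
    unfolding kernel_def by (auto intro: order_trans)
qed

lemma kernel_singular_part:
  assumes d: "d > 0"
  shows "kernel (\<lambda>x. rl \<alpha> x - psi d x) (d powr \<alpha> / \<alpha> / Gamma \<alpha>)"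
proof -
  have "(\<integral>\<^sup>+x. ennreal (rl \<alpha> x - psi d x) \<partial>lborel)
      \<le> (\<integral>\<^sup>+x. ennreal (indicator {0<..d} x * x powr (\<alpha> - 1)) * ennreal (1 / Gamma \<alpha>) \<partial>lborel)"
  proof (intro nn_integral_mono)
    fix x
    have "rl \<alpha> x - psi d x \<le> indicat_real {0<..d} x * x powr (\<alpha> - 1) * (1 / Gamma \<alpha>)"
    proof (cases "0 < x \<and> x \<le> d")
      case True
      moreover have "x powr (\<alpha> - 1) / Gamma \<alpha> \<ge> 0" using Gamma_pos by simp
      ultimately show ?thesis using psi_nonneg[of d x] by (cases "x \<le> T") (simp_all add: rl_def)
    next
      case False
      then have "rl \<alpha> x - psi d x = 0" by (auto simp: rl_def psi_def max_def)
      then show ?thesis using False by simp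
    qed
    then have "ennreal (rl \<alpha> x - psi d x) \<le> ennreal (indicat_real {0<..d} x * x powr (\<alpha> - 1) * (1 / Gamma \<alpha>))"
      by (rule ennreal_leI)
    also have "\<dots> = ennreal (indicat_real {0<..d} x * x powr (\<alpha> - 1)) * ennreal (1 / Gamma \<alpha>)"
      using Gamma_pos by (intro ennreal_mult) auto
    finally show "ennreal (rl \<alpha> x - psi d x) \<le> ennreal (indicat_real {0<..d} x * x powr (\<alpha> - 1)) * ennreal (1 / Gamma \<alpha>)" .
  qed
  also have "\<dots> = ennreal (d powr \<alpha> / \<alpha>) * ennreal (1 / Gamma \<alpha>)"
    using nn_integral_powr_initial[OF \<alpha>(1), of d] d by (subst nn_integral_multc) auto
  also have "\<dots> = ennreal (d powr \<alpha> / \<alpha> / Gamma \<alpha>)" using Gamma_pos \<alpha> by (simp flip: ennreal_mult')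
  finally show ?thesis using psi_le_rl \<alpha> Gamma_pos by (auto simp: kernel_def)
qed

lemma psi_uniform:
  assumes d: "d > 0" and e: "e > 0"
  obtains \<eta> where "\<eta> > 0" "\<And>x y. 0 < x \<Longrightarrow> x \<le> T \<Longrightarrow> 0 < y \<Longrightarrow> y \<le> T \<Longrightarrow> \<bar>x - y\<bar> < \<eta> \<Longrightarrow> \<bar>psi d x - psi d y\<bar> \<le> e"
proof -
  define g where "g x = max x d powr (\<alpha> - 1) / Gamma \<alpha>" for x
  have "max x d \<noteq> 0" for x using d by (simp add: max_def)
  then have "continuous_on {0..T} g" unfolding g_def using Gamma_pos by (intro continuous_intros) auto
  then have "uniformly_continuous_on {0..T} g" by (intro compact_uniformly_continuous) auto
  then obtain \<eta> where \<eta>: "\<eta> > 0" "\<And>x y. x \<in> {0..T} \<Longrightarrow> y \<in> {0..T} \<Longrightarrow> dist y x < \<eta> \<Longrightarrow> dist (g y) (g x) < e"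
    using e unfolding uniformly_continuous_on_def by blast
  have "\<bar>psi d x - psi d y\<bar> \<le> e" if "0 < x" "x \<le> T" "0 < y" "y \<le> T" "\<bar>x - y\<bar> < \<eta>" for x y
    using \<eta>(2)[of y x] that by (simp add: psi_def g_def dist_real_def)
  then show ?thesis using that \<eta>(1) by blast
qed

text \<open>One enumeration of the values of all truncated convolutions with level
  \<open>1 / (m + 1)\<close> at all grid points \<open>T * k / (l + 1)\<close>. Points beyond
  \<open>T\<close> occur as well; the functional is linear and bounded there too.\<close>

definition Lf :: "nat \<Rightarrow> (real \<Rightarrow> real) \<Rightarrow> real" where
  "Lf j v = (let (m, z) = prod_decode j; (k, l) = prod_decode z in
     conv (psi (1 / real (Suc m))) v (T * real k / real (Suc l)))"

lemma conv_psi_integrable: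
  assumes d: "d > 0" and v: "integrable M v"
  shows "integrable M (\<lambda>s. psi d (t - s) * v s)"
proof (rule Lp_bounded_by(1))
  show "integrable M (\<lambda>s. d powr (\<alpha> - 1) / Gamma \<alpha> * \<bar>v s\<bar>)" using v by simp
  show "(\<lambda>s. psi d (t - s) * v s) \<in> borel_measurable M"
    using borel_M(1)[OF psi_measurable, of d t] v by (intro borel_measurable_times) auto
  show "\<bar>psi d (t - s) * v s\<bar> \<le> d powr (\<alpha> - 1) / Gamma \<alpha> * \<bar>v s\<bar>" for s
    unfolding abs_mult using psi_le[OF d] psi_nonneg by (intro mult_right_mono) auto
qed

lemma Lf_lin:
  assumes "v \<in> Lp p M" "w \<in> Lp p M"
  shows "Lf j (\<lambda>t. c * v t + d * w t) = c * Lf j v + d * Lf j w"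
  unfolding Lf_def
  using conv_lin[OF conv_psi_integrable conv_psi_integrable] Lp_integrable[OF p assms(1)] Lp_integrable[OF p assms(2)]
  by (auto split: prod.split)

lemma Lf_bd: "\<exists>B. \<forall>v\<in>Lp p M. \<bar>Lf j v\<bar> powr p \<le> B * Np p M v"
proof -
  interpret finite_measure M by (rule finite_M)
  obtain m k l where j: "prod_decode j = (m, prod_encode (k, l))"
    by (metis prod.exhaust prod_decode_inverse)
  define d where "d = 1 / real (Suc m)"
  have d: "d > 0" by (simp add: d_def)
  define b where "b = d powr (\<alpha> - 1) / Gamma \<alpha>"
  have b: "b \<ge> 0" using Gamma_pos by (simp add: b_def)
  have "\<bar>Lf j v\<bar> powr p \<le> (b powr p * T powr (p - 1)) * Np p M v" if v: "v \<in> Lp p M" for v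
  proof -
    define r where "r = T * real k / real (Suc l)"
    have vi: "integrable M v" by (rule Lp_integrable[OF p v])
    have "\<bar>Lf j v\<bar> = \<bar>LINT s|M. psi d (r - s) * v s\<bar>" by (simp add: Lf_def j d_def r_def conv_def)
    also have "\<dots> \<le> (LINT s|M. b * \<bar>v s\<bar>)"
    proof (rule Lp_bounded_by(2))
      show "(\<lambda>s. psi d (r - s) * v s) \<in> borel_measurable M" using conv_psi_integrable[OF d vi] by simp
      show "\<bar>psi d (r - s) * v s\<bar> \<le> b * \<bar>v s\<bar>" for s
        unfolding abs_mult b_def using psi_le[OF d] psi_nonneg by (intro mult_right_mono) auto
    qed (use vi in simp)
    also have "\<dots> = b * (LINT s|M. 1 * \<bar>v s\<bar>)" by simp
    finally have "\<bar>Lf j v\<bar> powr p \<le> (b * (LINT s|M. 1 * \<bar>v s\<bar>)) powr p" using p by (intro powr_mono2) auto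
    also have "\<dots> = b powr p * (LINT s|M. 1 * \<bar>v s\<bar>) powr p" by (rule powr_mult)
    also have "(LINT s|M. 1 * \<bar>v s\<bar>) powr p \<le> T powr (p - 1) * (LINT s|M. 1 * \<bar>v s\<bar> powr p)"
      by (rule weighted_jensen[OF p]) (use vi v measure_M in \<open>auto simp: Lp_def\<close>)
    finally show ?thesis by (simp add: Np_def mult_left_mono mult.assoc)
  qed
  then show ?thesis by blast
qed

lemma grid_point:
  assumes t: "0 \<le> t" "t \<le> T"
  obtains k where "k \<le> Suc l" "T * real k / real (Suc l) \<le> t" "t - T * real k / real (Suc l) < T / real (Suc l)"
proof -
  define k where "k = nat \<lfloor>t * real (Suc l) / T\<rfloor>"
  have nn: "t * real (Suc l) / T \<ge> 0" using t T by simp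
  then have k: "real k \<le> t * real (Suc l) / T" "t * real (Suc l) / T < real k + 1"
    unfolding k_def by linarith+
  have "t * real (Suc l) / T \<le> real (Suc l)" using t T by (simp add: divide_le_eq mult_right_mono)
  then have "k \<le> Suc l" using k(1) by linarith
  moreover have "T * real k / real (Suc l) \<le> t"
  proof -
    have "real k * T \<le> t * real (Suc l)" using k(1) T by (simp add: pos_le_divide_eq)
    then show ?thesis by (simp add: pos_divide_le_eq mult.commute del: of_nat_Suc)
  qed
  moreover have "t - T * real k / real (Suc l) < T / real (Suc l)"
  proof -
    have "t * real (Suc l) < (real k + 1) * T" using k(2) T by (simp add: pos_divide_less_eq)
    then have "t < (real k + 1) * T / real (Suc l)" by (simp add: pos_less_divide_eq del: of_nat_Suc)
    also have "\<dots> = T * real k / real (Suc l) + T / real (Suc l)"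
      unfolding distrib_right add_divide_distrib by (simp add: mult.commute)
    finally show ?thesis by linarith
  qed
  ultimately show ?thesis using that by blast
qed

text \<open>Compactness of the fractional integral: the singular part of the kernel has small norm, and the
  truncated part maps bounded sets to equicontinuous functions, which are controlled by their values on
  a grid.\<close>

lemma frac_compact:
  assumes e: "e > 0"
  shows "\<exists>m \<eta>. \<eta> > 0 \<and> (\<forall>v\<in>Lp p M. Np p M v \<le> R \<longrightarrow> (\<forall>j<m. \<bar>Lf j v\<bar> \<le> \<eta>) \<longrightarrow> Np p M (conv (rl \<alpha>) v) \<le> e)"
proof -
  interpret finite_measure M by (rule finite_M)
  have p0: "p > 0" using p by simp
  \<comment> \<open>Bounds the contribution of the singular part at truncation level
    \<open>1 / (n + 1)\<close>, including the factor of the triangle inequality; the mass of that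
    part tends to 0.\<close>
  define Q where "Q n = 2 powr p * (((inverse (real (Suc n))) powr \<alpha> / \<alpha> / Gamma \<alpha>) powr p * \<bar>R\<bar>)" for n
  have "(\<lambda>n. (inverse (real (Suc n))) powr \<alpha>) \<longlonglongrightarrow> 0 powr \<alpha>"
    by (rule tendsto_powr2[OF LIMSEQ_inverse_real_of_nat tendsto_const]) (use \<alpha> in auto)
  then have "(\<lambda>n. (inverse (real (Suc n))) powr \<alpha> / \<alpha> / Gamma \<alpha>) \<longlonglongrightarrow> 0"
    by (intro tendsto_divide_zero) simp
  then have "(\<lambda>n. ((inverse (real (Suc n))) powr \<alpha> / \<alpha> / Gamma \<alpha>) powr p) \<longlonglongrightarrow> 0 powr p"
    by (rule tendsto_powr2[OF _ tendsto_const]) (use \<alpha> p Gamma_pos in auto)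
  then have "Q \<longlonglongrightarrow> 0" unfolding Q_def by (intro tendsto_mult_right_zero tendsto_mult_left_zero) simp
  then have "eventually (\<lambda>n. Q n < e / 2) sequentially" using e by (intro order_tendstoD(2)) auto
  then obtain m where m: "Q m < e / 2" by (auto simp: eventually_sequentially)
  define d where "d = 1 / real (Suc m)"
  have d: "d > 0" by (simp add: d_def)
  define B where "B = d powr (\<alpha> - 1) / Gamma \<alpha>"
  have B: "B > 0" using Gamma_pos d by (simp add: B_def)
  \<comment> \<open>If the truncated part is at most \<open>\<sigma>\<close> on all of
    \<open>[0,T]\<close>, it contributes \<open>e / 2\<close>. The four quarters of
    \<open>\<sigma>\<close> go to the value at a grid point, to the modulus of continuity of
    \<open>psi\<close> via \<open>e2\<close>, and to the two terms for the jump via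
    \<open>e3\<close> and \<open>l\<close>.\<close>
  define \<sigma> where "\<sigma> = (e / (2 * (2 powr p * T))) powr (1 / p)"
  have \<sigma>: "\<sigma> > 0" using e T by (simp add: \<sigma>_def)
  have \<sigma>p: "2 powr p * (T * \<sigma> powr p) = e / 2"
  proof -
    have "\<sigma> powr p = e / (2 * (2 powr p * T))" using p e T by (simp add: \<sigma>_def powr_powr)
    then show ?thesis using T by simp
  qed
  define e2 where "e2 = \<sigma> / (4 * (T + \<bar>R\<bar>))"
  have e2: "e2 > 0" "e2 * (T + \<bar>R\<bar>) = \<sigma> / 4"
  proof -
    have TR: "T + \<bar>R\<bar> > 0" using T by simp
    then show "e2 > 0" using \<sigma> by (simp add: e2_def)
    have "\<sigma> / (4 * x) * x = \<sigma> / 4" if "x > 0" for x :: real using that by simp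
    then show "e2 * (T + \<bar>R\<bar>) = \<sigma> / 4" unfolding e2_def using TR by blast
  qed
  define e3 where "e3 = \<sigma> / (4 * (B * (\<bar>R\<bar> + 1)))"
  have e3: "e3 > 0" using \<sigma> B by (simp add: e3_def add_nonneg_pos)
  have e3': "B * (e3 * \<bar>R\<bar>) \<le> \<sigma> / 4"
  proof -
    have BR: "B * (\<bar>R\<bar> + 1) > 0" using B by (simp add: add_nonneg_pos)
    have "B * (e3 * \<bar>R\<bar>) \<le> B * (e3 * (\<bar>R\<bar> + 1))" using B e3 by (intro mult_left_mono) auto
    also have "\<dots> = \<sigma> / (4 * (B * (\<bar>R\<bar> + 1))) * (B * (\<bar>R\<bar> + 1))" by (simp only: e3_def mult_ac)
    also have "\<dots> = \<sigma> / 4"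
    proof -
      have "\<sigma> / (4 * x) * x = \<sigma> / 4" if "x > 0" for x :: real using that by simp
      then show ?thesis using BR by blast
    qed
    finally show ?thesis .
  qed
  \<comment> \<open>Equi-integrability: together with the bound on \<open>Np p M v\<close> this
    makes the integral of \<open>\<bar>v\<bar>\<close> over short intervals uniformly small.\<close>
  obtain C3 where C3: "C3 \<ge> 0" "\<And>x. \<bar>x\<bar> powr 1 \<le> e3 * \<bar>x\<bar> powr p + C3"
    by (rule powr_le_eps_powr[of 1 p e3]) (use p e3 in auto)
  obtain d2 where d2: "d2 > 0" "\<And>x y. 0 < x \<Longrightarrow> x \<le> T \<Longrightarrow> 0 < y \<Longrightarrow> y \<le> T \<Longrightarrow> \<bar>x - y\<bar> < d2 \<Longrightarrow> \<bar>psi d x - psi d y\<bar> \<le> e2"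
    by (rule psi_uniform[OF d e2(1)]) blast
  have "min (d2 / T) (\<sigma> / (4 * (B * C3 * T + 1))) > 0" using d2 T \<sigma> B C3 by (simp add: add_nonneg_pos)
  then obtain l where l: "inverse (real (Suc l)) < min (d2 / T) (\<sigma> / (4 * (B * C3 * T + 1)))" using reals_Archimedean by blast
  have l1: "T / real (Suc l) < d2"
  proof -
    have "T * inverse (real (Suc l)) < T * (d2 / T)" using l T by (intro mult_strict_left_mono) auto
    also have "T * (d2 / T) = d2" using T by simp
    finally show ?thesis by (simp only: divide_inverse)
  qed
  have l2: "B * (C3 * (T / real (Suc l))) \<le> \<sigma> / 4"
  proof -
    have pos: "B * C3 * T + 1 > 0" using B C3 T by (simp add: add_nonneg_pos)
    have "B * (C3 * (T / real (Suc l))) = (B * C3 * T) * inverse (real (Suc l))" by (simp add: divide_inverse)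
    also have "\<dots> \<le> (B * C3 * T + 1) * (\<sigma> / (4 * (B * C3 * T + 1)))" using l B C3 T by (intro mult_mono) auto
    also have "\<dots> = \<sigma> / 4"
    proof -
      have "x * (\<sigma> / (4 * x)) = \<sigma> / 4" if "x > 0" for x :: real using that by simp
      then show ?thesis using pos by blast
    qed
    finally show ?thesis .
  qed
  define J where "J = (\<lambda>k. prod_encode (m, prod_encode (k, l))) ` {..Suc l}"
  define m0 where "m0 = Suc (Max J)"
  have Jm0: "j < m0" if "j \<in> J" for j
    using that Max_ge[of J j] by (simp add: m0_def J_def less_Suc_eq_le)
  have "Np p M (conv (rl \<alpha>) v) \<le> e"
    if v: "v \<in> Lp p M" "Np p M v \<le> R" and small: "\<forall>j<m0. \<bar>Lf j v\<bar> \<le> \<sigma> / 4" for v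
  proof -
    have vi: "integrable M v" by (rule Lp_integrable[OF p v(1)])
    have vp: "integrable M (\<lambda>s. \<bar>v s\<bar> powr p)" using v(1) by (simp add: Lp_def)
    have vm: "v \<in> borel_measurable M" using v(1) by (simp add: Lp_def)
    have R0: "R \<ge> 0" using Np_nonneg[of p M v] v(2) by linarith
    have v1: "(LINT s|M. \<bar>v s\<bar>) \<le> T + \<bar>R\<bar>"
    proof -
      have "(LINT s|M. \<bar>v s\<bar>) \<le> (LINT s|M. 1 + \<bar>v s\<bar> powr p)"
      proof (rule integral_mono)
        show "\<bar>v s\<bar> \<le> 1 + \<bar>v s\<bar> powr p" for s using powr_diff_one_mult_le[OF p, of 1 "v s"] by simp
      qed (use vi vp in auto)
      also have "\<dots> = T + Np p M v" using vp measure_M by (simp add: Np_def)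
      finally show ?thesis using v(2) by linarith
    qed
    have sup: "\<bar>conv (psi d) v t\<bar> \<le> \<sigma>" if t: "t \<in> {0..T}" for t
    proof -
      obtain k where k: "k \<le> Suc l" "T * real k / real (Suc l) \<le> t" "t - T * real k / real (Suc l) < T / real (Suc l)"
        by (rule grid_point[of t l]) (use t in auto)
      define r where "r = T * real k / real (Suc l)"
      have r: "0 \<le> r" "r \<le> t" "t - r < T / real (Suc l)" using k T by (auto simp: r_def)
      have "prod_encode (m, prod_encode (k, l)) \<in> J" using k(1) by (auto simp: J_def)
      then have "\<bar>Lf (prod_encode (m, prod_encode (k, l))) v\<bar> \<le> \<sigma> / 4" using small Jm0 by blast
      then have Lr: "\<bar>conv (psi d) v r\<bar> \<le> \<sigma> / 4" by (simp add: Lf_def r_def d_def)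
      have i1: "integrable M (\<lambda>s. indicat_real {r..t} s * \<bar>v s\<bar>)"
        by (rule Lp_bounded_by(1)[of _ _ "\<lambda>s. \<bar>v s\<bar>"]) (use vi vm in \<open>auto simp: indicator_def\<close>)
      have ind: "integrable M (indicat_real {r..t})"
        by (rule Lp_bounded_by(1)[of _ _ "\<lambda>s. 1"]) (auto simp: indicator_def)
      have deq: "conv (psi d) v t - conv (psi d) v r = (LINT s|M. (psi d (t - s) - psi d (r - s)) * v s)"
        unfolding conv_def using conv_psi_integrable[OF d vi, of t] conv_psi_integrable[OF d vi, of r]
        by (simp add: left_diff_distrib)
      have "\<bar>conv (psi d) v t - conv (psi d) v r\<bar> \<le> (LINT s|M. e2 * \<bar>v s\<bar> + B * (indicat_real {r..t} s * \<bar>v s\<bar>))"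
        unfolding deq
      proof (rule Lp_bounded_by(2))
        show "(\<lambda>s. (psi d (t - s) - psi d (r - s)) * v s) \<in> borel_measurable M"
          using borel_M(1)[OF psi_measurable, of d] vm by (intro borel_measurable_times borel_measurable_diff)
        fix s assume "s \<in> space M"
        then have s: "0 \<le> s" "s \<le> T" by auto
        have "\<bar>psi d (t - s) - psi d (r - s)\<bar> \<le> e2 + B * indicat_real {r..t} s"
        proof -
          consider "s < r" | "r \<le> s" "s < t" | "s \<ge> t" by linarith
          then show ?thesis
          proof cases
            case 1
            have "\<bar>psi d (t - s) - psi d (r - s)\<bar> \<le> e2" by (rule d2(2)) (use 1 r s t l1 in auto)
            then show ?thesis using B by (simp add: add_increasing2)
          next
            \<comment> \<open>Between \<open>r\<close> and \<open>t\<close> one of the two kernel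
              values has passed the jump at 0 and vanishes, so that only the bound \<open>B\<close>
              is left; the interval is short.\<close>
            case 2
            then have "psi d (r - s) = 0" by (simp add: psi_def)
            then have "\<bar>psi d (t - s) - psi d (r - s)\<bar> \<le> B" using psi_le[OF d, of "t - s"] psi_nonneg[of d "t - s"] by (simp add: B_def)
            then show ?thesis using 2 e2(1) by simp
          next
            case 3
            then have "psi d (t - s) = 0" "psi d (r - s) = 0" using r by (auto simp: psi_def)
            then show ?thesis using B e2(1) by (simp add: add_nonneg_nonneg)
          qed
        qed
        then have "\<bar>psi d (t - s) - psi d (r - s)\<bar> * \<bar>v s\<bar> \<le> (e2 + B * indicat_real {r..t} s) * \<bar>v s\<bar>" by (rule mult_right_mono) simp
        then show "\<bar>(psi d (t - s) - psi d (r - s)) * v s\<bar> \<le> e2 * \<bar>v s\<bar> + B * (indicat_real {r..t} s * \<bar>v s\<bar>)"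
          unfolding abs_mult by (simp only: distrib_right mult.assoc)
      qed (use vi i1 in auto)
      also have "\<dots> = e2 * (LINT s|M. \<bar>v s\<bar>) + B * (LINT s|M. indicat_real {r..t} s * \<bar>v s\<bar>)"
        using integrable_abs[OF vi] i1
        by (subst Bochner_Integration.integral_add) (simp_all only: integral_mult_right_zero integrable_mult_right)
      also have "\<dots> \<le> \<sigma> / 4 + (\<sigma> / 4 + \<sigma> / 4)"
      proof (intro add_mono)
        have "e2 * (LINT s|M. \<bar>v s\<bar>) \<le> e2 * (T + \<bar>R\<bar>)" using v1 e2(1) by (intro mult_left_mono) auto
        then show "e2 * (LINT s|M. \<bar>v s\<bar>) \<le> \<sigma> / 4" using e2(2) by simp
        have "(LINT s|M. indicat_real {r..t} s * \<bar>v s\<bar>) \<le> (LINT s|M. e3 * \<bar>v s\<bar> powr p + C3 * indicat_real {r..t} s)"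
        proof (rule integral_mono)
          show "indicat_real {r..t} s * \<bar>v s\<bar> \<le> e3 * \<bar>v s\<bar> powr p + C3 * indicat_real {r..t} s" for s
            using C3(2)[of "v s"] e3 by (auto simp: indicator_def)
        qed (use i1 vp ind in auto)
        also have "\<dots> = e3 * Np p M v + C3 * (LINT s|M. indicat_real {r..t} s)"
          using vp ind
          by (subst Bochner_Integration.integral_add) (simp_all only: integral_mult_right_zero integrable_mult_right Np_def)
        also have "(LINT s|M. indicat_real {r..t} s) = t - r"
        proof -
          have "{r..t} \<inter> {0..T} = {r..t}" using r t by auto
          then show ?thesis using r by (simp add: measure_restrict_space)
        qed
        also have "e3 * Np p M v + C3 * (t - r) \<le> e3 * \<bar>R\<bar> + C3 * (T / real (Suc l))"
          using v(2) r e3 C3(1) by (intro add_mono mult_left_mono) auto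
        finally have "B * (LINT s|M. indicat_real {r..t} s * \<bar>v s\<bar>) \<le> B * (e3 * \<bar>R\<bar> + C3 * (T / real (Suc l)))"
          using B by (intro mult_left_mono) auto
        then show "B * (LINT s|M. indicat_real {r..t} s * \<bar>v s\<bar>) \<le> \<sigma> / 4 + \<sigma> / 4"
          unfolding distrib_left using e3' l2 by linarith
      qed
      finally show ?thesis using Lr by linarith
    qed
    note S1 = schur[OF p kernel_singular_part[OF d] v(1)]
    note S2 = schur[OF p kernel_psi[of d] v(1)]
    note S = schur[OF p kernel_rl[OF \<alpha>(1)] v(1)]
    have "AE t in M. conv (rl \<alpha>) v t = conv (\<lambda>x. rl \<alpha> x - psi d x) v t + conv (psi d) v t"
      using S1(1)
    proof eventually_elim
      fix t assume i: "integrable M (\<lambda>s. (rl \<alpha> (t - s) - psi d (t - s)) * v s)"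
      have "conv (rl \<alpha>) v t = (LINT s|M. (rl \<alpha> (t - s) - psi d (t - s)) * v s + psi d (t - s) * v s)"
        unfolding conv_def by (simp add: algebra_simps)
      then show "conv (rl \<alpha>) v t = conv (\<lambda>x. rl \<alpha> x - psi d x) v t + conv (psi d) v t"
        using i conv_psi_integrable[OF d vi, of t] by (simp add: conv_def)
    qed
    then have "Np p M (conv (rl \<alpha>) v) = Np p M (\<lambda>t. conv (\<lambda>x. rl \<alpha> x - psi d x) v t + conv (psi d) v t)"
      using LpD(1)[OF S(2)] LpD(1)[OF S1(2)] LpD(1)[OF S2(2)] by (intro Np_cong_AE) auto
    also have "\<dots> \<le> 2 powr p * (Np p M (conv (\<lambda>x. rl \<alpha> x - psi d x) v) + Np p M (conv (psi d) v))"
      by (rule Lp_add(2)[OF p0 S1(2) S2(2)])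
    also have "Np p M (conv (\<lambda>x. rl \<alpha> x - psi d x) v) \<le> (d powr \<alpha> / \<alpha> / Gamma \<alpha>) powr p * \<bar>R\<bar>"
      by (rule order_trans[OF S1(3)], intro mult_left_mono) (use v(2) in auto)
    also have "Np p M (conv (psi d) v) \<le> T * \<sigma> powr p"
    proof -
      have "Np p M (conv (psi d) v) \<le> (LINT t|M. \<sigma> powr p)"
        unfolding Np_def
      proof (rule integral_mono)
        show "\<bar>conv (psi d) v t\<bar> powr p \<le> \<sigma> powr p" if "t \<in> space M" for t
          using sup[of t] that p by (intro powr_mono2) auto
      qed (use LpD(2)[OF S2(2)] in auto)
      then show ?thesis by (simp add: measure_M)
    qed
    finally have "Np p M (conv (rl \<alpha>) v) \<le> 2 powr p * ((d powr \<alpha> / \<alpha> / Gamma \<alpha>) powr p * \<bar>R\<bar>) + 2 powr p * (T * \<sigma> powr p)"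
      by (simp add: distrib_left)
    also have "2 powr p * ((d powr \<alpha> / \<alpha> / Gamma \<alpha>) powr p * \<bar>R\<bar>) \<le> e / 2"
      using m by (simp add: Q_def d_def inverse_eq_divide)
    finally show ?thesis unfolding \<sigma>p by simp
  qed
  then show ?thesis using \<sigma> by (intro exI[of _ m0] exI[of _ "\<sigma> / 4"]) auto
qed

end

section \<open>Fractional derivatives and the fractional derivative space\<close>

context interval begin

lemma complete_M: "complete_measure M"
proof
  fix A B assume B: "B \<subseteq> A" and A: "A \<in> null_sets M"
  have eq: "A \<in> null_sets M \<longleftrightarrow> A \<subseteq> {0..T} \<and> A \<in> null_sets lebesgue"
    by (rule null_sets_restrict_space) simp
  have "negligible A" using A eq by (simp only: negligible_iff_null_sets)
  then have "negligible B" using B by (rule negligible_subset)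
  then have "B \<in> sets lebesgue" by (rule negligible_imp_sets)
  moreover have "B \<subseteq> {0..T}" using A eq B by (simp only:) blast
  ultimately show "B \<in> sets M" by (subst sets_restrict_space_iff) simp_all
qed

text \<open>Fractional derivatives are identified only almost everywhere; completeness of the
  measure absorbs the exceptional set, on which nothing is known about
  \<open>left_RL_deriv\<close>.\<close>

lemma measurable_cong_AE_M:
  fixes f g :: "real \<Rightarrow> real"
  assumes f: "f \<in> borel_measurable M" and ae: "AE t in M. g t = f t"
  shows "g \<in> borel_measurable M"
proof -
  interpret complete_measure M by (rule complete_M)
  show ?thesis
    unfolding borel_measurable_iff_le
  proof
    fix a
    show "{w \<in> space M. g w \<le> a} \<in> sets M"
    proof (rule in_sets_AE)
      show "{w \<in> space M. f w \<le> a} \<in> sets M" using f by measurable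
      show "AE x in M. (x \<in> {w \<in> space M. f w \<le> a}) = (x \<in> {w \<in> space M. g w \<le> a})"
        using ae by eventually_elim auto
    qed auto
  qed
qed

lemma Lp_cong_AE:
  assumes f: "f \<in> Lp p M" and ae: "AE t in M. g t = f t"
  shows "g \<in> Lp p M"
proof -
  have gm: "g \<in> borel_measurable M" by (rule measurable_cong_AE_M[OF LpD(1)[OF f] ae])
  have "integrable M (\<lambda>t. \<bar>f t\<bar> powr p) = integrable M (\<lambda>t. \<bar>g t\<bar> powr p)"
    using gm LpD(1)[OF f] ae by (intro integrable_cong_AE) auto
  then show ?thesis using gm f by (simp add: Lp_def)
qed

lemma AE_interior: "AE t in M. 0 < t \<and> t < T"
proof -
  have "AE t in lebesgue. t \<noteq> (0::real)" "AE t in lebesgue. t \<noteq> T"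
    by (rule AE_not_in[of "{x}" for x, simplified], simp add: negligible_iff_null_sets[symmetric])+
  then have "AE t in lebesgue. t \<in> {0..T} \<longrightarrow> 0 < t \<and> t < T" by eventually_elim auto
  moreover have "(AE t in M. 0 < t \<and> t < T) = (AE t in lebesgue. t \<in> {0..T} \<longrightarrow> 0 < t \<and> t < T)"
    by (rule AE_restrict_space_iff) simp
  ultimately show ?thesis by (simp only:)
qed

lemma integral_Icc_M:
  assumes t: "0 \<le> t" "t \<le> T"
  shows "(LINT s|lebesgue_on {0..t}. g s) = (LINT s|M. indicat_real {..t} s * g s)"
    and "integrable (lebesgue_on {0..t}) g \<longleftrightarrow> integrable M (\<lambda>s. indicat_real {..t} s * (g s :: real))"
proof -
  have e: "(\<lambda>s. indicat_real {0..T} s *\<^sub>R (indicat_real {..t} s * g s)) = (\<lambda>s. indicat_real {0..t} s *\<^sub>R g s)"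
    using t by (auto simp: indicator_def)
  show "(LINT s|lebesgue_on {0..t}. g s) = (LINT s|M. indicat_real {..t} s * g s)"
    by (subst (1 2) integral_restrict_space) (simp_all only: e, auto)
  show "integrable (lebesgue_on {0..t}) g \<longleftrightarrow> integrable M (\<lambda>s. indicat_real {..t} s * g s)"
    by (subst (1 2) integrable_restrict_space) (simp_all only: e, auto)
qed

end

section \<open>Fractional differentiation on the interval\<close>

context frac_interval begin

abbreviation "\<gamma> \<equiv> 1 - \<alpha>"
abbreviation "K \<equiv> conv (rl \<alpha>)"

lemma \<gamma>: "0 < \<gamma>" using \<alpha> by simp

lemma rl_indicator:
  assumes "0 \<le> t" "t \<le> T" "0 \<le> s" "\<beta> > 0"
  shows "rl \<beta> (t - s) = indicat_real {..t} s * ((t - s) powr (\<beta> - 1)) / Gamma \<beta>"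
  using assms by (cases "s = t") (auto simp: rl_def indicator_def)

lemma left_RL_integral_conv:
  assumes t: "0 \<le> t" "t \<le> T"
  shows "left_RL_integral \<gamma> u t = conv (rl \<gamma>) u t"
proof -
  have "left_RL_integral \<gamma> u t = 1 / Gamma \<gamma> * (LINT s|M. indicat_real {..t} s * ((t - s) powr (\<gamma> - 1) * u s))"
    unfolding left_RL_integral_def integral_Icc_M(1)[OF t] ..
  also have "\<dots> = (LINT s|M. 1 / Gamma \<gamma> * (indicat_real {..t} s * ((t - s) powr (\<gamma> - 1) * u s)))" by simp
  also have "\<dots> = conv (rl \<gamma>) u t"
    unfolding conv_def
    by (intro Bochner_Integration.integral_cong) (use t \<gamma> in \<open>auto simp: rl_indicator\<close>)
  finally show ?thesis .
qed

lemma RL_integrable_iff: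
  assumes t: "0 \<le> t" "t \<le> T"
  shows "integrable (lebesgue_on {0..t}) (\<lambda>s. (t - s) powr (- \<alpha>) * u s) \<longleftrightarrow> integrable M (\<lambda>s. rl \<gamma> (t - s) * u s)"
proof -
  have G: "Gamma \<gamma> \<noteq> 0" using Gamma_real_pos[OF \<gamma>] by simp
  have "integrable (lebesgue_on {0..t}) (\<lambda>s. (t - s) powr (- \<alpha>) * u s)
      \<longleftrightarrow> integrable M (\<lambda>s. indicat_real {..t} s * ((t - s) powr (- \<alpha>) * u s))" by (rule integral_Icc_M(2)[OF t])
  also have "\<dots> \<longleftrightarrow> integrable M (\<lambda>s. Gamma \<gamma> * (rl \<gamma> (t - s) * u s))"
    by (intro Bochner_Integration.integrable_cong) (use t \<gamma> G in \<open>auto simp: rl_indicator\<close>)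
  also have "\<dots> \<longleftrightarrow> integrable M (\<lambda>s. rl \<gamma> (t - s) * u s)" using G by simp
  finally show ?thesis .
qed

lemma left_RL_differentiable_alt:
  "left_RL_differentiable \<alpha> T u \<longleftrightarrow> (\<forall>t\<in>{0..T}. integrable M (\<lambda>s. rl \<gamma> (t - s) * u s)) \<and>
     (AE t in M. left_RL_integral \<gamma> u differentiable (at t))"
  unfolding left_RL_differentiable_def using RL_integrable_iff by auto

text \<open>\<open>left_RL_integral\<close> agrees with a convolution only on \<open>[0,T]\<close>,
  whereas its derivative is two-sided. Hence the restriction to interior points, which is harmless
  almost everywhere.\<close>

lemma deriv_transfer:
  assumes eq: "\<And>t. 0 \<le> t \<Longrightarrow> t \<le> T \<Longrightarrow> g t = h t" and t: "0 < t" "t < T"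
  shows "(g has_real_derivative d) (at t) \<longleftrightarrow> (h has_real_derivative d) (at t)"
proof -
  have "eventually (\<lambda>x. x \<in> {0<..<T}) (nhds t)" using t by (intro eventually_nhds_in_open) auto
  then have "eventually (\<lambda>x. g x = h x) (nhds t)" by eventually_elim (auto intro: eq)
  then show ?thesis by (intro DERIV_cong_ev) auto
qed

text \<open>By \<open>semigroup\<close> the fractional integral of order \<open>1 - \<alpha>\<close>
  of \<open>K v\<close> is the ordinary integral of \<open>v\<close>, to which the Lebesgue
  differentiation theorem applies after extension by 0 outside \<open>[0,T]\<close>.\<close>

lemma frac_deriv_K:
  assumes v: "integrable M v"
  shows "AE t in M. (left_RL_integral \<gamma> (K v) has_real_derivative v t) (at t)"
proof -
  define g where "g s = indicat_real {0..T} s * v s" for s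
  have g: "integrable lebesgue g"
    using v by (simp add: g_def[abs_def] integrable_restrict_space)
  have "AE t in lebesgue. ((\<lambda>x. LINT s|lebesgue. indicator {..x} s * g s) has_real_derivative g t) (at t)"
    by (rule lebesgue_differentiation[OF g])
  then have "AE t in M. ((\<lambda>x. LINT s|lebesgue. indicator {..x} s * g s) has_real_derivative g t) (at t)"
    by (auto simp: AE_restrict_space_iff elim: eventually_mono)
  with AE_interior show ?thesis
  proof eventually_elim
    fix t assume t: "0 < t \<and> t < T"
      and D: "((\<lambda>x. LINT s|lebesgue. indicator {..x} s * g s) has_real_derivative g t) (at t)"
    have "left_RL_integral \<gamma> (K v) x = (LINT s|lebesgue. indicator {..x} s * g s)" if x: "0 \<le> x" "x \<le> T" for x
    proof -
      have "left_RL_integral \<gamma> (K v) x = (LINT r|M. indicator {..x} r * v r)"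
        unfolding left_RL_integral_conv[OF x] by (rule semigroup(2)) (use v x \<alpha> in auto)
      also have "\<dots> = (LINT s|lebesgue. indicator {..x} s * g s)"
        by (subst integral_restrict_space) (auto simp: g_def mult.left_commute)
      finally show ?thesis .
    qed
    then show "(left_RL_integral \<gamma> (K v) has_real_derivative v t) (at t)"
      using deriv_transfer[of "left_RL_integral \<gamma> (K v)" "\<lambda>x. LINT s|lebesgue. indicator {..x} s * g s" t "g t"] D t
      by (simp add: g_def)
  qed
qed

lemma K_differentiable:
  assumes v: "integrable M v"
  shows "left_RL_differentiable \<alpha> T (K v)" and "AE t in M. left_RL_deriv \<alpha> (K v) t = v t"
proof -
  show "left_RL_differentiable \<alpha> T (K v)"
    unfolding left_RL_differentiable_alt
  proof
    show "\<forall>t\<in>{0..T}. integrable M (\<lambda>s. rl \<gamma> (t - s) * K v s)"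
      using semigroup(1)[of \<gamma> \<alpha> v] v \<alpha> by auto
    show "AE t in M. left_RL_integral \<gamma> (K v) differentiable (at t)"
      using frac_deriv_K[OF v] by eventually_elim (auto simp: real_differentiable_def)
  qed
  show "AE t in M. left_RL_deriv \<alpha> (K v) t = v t"
    using frac_deriv_K[OF v] by eventually_elim (simp add: left_RL_deriv_def DERIV_imp_deriv)
qed

lemma left_RL_deriv_cong:
  assumes eq: "\<And>t. t \<in> {0..T} \<Longrightarrow> u t = w t"
  shows "\<And>t. 0 \<le> t \<Longrightarrow> t \<le> T \<Longrightarrow> left_RL_integral \<gamma> u t = left_RL_integral \<gamma> w t"
    and "left_RL_differentiable \<alpha> T w \<Longrightarrow> left_RL_differentiable \<alpha> T u"
    and "AE t in M. left_RL_deriv \<alpha> u t = left_RL_deriv \<alpha> w t"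
proof -
  show I: "left_RL_integral \<gamma> u t = left_RL_integral \<gamma> w t" if "0 \<le> t" "t \<le> T" for t
    unfolding left_RL_integral_conv[OF that] conv_def by (intro Bochner_Integration.integral_cong) (auto simp: eq)
  have d: "(left_RL_integral \<gamma> u has_real_derivative d) (at t) \<longleftrightarrow> (left_RL_integral \<gamma> w has_real_derivative d) (at t)"
    if "0 < t" "t < T" for t d by (rule deriv_transfer[OF I that])
  show "left_RL_differentiable \<alpha> T w \<Longrightarrow> left_RL_differentiable \<alpha> T u"
  proof -
    assume w: "left_RL_differentiable \<alpha> T w"
    have "integrable M (\<lambda>s. rl \<gamma> (t - s) * u s) \<longleftrightarrow> integrable M (\<lambda>s. rl \<gamma> (t - s) * w s)" for t
      by (intro Bochner_Integration.integrable_cong) (auto simp: eq)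
    moreover have "AE t in M. left_RL_integral \<gamma> w differentiable (at t)" using w by (simp add: left_RL_differentiable_alt)
    with AE_interior have "AE t in M. left_RL_integral \<gamma> u differentiable (at t)"
      by eventually_elim (simp add: real_differentiable_def d)
    ultimately show ?thesis using w by (simp add: left_RL_differentiable_alt)
  qed
  show "AE t in M. left_RL_deriv \<alpha> u t = left_RL_deriv \<alpha> w t"
    using AE_interior by eventually_elim (simp add: left_RL_deriv_def deriv_def d)
qed

lemma left_RL_deriv_lin:
  assumes u: "left_RL_differentiable \<alpha> T u" and w: "left_RL_differentiable \<alpha> T w"
  shows "AE t in M. left_RL_deriv \<alpha> (\<lambda>t. c * u t + d * w t) t = c * left_RL_deriv \<alpha> u t + d * left_RL_deriv \<alpha> w t"
proof -
  have iu: "integrable M (\<lambda>s. rl \<gamma> (t - s) * u s)" and iw: "integrable M (\<lambda>s. rl \<gamma> (t - s) * w s)" if "t \<in> {0..T}" for t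
    using u w that by (auto simp: left_RL_differentiable_alt)
  have I: "left_RL_integral \<gamma> (\<lambda>t. c * u t + d * w t) t = c * left_RL_integral \<gamma> u t + d * left_RL_integral \<gamma> w t"
    if "0 \<le> t" "t \<le> T" for t
    unfolding left_RL_integral_conv[OF that] using conv_lin[OF iu iw] that by simp
  have du: "AE t in M. left_RL_integral \<gamma> u differentiable (at t)" and dw: "AE t in M. left_RL_integral \<gamma> w differentiable (at t)"
    using u w by (auto simp: left_RL_differentiable_alt)
  show ?thesis
    using AE_interior du dw
  proof eventually_elim
    fix t assume t: "0 < t \<and> t < T" and D: "left_RL_integral \<gamma> u differentiable (at t)" "left_RL_integral \<gamma> w differentiable (at t)"
    have "(left_RL_integral \<gamma> u has_real_derivative left_RL_deriv \<alpha> u t) (at t)"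
      "(left_RL_integral \<gamma> w has_real_derivative left_RL_deriv \<alpha> w t) (at t)"
      unfolding left_RL_deriv_def using D by (simp_all add: DERIV_deriv_iff_real_differentiable)
    then have "((\<lambda>t. c * left_RL_integral \<gamma> u t + d * left_RL_integral \<gamma> w t) has_real_derivative
        c * left_RL_deriv \<alpha> u t + d * left_RL_deriv \<alpha> w t) (at t)" by (intro DERIV_add DERIV_cmult)
    then have "(left_RL_integral \<gamma> (\<lambda>t. c * u t + d * w t) has_real_derivative
        c * left_RL_deriv \<alpha> u t + d * left_RL_deriv \<alpha> w t) (at t)"
      using deriv_transfer[where g = "left_RL_integral \<gamma> (\<lambda>t. c * u t + d * w t)" and t = t
          and h = "\<lambda>t. c * left_RL_integral \<gamma> u t + d * left_RL_integral \<gamma> w t", OF I] t by simp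
    then show "left_RL_deriv \<alpha> (\<lambda>t. c * u t + d * w t) t = c * left_RL_deriv \<alpha> u t + d * left_RL_deriv \<alpha> w t"
      unfolding left_RL_deriv_def[of \<alpha> "\<lambda>t. c * u t + d * w t"] by (rule DERIV_imp_deriv)
  qed
qed

lemma C0_infinity_lin:
  assumes "\<phi> \<in> C0_infinity T" "\<psi> \<in> C0_infinity T"
  shows "(\<lambda>t. a * \<phi> t + b * \<psi> t) \<in> C0_infinity T"
proof -
  obtain d1 d2 where d: "d1 0 = \<phi>" "\<And>k t. t \<in> {0..T} \<Longrightarrow> (d1 k has_real_derivative d1 (Suc k) t) (at t within {0..T})"
    "d2 0 = \<psi>" "\<And>k t. t \<in> {0..T} \<Longrightarrow> (d2 k has_real_derivative d2 (Suc k) t) (at t within {0..T})"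
    and z: "\<phi> 0 = 0" "\<phi> T = 0" "\<psi> 0 = 0" "\<psi> T = 0"
    using assms unfolding C0_infinity_def by blast
  show ?thesis
    unfolding C0_infinity_def
  proof (intro CollectI conjI exI[of _ "\<lambda>k t. a * d1 k t + b * d2 k t"] allI ballI)
    show "((\<lambda>t. a * d1 k t + b * d2 k t) has_real_derivative a * d1 (Suc k) t + b * d2 (Suc k) t) (at t within {0..T})"
      if "t \<in> {0..T}" for k t using d that by (intro DERIV_add DERIV_cmult) auto
  qed (use d z in auto)
qed

lemma continuous_Lp:
  assumes "continuous_on {0..T} \<psi>"
  shows "\<psi> \<in> Lp p M"
proof -
  interpret finite_measure M by (rule finite_M)
  have m: "\<psi> \<in> borel_measurable M"
    using continuous_imp_measurable_on_sets_lebesgue[OF assms] by simp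
  obtain B where B: "\<And>t. t \<in> {0..T} \<Longrightarrow> \<bar>\<psi> t\<bar> \<le> B"
    using compact_imp_bounded[OF compact_continuous_image[OF assms compact_Icc]] unfolding bounded_iff by force
  have "integrable M (\<lambda>t. \<bar>\<psi> t\<bar> powr p)"
    by (rule Lp_bounded_by(1)[of _ _ "\<lambda>t. B powr p"]) (use m B p in \<open>auto intro!: powr_mono2\<close>)
  then show ?thesis using m by (simp add: Lp_def)
qed

text \<open>As \<open>\<phi> 0 = 0\<close>, the function is the integral of its classical derivative
  \<open>\<psi>\<close>, and this integral factors through the orders \<open>1 - \<alpha>\<close>
  and \<open>\<alpha>\<close>. So \<open>\<phi> = K w\<close> holds at every point with
  \<open>w\<close> the integral of order \<open>1 - \<alpha>\<close> of \<open>\<psi>\<close>, and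
  \<open>w\<close> is the fractional derivative almost everywhere.\<close>

lemma C0_infinity_K:
  assumes \<phi>: "\<phi> \<in> C0_infinity T"
  shows "left_RL_differentiable \<alpha> T \<phi>" "left_RL_deriv \<alpha> \<phi> \<in> Lp p M" "\<And>t. t \<in> {0..T} \<Longrightarrow> \<phi> t = K (left_RL_deriv \<alpha> \<phi>) t"
proof -
  obtain d where d: "d 0 = \<phi>" "\<And>k t. t \<in> {0..T} \<Longrightarrow> (d k has_real_derivative d (Suc k) t) (at t within {0..T})"
    and z: "\<phi> 0 = 0" using \<phi> unfolding C0_infinity_def by blast
  define \<psi> where "\<psi> = d 1"
  have der: "(\<phi> has_real_derivative \<psi> t) (at t within {0..T})" if "t \<in> {0..T}" for t
    using d(2)[OF that, of 0] by (simp add: d(1) \<psi>_def)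
  have cont: "continuous_on {0..T} \<psi>"
    unfolding \<psi>_def using d(2)[of _ 1] by (intro DERIV_continuous_on) auto
  have \<psi>L: "\<psi> \<in> Lp p M" by (rule continuous_Lp[OF cont])
  have \<psi>i: "integrable M \<psi>" by (rule Lp_integrable[OF p \<psi>L])
  define w where "w = conv (rl \<gamma>) \<psi>"
  have w: "w \<in> Lp p M" unfolding w_def by (rule schur(2)[OF p kernel_rl[OF \<gamma>] \<psi>L])
  have wi: "integrable M w" by (rule Lp_integrable[OF p w])
  have eq: "\<phi> t = K w t" if t: "t \<in> {0..T}" for t
  proof -
    have t': "0 \<le> t" "t \<le> T" using t by auto
    have "K w t = (LINT r|M. indicator {..t} r * \<psi> r)"
      unfolding w_def by (rule semigroup(2)) (use \<psi>i t \<alpha> in auto)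
    also have "\<dots> = (LINT r|lebesgue_on {0..t}. \<psi> r)" by (rule integral_Icc_M(1)[OF t', symmetric])
    also have "\<dots> = integral {0..t} \<psi>"
    proof (rule lebesgue_integral_eq_integral)
      show "integrable (lebesgue_on {0..t}) \<psi>"
        by (intro continuous_imp_integrable_real continuous_on_subset[OF cont]) (use t in auto)
    qed simp
    also have "\<dots> = \<phi> t - \<phi> 0"
    proof (rule integral_unique, rule fundamental_theorem_of_calculus)
      fix x assume "x \<in> {0..t}"
      then show "(\<phi> has_vector_derivative \<psi> x) (at x within {0..t})"
        using der[of x] t by (auto simp: has_real_derivative_iff_has_vector_derivative
            intro: has_vector_derivative_within_subset)
    qed (use t in auto)
    finally show ?thesis using z by simp
  qed
  show "left_RL_differentiable \<alpha> T \<phi>"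
    using eq K_differentiable(1)[OF wi] by (rule left_RL_deriv_cong(2))
  have "AE t in M. left_RL_deriv \<alpha> \<phi> t = left_RL_deriv \<alpha> (K w) t"
    using eq by (rule left_RL_deriv_cong(3))
  then have ae: "AE t in M. left_RL_deriv \<alpha> \<phi> t = w t"
    using K_differentiable(2)[OF wi] by eventually_elim simp
  show L: "left_RL_deriv \<alpha> \<phi> \<in> Lp p M" by (rule Lp_cong_AE[OF w ae])
  show "\<phi> t = K (left_RL_deriv \<alpha> \<phi>) t" if "t \<in> {0..T}" for t
    unfolding eq[OF that] using ae by (intro conv_cong_AE[symmetric] LpD(1)[OF L] LpD(1)[OF w] rl_measurable)
qed

end

section \<open>The fractional derivative space as a closed subspace of the Lebesgue space\<close>

context frac_interval begin

definition V :: "(real \<Rightarrow> real) set" where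
  "V = {v \<in> Lp p M. \<forall>e>0. \<exists>\<phi>\<in>C0_infinity T. Np p M (\<lambda>t. v t - left_RL_deriv \<alpha> \<phi> t) < e}"

definition "AK = (T powr \<alpha> / \<alpha> / Gamma \<alpha>) powr p"

lemma p_pos: "p > 0" using p by simp

lemma V_Lp: "v \<in> V \<Longrightarrow> v \<in> Lp p M"
  by (simp add: V_def)

lemma AK_nonneg: "AK \<ge> 0" by (simp add: AK_def)

lemma K_Lp: "v \<in> Lp p M \<Longrightarrow> K v \<in> Lp p M"
  by (rule schur(2)[OF p kernel_rl[OF \<alpha>(1)]])

lemma K_bd: "v \<in> Lp p M \<Longrightarrow> Np p M (K v) \<le> AK * Np p M v"
  unfolding AK_def by (rule schur(3)[OF p kernel_rl[OF \<alpha>(1)]])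

lemma K_lin:
  assumes "v \<in> Lp p M" "w \<in> Lp p M"
  shows "AE t in M. K (\<lambda>t. c * v t + d * w t) t = c * K v t + d * K w t"
  using schur(1)[OF p kernel_rl[OF \<alpha>(1)] assms(1)] schur(1)[OF p kernel_rl[OF \<alpha>(1)] assms(2)]
  by eventually_elim (rule conv_lin)

lemma K_diff_bd:
  assumes "v \<in> Lp p M" "w \<in> Lp p M"
  shows "Np p M (\<lambda>t. K v t - K w t) \<le> AK * Np p M (\<lambda>t. v t - w t)"
proof -
  have L: "(\<lambda>t. v t - w t) \<in> Lp p M" by (rule Lp_diff(1)[OF p_pos assms])
  have "AE t in M. K v t - K w t = K (\<lambda>t. v t - w t) t"
    using K_lin[OF assms, of 1 "-1"] by eventually_elim simp
  then have "Np p M (\<lambda>t. K v t - K w t) = Np p M (K (\<lambda>t. v t - w t))"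
    using LpD(1)[OF K_Lp[OF assms(1)]] LpD(1)[OF K_Lp[OF assms(2)]] LpD(1)[OF K_Lp[OF L]]
    by (intro Np_cong_AE) auto
  then show ?thesis using K_bd[OF L] by simp
qed

lemma V_lin:
  assumes "v \<in> V" "w \<in> V"
  shows "(\<lambda>t. c * v t + d * w t) \<in> V"
proof -
  note L = V_Lp[OF assms(1)] V_Lp[OF assms(2)]
  note lin = Lp_add(1)[OF p_pos Lp_scale Lp_scale]
  have "\<exists>\<phi>\<in>C0_infinity T. Np p M (\<lambda>t. c * v t + d * w t - left_RL_deriv \<alpha> \<phi> t) < e" if e: "e > 0" for e
  proof -
    define h where "h = 2 powr p * (\<bar>c\<bar> powr p + \<bar>d\<bar> powr p) + 1"
    have h: "h > 0" unfolding h_def by (intro add_nonneg_pos) auto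
    have eh: "e / h > 0" using e h by simp
    obtain \<phi> where \<phi>: "\<phi> \<in> C0_infinity T" "Np p M (\<lambda>t. v t - left_RL_deriv \<alpha> \<phi> t) < e / h"
      using assms(1) eh unfolding V_def by blast
    obtain \<psi> where \<psi>: "\<psi> \<in> C0_infinity T" "Np p M (\<lambda>t. w t - left_RL_deriv \<alpha> \<psi> t) < e / h"
      using assms(2) eh unfolding V_def by blast
    note D = C0_infinity_K(2)[OF \<phi>(1)] C0_infinity_K(2)[OF \<psi>(1)]
    note D' = C0_infinity_K(2)[OF C0_infinity_lin[OF \<phi>(1) \<psi>(1), of c d]]
    note d = Lp_diff(1)[OF p_pos L(1) D(1)] Lp_diff(1)[OF p_pos L(2) D(2)]
    have "AE t in M. left_RL_deriv \<alpha> (\<lambda>t. c * \<phi> t + d * \<psi> t) t = c * left_RL_deriv \<alpha> \<phi> t + d * left_RL_deriv \<alpha> \<psi> t"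
      by (rule left_RL_deriv_lin[OF C0_infinity_K(1)[OF \<phi>(1)] C0_infinity_K(1)[OF \<psi>(1)]])
    then have ae: "AE t in M. c * v t + d * w t - left_RL_deriv \<alpha> (\<lambda>t. c * \<phi> t + d * \<psi> t) t
        = c * (v t - left_RL_deriv \<alpha> \<phi> t) + d * (w t - left_RL_deriv \<alpha> \<psi> t)"
      by eventually_elim (simp add: algebra_simps)
    have "Np p M (\<lambda>t. c * v t + d * w t - left_RL_deriv \<alpha> (\<lambda>t. c * \<phi> t + d * \<psi> t) t)
        = Np p M (\<lambda>t. c * (v t - left_RL_deriv \<alpha> \<phi> t) + d * (w t - left_RL_deriv \<alpha> \<psi> t))"
      by (rule Np_cong_AE[OF LpD(1)[OF Lp_diff(1)[OF p_pos lin[OF L] D']] LpD(1)[OF lin[OF d]] ae])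
    also have "\<dots> \<le> 2 powr p * (Np p M (\<lambda>t. c * (v t - left_RL_deriv \<alpha> \<phi> t)) + Np p M (\<lambda>t. d * (w t - left_RL_deriv \<alpha> \<psi> t)))"
      by (rule Lp_add(2)[OF p_pos Lp_scale[OF d(1)] Lp_scale[OF d(2)]])
    also have "\<dots> \<le> 2 powr p * (\<bar>c\<bar> powr p * (e / h) + \<bar>d\<bar> powr p * (e / h))"
      unfolding Np_scale using \<phi>(2) \<psi>(2) by (intro mult_left_mono add_mono) auto
    also have "\<dots> = (h - 1) * (e / h)"
      unfolding h_def by (simp only: add_diff_cancel_right' distrib_right mult.assoc)
    also have "\<dots> < h * (e / h)" using eh by (intro mult_strict_right_mono) auto
    also have "\<dots> = e" using h by simp
    finally show ?thesis using C0_infinity_lin[OF \<phi>(1) \<psi>(1), of c d] by (intro bexI)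
  qed
  then show ?thesis using lin[OF L] by (simp add: V_def)
qed

lemma V_closed:
  assumes vn: "\<And>n. vn n \<in> V" and u: "u \<in> Lp p M" and lim: "(\<lambda>n. Np p M (\<lambda>t. vn n t - u t)) \<longlonglongrightarrow> 0"
  shows "u \<in> V"
proof -
  have "\<exists>\<phi>\<in>C0_infinity T. Np p M (\<lambda>t. u t - left_RL_deriv \<alpha> \<phi> t) < e" if e: "e > 0" for e
  proof -
    define k where "k = e / (2 * 2 powr p)"
    have k: "k > 0" using e by (simp add: k_def)
    obtain n where n: "Np p M (\<lambda>t. vn n t - u t) < k"
      using order_tendstoD(2)[OF lim k] eventually_happens[of _ sequentially] by auto
    obtain \<phi> where \<phi>: "\<phi> \<in> C0_infinity T" "Np p M (\<lambda>t. vn n t - left_RL_deriv \<alpha> \<phi> t) < k"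
      using vn[of n] k unfolding V_def by blast
    have "Np p M (\<lambda>t. u t - left_RL_deriv \<alpha> \<phi> t)
        \<le> 2 powr p * (Np p M (\<lambda>t. u t - vn n t) + Np p M (\<lambda>t. vn n t - left_RL_deriv \<alpha> \<phi> t))"
      by (rule Np_triangle[OF p_pos u V_Lp[OF vn] C0_infinity_K(2)[OF \<phi>(1)]])
    also have "\<dots> < 2 powr p * (k + k)"
      using n \<phi>(2) by (intro mult_strict_left_mono add_strict_mono) (auto simp: Np_minus_commute[of p M u])
    also have "\<dots> = e" by (simp add: k_def)
    finally show ?thesis using \<phi>(1) by blast
  qed
  then show ?thesis using u by (simp add: V_def)
qed

lemma deriv_C0_infinity_V:
  assumes "\<phi> \<in> C0_infinity T"
  shows "left_RL_deriv \<alpha> \<phi> \<in> V"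
  unfolding V_def using C0_infinity_K(2)[OF assms] p_pos
  by (auto intro!: bexI[OF _ assms] simp: Np_def)

text \<open>The polynomials \<open>t ^ (i + 1) * (T - t)\<close>: smooth, linearly independent and
  zero at both ends.\<close>

definition bump :: "nat \<Rightarrow> real poly" where
  "bump i = [:0, T, - 1:] * Polynomial.monom 1 i"

lemma bump_C0_infinity: "poly (bump i) \<in> C0_infinity T"
  unfolding C0_infinity_def
proof (intro CollectI conjI exI[of _ "\<lambda>k. poly ((pderiv ^^ k) (bump i))"] allI ballI)
  show "(poly ((pderiv ^^ k) (bump i)) has_real_derivative poly ((pderiv ^^ Suc k) (bump i)) t) (at t within {0..T})" for k t
    using poly_DERIV[of "(pderiv ^^ k) (bump i)" t] by (simp add: has_field_derivative_at_within)
qed (simp_all add: bump_def)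

definition "E i = left_RL_deriv \<alpha> (poly (bump i))"

lemma E_V: "E i \<in> V"
  unfolding E_def by (rule deriv_C0_infinity_V[OF bump_C0_infinity])

text \<open>\<open>K\<close> recovers the test functions from their derivatives, so the image of the
  combination is almost everywhere a nonzero polynomial, which has only finitely many roots.\<close>

lemma E_indep:
  assumes i: "i \<le> m" "x i \<noteq> 0"
  shows "\<not> (AE t in M. K (\<lambda>t. \<Sum>i\<le>m. x i * E i t) t = 0)"
proof
  assume Z: "AE t in M. K (\<lambda>t. \<Sum>i\<le>m. x i * E i t) t = 0"
  define Q where "Q = (\<Sum>i\<le>m. Polynomial.monom (x i) i)"
  define P where "P = [:0, T, - 1:] * Q"
  have "poly.coeff Q i = x i" using i(1) by (simp add: Q_def coeff_sum)
  then have Q0: "Q \<noteq> 0" using i(2) by auto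
  then have P0: "P \<noteq> 0" unfolding P_def mult_eq_0_iff by (simp del: mult_pCons_left)
  have P: "poly P t = (\<Sum>i\<le>m. x i * poly (bump i) t)" for t
    by (simp add: P_def Q_def bump_def poly_sum poly_monom sum_distrib_left algebra_simps)
  have int: "AE t in M. \<forall>i. integrable M (\<lambda>s. rl \<alpha> (t - s) * E i s)"
    unfolding AE_all_countable using schur(1)[OF p kernel_rl[OF \<alpha>(1)] V_Lp[OF E_V]] by blast
  have "AE t in M. t \<notin> {t. poly P t = 0}"
  proof -
    have "negligible {t. poly P t = 0}" by (intro negligible_finite poly_roots_finite P0)
    then have "AE t in lebesgue. t \<notin> {t. poly P t = 0}" by (intro AE_not_in) (simp only: negligible_iff_null_sets)
    then have "AE t in lebesgue. t \<in> {0..T} \<longrightarrow> t \<notin> {t. poly P t = 0}" by eventually_elim blast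
    moreover have "(AE t in M. t \<notin> {t. poly P t = 0}) = (AE t in lebesgue. t \<in> {0..T} \<longrightarrow> t \<notin> {t. poly P t = 0})"
      by (rule AE_restrict_space_iff) simp
    ultimately show ?thesis by (simp only:)
  qed
  with int Z AE_space[of M] have "AE t in M. False"
  proof eventually_elim
    fix t assume int: "\<forall>i. integrable M (\<lambda>s. rl \<alpha> (t - s) * E i s)" and z: "K (\<lambda>t. \<Sum>i\<le>m. x i * E i t) t = 0"
      and n: "t \<notin> {t. poly P t = 0}" and "t \<in> space M"
    then have t: "t \<in> {0..T}" by simp
    have "K (\<lambda>t. \<Sum>i\<le>m. x i * E i t) t = (LINT s|M. (\<Sum>i\<le>m. x i * (rl \<alpha> (t - s) * E i s)))"
      unfolding conv_def sum_distrib_left by (intro Bochner_Integration.integral_cong sum.cong refl) (simp only: mult_ac)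
    also have "\<dots> = (\<Sum>i\<le>m. (LINT s|M. x i * (rl \<alpha> (t - s) * E i s)))"
      using int by (intro Bochner_Integration.integral_sum) simp
    also have "\<dots> = (\<Sum>i\<le>m. x i * K (E i) t)"
      by (simp only: integral_mult_right_zero conv_def)
    also have "\<dots> = poly P t"
      unfolding P E_def using C0_infinity_K(3)[OF bump_C0_infinity t] by simp
    finally show False using z n by simp
  qed
  then have "AE t in M. t \<notin> space M" by (rule eventually_mono) (rule FalseE)
  then have "space M \<in> null_sets M" by (rule AE_iff_null_sets[OF sets.top, THEN iffD2])
  then have "measure M {0..T} = 0" by (simp add: measure_def null_sets_def)
  then show False using measure_M T by simp
qed

lemma frac_norm_less:
  assumes "e > 0" "Np p M u + Np p M (left_RL_deriv \<alpha> u) < e powr p"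
  shows "frac_norm \<alpha> p T u < e"
proof -
  have "frac_norm \<alpha> p T u = (Np p M u + Np p M (left_RL_deriv \<alpha> u)) powr (1 / p)"
    by (simp only: frac_norm_def Np_def)
  also have "\<dots> < (e powr p) powr (1 / p)"
    using assms p Np_nonneg[of p M] by (intro powr_less_mono2) (auto intro: add_nonneg_nonneg)
  also have "\<dots> = e" using assms(1) p by (simp add: powr_powr)
  finally show ?thesis .
qed

lemma frac_norm_lessD:
  assumes "frac_norm \<alpha> p T u < e"
  shows "Np p M u + Np p M (left_RL_deriv \<alpha> u) < e powr p"
proof -
  define n where "n = Np p M u + Np p M (left_RL_deriv \<alpha> u)"
  have n: "n \<ge> 0" using Np_nonneg[of p M] by (simp add: n_def)
  have "frac_norm \<alpha> p T u = n powr (1 / p)"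
    by (simp only: frac_norm_def Np_def n_def)
  then have "(n powr (1 / p)) powr p < e powr p"
    using assms p by (intro powr_less_mono2) auto
  then show ?thesis using n p by (simp add: powr_powr n_def)
qed

lemma Lp_space_eq: "Lp_space p T = Lp p M"
  by (simp only: Lp_space_def Lp_def)

text \<open>Approximating the derivative is enough, since \<open>K_diff_bd\<close> then controls the
  distance of the functions themselves.\<close>

lemma K_frac_space:
  assumes v: "v \<in> V"
  shows "K v \<in> frac_space \<alpha> p T"
proof -
  note L = V_Lp[OF v]
  note d = K_differentiable[OF Lp_integrable[OF p L]]
  have DL: "left_RL_deriv \<alpha> (K v) \<in> Lp p M" by (rule Lp_cong_AE[OF L d(2)])
  have "\<exists>\<phi>\<in>C0_infinity T. frac_norm \<alpha> p T (\<lambda>t. K v t - \<phi> t) < e" if e: "e > 0" for e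
  proof -
    have "e powr p / (AK + 1) > 0" using e AK_nonneg by simp
    then obtain \<phi> where \<phi>: "\<phi> \<in> C0_infinity T" "Np p M (\<lambda>t. v t - left_RL_deriv \<alpha> \<phi> t) < e powr p / (AK + 1)"
      using v unfolding V_def by blast
    note c = C0_infinity_K[OF \<phi>(1)]
    note LD = Lp_diff(1)[OF p_pos L c(2)]
    have ae: "AE t in M. left_RL_deriv \<alpha> (\<lambda>t. K v t - \<phi> t) t = v t - left_RL_deriv \<alpha> \<phi> t"
      using left_RL_deriv_lin[OF d(1) c(1), of 1 "-1"] d(2) by eventually_elim simp
    have "Np p M (left_RL_deriv \<alpha> (\<lambda>t. K v t - \<phi> t)) = Np p M (\<lambda>t. v t - left_RL_deriv \<alpha> \<phi> t)"
      by (rule Np_cong_AE[OF LpD(1)[OF Lp_cong_AE[OF LD ae]] LpD(1)[OF LD] ae])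
    moreover have "Np p M (\<lambda>t. K v t - \<phi> t) \<le> AK * Np p M (\<lambda>t. v t - left_RL_deriv \<alpha> \<phi> t)"
    proof -
      have "Np p M (\<lambda>t. K v t - \<phi> t) = Np p M (\<lambda>t. K v t - K (left_RL_deriv \<alpha> \<phi>) t)"
        unfolding Np_def by (intro Bochner_Integration.integral_cong refl) (simp add: c(3)[symmetric])
      then show ?thesis using K_diff_bd[OF L c(2)] by simp
    qed
    moreover have "(AK + 1) * Np p M (\<lambda>t. v t - left_RL_deriv \<alpha> \<phi> t) < e powr p"
      using \<phi>(2) AK_nonneg by (simp add: pos_less_divide_eq mult.commute)
    ultimately have "Np p M (\<lambda>t. K v t - \<phi> t) + Np p M (left_RL_deriv \<alpha> (\<lambda>t. K v t - \<phi> t)) < e powr p"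
      by (simp add: distrib_right)
    then show ?thesis using frac_norm_less[OF e] \<phi>(1) by blast
  qed
  then show ?thesis
    unfolding frac_space_def Lp_space_eq using K_Lp[OF L] d(1) DL by blast
qed

text \<open>The representation holds for test functions and passes to the closure: convergence in
  \<open>frac_norm\<close> makes both the functions and their derivatives converge, and
  \<open>K\<close> is continuous.\<close>

lemma frac_space_K:
  assumes u: "u \<in> frac_space \<alpha> p T"
  shows "left_RL_deriv \<alpha> u \<in> V" "AE t in M. u t = K (left_RL_deriv \<alpha> u) t"
proof -
  have L: "u \<in> Lp p M" "left_RL_deriv \<alpha> u \<in> Lp p M" and d: "left_RL_differentiable \<alpha> T u"
    using u unfolding frac_space_def Lp_space_eq by auto
  have approx: "\<exists>\<phi>\<in>C0_infinity T. Np p M (\<lambda>t. u t - \<phi> t) < e \<and> Np p M (\<lambda>t. left_RL_deriv \<alpha> u t - left_RL_deriv \<alpha> \<phi> t) < e"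
    if e: "e > 0" for e
  proof -
    have "e powr (1 / p) > 0" using e by simp
    then obtain \<phi> where \<phi>: "\<phi> \<in> C0_infinity T" "frac_norm \<alpha> p T (\<lambda>t. u t - \<phi> t) < e powr (1 / p)"
      using u unfolding frac_space_def by blast
    have "(e powr (1 / p)) powr p = e" using e p by (simp add: powr_powr)
    then have n: "Np p M (\<lambda>t. u t - \<phi> t) + Np p M (left_RL_deriv \<alpha> (\<lambda>t. u t - \<phi> t)) < e"
      using frac_norm_lessD[OF \<phi>(2)] by simp
    note c = C0_infinity_K[OF \<phi>(1)]
    note LD = Lp_diff(1)[OF p_pos L(2) c(2)]
    have ae: "AE t in M. left_RL_deriv \<alpha> (\<lambda>t. u t - \<phi> t) t = left_RL_deriv \<alpha> u t - left_RL_deriv \<alpha> \<phi> t"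
      using left_RL_deriv_lin[OF d c(1), of 1 "-1"] by simp
    have "Np p M (left_RL_deriv \<alpha> (\<lambda>t. u t - \<phi> t)) = Np p M (\<lambda>t. left_RL_deriv \<alpha> u t - left_RL_deriv \<alpha> \<phi> t)"
      by (rule Np_cong_AE[OF LpD(1)[OF Lp_cong_AE[OF LD ae]] LpD(1)[OF LD] ae])
    then have "Np p M (\<lambda>t. u t - \<phi> t) < e \<and> Np p M (\<lambda>t. left_RL_deriv \<alpha> u t - left_RL_deriv \<alpha> \<phi> t) < e"
      using n Np_nonneg[of p M "\<lambda>t. u t - \<phi> t"] Np_nonneg[of p M "\<lambda>t. left_RL_deriv \<alpha> u t - left_RL_deriv \<alpha> \<phi> t"]
      by linarith
    then show ?thesis using \<phi>(1) by blast
  qed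
  show "left_RL_deriv \<alpha> u \<in> V" unfolding V_def using L(2) approx by blast
  define G where "G = Np p M (\<lambda>t. u t - K (left_RL_deriv \<alpha> u) t)"
  \<comment> \<open>The total loss in the comparison below: the triangle inequality, and
    \<open>K\<close> applied to the error of the derivative.\<close>
  define h where "h = 2 powr p * (1 + AK)"
  have h: "h > 0" using AK_nonneg by (simp add: h_def)
  have KL: "K (left_RL_deriv \<alpha> u) \<in> Lp p M" by (rule K_Lp[OF L(2)])
  have "G \<le> e" if e: "e > 0" for e
  proof -
    have "e / h > 0" using e h by simp
    then obtain \<phi> where \<phi>: "\<phi> \<in> C0_infinity T" "Np p M (\<lambda>t. u t - \<phi> t) < e / h"
      "Np p M (\<lambda>t. left_RL_deriv \<alpha> u t - left_RL_deriv \<alpha> \<phi> t) < e / h" using approx by blast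
    note c = C0_infinity_K[OF \<phi>(1)]
    have \<phi>K: "Np p M (\<lambda>t. u t - K (left_RL_deriv \<alpha> \<phi>) t) = Np p M (\<lambda>t. u t - \<phi> t)"
      unfolding Np_def by (intro Bochner_Integration.integral_cong refl) (simp add: c(3)[symmetric])
    have "G \<le> 2 powr p * (Np p M (\<lambda>t. u t - K (left_RL_deriv \<alpha> \<phi>) t)
        + Np p M (\<lambda>t. K (left_RL_deriv \<alpha> \<phi>) t - K (left_RL_deriv \<alpha> u) t))"
      unfolding G_def by (rule Np_triangle[OF p_pos L(1) K_Lp[OF c(2)] KL])
    also have "\<dots> \<le> 2 powr p * (e / h + AK * (e / h))"
    proof (intro mult_left_mono add_mono)
      show "Np p M (\<lambda>t. u t - K (left_RL_deriv \<alpha> \<phi>) t) \<le> e / h" using \<phi>K \<phi>(2) by simp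
      have "Np p M (\<lambda>t. K (left_RL_deriv \<alpha> \<phi>) t - K (left_RL_deriv \<alpha> u) t)
          \<le> AK * Np p M (\<lambda>t. left_RL_deriv \<alpha> \<phi> t - left_RL_deriv \<alpha> u t)" by (rule K_diff_bd[OF c(2) L(2)])
      also have "\<dots> \<le> AK * (e / h)"
        using \<phi>(3) AK_nonneg by (intro mult_left_mono) (auto simp: Np_minus_commute[of p M "left_RL_deriv \<alpha> \<phi>"])
      finally show "Np p M (\<lambda>t. K (left_RL_deriv \<alpha> \<phi>) t - K (left_RL_deriv \<alpha> u) t) \<le> AK * (e / h)" .
    qed simp
    also have "\<dots> = h * (e / h)" by (simp only: h_def distrib_left distrib_right mult_1 mult_1_right mult.assoc)
    also have "\<dots> = e" using h by simp
    finally show ?thesis .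
  qed
  then have "G \<le> 0" by (rule field_le_epsilon[of G 0, simplified])
  then have "G = 0" using Np_nonneg[of p M] by (simp add: G_def antisym)
  then have "AE t in M. u t - K (left_RL_deriv \<alpha> u) t = 0"
    unfolding G_def using Np_eq_0_iff[OF Lp_diff(1)[OF p_pos L(1) KL]] by blast
  then show "AE t in M. u t = K (left_RL_deriv \<alpha> u) t" by simp
qed

end

section \<open>The nonlinearity\<close>

locale sublinear_potential =
  fixes T p q :: real and f :: "real \<Rightarrow> real \<Rightarrow> real" and a b :: "real \<Rightarrow> real"
  assumes T: "T > 0" and p: "1 < p" and q: "1 < q" "q < p"
    and f_cont: "continuous_on ({0..T} \<times> UNIV) (\<lambda>(t, x). f t x)"
    and a: "continuous_on {0..T} a" "\<forall>t\<in>{0..T}. a t > 0"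
    and b: "continuous_on {0..T} b" "\<forall>t\<in>{0..T}. b t > 0"
    and lower: "\<forall>t\<in>{0..T}. \<forall>x. primitive f t x \<ge> a t * \<bar>x\<bar> powr q"
    and upper: "\<forall>t\<in>{0..T}. \<forall>x. \<bar>f t x\<bar> \<le> q * b t * \<bar>x\<bar> powr (q - 1)"
    and symmetric: "\<forall>t\<in>{0..T}. \<forall>x. primitive f t x = primitive f t (- x)"
begin

lemma f_slice: "t \<in> {0..T} \<Longrightarrow> continuous_on S (f t)"
proof -
  assume t: "t \<in> {0..T}"
  have "continuous_on S (\<lambda>x. (\<lambda>(t, x). f t x) (t, x))"
    by (rule continuous_on_compose2[OF f_cont]) (use t in \<open>auto intro: continuous_intros\<close>)
  then show ?thesis by simp
qed

lemma primitive_deriv: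
  assumes t: "t \<in> {0..T}"
  shows "(primitive f t has_real_derivative f t x) (at x)"
proof -
  define m where "m = \<bar>x\<bar> + 1"
  have m: "- m \<le> 0" "0 \<le> m" "- m < x" "x < m" by (auto simp: m_def)
  have "((\<lambda>u. LBINT s=ereal 0..ereal u. f t s) has_vector_derivative f t x) (at x within {- m..m})"
    by (rule interval_integral_FTC2[OF m(1,2) f_slice[OF t]]) (use m in auto)
  moreover have "at x within {- m..m} = at x" by (rule at_within_interior) (use m in simp)
  ultimately show ?thesis
    by (simp add: primitive_def[abs_def] has_real_derivative_iff_has_vector_derivative)
qed

lemma primitive_zero: "primitive f t 0 = 0"
  by (simp add: primitive_def)

lemma primitive_mvt:
  assumes t: "t \<in> {0..T}"
  shows "\<exists>\<xi>. \<bar>\<xi> - x\<bar> \<le> \<bar>y - x\<bar> \<and> primitive f t y - primitive f t x = f t \<xi> * (y - x)"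
proof (cases x y rule: linorder_cases)
  case less
  obtain z where "x < z" "z < y" "primitive f t y - primitive f t x = (y - x) * f t z"
    using MVT2[OF less, of "primitive f t" "f t"] primitive_deriv[OF t] by blast
  then show ?thesis by (intro exI[of _ z]) auto
next
  case greater
  obtain z where "y < z" "z < x" "primitive f t x - primitive f t y = (x - y) * f t z"
    using MVT2[OF greater, of "primitive f t" "f t"] primitive_deriv[OF t] by blast
  then show ?thesis by (intro exI[of _ z]) (auto simp: algebra_simps)
qed auto

text \<open>Differentiating the evenness of the primitive.\<close>

lemma f_odd:
  assumes t: "t \<in> {0..T}"
  shows "f t (- x) = - f t x"
proof -
  have "((\<lambda>x. primitive f t (- x)) has_real_derivative f t (- x) * - 1) (at x)"
    by (rule DERIV_chain2[OF primitive_deriv[OF t] DERIV_minus[OF DERIV_ident]])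
  moreover have "(\<lambda>x. primitive f t (- x)) = primitive f t"
    using symmetric t by (intro ext) metis
  ultimately have "(primitive f t has_real_derivative f t (- x) * - 1) (at x)" by (simp only:)
  then have "f t (- x) * - 1 = f t x" using primitive_deriv[OF t] by (rule DERIV_unique)
  then show ?thesis by simp
qed

lemma a_min: obtains a0 where "a0 > 0" "\<And>t x. t \<in> {0..T} \<Longrightarrow> primitive f t x \<ge> a0 * \<bar>x\<bar> powr q"
proof -
  obtain t0 where t0: "t0 \<in> {0..T}" "\<forall>t\<in>{0..T}. a t0 \<le> a t"
    using continuous_attains_inf[OF compact_Icc _ a(1)] T by auto
  show ?thesis
  proof (rule that[of "a t0"])
    fix t x assume t: "t \<in> {0..T}"
    have "a t0 * \<bar>x\<bar> powr q \<le> a t * \<bar>x\<bar> powr q" using t0 t by (intro mult_right_mono) auto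
    then show "primitive f t x \<ge> a t0 * \<bar>x\<bar> powr q" using lower t by (meson order_trans)
  qed (use a t0 in auto)
qed

lemma b_max: obtains A' where "A' \<ge> 0" "\<And>t x. t \<in> {0..T} \<Longrightarrow> \<bar>f t x\<bar> \<le> A' * \<bar>x\<bar> powr (q - 1)"
proof -
  obtain t0 where t0: "t0 \<in> {0..T}" "\<forall>t\<in>{0..T}. b t \<le> b t0"
    using continuous_attains_sup[OF compact_Icc _ b(1)] T by auto
  show ?thesis
  proof (rule that[of "q * b t0"])
    show "q * b t0 \<ge> 0" using b t0 q by (simp add: less_imp_le)
    fix t x assume t: "t \<in> {0..T}"
    have "q * b t * \<bar>x\<bar> powr (q - 1) \<le> q * b t0 * \<bar>x\<bar> powr (q - 1)"
      using t0 t q by (intro mult_right_mono mult_left_mono) auto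
    then show "\<bar>f t x\<bar> \<le> q * b t0 * \<bar>x\<bar> powr (q - 1)" using upper t by (meson order_trans)
  qed
qed

lemma superposition_measurable:
  fixes g :: "real \<Rightarrow> real \<Rightarrow> real"
  assumes g: "continuous_on ({0..T} \<times> UNIV) (\<lambda>(t, x). g t x)" and u: "u \<in> borel_measurable (lebesgue_on {0..T})"
  shows "(\<lambda>t. g t (u t)) \<in> borel_measurable (lebesgue_on {0..T})"
proof -
  let ?M = "lebesgue_on {0..T}"
  have id: "(\<lambda>t. t) \<in> borel_measurable ?M"
    by (rule measurable_restrict_space1) (use borel_measurable_const in \<open>simp add: measurable_completion\<close>)
  have "(\<lambda>t. (t, u t)) \<in> ?M \<rightarrow>\<^sub>M borel" by (rule borel_measurable_Pair[OF id u])
  then have "(\<lambda>t. (t, u t)) \<in> ?M \<rightarrow>\<^sub>M restrict_space borel ({0..T} \<times> UNIV)"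
    by (rule measurable_restrict_space2[rotated]) auto
  moreover have "(\<lambda>(t, x). g t x) \<in> borel_measurable (restrict_space borel ({0..T} \<times> UNIV))"
    by (rule borel_measurable_continuous_on_restrict[OF g])
  ultimately have "(\<lambda>t. (\<lambda>(t, x). g t x) (t, u t)) \<in> borel_measurable ?M" by (rule measurable_compose)
  then show ?thesis by simp
qed

text \<open>Rescaling to a fixed interval of integration makes joint continuity in
  \<open>(t, x)\<close> a matter of continuous dependence on parameters, and it covers both signs of
  \<open>x\<close>.\<close>

lemma primitive_scaled:
  assumes t: "t \<in> {0..T}"
  shows "primitive f t x = x * integral {0..1} (\<lambda>\<theta>. f t (\<theta> * x))"
proof -
  have "((\<lambda>\<theta>. f t (\<theta> * x) * x) has_integral primitive f t (1 * x) - primitive f t (0 * x)) {0..1}"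
  proof (rule fundamental_theorem_of_calculus)
    fix \<theta> :: real
    have "((\<lambda>\<theta>. primitive f t (\<theta> * x)) has_real_derivative f t (\<theta> * x) * x) (at \<theta>)"
      by (rule DERIV_chain2[where f = "primitive f t" and g = "\<lambda>\<theta>. \<theta> * x", OF primitive_deriv[OF t]])
         (auto intro!: derivative_eq_intros)
    then show "((\<lambda>\<theta>. primitive f t (\<theta> * x)) has_vector_derivative f t (\<theta> * x) * x) (at \<theta> within {0..1})"
      by (simp add: has_real_derivative_iff_has_vector_derivative has_vector_derivative_at_within)
  qed simp
  from integral_unique[OF this] have "integral {0..1} (\<lambda>\<theta>. f t (\<theta> * x) * x) = primitive f t x"
    by (simp only: mult_1 mult_zero_left primitive_zero diff_0_right)
  then show ?thesis by (simp add: mult.commute)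
qed

lemma primitive_cont: "continuous_on ({0..T} \<times> UNIV) (\<lambda>(t, x). primitive f t x)"
proof -
  have "continuous_on (({0..T} \<times> UNIV) \<times> cbox 0 1) (\<lambda>z. (\<lambda>(t, x). f t x) (fst (fst z), snd z * snd (fst z)))"
    by (rule continuous_on_compose2[OF f_cont]) (auto intro!: continuous_intros)
  then have "continuous_on ({0..T} \<times> UNIV) (\<lambda>z. integral (cbox 0 1) (\<lambda>\<theta>. f (fst z) (\<theta> * snd z)))"
    by (intro integral_continuous_on_param) (simp add: case_prod_unfold)
  then have "continuous_on ({0..T} \<times> UNIV) (\<lambda>z. snd z * integral {0..1} (\<lambda>\<theta>. f (fst z) (\<theta> * snd z)))"
    by (intro continuous_intros) simp
  then show ?thesis
    by (rule continuous_on_eq) (auto simp: primitive_scaled)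
qed

text \<open>For bounded arguments that are close the estimate is uniform continuity; if the arguments are
  bounded but not close, the last term absorbs everything; large arguments are absorbed by the
  first term because \<open>q < p\<close>.\<close>

lemma nemytskii_modulus:
  assumes e: "e > 0"
  shows "\<exists>C\<ge>0. \<forall>t\<in>{0..T}. \<forall>x x' y. \<bar>f t x - f t x'\<bar> * \<bar>y\<bar>
      \<le> e * (1 + \<bar>x\<bar> powr p + \<bar>y\<bar> powr p) + C * \<bar>x - x'\<bar> powr p"
proof -
  obtain A where A: "A \<ge> 0" "\<And>t x. t \<in> {0..T} \<Longrightarrow> \<bar>f t x\<bar> \<le> A * \<bar>x\<bar> powr (q - 1)"
    by (rule b_max) blast
  define A2 where "A2 = A * (1 + 2 powr (q - 1)) + 1"
  have A2: "A2 > 0" using A(1) unfolding A2_def by (intro add_nonneg_pos) auto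
  \<comment> \<open>Beyond \<open>L\<close> the gap between the exponents \<open>q - 1\<close> and
    \<open>p - 1\<close> absorbs the growth constant:
    \<open>A2 * L powr (q - p) \<le> e\<close>.\<close>
  define L where "L = 1 + (e / A2) powr (1 / (q - p))"
  have L: "L \<ge> 1" by (simp add: L_def)
  have "L powr (q - p) \<le> ((e / A2) powr (1 / (q - p))) powr (q - p)"
    using q e A2 by (intro powr_mono2') (auto simp: L_def)
  also have "\<dots> = e / A2" using q e A2 by (simp add: powr_powr)
  finally have Lq: "A2 * L powr (q - p) \<le> e" using A2 by (simp add: field_simps)
  have "compact ({0..T} \<times> {- (L + 1)..L + 1})" by (intro compact_Times compact_Icc)
  then have "uniformly_continuous_on ({0..T} \<times> {- (L + 1)..L + 1}) (\<lambda>(t, x). f t x)"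
    by (intro compact_uniformly_continuous continuous_on_subset[OF f_cont]) auto
  then obtain \<eta>0 where \<eta>0: "\<eta>0 > 0" "\<And>t x x'. t \<in> {0..T} \<Longrightarrow> \<bar>x\<bar> \<le> L + 1 \<Longrightarrow> \<bar>x'\<bar> \<le> L + 1 \<Longrightarrow> \<bar>x - x'\<bar> < \<eta>0
      \<Longrightarrow> \<bar>f t x - f t x'\<bar> < e"
  proof -
    assume u: "uniformly_continuous_on ({0..T} \<times> {- (L + 1)..L + 1}) (\<lambda>(t, x). f t x)"
    obtain d where d: "d > 0" "\<forall>z\<in>{0..T} \<times> {- (L + 1)..L + 1}. \<forall>z'\<in>{0..T} \<times> {- (L + 1)..L + 1}.
        dist z' z < d \<longrightarrow> dist ((\<lambda>(t, x). f t x) z') ((\<lambda>(t, x). f t x) z) < e"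
      using u e unfolding uniformly_continuous_on_def by meson
    assume *: "\<And>\<eta>0. 0 < \<eta>0 \<Longrightarrow> (\<And>t x x'. t \<in> {0..T} \<Longrightarrow> \<bar>x\<bar> \<le> L + 1 \<Longrightarrow> \<bar>x'\<bar> \<le> L + 1 \<Longrightarrow> \<bar>x - x'\<bar> < \<eta>0
      \<Longrightarrow> \<bar>f t x - f t x'\<bar> < e) \<Longrightarrow> thesis"
    show thesis
    proof (rule *[OF d(1)])
      fix t x x' assume h: "t \<in> {0..T}" "\<bar>x\<bar> \<le> L + 1" "\<bar>x'\<bar> \<le> L + 1" "\<bar>x - x'\<bar> < d"
      have "(t, x) \<in> {0..T} \<times> {- (L + 1)..L + 1}" "(t, x') \<in> {0..T} \<times> {- (L + 1)..L + 1}" using h by auto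
      moreover have "dist (t, x) (t, x') < d" using h(4) by (simp add: dist_Pair_Pair dist_real_def)
      ultimately show "\<bar>f t x - f t x'\<bar> < e" using d(2) by (fastforce simp: dist_real_def)
    qed
  qed
  define \<eta> where "\<eta> = min \<eta>0 1"
  have \<eta>: "\<eta> > 0" "\<eta> \<le> \<eta>0" "\<eta> \<le> 1" using \<eta>0(1) by (auto simp: \<eta>_def)
  \<comment> \<open>The first bound leaves half of \<open>e\<close> for the term
    \<open>B * \<bar>y\<bar>\<close>; the second pays the factor \<open>2 powr p\<close> for
    splitting \<open>z = \<bar>x\<bar> + d\<close>.\<close>
  define c where "c = min (e / 2) (e / 2 powr p)"
  have c: "c > 0" "c \<le> e / 2" "c * 2 powr p \<le> e"
    using e by (auto simp: c_def min_def field_simps)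
  obtain B where B: "B \<ge> 0" "\<And>z. 2 * A * \<bar>z\<bar> powr (q - 1) \<le> c * \<bar>z\<bar> powr (p - 1) + B"
  proof -
    have cA: "c / (2 * A + 1) > 0" using c(1) A(1) by simp
    obtain B where B: "B \<ge> 0" "\<And>z. \<bar>z\<bar> powr (q - 1) \<le> c / (2 * A + 1) * \<bar>z\<bar> powr (p - 1) + B"
      by (rule powr_le_eps_powr[of "q - 1" "p - 1" "c / (2 * A + 1)"]) (use q cA in auto)
    have "2 * A * \<bar>z\<bar> powr (q - 1) \<le> c * \<bar>z\<bar> powr (p - 1) + 2 * A * B" for z
    proof -
      have "2 * A * \<bar>z\<bar> powr (q - 1) \<le> 2 * A * (c / (2 * A + 1) * \<bar>z\<bar> powr (p - 1) + B)"
        using A(1) by (intro mult_left_mono[OF B(2)]) auto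
      also have "\<dots> = 2 * A / (2 * A + 1) * (c * \<bar>z\<bar> powr (p - 1)) + 2 * A * B" by (simp add: distrib_left)
      also have "\<dots> \<le> 1 * (c * \<bar>z\<bar> powr (p - 1)) + 2 * A * B"
        using A(1) c(1) B(1) by (intro add_mono mult_right_mono) auto
      finally show ?thesis by simp
    qed
    then show ?thesis using that[of "2 * A * B"] A(1) B(1) by simp
  qed
  obtain D where D: "D \<ge> 0" "\<And>y. B * \<bar>y\<bar> \<le> e / 2 * \<bar>y\<bar> powr p + D"
  proof -
    have eB: "e / (2 * (B + 1)) > 0" using e B(1) by simp
    obtain D where D: "D \<ge> 0" "\<And>y. \<bar>y\<bar> powr 1 \<le> e / (2 * (B + 1)) * \<bar>y\<bar> powr p + D"
      by (rule powr_le_eps_powr[of 1 p "e / (2 * (B + 1))"]) (use p eB in auto)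
    have "B * \<bar>y\<bar> \<le> e / 2 * \<bar>y\<bar> powr p + B * D" for y
    proof -
      have "B * \<bar>y\<bar> \<le> B * (e / (2 * (B + 1)) * \<bar>y\<bar> powr p + D)"
        using D(2)[of y] B(1) by (intro mult_left_mono) auto
      also have "\<dots> = B / (B + 1) * (e / 2 * \<bar>y\<bar> powr p) + B * D" by (simp add: distrib_left)
      also have "\<dots> \<le> 1 * (e / 2 * \<bar>y\<bar> powr p) + B * D"
        using B(1) D(1) e by (intro add_mono mult_right_mono) auto
      finally show ?thesis by simp
    qed
    then show ?thesis using that[of "B * D"] D(1) B(1) by simp
  qed
  \<comment> \<open>The summand \<open>e\<close> takes the share of \<open>d\<close> in
    \<open>z powr p\<close>; the other one absorbs the constant \<open>D\<close>, as
    \<open>d \<ge> \<eta>\<close> in the case of distant arguments.\<close>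
  define C where "C = e + D / \<eta> powr p"
  have C: "C \<ge> 0" using e D(1) by (simp add: C_def)
  have main: "\<bar>f t x - f t x'\<bar> * \<bar>y\<bar> \<le> e * (1 + \<bar>x\<bar> powr p + \<bar>y\<bar> powr p) + C * \<bar>x - x'\<bar> powr p"
    if t: "t \<in> {0..T}" for t x x' y
  proof -
    consider "\<bar>x - x'\<bar> < \<eta>" "\<bar>x\<bar> \<le> L" | "\<bar>x - x'\<bar> < \<eta>" "\<bar>x\<bar> > L" | "\<bar>x - x'\<bar> \<ge> \<eta>" by linarith
    then show ?thesis
    proof cases
      case 1
      have "\<bar>f t x - f t x'\<bar> < e" using 1 \<eta> by (intro \<eta>0(2)[OF t]) auto
      then have "\<bar>f t x - f t x'\<bar> * \<bar>y\<bar> \<le> e * \<bar>y\<bar>" by (intro mult_right_mono) auto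
      also have "\<dots> \<le> e * (1 + \<bar>x\<bar> powr p + \<bar>y\<bar> powr p)"
      proof (rule mult_left_mono)
        have "\<bar>y\<bar> \<le> 1 + \<bar>y\<bar> powr p" using powr_diff_one_mult_le[OF p, of 1 y] by simp
        then show "\<bar>y\<bar> \<le> 1 + \<bar>x\<bar> powr p + \<bar>y\<bar> powr p" using powr_ge_zero[of "\<bar>x\<bar>" p] by linarith
      qed (use e in simp)
      finally show ?thesis using C by (simp add: add_increasing2)
    next
      case 2
      have x': "\<bar>x'\<bar> \<le> 2 * \<bar>x\<bar>" using 2 \<eta>(3) L by linarith
      have "\<bar>x'\<bar> powr (q - 1) \<le> (2 * \<bar>x\<bar>) powr (q - 1)" using x' q by (intro powr_mono2) auto
      then have "A * \<bar>x'\<bar> powr (q - 1) \<le> A * (2 powr (q - 1) * \<bar>x\<bar> powr (q - 1))"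
        using A(1) by (intro mult_left_mono) (auto simp: powr_mult)
      then have "\<bar>f t x - f t x'\<bar> \<le> A * \<bar>x\<bar> powr (q - 1) + A * (2 powr (q - 1) * \<bar>x\<bar> powr (q - 1))"
        using A(2)[OF t, of x] A(2)[OF t, of x'] by linarith
      also have "\<dots> \<le> A2 * \<bar>x\<bar> powr (q - 1)" by (simp add: A2_def algebra_simps)
      also have "\<bar>x\<bar> powr (q - 1) = \<bar>x\<bar> powr (q - p) * \<bar>x\<bar> powr (p - 1)"
        by (simp add: powr_add[symmetric])
      also have "A2 * (\<bar>x\<bar> powr (q - p) * \<bar>x\<bar> powr (p - 1)) \<le> A2 * (L powr (q - p) * \<bar>x\<bar> powr (p - 1))"
        using 2 L q A2 by (intro mult_left_mono mult_right_mono powr_mono2') auto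
      also have "\<dots> = (A2 * L powr (q - p)) * \<bar>x\<bar> powr (p - 1)" by simp
      also have "\<dots> \<le> e * \<bar>x\<bar> powr (p - 1)" using Lq by (intro mult_right_mono) auto
      finally have "\<bar>f t x - f t x'\<bar> * \<bar>y\<bar> \<le> e * \<bar>x\<bar> powr (p - 1) * \<bar>y\<bar>" by (intro mult_right_mono) auto
      also have "\<dots> \<le> e * (1 + \<bar>x\<bar> powr p + \<bar>y\<bar> powr p)"
        unfolding mult.assoc using powr_diff_one_mult_le[OF p, of x y] e by (intro mult_left_mono) auto
      finally show ?thesis using C by (simp add: add_increasing2)
    next
      case 3
      define d where "d = \<bar>x - x'\<bar>"
      define z where "z = \<bar>x\<bar> + d"
      have d: "d \<ge> \<eta>" using 3 by (simp add: d_def)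
      have z: "z \<ge> 0" "\<bar>x\<bar> \<le> z" "\<bar>x'\<bar> \<le> z" by (auto simp: z_def d_def)
      have "\<bar>x\<bar> powr (q - 1) \<le> z powr (q - 1)" "\<bar>x'\<bar> powr (q - 1) \<le> z powr (q - 1)"
        using z q by (auto intro!: powr_mono2)
      then have "A * \<bar>x\<bar> powr (q - 1) \<le> A * z powr (q - 1)" "A * \<bar>x'\<bar> powr (q - 1) \<le> A * z powr (q - 1)"
        using A(1) by (auto intro: mult_left_mono)
      then have "\<bar>f t x - f t x'\<bar> \<le> 2 * A * z powr (q - 1)"
        using A(2)[OF t, of x] A(2)[OF t, of x'] by linarith
      also have "\<dots> \<le> c * z powr (p - 1) + B" using B(2)[of z] z(1) by simp
      finally have "\<bar>f t x - f t x'\<bar> * \<bar>y\<bar> \<le> (c * z powr (p - 1) + B) * \<bar>y\<bar>" by (intro mult_right_mono) auto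
      also have "\<dots> = c * (\<bar>z\<bar> powr (p - 1) * \<bar>y\<bar>) + B * \<bar>y\<bar>" using z(1) by (simp add: distrib_right)
      also have "\<dots> \<le> c * (\<bar>z\<bar> powr p + \<bar>y\<bar> powr p) + (e / 2 * \<bar>y\<bar> powr p + D)"
        using c(1) by (intro add_mono mult_left_mono powr_diff_one_mult_le[OF p] D(2)) auto
      also have "\<dots> = c * \<bar>z\<bar> powr p + c * \<bar>y\<bar> powr p + e / 2 * \<bar>y\<bar> powr p + D" by (simp add: distrib_left)
      also have "c * \<bar>z\<bar> powr p \<le> e * \<bar>x\<bar> powr p + e * d powr p"
      proof -
        have "c * \<bar>z\<bar> powr p \<le> c * (2 powr p * (\<bar>x\<bar> powr p + d powr p))"
          using abs_powr_add_le[of p "\<bar>x\<bar>" d] p c(1) \<eta>(1) d unfolding z_def by (intro mult_left_mono) auto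
        also have "\<dots> = (c * 2 powr p) * (\<bar>x\<bar> powr p + d powr p)" by simp
        also have "\<dots> \<le> e * (\<bar>x\<bar> powr p + d powr p)" using c(3) by (intro mult_right_mono) auto
        finally show ?thesis by (simp add: distrib_left)
      qed
      also have "c * \<bar>y\<bar> powr p \<le> e / 2 * \<bar>y\<bar> powr p" using c(2) by (intro mult_right_mono) auto
      also have "D \<le> D / \<eta> powr p * d powr p"
      proof -
        have "\<eta> powr p \<le> d powr p" using d \<eta>(1) p by (intro powr_mono2) auto
        then have "D * \<eta> powr p \<le> D * d powr p" using D(1) by (intro mult_left_mono) auto
        then show ?thesis using \<eta>(1) by (simp add: pos_le_divide_eq)
      qed
      finally have "\<bar>f t x - f t x'\<bar> * \<bar>y\<bar> \<le> e * \<bar>x\<bar> powr p + e * d powr p + e / 2 * \<bar>y\<bar> powr p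
          + e / 2 * \<bar>y\<bar> powr p + D / \<eta> powr p * d powr p" by simp
      also have "\<dots> = e * \<bar>x\<bar> powr p + e * \<bar>y\<bar> powr p + C * d powr p" by (simp add: C_def distrib_right)
      finally show ?thesis using e by (simp add: d_def distrib_left)
    qed
  qed
  show ?thesis by (intro exI[of _ C] conjI ballI allI C main)
qed

end

section \<open>Weak solutions\<close>

locale fractional_problem = frac_interval T \<alpha> p + S: sublinear_potential T p q f a b
  for T \<alpha> p q :: real and f :: "real \<Rightarrow> real \<Rightarrow> real" and a b :: "real \<Rightarrow> real"
begin

lemma f_superposition_measurable:
  "u \<in> borel_measurable M \<Longrightarrow> (\<lambda>t. f t (u t)) \<in> borel_measurable M"
  by (rule S.superposition_measurable[OF S.f_cont])

lemma variational_K: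
  "\<exists>A' a0. variational M p q AK A' a0 V K f (primitive f) Lf E"
proof -
  obtain a0 where a0: "a0 > 0" "\<And>t x. t \<in> {0..T} \<Longrightarrow> primitive f t x \<ge> a0 * \<bar>x\<bar> powr q"
    by (rule S.a_min) blast
  obtain A' where A': "A' \<ge> 0" "\<And>t x. t \<in> {0..T} \<Longrightarrow> \<bar>f t x\<bar> \<le> A' * \<bar>x\<bar> powr (q - 1)"
    by (rule S.b_max) blast
  have "variational_axioms M p q AK A' a0 V K f (primitive f) Lf E"
  proof (rule variational_axioms.intro)
    show "1 < p" "1 < q" "q < p" "0 \<le> AK" "0 \<le> A'" "0 < a0"
      using p S.q AK_nonneg A' a0 by auto
    show "v \<in> V \<Longrightarrow> v \<in> Lp p M" for v by (rule V_Lp)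
    show "v \<in> V \<Longrightarrow> w \<in> V \<Longrightarrow> (\<lambda>t. c * v t + d * w t) \<in> V" for v w c d by (rule V_lin)
    show "(\<And>n. vn n \<in> V) \<Longrightarrow> u \<in> Lp p M \<Longrightarrow> (\<lambda>n. Np p M (\<lambda>t. vn n t - u t)) \<longlonglongrightarrow> 0 \<Longrightarrow> u \<in> V" for vn u
      by (rule V_closed)
    show "v \<in> V \<Longrightarrow> K v \<in> Lp p M" for v by (intro K_Lp V_Lp)
    show "v \<in> V \<Longrightarrow> w \<in> V \<Longrightarrow> AE t in M. K (\<lambda>t. c * v t + d * w t) t = c * K v t + d * K w t" for v w c d
      by (intro K_lin V_Lp)
    show "v \<in> V \<Longrightarrow> Np p M (K v) \<le> AK * Np p M v" for v by (intro K_bd V_Lp)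
    show "v \<in> V \<Longrightarrow> w \<in> V \<Longrightarrow> Lf j (\<lambda>t. c * v t + d * w t) = c * Lf j v + d * Lf j w" for v w c d j
      by (intro Lf_lin V_Lp)
    show "\<exists>B. \<forall>v\<in>V. \<bar>Lf j v\<bar> powr p \<le> B * Np p M v" for j
      using Lf_bd[of j] V_Lp by blast
    show "\<exists>m \<eta>. \<eta> > 0 \<and> (\<forall>v\<in>V. Np p M v \<le> R \<longrightarrow> (\<forall>j<m. \<bar>Lf j v\<bar> \<le> \<eta>) \<longrightarrow> Np p M (K v) \<le> e)"
      if e: "e > 0" for e R
    proof -
      obtain m \<eta> where "\<eta> > 0" "\<forall>v\<in>Lp p M. Np p M v \<le> R \<longrightarrow> (\<forall>j<m. \<bar>Lf j v\<bar> \<le> \<eta>) \<longrightarrow> Np p M (K v) \<le> e"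
        using frac_compact[OF e, of R] by blast
      then show ?thesis using V_Lp by (intro exI[of _ m] exI[of _ \<eta>]) blast
    qed
    show "E i \<in> V" for i by (rule E_V)
    show "i \<le> m \<Longrightarrow> x i \<noteq> 0 \<Longrightarrow> \<not> (AE t in M. K (\<lambda>t. \<Sum>i\<le>m. x i * E i t) t = 0)" for i m x
      by (rule E_indep)
    show "u \<in> borel_measurable M \<Longrightarrow> (\<lambda>t. f t (u t)) \<in> borel_measurable M" for u
      by (rule f_superposition_measurable)
    show "u \<in> borel_measurable M \<Longrightarrow> (\<lambda>t. primitive f t (u t)) \<in> borel_measurable M" for u
      by (rule S.superposition_measurable[OF S.primitive_cont])
    show "\<exists>C\<ge>0. \<forall>t\<in>space M. \<forall>x x' y. \<bar>f t x - f t x'\<bar> * \<bar>y\<bar>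
        \<le> e * (1 + \<bar>x\<bar> powr p + \<bar>y\<bar> powr p) + C * \<bar>x - x'\<bar> powr p" if "e > 0" for e
      unfolding space_M by (rule S.nemytskii_modulus[OF that])
    show "\<exists>\<xi>. \<bar>\<xi> - x\<bar> \<le> \<bar>y - x\<bar> \<and> primitive f t y - primitive f t x = f t \<xi> * (y - x)" if "t \<in> space M" for t x y
      by (rule S.primitive_mvt) (use that in simp)
    show "primitive f t 0 = 0" for t by (rule S.primitive_zero)
    fix t x assume "t \<in> space M"
    then have t: "t \<in> {0..T}" by simp
    show "\<bar>f t x\<bar> \<le> A' * \<bar>x\<bar> powr (q - 1)" by (rule A'(2)[OF t])
    show "f t (- x) = - f t x" by (rule S.f_odd[OF t])
    show "primitive f t x \<ge> a0 * \<bar>x\<bar> powr q" by (rule a0(2)[OF t])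
  qed
  then show ?thesis using variational.intro[OF finite_M] by blast
qed

text \<open>The derivative of \<open>K v\<close> is \<open>v\<close>, and every test function is
  \<open>K\<close> of its own derivative in \<open>V\<close>, so the weak equation becomes an
  identity between integrals over \<open>V\<close>.\<close>

lemma weak_solution_K:
  assumes v: "v \<in> V" and crit: "\<And>w. w \<in> V \<Longrightarrow> (LINT t|M. pw p (v t) * w t) = (LINT t|M. f t (K v t) * K w t)"
  shows "weak_solution \<alpha> p T f (K v)"
  unfolding weak_solution_def
proof (intro conjI ballI K_frac_space[OF v])
  fix \<phi> assume \<phi>: "\<phi> \<in> frac_space \<alpha> p T"
  define w where "w = left_RL_deriv \<alpha> \<phi>"
  have w: "w \<in> V" and \<phi>K: "AE t in M. \<phi> t = K w t"
    unfolding w_def by (rule frac_space_K[OF \<phi>])+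
  have D: "AE t in M. left_RL_deriv \<alpha> (K v) t = v t"
    by (rule K_differentiable(2)[OF Lp_integrable[OF p V_Lp[OF v]]])
  have [measurable]: "left_RL_deriv \<alpha> (K v) \<in> borel_measurable M" "v \<in> borel_measurable M" "w \<in> borel_measurable M"
    "K v \<in> borel_measurable M" "K w \<in> borel_measurable M" "\<phi> \<in> borel_measurable M"
    using LpD(1)[OF Lp_cong_AE[OF V_Lp[OF v] D]] LpD(1)[OF V_Lp[OF v]] LpD(1)[OF V_Lp[OF w]]
      LpD(1)[OF K_Lp[OF V_Lp[OF v]]] LpD(1)[OF K_Lp[OF V_Lp[OF w]]]
      LpD(1)[of \<phi> p M] \<phi> unfolding frac_space_def Lp_space_eq by auto
  have [measurable]: "(\<lambda>t. f t (K v t)) \<in> borel_measurable M" by (rule f_superposition_measurable) measurable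
  have "(LINT t|M. \<bar>left_RL_deriv \<alpha> (K v) t\<bar> powr (p - 2) * left_RL_deriv \<alpha> (K v) t * w t) = (LINT t|M. pw p (v t) * w t)"
  proof (rule integral_cong_AE)
    show "AE t in M. \<bar>left_RL_deriv \<alpha> (K v) t\<bar> powr (p - 2) * left_RL_deriv \<alpha> (K v) t * w t = pw p (v t) * w t"
      using D by eventually_elim (simp add: pw_def)
  qed (simp_all add: pw_def)
  also have "\<dots> = (LINT t|M. f t (K v t) * K w t)" by (rule crit[OF w])
  also have "\<dots> = (LINT t|M. f t (K v t) * \<phi> t)"
  proof (rule integral_cong_AE)
    show "AE t in M. f t (K v t) * K w t = f t (K v t) * \<phi> t" using \<phi>K by eventually_elim simp
  qed simp_all
  finally show "(LINT t|M. \<bar>left_RL_deriv \<alpha> (K v) t\<bar> powr (p - 2) * left_RL_deriv \<alpha> (K v) t * left_RL_deriv \<alpha> \<phi> t)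
      = (LINT t|M. f t (K v t) * \<phi> t)" unfolding w_def .
qed

text \<open>The functional \<open>J\<close>, stated outside the interpretation of
  \<open>variational\<close>, whose constants are only known to exist; this gives one function that
  compares solutions found at different times.\<close>

definition energy :: "(real \<Rightarrow> real) \<Rightarrow> real" where
  "energy v = Np p M v / p - (LINT t|M. primitive f t (K v t))"

lemma energy_cong_AE:
  assumes "v \<in> Lp p M" "AE t in M. w t = v t"
  shows "energy w = energy v"
proof -
  have w: "w \<in> Lp p M" by (rule Lp_cong_AE[OF assms])
  have "Np p M w = Np p M v" by (rule Np_cong_AE[OF LpD(1)[OF w] LpD(1)[OF assms(1)] assms(2)])
  moreover have "K w t = K v t" for t
    by (rule conv_cong_AE[OF assms(2) LpD(1)[OF w] LpD(1)[OF assms(1)] rl_measurable])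
  ultimately show ?thesis by (simp add: energy_def)
qed

lemma left_RL_deriv_cong_AE:
  assumes ae: "AE t in M. u t = w t" and m: "u \<in> borel_measurable M" "w \<in> borel_measurable M"
  shows "AE t in M. left_RL_deriv \<alpha> u t = left_RL_deriv \<alpha> w t"
proof -
  have I: "left_RL_integral \<gamma> u t = left_RL_integral \<gamma> w t" if "0 \<le> t" "t \<le> T" for t
    unfolding left_RL_integral_conv[OF that] by (rule conv_cong_AE[OF ae m rl_measurable])
  have d: "(left_RL_integral \<gamma> u has_real_derivative d) (at t) \<longleftrightarrow> (left_RL_integral \<gamma> w has_real_derivative d) (at t)"
    if "0 < t" "t < T" for t d by (rule deriv_transfer[OF I that])
  show ?thesis
    using AE_interior by eventually_elim (simp add: left_RL_deriv_def deriv_def d)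
qed

lemma solutions_near_zero:
  assumes e: "e > 0"
  shows "\<exists>u. weak_solution \<alpha> p T f u \<and> \<not> (AE t in M. u t = 0) \<and>
      - e \<le> energy (left_RL_deriv \<alpha> u) \<and> energy (left_RL_deriv \<alpha> u) < 0"
proof -
  obtain A' a0 where "variational M p q AK A' a0 V K f (primitive f) Lf E" using variational_K by blast
  then interpret Z: variational M p q AK A' a0 V K f "primitive f" Lf E .
  have J: "Z.J v = energy v" for v unfolding Z.J_def energy_def Z.FI_def ..
  obtain v where c: "Z.crit v" and b: "- e \<le> energy v" "energy v < 0"
    using Z.crit_in_window[OF e] unfolding J by blast
  have v: "v \<in> V" using c unfolding Z.crit_def by blast
  have "weak_solution \<alpha> p T f (K v)"
    using c unfolding Z.crit_def Z.fi_def by (intro weak_solution_K[OF v]) blast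
  \<comment> \<open>Negative energy excludes the zero function: without the potential term the
    energy is nonnegative.\<close>
  moreover have "\<not> (AE t in M. K v t = 0)"
  proof
    assume "AE t in M. K v t = 0"
    then have "AE t in M. primitive f t (K v t) = 0" by eventually_elim (simp add: S.primitive_zero)
    then have "(LINT t|M. primitive f t (K v t)) = 0" by (rule integral_eq_zero_AE)
    then have "energy v \<ge> 0" using Np_nonneg[of p M v] p by (simp add: energy_def)
    then show False using b by simp
  qed
  moreover have "energy (left_RL_deriv \<alpha> (K v)) = energy v"
    by (rule energy_cong_AE[OF V_Lp[OF v] K_differentiable(2)[OF Lp_integrable[OF p V_Lp[OF v]]]])
  ultimately show ?thesis using b by (intro exI[of _ "K v"]) simp
qed

end

text \<open>A function that is constant on classes factors through the quotient, so infinitely many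
  values force infinitely many classes.\<close>

lemma infinite_quotient:
  assumes inf: "infinite (g ` X)" and refl: "\<And>x. x \<in> X \<Longrightarrow> (x, x) \<in> r"
    and inv: "\<And>x y. x \<in> X \<Longrightarrow> y \<in> X \<Longrightarrow> (x, y) \<in> r \<Longrightarrow> g x = g y"
  shows "infinite (X // r)"
proof
  assume fin: "finite (X // r)"
  define h where "h c = (SOME y. \<exists>x\<in>X. c = r `` {x} \<and> y = g x)" for c
  have "g ` X \<subseteq> h ` (X // r)"
  proof
    fix y assume "y \<in> g ` X"
    then obtain x where x: "x \<in> X" "y = g x" by blast
    have "\<exists>x'\<in>X. r `` {x} = r `` {x'} \<and> h (r `` {x}) = g x'"
      unfolding h_def by (rule someI_ex) (use x in blast)
    then obtain x' where x': "x' \<in> X" "r `` {x} = r `` {x'}" "h (r `` {x}) = g x'" by blast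
    have "x \<in> r `` {x'}" using refl[OF x(1)] x'(2) by blast
    then have "g x' = g x" using inv[OF x'(1) x(1)] by simp
    then show "y \<in> h ` (X // r)" using x x'(3) by (auto simp: quotient_def intro!: image_eqI[of _ _ "r `` {x}"])
  qed
  then show False using inf fin finite_surj by blast
qed

lemma infinite_accumulating:
  fixes S :: "real set"
  assumes "\<And>e. e > 0 \<Longrightarrow> \<exists>y\<in>S. - e \<le> y \<and> y < 0"
  shows "infinite S"
proof
  assume fin: "finite S"
  define S' where "S' = {y \<in> S. y < 0}"
  have "finite S'" "S' \<noteq> {}" using fin assms[of 1] by (auto simp: S'_def)
  then have m: "Max S' < 0" "\<And>y. y \<in> S' \<Longrightarrow> y \<le> Max S'" using Max_in[of S'] by (auto simp: S'_def)
  then obtain y where "y \<in> S" "Max S' / 2 \<le> y" "y < 0" using assms[of "- Max S' / 2"] by auto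
  then show False using m(2)[of y] m(1) by (simp add: S'_def)
qed

theorem theorem1p3:
  fixes T \<alpha> p q \<mu> :: real
    and f F :: "real \<Rightarrow> real \<Rightarrow> real"
    and a b :: "real \<Rightarrow> real"
  assumes T: "T > 0"
    and alpha: "0 < \<alpha>" "\<alpha> < 1"
    and p: "1 < p"
    and f_cont: "continuous_on ({0..T} \<times> UNIV) (\<lambda>(t, x). f t x)"
    and F: "F = primitive f"
    and q: "1 < q" "q < p"
    and a: "continuous_on {0..T} a" "\<forall>t\<in>{0..T}. a t > 0"
    and b: "continuous_on {0..T} b" "\<forall>t\<in>{0..T}. b t > 0"
    and f1_zero: "\<forall>t\<in>{0..T}. F t 0 = 0"
    and f1_lower: "\<forall>t\<in>{0..T}. \<forall>x. F t x \<ge> a t * \<bar>x\<bar> powr q"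
    and f1_upper: "\<forall>t\<in>{0..T}. \<forall>x. \<bar>f t x\<bar> \<le> q * b t * \<bar>x\<bar> powr (q - 1)"
    and mu: "1 < \<mu>" "\<mu> \<le> q"
    and f2: "\<forall>t\<in>{0..T}. \<forall>x. f t x * x \<le> \<mu> * F t x"
    and f3: "\<forall>t\<in>{0..T}. \<forall>x. F t x = F t (- x)"
  shows "infinite ({u. weak_solution \<alpha> p T f u \<and>
                       \<not> (AE t in lebesgue_on {0..T}. u t = 0)} // ae_eq_rel T)"
proof -
  have "fractional_problem T \<alpha> p q f a b"
    unfolding fractional_problem_def frac_interval_def interval_def frac_interval_axioms_def sublinear_potential_def
    by (intro conjI T alpha p q f_cont a b f1_upper f1_lower[unfolded F] f3[unfolded F])
  then interpret fractional_problem T \<alpha> p q f a b .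
  \<comment> \<open>The energy depends only on the class of \<open>u\<close> up to null sets,
    although \<open>left_RL_deriv\<close> is computed from a representative: the fractional integral
    does not see changes on null sets.\<close>
  let ?g = "\<lambda>u. energy (left_RL_deriv \<alpha> u)"
  let ?X = "{u. weak_solution \<alpha> p T f u \<and> \<not> (AE t in lebesgue_on {0..T}. u t = 0)}"
  show ?thesis
  proof (rule infinite_quotient[where g = ?g])
    show "infinite (?g ` ?X)"
    proof (rule infinite_accumulating)
      fix e :: real assume "e > 0"
      then show "\<exists>y\<in>?g ` ?X. - e \<le> y \<and> y < 0" using solutions_near_zero by blast
    qed
    show "(x, x) \<in> ae_eq_rel T" for x by (simp add: ae_eq_rel_def)
    fix u w assume "u \<in> ?X" "w \<in> ?X" and r: "(u, w) \<in> ae_eq_rel T"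
    then have L: "u \<in> Lp p M" "w \<in> Lp p M" "left_RL_deriv \<alpha> w \<in> Lp p M"
      by (simp_all add: weak_solution_def frac_space_def Lp_space_eq)
    have "AE t in M. u t = w t" using r by (simp add: ae_eq_rel_def)
    then show "?g u = ?g w"
      by (intro energy_cong_AE[OF L(3)] left_RL_deriv_cong_AE LpD(1)[OF L(1)] LpD(1)[OF L(2)])
  qed
qed

end
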